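(* Let $p$ be a prime and let $F$ be a field of characteristic $p$. If $A(K/F)$ is a full algebraic matroid of rank at least three, then there exists an embedding of $L_p$ in $A(K/F)$, and for every such embedding $h^\infty(L_p)$ is a Desarguesian projective plane of order $p$ in $A(K/F)$.
   Context: Full algebraic matroid: let $F\subseteq K$ be algebraically closed fields such that $K$ has finite transcendence degree over $F$. The subfields of $K$ that contain $F$ and are algebraically closed form, under inclusion, a lattice isomorphic to the lattice of flats of a matroid, called the full algebraic matroid $A(K/F)$. A set $S\subseteq K$ is independent iff its elements are algebraically independent over $F$. The rank of a flat is its transcendence degree over $F$; the points of $A(K/F)$ are the flats of transcendence degree one over $F$, lines are the flats of transcendence degree two, and the rank of $A(K/F)$ is the transcendence degree of $K$ over $F$. In what follows $A(K/F)$ is regarded as a simple matroid on its points. In a simple matroid $M$ (ground set possibly infinite) with closure operator $\operatorname{cl}$, a set of points is collinear if it has rank at most $2$. For elements $y,x,z,o,q,r,s$ of $M$, $\mathrm{HP}(y,x,z;o,q,r,s)$ means that these are seven distinct elements and $M|\{y,x,z,o,q,r,s\}$ is a rank-3 matroid whose three-point lines are $\{y,x,z\},\{y,o,q\},\{y,r,s\},\{x,q,s\},\{z,o,s\},\{z,q,r\}$ and possibly also $\{x,o,r\}$, and no other set of three elements is collinear (so it is the non-Fano matroid $F_7^-$, or the Fano matroid $F_7$ if $\{x,o,r\}$ is collinear). $\mathrm{H}(y,z;x,x')$ means that there are $o,q,r,s$ with $\mathrm{HP}(y,x,z;o,q,r,s)$ and $\operatorname{cl}(\{y,z\})\cap\operatorname{cl}(\{o,r\})=\{x'\}$.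 For a set $S$ of points of $M$: $h(S)=S\cup\{x\in M: \mathrm{H}(a,c;b,x)\text{ for some }a,b,c\in S\}$, $h^0(S)=S$, $h^n(S)=h(h^{n-1}(S))$, and $h^\infty(S)=\bigcup_{n\ge 0}h^n(S)$. $L_p$ is the restriction of the projective plane $PG(2,p)$ over $\mathbb Z_p$ (points in homogeneous coordinates $[x,y,z]$) to the set $\{[0,i,1],[1,i,1],[1,i,0]: i\in\mathbb Z_p\}\cup\{[0,1,0]\}$. Its lines with at least three points are $\{[0,i,1]:i\in\mathbb Z_p\}\cup\{[0,1,0]\}$, $\{[1,i,1]:i\in\mathbb Z_p\}\cup\{[0,1,0]\}$, $\{[1,i,0]:i\in\mathbb Z_p\}\cup\{[0,1,0]\}$, and $\{[0,i,1],[1,i+j,1],[1,j,0]\}$ for $i,j\in\mathbb Z_p$. An embedding of a matroid $N$ in $M$ is an injective map of the ground set of $N$ into the set of points of $M$ under which a set is independent in $N$ iff its image is independent in $M$; $N$ is then identified with its image. A set $S$ of points "is a projective plane in $M$" means that $S$, with the lines of the restriction $M|S$, is a projective plane. *)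

theory Defs
  imports
    "HOL-Computational_Algebra.Computational_Algebra"
    "HOL-Library.Poly_Mapping"
    "HOL-Library.Extended_Nat"
begin

section \<open>Matroids on a possibly infinite ground set\<close>

record 'a matroid =
  ground :: "'a set"
  indep :: "'a set \<Rightarrow> bool"

definition matroid_rank :: "'a matroid \<Rightarrow> 'a set \<Rightarrow> enat" where
  "matroid_rank M X = (SUP I\<in>{I. I \<subseteq> X \<and> finite I \<and> indep M I}. enat (card I))"

definition matroid_cl :: "'a matroid \<Rightarrow> 'a set \<Rightarrow> 'a set" where
  "matroid_cl M X =
     {e \<in> ground M. e \<in> X \<or> (\<exists>I. I \<subseteq> X \<and> indep M I \<and> \<not> indep M (insert e I))}"

definition matroid_lines :: "'a matroid \<Rightarrow> 'a set set" where
  "matroid_lines M = {l. l \<subseteq> ground M \<and> matroid_cl M l = l \<and> matroid_rank M l = 2}"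

definition collinear_in :: "'a matroid \<Rightarrow> 'a set \<Rightarrow> bool" where
  "collinear_in M X \<longleftrightarrow> matroid_rank M X \<le> 2"

definition matroid_restrict :: "'a matroid \<Rightarrow> 'a set \<Rightarrow> 'a matroid" where
  "matroid_restrict M S = \<lparr>ground = ground M \<inter> S, indep = (\<lambda>I. I \<subseteq> S \<and> indep M I)\<rparr>"

definition matroid_embedding :: "('a \<Rightarrow> 'b) \<Rightarrow> 'a matroid \<Rightarrow> 'b matroid \<Rightarrow> bool" where
  "matroid_embedding f N M \<longleftrightarrow>
     inj_on f (ground N) \<and> f ` ground N \<subseteq> ground M \<and>
     (\<forall>I. I \<subseteq> ground N \<longrightarrow> (indep N I \<longleftrightarrow> indep M (f ` I)))"

text \<open>
  Both full algebraic matroids and projective geometries are simplifications: their points are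
  sets of pairwise parallel elements (a point may also contain loops), and a set of points is
  independent if independent representatives can be chosen in these points.
\<close>

definition transversal_indep :: "('a set \<Rightarrow> bool) \<Rightarrow> 'a set set \<Rightarrow> bool" where
  "transversal_indep ind Q \<longleftrightarrow>
     (\<exists>f. inj_on f Q \<and> (\<forall>P\<in>Q. f P \<in> P) \<and> ind (f ` Q))"


section \<open>Harmonic conjugation and harmonic closure\<close>

text \<open>The point \<open>u\<close> is usually called \<open>o\<close>, which is reserved syntax in HOL.\<close>

definition HP :: "'a matroid \<Rightarrow> 'a \<Rightarrow> 'a \<Rightarrow> 'a \<Rightarrow> 'a \<Rightarrow> 'a \<Rightarrow> 'a \<Rightarrow> 'a \<Rightarrow> bool" where
  "HP M y x z u q r s \<longleftrightarrow>
     distinct [y, x, z, u, q, r, s] \<and> {y, x, z, u, q, r, s} \<subseteq> ground M \<and>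
     matroid_rank M {y, x, z, u, q, r, s} = 3 \<and>
     (\<forall>T. T \<subseteq> {y, x, z, u, q, r, s} \<and> card T = 3 \<and> T \<noteq> {x, u, r} \<longrightarrow>
        (collinear_in M T \<longleftrightarrow>
         T \<in> {{y, x, z}, {y, u, q}, {y, r, s}, {x, q, s}, {z, u, s}, {z, q, r}}))"

definition harmonic_conj :: "'a matroid \<Rightarrow> 'a \<Rightarrow> 'a \<Rightarrow> 'a \<Rightarrow> 'a \<Rightarrow> bool" where
  "harmonic_conj M y z x x' \<longleftrightarrow>
     (\<exists>u q r s. HP M y x z u q r s \<and> matroid_cl M {y, z} \<inter> matroid_cl M {u, r} = {x'})"

definition harmonic_step :: "'a matroid \<Rightarrow> 'a set \<Rightarrow> 'a set" where
  "harmonic_step M S =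
     S \<union> {x \<in> ground M. \<exists>a\<in>S. \<exists>b\<in>S. \<exists>c\<in>S. harmonic_conj M a c b x}"

definition harmonic_closure :: "'a matroid \<Rightarrow> 'a set \<Rightarrow> 'a set" where
  "harmonic_closure M S = (\<Union>n. (harmonic_step M ^^ n) S)"


section \<open>Projective planes\<close>

definition projective_plane :: "'a set \<Rightarrow> 'a set set \<Rightarrow> bool" where
  "projective_plane P L \<longleftrightarrow>
     L \<subseteq> Pow P \<and>
     (\<forall>a\<in>P. \<forall>b\<in>P. a \<noteq> b \<longrightarrow> (\<exists>!l. l \<in> L \<and> a \<in> l \<and> b \<in> l)) \<and>
     (\<forall>l\<in>L. \<forall>m\<in>L. l \<noteq> m \<longrightarrow> (\<exists>!a. a \<in> l \<and> a \<in> m)) \<and>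
     (\<exists>Q. Q \<subseteq> P \<and> card Q = 4 \<and> (\<forall>l\<in>L. card (Q \<inter> l) \<le> 2))"

definition plane_order :: "'a set set \<Rightarrow> nat \<Rightarrow> bool" where
  "plane_order L n \<longleftrightarrow> (\<forall>l\<in>L. card l = n + 1)"

definition on_line :: "'a set set \<Rightarrow> 'a set \<Rightarrow> bool" where
  "on_line L X \<longleftrightarrow> (\<exists>l\<in>L. X \<subseteq> l)"

text \<open>
  Desargues' theorem: two triangles \<open>a\<^sub>1 a\<^sub>2 a\<^sub>3\<close> and \<open>b\<^sub>1 b\<^sub>2 b\<^sub>3\<close> in perspective from a point \<open>c\<close>
  are in perspective from a line. Here \<open>d\<^sub>i\<^sub>j\<close> is the point of intersection of \<open>a\<^sub>i a\<^sub>j\<close> and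
  \<open>b\<^sub>i b\<^sub>j\<close>; these two lines are automatically distinct, as the lines \<open>l\<^sub>i\<close> are.
\<close>

definition desargues :: "'a set \<Rightarrow> 'a set set \<Rightarrow> bool" where
  "desargues P L \<longleftrightarrow>
     (\<forall>c\<in>P. \<forall>a1\<in>P. \<forall>a2\<in>P. \<forall>a3\<in>P. \<forall>b1\<in>P. \<forall>b2\<in>P. \<forall>b3\<in>P.
      \<forall>l1\<in>L. \<forall>l2\<in>L. \<forall>l3\<in>L. \<forall>d12\<in>P. \<forall>d13\<in>P. \<forall>d23\<in>P.
        distinct [l1, l2, l3] \<and>
        distinct [c, a1, b1] \<and> {c, a1, b1} \<subseteq> l1 \<and>
        distinct [c, a2, b2] \<and> {c, a2, b2} \<subseteq> l2 \<and>
        distinct [c, a3, b3] \<and> {c, a3, b3} \<subseteq> l3 \<and>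
        \<not> on_line L {a1, a2, a3} \<and> \<not> on_line L {b1, b2, b3} \<and>
        on_line L {a1, a2, d12} \<and> on_line L {b1, b2, d12} \<and>
        on_line L {a1, a3, d13} \<and> on_line L {b1, b3, d13} \<and>
        on_line L {a2, a3, d23} \<and> on_line L {b2, b3, d23}
        \<longrightarrow> on_line L {d12, d13, d23})"

definition desarguesian_plane :: "'a set \<Rightarrow> 'a set set \<Rightarrow> bool" where
  "desarguesian_plane P L \<longleftrightarrow> projective_plane P L \<and> desargues P L"


section \<open>The projective plane over the integers modulo a prime and its restriction \<open>L\<^sub>p\<close>\<close>

text \<open>Vectors over the integers modulo \<open>p\<close> are triples of integers, read modulo \<open>p\<close>.\<close>

definition lin_indep_mod :: "nat \<Rightarrow> (int \<times> int \<times> int) set \<Rightarrow> bool" where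
  "lin_indep_mod p V \<longleftrightarrow>
     finite V \<and>
     (\<forall>k. int p dvd (\<Sum>v\<in>V. k v * fst v) \<and>
          int p dvd (\<Sum>v\<in>V. k v * fst (snd v)) \<and>
          int p dvd (\<Sum>v\<in>V. k v * snd (snd v))
          \<longrightarrow> (\<forall>v\<in>V. int p dvd k v))"

text \<open>
  The point with homogeneous coordinates \<open>[x, y, z]\<close>: the nonzero multiples of \<open>(x, y, z)\<close>,
  represented by least nonnegative residues.
\<close>

definition hpoint :: "nat \<Rightarrow> int \<Rightarrow> int \<Rightarrow> int \<Rightarrow> (int \<times> int \<times> int) set" where
  "hpoint p x y z =
     {(t * x mod int p, t * y mod int p, t * z mod int p) | t. \<not> int p dvd t}"

definition PG2 :: "nat \<Rightarrow> (int \<times> int \<times> int) set matroid" where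
  "PG2 p =
     (let E = {hpoint p x y z | x y z. \<not> (int p dvd x \<and> int p dvd y \<and> int p dvd z)}
      in \<lparr>ground = E, indep = (\<lambda>Q. Q \<subseteq> E \<and> transversal_indep (lin_indep_mod p) Q)\<rparr>)"

definition Lp :: "nat \<Rightarrow> (int \<times> int \<times> int) set matroid" where
  "Lp p = matroid_restrict (PG2 p)
     ((\<Union>i\<in>{0..<int p}. {hpoint p 0 i 1, hpoint p 1 i 1, hpoint p 1 i 0}) \<union> {hpoint p 0 1 0})"


section \<open>Full algebraic matroids\<close>

definition is_subfield :: "'a::field set \<Rightarrow> bool" where
  "is_subfield L \<longleftrightarrow>
     0 \<in> L \<and> 1 \<in> L \<and>
     (\<forall>x\<in>L. \<forall>y\<in>L. x + y \<in> L \<and> x * y \<in> L) \<and> (\<forall>x\<in>L. - x \<in> L \<and> inverse x \<in> L)"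

definition alg_closed_subfield :: "'a::field set \<Rightarrow> bool" where
  "alg_closed_subfield L \<longleftrightarrow>
     is_subfield L \<and>
     (\<forall>g. (\<forall>i. poly.coeff g i \<in> L) \<and> Polynomial.degree g > 0 \<longrightarrow> (\<exists>x\<in>L. poly g x = 0))"

text \<open>
  A multivariate polynomial whose variables are indexed by elements of the field is a finitely
  supported function from monomials to coefficients, a monomial being a finitely supported
  function from variables to exponents. \<open>eval_self\<close> substitutes for each variable the field
  element that indexes it.
\<close>

definition eval_self :: "(('a \<Rightarrow>\<^sub>0 nat) \<Rightarrow>\<^sub>0 'a) \<Rightarrow> 'a::field" where
  "eval_self g =
     (\<Sum>m\<in>Poly_Mapping.keys g. Poly_Mapping.lookup g m *
        (\<Prod>x\<in>Poly_Mapping.keys m. x ^ Poly_Mapping.lookup m x))"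

definition alg_indep :: "'a::field set \<Rightarrow> 'a set \<Rightarrow> bool" where
  "alg_indep F S \<longleftrightarrow>
     (\<forall>g :: ('a \<Rightarrow>\<^sub>0 nat) \<Rightarrow>\<^sub>0 'a.
        (\<forall>m. Poly_Mapping.lookup g m \<in> F) \<and>
        (\<forall>m\<in>Poly_Mapping.keys g. Poly_Mapping.keys m \<subseteq> S) \<and>
        eval_self g = 0 \<longrightarrow> g = 0)"

definition trdeg :: "'a::field set \<Rightarrow> 'a set \<Rightarrow> enat" where
  "trdeg F L = (SUP B\<in>{B. B \<subseteq> L \<and> finite B \<and> alg_indep F B}. enat (card B))"

text \<open>The simple matroid \<open>A(K/F)\<close>, where \<open>K\<close> is the whole type.\<close>

definition alg_points :: "'a::alg_closed_field set \<Rightarrow> 'a set set" where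
  "alg_points F = {P. alg_closed_subfield P \<and> F \<subseteq> P \<and> trdeg F P = 1}"

definition full_algebraic_matroid :: "'a::alg_closed_field set \<Rightarrow> 'a set matroid" where
  "full_algebraic_matroid F =
     \<lparr>ground = alg_points F,
      indep = (\<lambda>Q. Q \<subseteq> alg_points F \<and> transversal_indep (alg_indep F) Q)\<rparr>"

end

theory Submission
  imports "HOL-Algebra.Algebraic_Closure_Type" Defs
begin

text \<open>
  Everything rests on one fact about a full algebraic matroid: for points \<open>y, x, z\<close> of a line, all
  quadrangles that construct a harmonic conjugate of \<open>x\<close> with respect to \<open>y\<close> and \<open>z\<close> construct the
  same point, and every such quadrangle does construct one (\<open>harmonic_concurrence\<close>).

  For two quadrangles in different planes through the line \<open>yz\<close>, this is the classical argument from
  solid geometry. The quadrangles are in perspective from a point, so that the two lines in question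
  and \<open>yz\<close> are pairwise coplanar, but not all in one plane; hence they meet. Both steps use the lemma
  of Ingleton and Main (\<open>ingleton_main_acl\<close>): three pairwise coplanar lines that do not lie in one
  plane have a common point. It replaces the modular law, which fails in algebraic matroids. Its
  reason is that, for an algebraically closed field \<open>L\<close>, the closure of \<open>L(t)\<close> is linearly disjoint
  over \<open>L\<close> from every algebraically closed extension of \<open>L\<close> that does not contain \<open>t\<close>
  (\<open>linear_disjointness\<close>, by specializing \<open>t\<close> to \<open>0\<close>). Hence an algebraic dependence of \<open>b\<close> on \<open>a\<close>
  that holds over two lines spanning a plane that does not contain \<open>a\<close> already holds over their
  intersection, which is not trivial if \<open>b\<close> does not depend on \<open>a\<close> alone. Any two quadrangles are
  brought into different planes by adjoining to the field an element \<open>t\<close> transcendental over it, and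
  by moving one of the quadrangles with an isomorphism that fixes the line \<open>yz\<close> and sends some point off this line
  to \<open>t\<close> (\<open>independent_copy\<close>). The common point lies on \<open>yz\<close>, so it is not moved.

  The second part is plane geometry in linear spaces with this property. Let \<open>A i\<close>, \<open>B i\<close>, \<open>C i\<close>, \<open>D\<close>
  be the points \<open>[0, i, 1]\<close>, \<open>[1, i, 0]\<close>, \<open>[1, i, 1]\<close>, \<open>[0, 1, 0]\<close> of \<open>L\<^sub>p\<close>. Conjugating \<open>B v\<close> with respect
  to \<open>A 0\<close> and \<open>C v\<close> gives a point \<open>C' v\<close> that behaves as \<open>[1, v, 2]\<close>: several quadrangles give the
  same conjugate, so that \<open>C' v\<close> is on the line of \<open>A k\<close> and \<open>C (v - k)\<close> for every \<open>k\<close>; and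
  the points \<open>C' v\<close> are collinear with \<open>D\<close>. Thus \<open>A, D, C, C'\<close> form again a copy of \<open>L\<^sub>p\<close>. Repeating
  the step constructs all points \<open>[1, v, n]\<close>, that is, a projective plane of order \<open>p\<close>. The plane is
  closed under harmonic conjugation, since a conjugate can be computed with a quadrangle inside the
  plane. So it is the harmonic closure, and it is Desarguesian as its points have homogeneous
  coordinates in the prime field.

  For the existence of an embedding of \<open>L\<^sub>p\<close>, take algebraically independent \<open>x, y, z\<close> and send
  \<open>[a, b, c]\<close> to the closure of \<open>a x + b y + c z\<close>: linear forms over the prime field are algebraically
  independent if and only if they are linearly independent (\<open>linear_embedding\<close>).
\<close>

section \<open>Closure operators with exchange\<close>

text \<open>
  Algebraic closure and linear span are both needed as closure operators, over varying base
  fields and for sets of field elements; ranks are only used for finite sets.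
\<close>

locale pregeometry =
  fixes cl :: "'a set \<Rightarrow> 'a set"
  assumes extensive: "U \<subseteq> cl U"
    and mono: "U \<subseteq> Y \<Longrightarrow> cl U \<subseteq> cl Y"
    and idem: "cl (cl U) \<subseteq> cl U"
    and exchange: "b \<in> cl (insert a U) \<Longrightarrow> b \<notin> cl U \<Longrightarrow> a \<in> cl (insert b U)"
begin

definition independent :: "'a set \<Rightarrow> bool" where
  "independent U \<longleftrightarrow> (\<forall>x\<in>U. x \<notin> cl (U - {x}))"

text \<open>
  For finite sets, where bases exist and have equal size (\<open>rk_basis\<close> and
  \<open>rk_eq\<close>).
\<close>

definition rk :: "'a set \<Rightarrow> nat" where
  "rk U = card (SOME B. B \<subseteq> U \<and> independent B \<and> U \<subseteq> cl B)"

lemma cl_least: "U \<subseteq> cl Y \<Longrightarrow> cl U \<subseteq> cl Y"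
  using mono[of U "cl Y"] idem by blast

lemma in_cl: "x \<in> U \<Longrightarrow> x \<in> cl U"
  using extensive by blast

lemma independent_empty [simp]: "independent {}"
  by (simp add: independent_def)

lemma independent_subset: "independent U \<Longrightarrow> Y \<subseteq> U \<Longrightarrow> independent Y"
  unfolding independent_def using mono by (metis Diff_mono order_refl subset_iff)

lemma independent_insert:
  assumes "independent B" "x \<notin> cl B"
  shows "independent (insert x B)"
  unfolding independent_def
proof
  fix y assume y: "y \<in> insert x B"
  show "y \<notin> cl (insert x B - {y})"
  proof (cases "y = x")
    case True
    then show ?thesis using assms(2) mono[of "insert x B - {x}" B] by auto
  next
    case False
    then have yB: "y \<in> B" using y by simp
    have eq: "insert x B - {y} = insert x (B - {y})" using False by auto
    show ?thesis
    proof
      assume "y \<in> cl (insert x B - {y})"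
      then have "y \<in> cl (insert x (B - {y}))" by (simp add: eq)
      moreover have "y \<notin> cl (B - {y})" using assms(1) yB by (simp add: independent_def)
      ultimately have "x \<in> cl (insert y (B - {y}))" by (rule exchange)
      then show False using assms(2) yB by (simp add: insert_absorb)
    qed
  qed
qed

lemma independent_insert_iff:
  assumes "x \<notin> B"
  shows "independent (insert x B) \<longleftrightarrow> independent B \<and> x \<notin> cl B"
proof
  assume *: "independent (insert x B)"
  have "insert x B - {x} = B" using assms by auto
  then show "independent B \<and> x \<notin> cl B"
    using * independent_subset[OF *, of B] unfolding independent_def by auto
qed (use independent_insert in blast)

lemma basis_extend:
  assumes "finite U" "Y \<subseteq> U" "independent Y"
  obtains B where "Y \<subseteq> B" "B \<subseteq> U" "independent B" "U \<subseteq> cl B"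
proof -
  have "\<exists>B. Y \<subseteq> B \<and> B \<subseteq> Y \<union> Z \<and> independent B \<and> Z \<subseteq> cl B" if "finite Z" for Z
    using that
  proof (induction Z)
    case empty
    then show ?case using assms(3) by auto
  next
    case (insert z Z)
    then obtain B where B: "Y \<subseteq> B" "B \<subseteq> Y \<union> Z" "independent B" "Z \<subseteq> cl B" by auto
    show ?case
    proof (cases "z \<in> cl B")
      case True
      then show ?thesis using B by blast
    next
      case False
      then have "independent (insert z B)" using B independent_insert by blast
      moreover have "insert z Z \<subseteq> cl (insert z B)"
        using B(4) mono[of B "insert z B"] extensive by blast
      ultimately show ?thesis using B by (intro exI[of _ "insert z B"]) auto
    qed
  qed
  from this[OF assms(1)] obtain B where B: "Y \<subseteq> B" "B \<subseteq> Y \<union> U" "independent B" "U \<subseteq> cl B"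
    by auto
  then show ?thesis using assms(2) that[of B] by auto
qed

lemma steinitz_finite:
  assumes "finite T" "finite B" "independent B" "B \<subseteq> cl T"
  shows "card B \<le> card T"
  using assms(2-)
proof (induction "card (B - T)" arbitrary: B rule: less_induct)
  case less
  show ?case
  proof (cases "B \<subseteq> T")
    case True
    then show ?thesis using assms(1) card_mono by blast
  next
    case False
    then obtain b where b: "b \<in> B" "b \<notin> T" by blast
    have "\<not> T \<subseteq> cl (B - {b})"
    proof
      assume "T \<subseteq> cl (B - {b})"
      then have "cl T \<subseteq> cl (B - {b})" by (rule cl_least)
      then have "b \<in> cl (B - {b})" using less.prems(3) b by blast
      then show False using less.prems(2) b by (simp add: independent_def)
    qed
    then obtain t where t: "t \<in> T" "t \<notin> cl (B - {b})" by blast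
    let ?B = "insert t (B - {b})"
    have ind: "independent ?B"
      by (meson Diff_subset independent_insert independent_subset less.prems(2) t(2))
    have "t \<notin> B - {b}" using t(2) in_cl by metis
    then have c: "card ?B = card B" using less.prems(1) b
      using card_Suc_Diff1[of B b] by simp
    have "?B - T \<subset> B - T" using b t by auto
    then have "card (?B - T) < card (B - T)" using less.prems(1)
      by (simp add: psubset_card_mono)
    moreover have "?B \<subseteq> cl T" using less.prems(3) t extensive by blast
    ultimately have "card ?B \<le> card T" using less.hyps ind less.prems(1) by simp
    then show ?thesis using c by simp
  qed
qed

lemma steinitz:
  assumes "finite T" "independent B" "B \<subseteq> cl T"
  shows "finite B \<and> card B \<le> card T"
proof -
  have "finite B"
  proof (rule ccontr)
    assume "infinite B"
    then obtain C where C: "C \<subseteq> B" "finite C" "card C = Suc (card T)"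
      using infinite_arbitrarily_large by blast
    then have "card C \<le> card T"
      using assms independent_subset[of B C] by (intro steinitz_finite) auto
    then show False using C by simp
  qed
  then show ?thesis using steinitz_finite assms by blast
qed

lemma rk_basis:
  assumes "finite U"
  obtains B where "B \<subseteq> U" "independent B" "U \<subseteq> cl B" "card B = rk U"
proof -
  obtain B where "B \<subseteq> U" "independent B" "U \<subseteq> cl B"
    using basis_extend[OF assms, of "{}"] by auto
  then have "\<exists>B. B \<subseteq> U \<and> independent B \<and> U \<subseteq> cl B" by blast
  from someI_ex[OF this] show ?thesis using that unfolding rk_def by blast
qed

lemma rk_eq:
  assumes "finite U" "independent B" "B \<subseteq> cl U" "U \<subseteq> cl B"
  shows "rk U = card B"
proof -
  obtain C where C: "C \<subseteq> U" "independent C" "U \<subseteq> cl C" "card C = rk U"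
    using rk_basis[OF assms(1)] by blast
  have fC: "finite C" using C(1) assms finite_subset by blast
  have "B \<subseteq> cl C" using assms(3) cl_least[OF C(3)] by blast
  then have 1: "finite B" "card B \<le> card C" using steinitz[OF fC assms(2)] by auto
  have "C \<subseteq> cl B" using C assms by blast
  then have "card C \<le> card B" using steinitz[OF 1(1) C(2)] by auto
  then show ?thesis using 1 C by simp
qed

lemma rk_independent: "finite U \<Longrightarrow> independent U \<Longrightarrow> rk U = card U"
  using rk_eq[of U U] extensive by blast

lemma rk_le_card: "finite U \<Longrightarrow> rk U \<le> card U"
  using rk_basis[of U] by (metis card_mono)

lemma independent_iff_rk:
  assumes "finite U"
  shows "independent U \<longleftrightarrow> card U \<le> rk U"
proof
  assume *: "card U \<le> rk U"
  obtain B where B: "B \<subseteq> U" "independent B" "U \<subseteq> cl B" "card B = rk U"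
    using rk_basis[OF assms] by blast
  then have "B = U" using * card_seteq[OF assms B(1)] by simp
  then show "independent U" using B by simp
qed (use rk_independent[OF assms] in simp)

lemma rk_mono_cl:
  assumes "finite U" "finite Y" "U \<subseteq> cl Y"
  shows "rk U \<le> rk Y"
proof -
  obtain B where B: "B \<subseteq> U" "independent B" "U \<subseteq> cl B" "card B = rk U"
    using rk_basis[OF assms(1)] by blast
  obtain C where C: "C \<subseteq> Y" "independent C" "Y \<subseteq> cl C" "card C = rk Y"
    using rk_basis[OF assms(2)] by blast
  have "B \<subseteq> cl C" using B assms(3) cl_least[OF C(3)] by blast
  moreover have "finite C" using C(1) assms(2) finite_subset by blast
  ultimately show ?thesis using steinitz[of C B] B C by simp
qed

lemma rk_mono: "finite Y \<Longrightarrow> U \<subseteq> Y \<Longrightarrow> rk U \<le> rk Y"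
  using rk_mono_cl[of U Y] extensive finite_subset by (metis order_trans)

lemma rk_insert_in: "finite U \<Longrightarrow> a \<in> cl U \<Longrightarrow> rk (insert a U) = rk U"
  by (meson dual_order.antisym extensive finite_insert insert_subset rk_mono rk_mono_cl subset_insertI)

lemma rk_insert_out:
  assumes "finite U" "a \<notin> cl U"
  shows "rk (insert a U) = Suc (rk U)"
proof -
  obtain B where B: "B \<subseteq> U" "independent B" "U \<subseteq> cl B" "card B = rk U"
    using rk_basis[OF assms(1)] by blast
  have a: "a \<notin> cl B" using mono[OF B(1)] assms by blast
  have fB: "finite B" using B(1) assms finite_subset by blast
  have "rk (insert a U) = card (insert a B)"
  proof (rule rk_eq)
    show "independent (insert a B)" using B a independent_insert by blast
    show "insert a B \<subseteq> cl (insert a U)" using B extensive[of "insert a U"] by blast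
    show "insert a U \<subseteq> cl (insert a B)"
      using B(3) mono[of B "insert a B"] extensive[of "insert a B"] by blast
  qed (use assms in simp)
  moreover have "a \<notin> B" using a extensive by blast
  ultimately show ?thesis using B fB by simp
qed

lemma in_cl_if_rk:
  assumes "finite U" "rk (insert a U) \<le> rk U"
  shows "a \<in> cl U"
  using rk_insert_out[OF assms(1), of a] assms(2) by fastforce

lemma subset_cl_if_rk:
  assumes "finite Y" "U \<subseteq> Y" "rk Y \<le> rk U"
  shows "Y \<subseteq> cl U"
proof
  fix a assume "a \<in> Y"
  then have "rk (insert a U) \<le> rk Y" using assms rk_mono[of Y "insert a U"] by blast
  then show "a \<in> cl U" using in_cl_if_rk[of U a] assms finite_subset by fastforce
qed

text \<open>
  A common basis of \<open>C\<close> is extended to bases of \<open>A\<close> and of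
  \<open>B\<close>.
\<close>

lemma rk_submodular:
  assumes "finite A" "finite B" "finite C" "C \<subseteq> cl A" "C \<subseteq> cl B"
  shows "rk (A \<union> B) + rk C \<le> rk A + rk B"
proof -
  obtain I where I: "I \<subseteq> C" "independent I" "C \<subseteq> cl I" "card I = rk C"
    using rk_basis[OF assms(3)] by blast
  have fI: "finite I" using I(1) assms finite_subset by blast
  have ext: "\<exists>J. J \<subseteq> U \<and> finite J \<and> card J + card I = rk U \<and> U \<subseteq> cl (I \<union> J)"
    if U: "finite U" "C \<subseteq> cl U" for U
  proof -
    obtain J where J: "I \<subseteq> J" "J \<subseteq> I \<union> U" "independent J" "I \<union> U \<subseteq> cl J"
      using basis_extend[of "I \<union> U" I] fI U I by auto
    have "rk U = card J"
    proof (rule rk_eq)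
      show "J \<subseteq> cl U" using J I U extensive[of U] by blast
    qed (use J U in auto)
    moreover have "card (J - I) + card I = card J" using J fI U
      by (metis add.commute card_Diff_subset card_mono finite_UnI finite_subset le_add_diff_inverse)
    moreover have "I \<union> (J - I) = J" using J by auto
    ultimately show ?thesis using J U(1) fI
      by (intro exI[of _ "J - I"]) (auto dest: finite_subset)
  qed
  obtain J where J: "finite J" "card J + card I = rk A" "A \<subseteq> cl (I \<union> J)"
    using ext[of A] assms by blast
  obtain J' where J': "finite J'" "card J' + card I = rk B" "B \<subseteq> cl (I \<union> J')"
    using ext[of B] assms by blast
  have "A \<union> B \<subseteq> cl (I \<union> J \<union> J')"
    using J(3) J'(3) mono[of "I \<union> J" "I \<union> J \<union> J'"] mono[of "I \<union> J'" "I \<union> J \<union> J'"] by blast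
  then have "rk (A \<union> B) \<le> rk (I \<union> J \<union> J')"
    using assms fI J J' by (intro rk_mono_cl) auto
  also have "\<dots> \<le> card (I \<union> J \<union> J')" using fI J J' by (intro rk_le_card) auto
  also have "\<dots> \<le> card I + card J + card J'"
    by (meson add_le_mono1 card_Un_le order_trans)
  finally show ?thesis using J J' I by linarith
qed

end

section \<open>Linear spans over subfields\<close>

definition is_subring :: "'a::field set \<Rightarrow> bool" where
  "is_subring R \<longleftrightarrow> 0 \<in> R \<and> 1 \<in> R \<and> (\<forall>x\<in>R. \<forall>y\<in>R. x + y \<in> R \<and> x * y \<in> R) \<and> (\<forall>x\<in>R. - x \<in> R)"

lemma is_subringD:
  assumes "is_subring R"
  shows "0 \<in> R" "1 \<in> R" "x \<in> R \<Longrightarrow> y \<in> R \<Longrightarrow> x + y \<in> R" "x \<in> R \<Longrightarrow> y \<in> R \<Longrightarrow> x * y \<in> R"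
    "x \<in> R \<Longrightarrow> - x \<in> R"
  using assms by (auto simp: is_subring_def)

lemma is_subring_diff: "is_subring R \<Longrightarrow> x \<in> R \<Longrightarrow> y \<in> R \<Longrightarrow> x - y \<in> R"
  using is_subringD(3)[of R x "- y"] is_subringD(5)[of R y] by simp

lemma is_subring_power: "is_subring R \<Longrightarrow> x \<in> R \<Longrightarrow> x ^ n \<in> R"
  by (induction n) (auto intro: is_subringD)

lemma is_subring_sum: "is_subring R \<Longrightarrow> (\<And>i. i \<in> I \<Longrightarrow> f i \<in> R) \<Longrightarrow> sum f I \<in> R"
  by (induction I rule: infinite_finite_induct) (auto intro: is_subringD)

lemma is_subfield_is_subring: "is_subfield L \<Longrightarrow> is_subring L"
  by (simp add: is_subfield_def is_subring_def)

lemma is_subfield_inverse: "is_subfield L \<Longrightarrow> x \<in> L \<Longrightarrow> inverse x \<in> L"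
  by (simp add: is_subfield_def)

lemma is_subfield_divide: "is_subfield L \<Longrightarrow> x \<in> L \<Longrightarrow> y \<in> L \<Longrightarrow> x / y \<in> L"
  by (simp add: is_subfield_def field_class.field_divide_inverse)

lemma alg_closed_subfield_is_subfield: "alg_closed_subfield L \<Longrightarrow> is_subfield L"
  by (simp add: alg_closed_subfield_def)

inductive_set lspan :: "'a::field set \<Rightarrow> 'a set \<Rightarrow> 'a set" for L V where
  zero: "0 \<in> lspan L V"
| gen: "v \<in> V \<Longrightarrow> v \<in> lspan L V"
| add: "x \<in> lspan L V \<Longrightarrow> y \<in> lspan L V \<Longrightarrow> x + y \<in> lspan L V"
| scale: "c \<in> L \<Longrightarrow> x \<in> lspan L V \<Longrightarrow> c * x \<in> lspan L V"

lemma lspan_sum: "(\<And>i. i \<in> I \<Longrightarrow> f i \<in> lspan L V) \<Longrightarrow> sum f I \<in> lspan L V"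
  by (induction I rule: infinite_finite_induct) (auto intro: lspan.intros)

lemma lspan_insertD:
  assumes "is_subfield L" "x \<in> lspan L (insert a V)"
  shows "\<exists>c\<in>L. x - c * a \<in> lspan L V"
  using assms(2)
proof (induction rule: lspan.induct)
  case zero
  then show ?case using assms(1) by (auto simp: is_subfield_def intro!: bexI[of _ 0] lspan.zero)
next
  case (gen v)
  show ?case
  proof (cases "v = a")
    case True
    then show ?thesis using assms(1)
      by (auto simp: is_subfield_def intro!: bexI[of _ 1] lspan.zero)
  next
    case False
    then show ?thesis using assms(1) gen
      by (auto simp: is_subfield_def intro!: bexI[of _ 0] lspan.gen)
  qed
next
  case (add x y)
  then obtain c d where cd: "c \<in> L" "x - c * a \<in> lspan L V" "d \<in> L" "y - d * a \<in> lspan L V"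
    by blast
  have "x + y - (c + d) * a = (x - c * a) + (y - d * a)" by (simp add: algebra_simps)
  then have "x + y - (c + d) * a \<in> lspan L V" using lspan.add[OF cd(2,4)] by argo
  moreover have "c + d \<in> L" using cd assms(1) by (auto simp: is_subfield_def)
  ultimately show ?case by blast
next
  case (scale e x)
  then obtain c where c: "c \<in> L" "x - c * a \<in> lspan L V" by blast
  have "e * x - (e * c) * a = e * (x - c * a)" by (simp add: algebra_simps)
  then have "e * x - (e * c) * a \<in> lspan L V" using lspan.scale[OF scale(1) c(2)] by argo
  moreover have "e * c \<in> L" using c assms(1) scale(1) by (auto simp: is_subfield_def)
  ultimately show ?case by blast
qed

lemma pregeometry_lspan:
  assumes "is_subfield L"
  shows "pregeometry (lspan L)"
proof
  fix V W :: "'a set" and a b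
  show "V \<subseteq> lspan L V" by (auto intro: lspan.gen)
  have *: "x \<in> lspan L W" if "x \<in> lspan L V" "V \<subseteq> lspan L W" for x V W
    using that by (induction rule: lspan.induct) (auto intro: lspan.intros)
  show "lspan L V \<subseteq> lspan L W" if "V \<subseteq> W"
    using that *[of _ V W] by (auto intro: lspan.gen)
  show "lspan L (lspan L V) \<subseteq> lspan L V"
    using *[of _ "lspan L V" V] by auto
  show "a \<in> lspan L (insert b V)" if b: "b \<in> lspan L (insert a V)" "b \<notin> lspan L V"
  proof -
    obtain c where c: "c \<in> L" "b - c * a \<in> lspan L V" using lspan_insertD[OF assms b(1)] by blast
    have "c \<noteq> 0" using c b(2) by auto
    have m1: "-1 \<in> L" using assms by (auto simp: is_subfield_def)
    have "b - c * a \<in> lspan L (insert b V)" using c *[of _ V "insert b V"] by (auto intro: lspan.gen)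
    then have "b + (-1) * (b - c * a) \<in> lspan L (insert b V)"
      by (intro lspan.add lspan.scale[OF m1]) (auto intro: lspan.gen)
    then have "inverse c * (b + (-1) * (b - c * a)) \<in> lspan L (insert b V)"
      using assms c by (intro lspan.scale is_subfield_inverse)
    moreover have "b + (-1) * (b - c * a) = c * a" by (simp add: algebra_simps)
    ultimately show ?thesis using \<open>c \<noteq> 0\<close> by (simp add: mult.assoc[symmetric])
  qed
qed

lemma lspan_imageD:
  assumes "is_subfield L" "x \<in> lspan L (v ` I)"
  shows "\<exists>J c. finite J \<and> J \<subseteq> I \<and> (\<forall>i. c i \<in> L) \<and> x = (\<Sum>i\<in>J. c i * v i)"
  using assms(2)
proof (induction rule: lspan.induct)
  case zero
  then show ?case using assms(1) by (intro exI[of _ "{}"] exI[of _ "\<lambda>_. 0"]) (auto simp: is_subfield_def)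
next
  case (gen y)
  then obtain i where "i \<in> I" "y = v i" by blast
  then show ?case using assms(1)
    by (intro exI[of _ "{i}"] exI[of _ "\<lambda>_. 1"]) (auto simp: is_subfield_def)
next
  case (add x y)
  obtain J c where c: "finite J" "J \<subseteq> I" "\<forall>i. c i \<in> L" "x = (\<Sum>i\<in>J. c i * v i)"
    using add.IH(1) by blast
  obtain J' d where d: "finite J'" "J' \<subseteq> I" "\<forall>i. d i \<in> L" "y = (\<Sum>i\<in>J'. d i * v i)"
    using add.IH(2) by blast
  let ?c = "\<lambda>i. if i \<in> J then c i else 0" and ?d = "\<lambda>i. if i \<in> J' then d i else 0"
  have "x = (\<Sum>i\<in>J \<union> J'. ?c i * v i)"
    unfolding c(4) using c(1) d(1) by (intro sum.mono_neutral_cong_left) auto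
  moreover have "y = (\<Sum>i\<in>J \<union> J'. ?d i * v i)"
    unfolding d(4) using c(1) d(1) by (intro sum.mono_neutral_cong_left) auto
  ultimately have "x + y = (\<Sum>i\<in>J \<union> J'. (?c i + ?d i) * v i)"
    by (simp add: sum.distrib distrib_right)
  moreover have "\<forall>i. ?c i + ?d i \<in> L" using c(3) d(3) assms(1) by (auto simp: is_subfield_def)
  ultimately show ?case using c d by (intro exI[of _ "J \<union> J'"] exI[of _ "\<lambda>i. ?c i + ?d i"]) auto
next
  case (scale e x)
  obtain J c where c: "finite J" "J \<subseteq> I" "\<forall>i. c i \<in> L" "x = (\<Sum>i\<in>J. c i * v i)"
    using scale.IH by blast
  then show ?case using assms(1) scale(1)
    by (intro exI[of _ J] exI[of _ "\<lambda>i. e * c i"]) (auto simp: is_subfield_def mult.assoc sum_distrib_left)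
qed

text \<open>
  A family instead of a set, because powers of a single element, which need not be distinct, are
  used as vectors.
\<close>

lemma lspan_dependent_family:
  assumes "is_subfield L" "finite T" "finite I" "card T < card I" "\<And>i. i \<in> I \<Longrightarrow> v i \<in> lspan L T"
  shows "\<exists>c. (\<forall>i. c i \<in> L) \<and> (\<exists>i\<in>I. c i \<noteq> 0) \<and> (\<Sum>i\<in>I. c i * v i) = 0"
proof -
  interpret pregeometry "lspan L" by (rule pregeometry_lspan[OF assms(1)])
  have L01: "0 \<in> L" "1 \<in> L" "-1 \<in> L" "\<And>x. x \<in> L \<Longrightarrow> - x \<in> L" using assms(1) by (auto simp: is_subfield_def)
  have "\<exists>i\<in>I. v i \<in> lspan L (v ` (I - {i}))"
  proof (rule ccontr)
    assume n: "\<not> ?thesis"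
    have inj: "inj_on v I"
    proof (rule inj_onI, rule ccontr)
      fix i j assume "i \<in> I" "j \<in> I" "v i = v j" "i \<noteq> j"
      then have "v i \<in> v ` (I - {i})" by auto
      then have "v i \<in> lspan L (v ` (I - {i}))" by (rule lspan.gen)
      then show False using n \<open>i \<in> I\<close> by blast
    qed
    have "pregeometry.independent (lspan L) (v ` I)"
      unfolding independent_def
    proof
      fix x assume "x \<in> v ` I"
      then obtain i where i: "i \<in> I" "x = v i" by blast
      have "v ` I - {x} = v ` (I - {i})" using i inj by (auto simp: inj_on_def)
      then show "x \<notin> lspan L (v ` I - {x})" using n i by auto
    qed
    then have "card (v ` I) \<le> card T" using steinitz[OF assms(2)] assms(5) by blast
    then show False using inj assms(4) by (simp add: card_image)
  qed
  then obtain i where i: "i \<in> I" "v i \<in> lspan L (v ` (I - {i}))" by blast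
  from lspan_imageD[OF assms(1) i(2)] obtain J c where
    c: "finite J" "J \<subseteq> I - {i}" "\<forall>j. c j \<in> L" "v i = (\<Sum>j\<in>J. c j * v j)" by blast
  let ?c = "\<lambda>j. if j = i then -1 else if j \<in> J then c j else 0"
  have "(\<Sum>j\<in>I. ?c j * v j) = ?c i * v i + (\<Sum>j\<in>I - {i}. ?c j * v j)"
    using i assms(3) by (simp add: sum.remove)
  also have "(\<Sum>j\<in>I - {i}. ?c j * v j) = (\<Sum>j\<in>J. c j * v j)"
    using c(2) assms(3) by (intro sum.mono_neutral_cong_right) auto
  finally have "(\<Sum>j\<in>I. ?c j * v j) = 0" using c by simp
  then show ?thesis using c i L01 by (intro exI[of _ ?c]) auto
qed

section \<open>Algebraic elements\<close>

definition polys_over :: "'a::field set \<Rightarrow> 'a poly set" where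
  "polys_over R = {f. \<forall>i. poly.coeff f i \<in> R}"

lemma polys_over_pCons [simp]: "pCons a f \<in> polys_over R \<longleftrightarrow> a \<in> R \<and> f \<in> polys_over R"
  unfolding polys_over_def by (auto simp: coeff_pCons split: nat.splits)

lemma polys_over_0: "0 \<in> R \<Longrightarrow> 0 \<in> polys_over R"
  by (simp add: polys_over_def)

lemma polys_over_add: "is_subring R \<Longrightarrow> f \<in> polys_over R \<Longrightarrow> g \<in> polys_over R \<Longrightarrow> f + g \<in> polys_over R"
  by (auto simp: polys_over_def intro: is_subringD)

lemma polys_over_minus: "is_subring R \<Longrightarrow> f \<in> polys_over R \<Longrightarrow> - f \<in> polys_over R"
  by (auto simp: polys_over_def intro: is_subringD)

lemma polys_over_mult: "is_subring R \<Longrightarrow> f \<in> polys_over R \<Longrightarrow> g \<in> polys_over R \<Longrightarrow> f * g \<in> polys_over R"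
  by (auto simp: polys_over_def coeff_mult intro!: is_subring_sum intro: is_subringD)

lemma polys_over_smult: "is_subring R \<Longrightarrow> c \<in> R \<Longrightarrow> g \<in> polys_over R \<Longrightarrow> Polynomial.smult c g \<in> polys_over R"
  by (auto simp: polys_over_def intro: is_subringD)

lemma polys_over_mono: "R \<subseteq> S \<Longrightarrow> f \<in> polys_over R \<Longrightarrow> f \<in> polys_over S"
  by (auto simp: polys_over_def)

lemma poly_in_subring: "is_subring R \<Longrightarrow> f \<in> polys_over R \<Longrightarrow> x \<in> R \<Longrightarrow> poly f x \<in> R"
  by (induction f) (auto intro: is_subringD)

lemma polys_over_sum_monom:
  assumes "is_subring R" "\<And>i. i \<in> I \<Longrightarrow> c i \<in> R"
  shows "(\<Sum>i\<in>I. Polynomial.monom (c i) (n i)) \<in> polys_over R"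
  using assms(2) by (auto simp: polys_over_def coeff_sum intro!: is_subring_sum[OF assms(1)] is_subringD(1)[OF assms(1)])

definition adjoin :: "'a::field set \<Rightarrow> 'a \<Rightarrow> 'a set" where
  "adjoin R b = (\<lambda>f. poly f b) ` polys_over R"

lemma adjoin_is_subring:
  assumes "is_subring R"
  shows "is_subring (adjoin R b)"
  unfolding is_subring_def
proof (intro conjI ballI)
  note R = is_subringD[OF assms]
  show "0 \<in> adjoin R b" unfolding adjoin_def using polys_over_0[OF R(1)] by force
  show "1 \<in> adjoin R b" unfolding adjoin_def
    by (rule image_eqI[of _ _ "[:1:]"]) (auto simp: R polys_over_0)
  fix x assume "x \<in> adjoin R b"
  then obtain f where f: "x = poly f b" "f \<in> polys_over R" by (auto simp: adjoin_def)
  show "- x \<in> adjoin R b" unfolding adjoin_def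
    by (rule image_eqI[of _ _ "- f"]) (use f polys_over_minus[OF assms] in auto)
  fix y assume "y \<in> adjoin R b"
  then obtain g where g: "y = poly g b" "g \<in> polys_over R" by (auto simp: adjoin_def)
  show "x + y \<in> adjoin R b" unfolding adjoin_def
    by (rule image_eqI[of _ _ "f + g"]) (use f g polys_over_add[OF assms] in auto)
  show "x * y \<in> adjoin R b" unfolding adjoin_def
    by (rule image_eqI[of _ _ "f * g"]) (use f g polys_over_mult[OF assms] in auto)
qed

lemma adjoin_base: "is_subring R \<Longrightarrow> R \<subseteq> adjoin R b"
  unfolding adjoin_def by (auto intro!: image_eqI[of _ _ "[:_:]"] polys_over_0 is_subringD)

lemma adjoin_gen: "is_subring R \<Longrightarrow> b \<in> adjoin R b"
  unfolding adjoin_def by (auto intro!: image_eqI[of _ _ "[:0, 1:]"] polys_over_0 is_subringD)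

definition fin_dim :: "'a::field set \<Rightarrow> 'a set \<Rightarrow> bool" where
  "fin_dim L R \<longleftrightarrow> (\<exists>T. finite T \<and> R \<subseteq> lspan L T)"

text \<open>
  Powers of \<open>b\<close> from the degree of the monic polynomial on can be reduced, so
  \<open>T\<close> times the lower powers of \<open>b\<close> spans.
\<close>

lemma fin_dim_adjoin:
  assumes "is_subfield L" "is_subring R" "fin_dim L R"
    and f: "f \<in> polys_over R" "Polynomial.lead_coeff f = 1" "poly f b = 0"
  shows "fin_dim L (adjoin R b)"
proof -
  obtain T where T: "finite T" "R \<subseteq> lspan L T" using assms(3) by (auto simp: fin_dim_def)
  define n where "n = Polynomial.degree f"
  define T' where "T' = (\<lambda>(t, i). t * b ^ i) ` (T \<times> {..<n})"
  have low: "r * b ^ m \<in> lspan L T'" if "r \<in> lspan L T" "m < n" for r m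
    using that(1)
  proof (induction rule: lspan.induct)
    case (gen t)
    then show ?case using that(2) by (auto intro!: lspan.gen simp: T'_def)
  qed (auto simp: algebra_simps intro: lspan.intros)
  have "poly f b = (\<Sum>i<n. poly.coeff f i * b ^ i) + b ^ n"
    using f(2) by (simp add: poly_altdef n_def lessThan_Suc_atMost[symmetric])
  then have bn: "b ^ n = - (\<Sum>i<n. poly.coeff f i * b ^ i)" using f(3) by (simp add: eq_neg_iff_add_eq_0 add.commute)
  have all: "\<forall>r\<in>R. r * b ^ m \<in> lspan L T'" for m
  proof (induction m rule: less_induct)
    case (less m)
    show ?case
    proof
      fix r assume r: "r \<in> R"
      show "r * b ^ m \<in> lspan L T'"
      proof (cases "m < n")
        case True
        then show ?thesis using low r T by blast
      next
        case False
        have "r * b ^ m = r * b ^ (m - n) * b ^ n"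
          using False by (simp add: power_add[symmetric] mult.assoc)
        also have "\<dots> = (\<Sum>i<n. (r * - poly.coeff f i) * b ^ (m - n + i))"
          by (simp add: bn sum_distrib_left sum_negf power_add algebra_simps)
        also have "\<dots> \<in> lspan L T'"
        proof (rule lspan_sum)
          fix i assume i: "i \<in> {..<n}"
          have "r * - poly.coeff f i \<in> R"
            using r f(1) assms(2) by (auto simp: polys_over_def intro: is_subringD)
          moreover have "m - n + i < m" using i False by auto
          ultimately show "(r * - poly.coeff f i) * b ^ (m - n + i) \<in> lspan L T'"
            using less by blast
        qed
        finally show ?thesis .
      qed
    qed
  qed
  have "adjoin R b \<subseteq> lspan L T'"
  proof
    fix x assume "x \<in> adjoin R b"
    then obtain g where g: "x = poly g b" "g \<in> polys_over R" by (auto simp: adjoin_def)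
    have "x = (\<Sum>i\<le>Polynomial.degree g. poly.coeff g i * b ^ i)" by (simp add: g poly_altdef)
    also have "\<dots> \<in> lspan L T'" using all g(2) by (intro lspan_sum) (auto simp: polys_over_def)
    finally show "x \<in> lspan L T'" .
  qed
  moreover have "finite T'" using T by (simp add: T'_def)
  ultimately show ?thesis by (auto simp: fin_dim_def)
qed

definition algebraics :: "'a::field set \<Rightarrow> 'a set" where
  "algebraics L = {b. \<exists>g. g \<noteq> 0 \<and> g \<in> polys_over L \<and> poly g b = 0}"

lemma fin_dim_algebraic:
  assumes "is_subfield L" "is_subring R" "fin_dim L R" "b \<in> R"
  shows "b \<in> algebraics L"
proof -
  obtain T where T: "finite T" "R \<subseteq> lspan L T" using assms(3) by (auto simp: fin_dim_def)
  obtain c where c: "\<forall>i. c i \<in> L" "\<exists>i\<in>{..card T}. c i \<noteq> 0" "(\<Sum>i\<le>card T. c i * b ^ i) = 0"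
    using lspan_dependent_family[OF assms(1) T(1), of "{..card T}" "\<lambda>i. b ^ i"]
      T(2) is_subring_power[OF assms(2,4)] by auto
  define g where "g = (\<Sum>i\<le>card T. Polynomial.monom (c i) i)"
  have "poly.coeff g i = c i" if "i \<le> card T" for i
    using that by (simp add: g_def coeff_sum if_distrib sum.delta cong: if_cong)
  then have "g \<noteq> 0" using c(2) by auto
  moreover have "g \<in> polys_over L"
    unfolding g_def using c is_subfield_is_subring[OF assms(1)] by (intro polys_over_sum_monom) auto
  moreover have "poly g b = 0" using c(3) by (simp add: g_def poly_sum poly_monom)
  ultimately show ?thesis by (auto simp: algebraics_def)
qed

lemma algebraics_monic:
  assumes "is_subfield L" "b \<in> algebraics L"
  obtains f where "f \<in> polys_over L" "Polynomial.lead_coeff f = 1" "poly f b = 0"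
proof -
  obtain g where g: "g \<noteq> 0" "g \<in> polys_over L" "poly g b = 0" using assms by (auto simp: algebraics_def)
  have "inverse (Polynomial.lead_coeff g) \<in> L"
    using g assms(1) by (auto simp: polys_over_def intro: is_subfield_inverse)
  then have "Polynomial.smult (inverse (Polynomial.lead_coeff g)) g \<in> polys_over L"
    using g is_subfield_is_subring[OF assms(1)] by (intro polys_over_smult)
  moreover have "Polynomial.lead_coeff (Polynomial.smult (inverse (Polynomial.lead_coeff g)) g) = 1"
    using g(1) by (metis lead_coeff_smult leading_coeff_0_iff left_inverse)
  moreover have "poly (Polynomial.smult (inverse (Polynomial.lead_coeff g)) g) b = 0" using g(3) by simp
  ultimately show ?thesis by (rule that)
qed

lemma fin_dim_self: "is_subfield L \<Longrightarrow> fin_dim L L"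
  unfolding fin_dim_def
proof (intro exI[of _ "{1}"] conjI subsetI)
  fix x assume "x \<in> L"
  then have "x * 1 \<in> lspan L {1}" by (intro lspan.scale lspan.gen) auto
  then show "x \<in> lspan L {1}" by simp
qed auto

text \<open>
  Finite-dimensional subrings turn closure properties of algebraic elements into linear algebra.
\<close>

lemma fin_dim_algebraics:
  assumes L: "is_subfield L" and "finite B" "B \<subseteq> algebraics L"
  shows "\<exists>R. is_subring R \<and> fin_dim L R \<and> L \<subseteq> R \<and> B \<subseteq> R"
  using assms(2,3)
proof (induction B)
  case empty
  then show ?case using L fin_dim_self is_subfield_is_subring by blast
next
  case (insert b B)
  then obtain R where R: "is_subring R" "fin_dim L R" "L \<subseteq> R" "B \<subseteq> R" by blast
  obtain f where f: "f \<in> polys_over L" "Polynomial.lead_coeff f = 1" "poly f b = 0"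
    using algebraics_monic[OF L] insert by blast
  have "fin_dim L (adjoin R b)"
    using fin_dim_adjoin[OF L R(1,2) polys_over_mono[OF R(3) f(1)] f(2,3)] .
  then show ?case
    using adjoin_is_subring[OF R(1), of b] adjoin_base[OF R(1), of b] adjoin_gen[OF R(1), of b] R(3,4)
    by (intro exI[of _ "adjoin R b"]) auto
qed

lemma algebraics_is_subfield:
  assumes L: "is_subfield L"
  shows "is_subfield (algebraics L)"
proof -
  have two: "f x y \<in> algebraics L"
    if "x \<in> algebraics L" "y \<in> algebraics L" "\<And>R. is_subring R \<Longrightarrow> x \<in> R \<Longrightarrow> y \<in> R \<Longrightarrow> f x y \<in> R"
    for f :: "'a \<Rightarrow> 'a \<Rightarrow> 'a" and x y
    using fin_dim_algebraics[OF L, of "{x, y}"] that fin_dim_algebraic[OF L] by blast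
  have base: "L \<subseteq> algebraics L"
    using fin_dim_algebraic[OF L is_subfield_is_subring[OF L] fin_dim_self[OF L]] by blast
  have inv: "inverse x \<in> algebraics L" if x: "x \<in> algebraics L" for x
  proof (cases "x = 0")
    case True
    then show ?thesis using x by simp
  next
    case False
    obtain g where g: "g \<noteq> 0" "g \<in> polys_over L" "poly g x = 0" using x by (auto simp: algebraics_def)
    have "reflect_poly g \<in> polys_over L"
      using g(2) L by (auto simp: polys_over_def coeff_reflect_poly is_subfield_def)
    moreover have "poly (reflect_poly g) (inverse x) = 0"
      using poly_reflect_poly_nz[of "inverse x" g] False g(3) by simp
    moreover have "reflect_poly g \<noteq> 0" using g(1) by simp
    ultimately show ?thesis unfolding algebraics_def by blast
  qed
  show ?thesis
    unfolding is_subfield_def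
    using base L inv two[of _ _ "(+)"] two[of _ _ "(*)"] two[of _ _ "\<lambda>x y. - x"]
    by (auto simp: is_subfield_def is_subring_def)
qed

lemma algebraics_base: "is_subfield L \<Longrightarrow> L \<subseteq> algebraics L"
  using fin_dim_algebraic[OF _ is_subfield_is_subring fin_dim_self] by blast

text \<open>
  The finitely many coefficients of a polynomial over \<open>algebraics L\<close> lie in one
  finite-dimensional ring, over which its root is still integral.
\<close>

lemma algebraics_idem:
  assumes L: "is_subfield L"
  shows "algebraics (algebraics L) \<subseteq> algebraics L"
proof
  fix b assume "b \<in> algebraics (algebraics L)"
  then obtain f where f: "f \<in> polys_over (algebraics L)" "Polynomial.lead_coeff f = 1" "poly f b = 0"
    using algebraics_monic[OF algebraics_is_subfield[OF L]] by blast
  have "finite (poly.coeff f ` {..Polynomial.degree f})" "poly.coeff f ` {..Polynomial.degree f} \<subseteq> algebraics L"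
    using f by (auto simp: polys_over_def)
  then obtain R where R: "is_subring R" "fin_dim L R" "L \<subseteq> R" "poly.coeff f ` {..Polynomial.degree f} \<subseteq> R"
    using fin_dim_algebraics[OF L] by metis
  have "poly.coeff f i \<in> R" for i
  proof (cases "i \<le> Polynomial.degree f")
    case False
    then show ?thesis using is_subringD(1)[OF R(1)] by (simp add: coeff_eq_0)
  qed (use R(4) in auto)
  then have "f \<in> polys_over R" by (simp add: polys_over_def)
  then have "fin_dim L (adjoin R b)" using fin_dim_adjoin[OF L R(1,2) _ f(2,3)] by blast
  then show "b \<in> algebraics L"
    using fin_dim_algebraic[OF L adjoin_is_subring[OF R(1)]] adjoin_gen[OF R(1)] by blast
qed

lemma alg_closed_subfield_algebraics:
  fixes L :: "'a::alg_closed_field set"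
  assumes L: "is_subfield L"
  shows "alg_closed_subfield (algebraics L)"
  unfolding alg_closed_subfield_def
proof (intro conjI allI impI)
  show "is_subfield (algebraics L)" by (rule algebraics_is_subfield[OF L])
  fix g :: "'a poly" assume g: "(\<forall>i. poly.coeff g i \<in> algebraics L) \<and> Polynomial.degree g > 0"
  then obtain x where x: "poly g x = 0" using alg_closed_imp_poly_has_root by blast
  have "x \<in> algebraics (algebraics L)"
    unfolding algebraics_def polys_over_def[of "algebraics L", unfolded algebraics_def]
    using g x by (auto simp: algebraics_def intro!: exI[of _ g])
  then show "\<exists>x\<in>algebraics L. poly g x = 0" using algebraics_idem[OF L] x by blast
qed

text \<open>
  A polynomial splits off linear factors over \<open>L\<close> until only the given root is
  left.
\<close>

lemma algebraics_alg_closed: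
  assumes L: "alg_closed_subfield L"
  shows "algebraics L = L"
proof -
  have sub: "is_subring L" using L alg_closed_subfield_is_subfield is_subfield_is_subring by blast
  have syn: "synthetic_div g x \<in> polys_over L" if "g \<in> polys_over L" "x \<in> L" for g x
    using that(1)
  proof (induction g)
    case 0
    then show ?case by simp
  next
    case (pCons a g)
    then show ?case using poly_in_subring[OF sub _ that(2)] by simp
  qed
  have "b \<in> L" if "g \<in> polys_over L" "g \<noteq> 0" "poly g b = 0" for g b
    using that
  proof (induction "Polynomial.degree g" arbitrary: g rule: less_induct)
    case less
    have "Polynomial.degree g > 0"
    proof (rule ccontr)
      assume "\<not> ?thesis"
      then obtain a where "g = [:a:]" by (meson degree_eq_zeroE gr0I)
      then show False using less.prems by auto
    qed
    then obtain x where x: "x \<in> L" "poly g x = 0"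
      using L less.prems(1) by (auto simp: alg_closed_subfield_def polys_over_def)
    have g: "g = [:- x, 1:] * synthetic_div g x"
      using synthetic_div_correct'[of x g] x(2) by simp
    show ?case
    proof (cases "b = x")
      case False
      have "poly g b = (b - x) * poly (synthetic_div g x) b"
        by (subst g) (simp add: algebra_simps)
      then have "poly (synthetic_div g x) b = 0" using False less.prems by simp
      moreover have "synthetic_div g x \<noteq> 0" using g less.prems(2) by auto
      moreover have "Polynomial.degree (synthetic_div g x) < Polynomial.degree g"
        using \<open>Polynomial.degree g > 0\<close> by (simp add: degree_synthetic_div)
      ultimately show ?thesis using less.hyps syn less.prems(1) x(1) by blast
    qed (use x in simp)
  qed
  then show ?thesis
    using algebraics_base[OF alg_closed_subfield_is_subfield[OF L]] by (auto simp: algebraics_def)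
qed

section \<open>Algebraic closure inside an algebraically closed field\<close>

definition acl :: "'a::field set \<Rightarrow> 'a set \<Rightarrow> 'a set" where
  "acl F V = \<Inter>{L. alg_closed_subfield L \<and> F \<union> V \<subseteq> L}"

lemma acl_least: "alg_closed_subfield L \<Longrightarrow> F \<subseteq> L \<Longrightarrow> V \<subseteq> L \<Longrightarrow> acl F V \<subseteq> L"
  by (auto simp: acl_def)

lemma acl_base: "F \<subseteq> acl F V"
  by (auto simp: acl_def)

lemma acl_gen: "V \<subseteq> acl F V"
  by (auto simp: acl_def)

lemma alg_closed_subfield_Inter:
  fixes \<L> :: "'a::alg_closed_field set set"
  assumes "\<And>L. L \<in> \<L> \<Longrightarrow> alg_closed_subfield L"
  shows "alg_closed_subfield (\<Inter>\<L>)"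
  unfolding alg_closed_subfield_def
proof (intro conjI allI impI)
  show "is_subfield (\<Inter>\<L>)"
    using assms by (auto simp: alg_closed_subfield_def is_subfield_def)
  fix g :: "'a poly" assume g: "(\<forall>i. poly.coeff g i \<in> \<Inter>\<L>) \<and> Polynomial.degree g > 0"
  then obtain x where x: "poly g x = 0" using alg_closed_imp_poly_has_root by blast
  have "x \<in> L" if L: "L \<in> \<L>" for L
  proof -
    have "g \<noteq> 0" "g \<in> polys_over L" using g L by (auto simp: polys_over_def)
    then have "x \<in> algebraics L" using x by (auto simp: algebraics_def)
    then show ?thesis using algebraics_alg_closed assms L by blast
  qed
  then show "\<exists>x\<in>\<Inter>\<L>. poly g x = 0" using x by blast
qed

lemma acl_closed: "alg_closed_subfield (acl F V)" for F :: "'a::alg_closed_field set"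
  unfolding acl_def by (rule alg_closed_subfield_Inter) auto

lemma acl_mono: "V \<subseteq> W \<Longrightarrow> acl F V \<subseteq> acl F W"
  by (auto simp: acl_def)

definition fracs :: "'a::field set \<Rightarrow> 'a set" where
  "fracs R = {x / y | x y. x \<in> R \<and> y \<in> R}"

lemma fracsI: "x \<in> R \<Longrightarrow> y \<in> R \<Longrightarrow> z = x / y \<Longrightarrow> z \<in> fracs R"
  by (auto simp: fracs_def)

lemma fracsE:
  assumes "is_subring R" "z \<in> fracs R"
  obtains x y where "x \<in> R" "y \<in> R" "y \<noteq> 0" "z = x / y"
proof -
  obtain x y where xy: "x \<in> R" "y \<in> R" "z = x / y" using assms by (auto simp: fracs_def)
  show ?thesis
  proof (cases "y = 0")
    case True
    then show ?thesis using xy that[of 0 1] is_subringD(1,2)[OF assms(1)] by auto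
  qed (use xy that in blast)
qed

lemma fracs_base: "is_subring R \<Longrightarrow> R \<subseteq> fracs R"
  using is_subringD(2) by (auto intro!: fracsI[of _ _ 1])

lemma fracs_is_subfield:
  assumes R: "is_subring R"
  shows "is_subfield (fracs R)"
  unfolding is_subfield_def
proof (intro conjI ballI)
  note D = is_subringD[OF R]
  show "0 \<in> fracs R" "1 \<in> fracs R" using fracs_base[OF R] D(1,2) by auto
  fix u assume "u \<in> fracs R"
  then obtain x y where xy: "x \<in> R" "y \<in> R" "y \<noteq> 0" "u = x / y" using fracsE[OF R] by blast
  show "- u \<in> fracs R" by (rule fracsI[of "- x" _ y]) (use xy D in auto)
  show "inverse u \<in> fracs R" by (rule fracsI[of y _ x]) (use xy D in auto)
  fix v assume "v \<in> fracs R"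
  then obtain x' y' where xy': "x' \<in> R" "y' \<in> R" "y' \<noteq> 0" "v = x' / y'" using fracsE[OF R] by blast
  show "u + v \<in> fracs R"
    by (rule fracsI[of "x * y' + x' * y" _ "y * y'"]) (use xy xy' D in \<open>auto simp: field_simps\<close>)
  show "u * v \<in> fracs R"
    by (rule fracsI[of "x * x'" _ "y * y'"]) (use xy xy' D in \<open>auto simp: field_simps\<close>)
qed

lemma fracs_common_denominator:
  assumes "is_subring R" "finite J" "\<And>j. j \<in> J \<Longrightarrow> f j \<in> fracs R"
  shows "\<exists>D\<in>R. D \<noteq> 0 \<and> (\<forall>j\<in>J. D * f j \<in> R)"
  using assms(2,3)
proof (induction J)
  case empty
  then show ?case using is_subringD(2)[OF assms(1)] by (intro bexI[of _ 1]) auto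
next
  case (insert j J)
  then obtain D where D: "D \<in> R" "D \<noteq> 0" "\<forall>j\<in>J. D * f j \<in> R" by auto
  obtain x y where xy: "x \<in> R" "y \<in> R" "y \<noteq> 0" "f j = x / y"
    using fracsE[OF assms(1)] insert.prems by blast
  have "D * y * f j = D * x" using xy by simp
  then have "D * y * f j \<in> R" using D xy is_subringD(4)[OF assms(1)] by simp
  moreover have "D * y * f i \<in> R" if "i \<in> J" for i
    using D(3) xy(2) that is_subringD(4)[OF assms(1), of y "D * f i"] by (simp add: mult.left_commute mult.assoc)
  ultimately have "\<forall>i\<in>insert j J. D * y * f i \<in> R" by simp
  then show ?case using D xy is_subringD(4)[OF assms(1)] by (intro bexI[of _ "D * y"]) auto
qed

text \<open>The coefficients can be multiplied by a common denominator.\<close>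

lemma algebraics_fracs:
  assumes R: "is_subring R" and b: "b \<in> algebraics (fracs R)"
  shows "\<exists>n c. (\<forall>j. c j \<in> R) \<and> (\<exists>j\<le>n. c j \<noteq> 0) \<and> (\<Sum>j\<le>n. c j * b ^ j) = 0"
proof -
  obtain g where g: "g \<noteq> 0" "g \<in> polys_over (fracs R)" "poly g b = 0"
    using b by (auto simp: algebraics_def)
  define n where "n = Polynomial.degree g"
  obtain D where D: "D \<noteq> 0" "\<forall>j\<in>{..n}. D * poly.coeff g j \<in> R"
    using fracs_common_denominator[OF R, of "{..n}" "poly.coeff g"] g(2) by (auto simp: polys_over_def)
  show ?thesis
  proof (rule exI[of _ n], rule exI[of _ "\<lambda>j. D * poly.coeff g j"], intro conjI allI)
    fix j show "D * poly.coeff g j \<in> R"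
      using D is_subringD(1)[OF R] by (cases "j \<le> n") (auto simp: n_def coeff_eq_0)
    show "\<exists>j\<le>n. D * poly.coeff g j \<noteq> 0" using g D by (intro exI[of _ n]) (auto simp: n_def)
    have "(\<Sum>j\<le>n. D * poly.coeff g j * b ^ j) = D * poly g b"
      by (simp add: poly_altdef n_def sum_distrib_left mult.assoc)
    then show "(\<Sum>j\<le>n. D * poly.coeff g j * b ^ j) = 0" using g by simp
  qed
qed

text \<open>
  The form in which algebraic closedness is used below: the relation is given by its
  coefficients, none of which is assumed to be leading.
\<close>

lemma root_in_alg_closed:
  assumes L: "alg_closed_subfield L" and c: "\<And>j. j \<le> n \<Longrightarrow> c j \<in> L" "(\<Sum>j\<le>n. c j * b ^ j) = 0" "\<exists>j\<le>n. c j \<noteq> 0"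
  shows "b \<in> L"
proof -
  define g where "g = (\<Sum>i\<le>n. Polynomial.monom (c i) i)"
  have "poly.coeff g i = c i" if "i \<le> n" for i
    using that by (simp add: g_def coeff_sum if_distrib sum.delta cong: if_cong)
  then have "g \<noteq> 0" using c(3) by auto
  moreover have "g \<in> polys_over L"
    unfolding g_def using c is_subfield_is_subring[OF alg_closed_subfield_is_subfield[OF L]]
    by (intro polys_over_sum_monom) auto
  moreover have "poly g b = 0" using c(2) by (simp add: g_def poly_sum poly_monom)
  ultimately have "b \<in> algebraics L" by (auto simp: algebraics_def)
  then show ?thesis using algebraics_alg_closed[OF L] by simp
qed

text \<open>
  A nontrivial bivariate relation. Its symmetry in \<open>a\<close> and \<open>b\<close> yields
  the exchange property, and it can be specialized in one of the two variables.
\<close>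

definition poly_relation :: "'a::field set \<Rightarrow> 'a \<Rightarrow> 'a \<Rightarrow> bool" where
  "poly_relation L a b \<longleftrightarrow> (\<exists>n c. (\<forall>i j. c i j \<in> L) \<and> (\<exists>i\<le>n. \<exists>j\<le>n. c i j \<noteq> 0) \<and>
     (\<Sum>i\<le>(n::nat). \<Sum>j\<le>n. c i j * a ^ i * b ^ j) = 0)"

lemma poly_relation_adjoin:
  assumes L: "is_subfield L" and b: "b \<in> algebraics (fracs (adjoin L a))"
  shows "poly_relation L a b"
proof -
  note sub = is_subfield_is_subring[OF L]
  note R = adjoin_is_subring[OF sub, of a]
  obtain n d where d: "\<And>j. d j \<in> adjoin L a" "\<exists>j\<le>n. d j \<noteq> 0" "(\<Sum>j\<le>n. d j * b ^ j) = 0"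
    using algebraics_fracs[OF R b] by blast
  have "\<forall>j. \<exists>f. f \<in> polys_over L \<and> d j = poly f a" using d(1) by (auto simp: adjoin_def)
  then obtain f where f: "\<And>j. f j \<in> polys_over L" "\<And>j. d j = poly (f j) a" by metis
  define N where "N = n + Max ((\<lambda>j. Polynomial.degree (f j)) ` {..n})"
  have N: "n \<le> N" "\<And>j. j \<le> n \<Longrightarrow> Polynomial.degree (f j) \<le> N"
    unfolding N_def by (auto intro!: trans_le_add2 Max_ge)
  let ?c = "\<lambda>i j. if j \<le> n then poly.coeff (f j) i else 0"
  have pol: "poly (f j) a = (\<Sum>i\<le>N. poly.coeff (f j) i * a ^ i)" if "j \<le> n" for j
    unfolding poly_altdef using N(2)[OF that]
    by (intro sum.mono_neutral_left) (auto simp: coeff_eq_0)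
  have "(\<Sum>i\<le>N. \<Sum>j\<le>N. ?c i j * a ^ i * b ^ j) = (\<Sum>j\<le>N. \<Sum>i\<le>N. ?c i j * a ^ i * b ^ j)"
    by (rule sum.swap)
  also have "\<dots> = (\<Sum>j\<le>n. d j * b ^ j)"
    by (rule sum.mono_neutral_cong_right) (use N(1) in \<open>auto simp: f(2) pol sum_distrib_right\<close>)
  finally have 0: "(\<Sum>i\<le>N. \<Sum>j\<le>N. ?c i j * a ^ i * b ^ j) = 0" using d(3) by simp
  obtain j where j: "j \<le> n" "d j \<noteq> 0" using d(2) by blast
  then have "f j \<noteq> 0" using f(2) by auto
  then have "?c (Polynomial.degree (f j)) j \<noteq> 0" using j by auto
  moreover have "\<forall>i j. ?c i j \<in> L" using f(1) is_subringD(1)[OF sub] by (auto simp: polys_over_def)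
  ultimately show ?thesis
    unfolding poly_relation_def using 0 N j(1)
    by (intro exI[of _ N] exI[of _ ?c] conjI exI[of _ "Polynomial.degree (f j)"] exI[of _ j]) auto
qed

lemma poly_relation_sym: "poly_relation L a b \<Longrightarrow> poly_relation L b a"
proof -
  assume "poly_relation L a b"
  then obtain n c where c: "\<forall>i j. c i j \<in> L" "\<exists>i\<le>n. \<exists>j\<le>n. c i j \<noteq> 0"
    "(\<Sum>i\<le>(n::nat). \<Sum>j\<le>n. c i j * a ^ i * b ^ j) = 0" by (auto simp: poly_relation_def)
  have "(\<Sum>i\<le>n. \<Sum>j\<le>n. c j i * b ^ i * a ^ j) = (\<Sum>j\<le>n. \<Sum>i\<le>n. c j i * b ^ i * a ^ j)"
    by (rule sum.swap)
  also have "\<dots> = (\<Sum>i\<le>n. \<Sum>j\<le>n. c i j * a ^ i * b ^ j)" by (simp add: algebra_simps)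
  finally show ?thesis
    unfolding poly_relation_def using c by (intro exI[of _ n] exI[of _ "\<lambda>i j. c j i"]) auto
qed

text \<open>
  As \<open>a\<close> is transcendental over \<open>L\<close>, substituting it leaves a nonzero
  coefficient in the relation for \<open>b\<close>.
\<close>

lemma poly_relation_algebraic:
  assumes L: "alg_closed_subfield L" and M: "alg_closed_subfield M" "L \<subseteq> M" "a \<in> M"
    and r: "poly_relation L a b" and a: "a \<notin> L"
  shows "b \<in> M"
proof -
  obtain n c where c: "\<forall>i j. c i j \<in> L" "\<exists>i\<le>n. \<exists>j\<le>n. c i j \<noteq> 0"
    "(\<Sum>i\<le>(n::nat). \<Sum>j\<le>n. c i j * a ^ i * b ^ j) = 0" using r by (auto simp: poly_relation_def)
  let ?d = "\<lambda>j. \<Sum>i\<le>n. c i j * a ^ i"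
  note sub = is_subfield_is_subring[OF alg_closed_subfield_is_subfield[OF M(1)]]
  show ?thesis
  proof (rule root_in_alg_closed[OF M(1)])
    show "?d j \<in> M" for j
      using c(1) M by (intro is_subring_sum[OF sub] is_subringD(4)[OF sub] is_subring_power[OF sub]) auto
    have "(\<Sum>j\<le>n. ?d j * b ^ j) = (\<Sum>j\<le>n. \<Sum>i\<le>n. c i j * a ^ i * b ^ j)"
      by (simp add: sum_distrib_right)
    also have "\<dots> = (\<Sum>i\<le>n. \<Sum>j\<le>n. c i j * a ^ i * b ^ j)" by (rule sum.swap)
    finally show "(\<Sum>j\<le>n. ?d j * b ^ j) = 0" using c(3) by simp
    obtain i j where ij: "i \<le> n" "j \<le> n" "c i j \<noteq> 0" using c(2) by blast
    have "?d j \<noteq> 0"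
    proof
      assume "?d j = 0"
      then have "a \<in> L" using c(1) ij by (intro root_in_alg_closed[OF L, of n "\<lambda>i. c i j" a]) auto
      then show False using a by simp
    qed
    then show "\<exists>j\<le>n. ?d j \<noteq> 0" using ij by blast
  qed
qed

text \<open>
  The right-hand side is an algebraically closed field that contains \<open>a\<close> and
  \<open>V\<close>. Unlike those of the intersection that defines the closure, its elements are
  given by equations.
\<close>

lemma acl_insert_subset:
  fixes F :: "'a::alg_closed_field set"
  shows "acl F (insert a V) \<subseteq> algebraics (fracs (adjoin (acl F V) a))"
proof -
  note sf = alg_closed_subfield_is_subfield[OF acl_closed[of F V]]
  note sub = is_subfield_is_subring[OF sf]
  note R = adjoin_is_subring[OF sub, of a]
  note K = fracs_is_subfield[OF R]
  have "insert a (acl F V) \<subseteq> fracs (adjoin (acl F V) a)"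
    using adjoin_base[OF sub, of a] adjoin_gen[OF sub, of a] fracs_base[OF R] by blast
  then have "insert a (acl F V) \<subseteq> algebraics (fracs (adjoin (acl F V) a))"
    using algebraics_base[OF K] by blast
  then show ?thesis
    using acl_base[of F V] acl_gen[of V F]
    by (intro acl_least alg_closed_subfield_algebraics[OF K]) blast+
qed

lemma acl_insert_relation:
  fixes F :: "'a::alg_closed_field set"
  assumes "b \<in> acl F (insert a V)"
  shows "poly_relation (acl F V) a b"
  using acl_insert_subset assms poly_relation_adjoin[OF alg_closed_subfield_is_subfield[OF acl_closed]]
  by blast

lemma pregeometry_acl: "pregeometry (acl F)" for F :: "'a::alg_closed_field set"
proof
  fix V W :: "'a set" and a b
  show "V \<subseteq> acl F V" by (rule acl_gen)
  show "acl F V \<subseteq> acl F W" if "V \<subseteq> W" using that by (rule acl_mono)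
  show "acl F (acl F V) \<subseteq> acl F V" by (rule acl_least[OF acl_closed acl_base order_refl])
  assume b: "b \<in> acl F (insert a V)" "b \<notin> acl F V"
  have "poly_relation (acl F V) b a" using acl_insert_relation[OF b(1)] by (rule poly_relation_sym)
  moreover have "acl F V \<subseteq> acl F (insert b V)" by (rule acl_mono) auto
  moreover have "b \<in> acl F (insert b V)" using acl_gen[of "insert b V" F] by blast
  ultimately show "a \<in> acl F (insert b V)"
    using poly_relation_algebraic[OF acl_closed acl_closed] b(2) by blast
qed

lemma acl_empty: "alg_closed_subfield F \<Longrightarrow> acl F {} = F"
  using acl_least[of F F "{}"] acl_base[of F "{}"] by auto

section \<open>Algebraic independence\<close>

definition monom_val :: "('a::field \<Rightarrow>\<^sub>0 nat) \<Rightarrow> 'a" where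
  "monom_val m = (\<Prod>x\<in>Poly_Mapping.keys m. x ^ Poly_Mapping.lookup m x)"

lemma monom_val_superset:
  "finite T \<Longrightarrow> Poly_Mapping.keys m \<subseteq> T \<Longrightarrow> monom_val m = (\<Prod>x\<in>T. x ^ Poly_Mapping.lookup m x)"
  unfolding monom_val_def by (intro prod.mono_neutral_left) (auto simp: in_keys_iff)

lemma monom_val_add: "monom_val (m + m') = monom_val m * monom_val m'"
proof -
  let ?T = "Poly_Mapping.keys m \<union> Poly_Mapping.keys m'"
  have "monom_val (m + m') = (\<Prod>x\<in>?T. x ^ Poly_Mapping.lookup (m + m') x)"
    by (rule monom_val_superset) (auto simp: Poly_Mapping.keys_add)
  also have "\<dots> = (\<Prod>x\<in>?T. x ^ Poly_Mapping.lookup m x) * (\<Prod>x\<in>?T. x ^ Poly_Mapping.lookup m' x)"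
    by (simp add: lookup_add power_add prod.distrib)
  also have "\<dots> = monom_val m * monom_val m'"
    using monom_val_superset[of ?T m] monom_val_superset[of ?T m'] by simp
  finally show ?thesis .
qed

lemma monom_val_0: "monom_val 0 = 1"
  by (simp add: monom_val_def)

lemma monom_val_single: "monom_val (Poly_Mapping.single x i) = x ^ i"
  using monom_val_superset[of "{x}" "Poly_Mapping.single x i"] by auto

lemma alg_indep_iff_monomials:
  assumes "0 \<in> F"
  shows "alg_indep F S \<longleftrightarrow> (\<forall>Mon c. finite Mon \<and> (\<forall>m\<in>Mon. Poly_Mapping.keys m \<subseteq> S) \<and> (\<forall>m. c m \<in> F) \<and>
     (\<Sum>m\<in>Mon. c m * monom_val m) = 0 \<longrightarrow> (\<forall>m\<in>Mon. c m = 0))"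
    (is "_ \<longleftrightarrow> ?R")
proof
  assume ai: "alg_indep F S"
  show ?R
  proof (intro allI impI ballI, elim conjE)
    fix Mon c m assume *: "finite Mon" "\<forall>m\<in>Mon. Poly_Mapping.keys m \<subseteq> S" "\<forall>m. c m \<in> F"
      "(\<Sum>m\<in>Mon. c m * monom_val m) = 0" "m \<in> Mon"
    define g where "g = Abs_poly_mapping (\<lambda>m. if m \<in> Mon then c m else 0)"
    have "finite {m. (if m \<in> Mon then c m else 0) \<noteq> 0}" using *(1) by (rule rev_finite_subset) auto
    then have lk: "Poly_Mapping.lookup g = (\<lambda>m. if m \<in> Mon then c m else 0)"
      unfolding g_def by (subst Abs_poly_mapping_inverse) auto
    have keys: "Poly_Mapping.keys g \<subseteq> Mon" by (auto simp: in_keys_iff lk split: if_splits)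
    have "eval_self g = (\<Sum>m\<in>Mon. c m * monom_val m)"
      unfolding eval_self_def monom_val_def
      by (rule sum.mono_neutral_cong_left) (use *(1) keys in \<open>auto simp: in_keys_iff lk\<close>)
    moreover have "\<forall>m. Poly_Mapping.lookup g m \<in> F" using *(3) assms by (simp add: lk)
    moreover have "\<forall>m\<in>Poly_Mapping.keys g. Poly_Mapping.keys m \<subseteq> S" using *(2) keys by blast
    ultimately have "g = 0" using ai *(4) by (simp add: alg_indep_def)
    then show "c m = 0" using *(5) lk by (metis lookup_zero)
  qed
next
  assume r: ?R
  show "alg_indep F S"
    unfolding alg_indep_def
  proof (intro allI impI, elim conjE)
    fix g :: "('a \<Rightarrow>\<^sub>0 nat) \<Rightarrow>\<^sub>0 'a"
    assume g: "\<forall>m. Poly_Mapping.lookup g m \<in> F"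
      "\<forall>m\<in>Poly_Mapping.keys g. Poly_Mapping.keys m \<subseteq> S" "eval_self g = 0"
    have "\<forall>m\<in>Poly_Mapping.keys g. Poly_Mapping.lookup g m = 0"
      using r[rule_format, of "Poly_Mapping.keys g" "Poly_Mapping.lookup g"] g
      by (auto simp: eval_self_def monom_val_def)
    then show "g = 0" by (auto simp: in_keys_iff intro!: poly_mapping_eqI)
  qed
qed

lemma alg_indep_subset: "alg_indep F S \<Longrightarrow> T \<subseteq> S \<Longrightarrow> alg_indep F T"
  unfolding alg_indep_def by blast

lemma monom_split:
  "m = Poly_Mapping.update b 0 m + Poly_Mapping.single b (Poly_Mapping.lookup m b)"
  by (rule poly_mapping_eqI) (auto simp: lookup_add lookup_update lookup_single when_def)

lemma keys_update_0: "Poly_Mapping.keys (Poly_Mapping.update b 0 m) = Poly_Mapping.keys m - {b}"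
  by (auto simp: in_keys_iff lookup_update split: if_splits)

lemma monom_val_in:
  assumes "is_subring R" "Poly_Mapping.keys m \<subseteq> R"
  shows "monom_val m \<in> R"
proof -
  have "(\<Prod>x\<in>T. x ^ Poly_Mapping.lookup m x) \<in> R" if "finite T" "T \<subseteq> R" for T
    using that by (induction T) (auto intro: is_subringD[OF assms(1)] is_subring_power[OF assms(1)])
  then show ?thesis unfolding monom_val_def using assms(2) by simp
qed

text \<open>
  Finitely many polynomials in the elements of \<open>S\<close> are the coefficients of a
  polynomial in \<open>b\<close>. This translates the definition of independence by multivariate
  polynomials into the closure operator, one variable at a time.
\<close>

lemma alg_indep_insert:
  fixes F :: "'a::alg_closed_field set"
  assumes F: "alg_closed_subfield F" and b: "b \<notin> S"
  shows "alg_indep F (insert b S) \<longleftrightarrow> alg_indep F S \<and> b \<notin> acl F S"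
proof -
  note FS = alg_closed_subfield_is_subfield[OF F]
  note FR = is_subfield_is_subring[OF FS]
  note F0 = is_subringD(1)[OF FR]
  note M = alg_indep_iff_monomials[OF F0]
  note AR = is_subfield_is_subring[OF alg_closed_subfield_is_subfield[OF acl_closed[of F S]]]
  show ?thesis
  proof (intro iffI conjI notI)
    assume "alg_indep F (insert b S)" then show "alg_indep F S" by (rule alg_indep_subset) auto
  next
    assume ai: "alg_indep F (insert b S)" and bS: "b \<in> acl F S"
    \<comment> \<open>\<open>R\<close> is the polynomial ring \<open>F[S]\<close>. A relation for
      \<open>b\<close> over its field of fractions is cleared of denominators and expanded into
      monomials in \<open>S\<close> and \<open>b\<close>.\<close>
    define I where "I = {m :: 'a \<Rightarrow>\<^sub>0 nat. Poly_Mapping.keys m \<subseteq> S}"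
    define R where "R = lspan F (monom_val ` I)"
    have inj: "m = m' \<and> j = j'" if "m + Poly_Mapping.single b j = m' + Poly_Mapping.single b j'" "m \<in> I" "m' \<in> I"
      for m m' j j'
    proof -
      have nb: "Poly_Mapping.lookup m b = 0" "Poly_Mapping.lookup m' b = 0"
        using that(2,3) b by (auto simp: I_def in_keys_iff)
      have "Poly_Mapping.lookup (m + Poly_Mapping.single b j) b = Poly_Mapping.lookup (m' + Poly_Mapping.single b j') b"
        using that(1) by simp
      then have "j = j'" using nb by (simp add: lookup_add)
      then show ?thesis using that(1) by simp
    qed
    have mult: "x * y \<in> R" if "x \<in> R" "y \<in> R" for x y
      using that(1) unfolding R_def
    proof (induction rule: lspan.induct)
      case (gen x)
      then obtain m where m: "m \<in> I" "x = monom_val m" by blast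
      show ?case using that(2) unfolding R_def
      proof (induction rule: lspan.induct)
        case (gen y)
        then obtain m' where m': "m' \<in> I" "y = monom_val m'" by blast
        have "m + m' \<in> I" using m m' Poly_Mapping.keys_add[of m m'] by (auto simp: I_def)
        then show ?case using m m' by (auto simp: monom_val_add[symmetric] intro!: lspan.gen)
      qed (auto simp: algebra_simps intro: lspan.intros)
    qed (auto simp: algebra_simps intro: lspan.intros)
    have one: "1 \<in> R"
      unfolding R_def using monom_val_0 by (auto intro!: lspan.gen image_eqI[of _ _ 0] simp: I_def)
    have "- x \<in> R" if "x \<in> R" for x
      using that lspan.scale[of "-1" F x "monom_val ` I"] is_subringD(2,5)[OF FR] unfolding R_def by simp
    then have R: "is_subring R"
      unfolding is_subring_def using mult one by (auto simp: R_def intro: lspan.intros)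
    have FinR: "F \<subseteq> R"
    proof
      fix x assume "x \<in> F"
      then have "x * 1 \<in> R" using one unfolding R_def by (rule lspan.scale)
      then show "x \<in> R" by simp
    qed
    have SR: "S \<subseteq> R"
    proof
      fix x assume "x \<in> S"
      then have "Poly_Mapping.single x 1 \<in> I" by (auto simp: I_def)
      then show "x \<in> R" unfolding R_def using monom_val_single[of x 1]
        by (intro lspan.gen image_eqI[of _ _ "Poly_Mapping.single x 1"]) auto
    qed
    have "acl F S \<subseteq> algebraics (fracs R)"
      using FinR SR fracs_base[OF R] algebraics_base[OF fracs_is_subfield[OF R]]
      by (intro acl_least alg_closed_subfield_algebraics fracs_is_subfield[OF R]) blast+
    then obtain n d where d: "\<And>j. d j \<in> R" "\<exists>j\<le>n. d j \<noteq> 0" "(\<Sum>j\<le>n. d j * b ^ j) = 0"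
      using algebraics_fracs[OF R, of b] bS by blast
    have "\<forall>j. \<exists>J c. finite J \<and> J \<subseteq> I \<and> (\<forall>m. c m \<in> F) \<and> d j = (\<Sum>m\<in>J. c m * monom_val m)"
      using d(1) lspan_imageD[OF FS] unfolding R_def by blast
    then obtain J c where Jc: "\<And>j. finite (J j)" "\<And>j. J j \<subseteq> I" "\<And>j m. c j m \<in> F"
      "\<And>j. d j = (\<Sum>m\<in>J j. c j m * monom_val m)" by metis
    define P where "P = Sigma {..n} J"
    define mm where "mm = (\<lambda>(j::nat, m). m + Poly_Mapping.single b j)"
    have fP: "finite P" using Jc(1) by (simp add: P_def)
    have injP: "inj_on mm P"
    proof (rule inj_onI)
      fix u v assume uv: "u \<in> P" "v \<in> P" "mm u = mm v"
      then have "snd u \<in> I" "snd v \<in> I" by (auto simp: P_def intro: subsetD[OF Jc(2)])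
      then show "u = v"
        using inj[of "snd u" "fst u" "snd v" "fst v"] uv(3) by (auto simp: mm_def case_prod_beta prod_eq_iff)
    qed
    define C where "C = (\<lambda>m. if m \<in> mm ` P then (case the_inv_into P mm m of (j, m) \<Rightarrow> c j m) else 0)"
    have CP: "C (mm (j, m)) = c j m" if "(j, m) \<in> P" for j m
      using that by (simp add: C_def the_inv_into_f_f[OF injP])
    have "(\<Sum>m\<in>mm ` P. C m * monom_val m) = (\<Sum>u\<in>P. C (mm u) * monom_val (mm u))"
      by (simp add: sum.reindex[OF injP])
    also have "\<dots> = (\<Sum>(j, m)\<in>P. c j m * monom_val m * b ^ j)"
    proof (rule sum.cong, simp)
      fix u assume "u \<in> P"
      then obtain j m where u: "u = (j, m)" "C (mm u) = c j m" using CP by (cases u) auto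
      have "monom_val (mm u) = monom_val m * b ^ j"
        by (simp add: u(1) mm_def monom_val_add monom_val_single)
      then show "C (mm u) * monom_val (mm u) = (case u of (j, m) \<Rightarrow> c j m * monom_val m * b ^ j)"
        using u(2) by (simp add: u(1))
    qed
    also have "\<dots> = (\<Sum>j\<le>n. \<Sum>m\<in>J j. c j m * monom_val m * b ^ j)"
      unfolding P_def using Jc(1) by (subst sum.Sigma) auto
    also have "\<dots> = 0" using d(3) by (simp add: Jc(4) sum_distrib_right)
    finally have "(\<Sum>m\<in>mm ` P. C m * monom_val m) = 0" .
    moreover have "\<forall>m\<in>mm ` P. Poly_Mapping.keys m \<subseteq> insert b S"
    proof
      fix m assume "m \<in> mm ` P"
      then obtain j m' where m': "m = m' + Poly_Mapping.single b j" "m' \<in> I"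
        using Jc(2) by (auto simp: P_def mm_def)
      then show "Poly_Mapping.keys m \<subseteq> insert b S"
        using Poly_Mapping.keys_add[of m' "Poly_Mapping.single b j"] by (auto simp: I_def split: if_splits)
    qed
    moreover have "\<forall>m. C m \<in> F" using Jc(3) F0 by (auto simp: C_def split: prod.split)
    ultimately have "\<forall>m\<in>mm ` P. C m = 0" using ai[unfolded M] fP by blast
    then have "c j m = 0" if "(j, m) \<in> P" for j m using CP that by auto
    then have "d j = 0" if "j \<le> n" for j using that by (auto simp: Jc(4) P_def)
    then show False using d(2) by blast
  next
    assume *: "alg_indep F S \<and> b \<notin> acl F S"
    show "alg_indep F (insert b S)"
      unfolding M
    proof (intro allI impI ballI, elim conjE)
      fix Mon c m0 assume c: "finite Mon" "\<forall>m\<in>Mon. Poly_Mapping.keys m \<subseteq> insert b S" "\<forall>m. c m \<in> F"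
        "(\<Sum>m\<in>Mon. c m * monom_val m) = 0" "m0 \<in> Mon"
      \<comment> \<open>Collect the monomials by their exponent of \<open>b\<close>. The
        coefficients \<open>?d k\<close> of the resulting relation for \<open>b\<close> must vanish,
        and then independence of \<open>S\<close> applies to each of them.\<close>
      let ?e = "\<lambda>m. Poly_Mapping.lookup m b" and ?r = "\<lambda>m. Poly_Mapping.update b 0 m"
      define N where "N = Max (?e ` Mon)"
      have eN: "?e m \<le> N" if "m \<in> Mon" for m unfolding N_def using that c(1) by simp
      define Mk where "Mk = (\<lambda>k. {m\<in>Mon. ?e m = k})"
      let ?d = "\<lambda>k. \<Sum>m\<in>Mk k. c m * monom_val (?r m)"
      have val: "monom_val m = monom_val (?r m) * b ^ ?e m" for m
        using monom_val_add[of "?r m" "Poly_Mapping.single b (?e m)"] monom_split[of m b]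
        by (simp add: monom_val_single)
      have "(\<Sum>m\<in>Mon. c m * monom_val m) = (\<Sum>k\<le>N. \<Sum>m\<in>Mk k. c m * monom_val m)"
        unfolding Mk_def using c(1) eN by (intro sum.group[symmetric]) auto
      also have "\<dots> = (\<Sum>k\<le>N. ?d k * b ^ k)"
      proof (rule sum.cong, simp)
        fix k
        show "(\<Sum>m\<in>Mk k. c m * monom_val m) = ?d k * b ^ k"
          unfolding sum_distrib_right
        proof (rule sum.cong, simp)
          fix m assume "m \<in> Mk k"
          then show "c m * monom_val m = c m * monom_val (?r m) * b ^ k"
            by (subst val) (simp add: Mk_def mult.assoc)
        qed
      qed
      finally have 0: "(\<Sum>k\<le>N. ?d k * b ^ k) = 0" using c(4) by simp
      have rS: "Poly_Mapping.keys (?r m) \<subseteq> S" if "m \<in> Mon" for m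
        using c(2) that by (auto simp: keys_update_0)
      have "?d k \<in> acl F S" for k
      proof (intro is_subring_sum[OF AR] is_subringD(4)[OF AR] monom_val_in[OF AR])
        fix m assume "m \<in> Mk k"
        then show "Poly_Mapping.keys (?r m) \<subseteq> acl F S" using rS[of m] acl_gen[of S F] by (auto simp: Mk_def)
        show "c m \<in> acl F S" using c(3) acl_base by blast
      qed
      then have d0: "?d k = 0" if "k \<le> N" for k
        using root_in_alg_closed[OF acl_closed, of N ?d F S b] 0 * that by blast
      define k where "k = ?e m0"
      have injr: "inj_on ?r (Mk k)"
      proof (rule inj_onI)
        fix m m' assume "m \<in> Mk k" "m' \<in> Mk k" "?r m = ?r m'"
        then show "m = m'" using monom_split[of m b] monom_split[of m' b] by (simp add: Mk_def)
      qed
      define C where "C = (\<lambda>m. if m \<in> ?r ` Mk k then c (the_inv_into (Mk k) ?r m) else 0)"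
      have Cr: "C (?r m) = c m" if "m \<in> Mk k" for m
        using that by (simp add: C_def the_inv_into_f_f[OF injr])
      have "(\<Sum>m\<in>?r ` Mk k. C m * monom_val m) = ?d k"
        by (simp add: sum.reindex[OF injr] Cr)
      also have "\<dots> = 0" using d0 eN c(5) by (simp add: k_def)
      finally have "(\<Sum>m\<in>?r ` Mk k. C m * monom_val m) = 0" .
      moreover have "finite (?r ` Mk k)" using c(1) by (simp add: Mk_def)
      moreover have "\<forall>m\<in>?r ` Mk k. Poly_Mapping.keys m \<subseteq> S" using rS by (auto simp: Mk_def)
      moreover have "\<forall>m. C m \<in> F" using c(3) F0 by (simp add: C_def)
      ultimately have "\<forall>m\<in>?r ` Mk k. C m = 0" using *[unfolded M] by blast
      moreover have "m0 \<in> Mk k" using c(5) by (simp add: Mk_def k_def)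
      ultimately show "c m0 = 0" using Cr by auto
    qed
  qed
qed

lemma alg_indep_iff_independent:
  fixes F :: "'a::alg_closed_field set"
  assumes F: "alg_closed_subfield F" and "finite S"
  shows "alg_indep F S \<longleftrightarrow> pregeometry.independent (acl F) S"
proof -
  interpret pregeometry "acl F" by (rule pregeometry_acl)
  show ?thesis using assms(2)
  proof (induction S)
    case empty
    have "alg_indep F {}"
      unfolding alg_indep_iff_monomials[OF is_subringD(1)[OF is_subfield_is_subring[OF alg_closed_subfield_is_subfield[OF F]]]]
    proof (intro allI impI ballI, elim conjE)
      fix Mon c and m :: "'a \<Rightarrow>\<^sub>0 nat"
      assume c: "finite Mon" "\<forall>m\<in>Mon. Poly_Mapping.keys m \<subseteq> {}" "(\<Sum>m\<in>Mon. c m * monom_val m) = 0" "m \<in> Mon"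
      have all0: "m = 0" if "m \<in> Mon" for m
        using c(2) that by (metis keys_eq_empty subset_empty)
      then have "Mon = {0}" using c(4) by blast
      then show "c m = 0" using c(3) all0[OF c(4)] by (simp add: monom_val_0)
    qed
    then show ?case by simp
  next
    case (insert b S)
    then show ?case using alg_indep_insert[OF F insert(2)] independent_insert_iff[OF insert(2)] by simp
  qed
qed

section \<open>Extension of places\<close>

text \<open>
  The graph of a ring homomorphism from a subring of \<open>'a\<close> to \<open>A\<close>.
  Extension of homomorphisms is inclusion of graphs, as Zorn's lemma needs it.
\<close>

definition partial_hom :: "'b set \<Rightarrow> ('a::field \<times> 'b::field) set \<Rightarrow> bool" where
  "partial_hom A G \<longleftrightarrow> (0, 0) \<in> G \<and> (1, 1) \<in> G \<and>
     (\<forall>x y x' y'. (x, y) \<in> G \<longrightarrow> (x', y') \<in> G \<longrightarrow> (x + x', y + y') \<in> G \<and> (x * x', y * y') \<in> G) \<and>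
     (\<forall>x y. (x, y) \<in> G \<longrightarrow> (- x, - y) \<in> G) \<and> (\<forall>y. (0, y) \<in> G \<longrightarrow> y = 0) \<and> snd ` G \<subseteq> A"

lemma partial_homD:
  assumes "partial_hom A G"
  shows "(0, 0) \<in> G" "(1, 1) \<in> G"
    "(x, y) \<in> G \<Longrightarrow> (x', y') \<in> G \<Longrightarrow> (x + x', y + y') \<in> G"
    "(x, y) \<in> G \<Longrightarrow> (x', y') \<in> G \<Longrightarrow> (x * x', y * y') \<in> G"
    "(x, y) \<in> G \<Longrightarrow> (- x, - y) \<in> G" "(0, y) \<in> G \<Longrightarrow> y = 0" "(x, y) \<in> G \<Longrightarrow> y \<in> A"
  using assms unfolding partial_hom_def by (blast, blast, blast, blast, blast, blast, force)

lemma partial_hom_diff: "partial_hom A G \<Longrightarrow> (x, y) \<in> G \<Longrightarrow> (x', y') \<in> G \<Longrightarrow> (x - x', y - y') \<in> G"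
  using partial_homD(3)[of A G x y "- x'" "- y'"] partial_homD(5)[of A G x' y'] by simp

lemma partial_hom_unique: "partial_hom A G \<Longrightarrow> (x, y) \<in> G \<Longrightarrow> (x, y') \<in> G \<Longrightarrow> y = y'"
  using partial_hom_diff[of A G x y x y'] partial_homD(6)[of A G "y - y'"] by simp

lemma partial_hom_sum:
  "partial_hom A G \<Longrightarrow> (\<And>i. i \<in> I \<Longrightarrow> (f i, g i) \<in> G) \<Longrightarrow> (sum f I, sum g I) \<in> G"
  by (induction I rule: infinite_finite_induct) (auto intro: partial_homD)

lemma partial_hom_power: "partial_hom A G \<Longrightarrow> (x, y) \<in> G \<Longrightarrow> (x ^ n, y ^ n) \<in> G"
  by (induction n) (auto intro: partial_homD)

text \<open>
  A relation, as a homomorphism given by its graph need not be applied to coefficients.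
\<close>

definition poly_lift :: "('a::field \<times> 'b::field) set \<Rightarrow> 'a poly \<Rightarrow> 'b poly \<Rightarrow> bool" where
  "poly_lift G f h \<longleftrightarrow> (\<forall>i. (poly.coeff f i, poly.coeff h i) \<in> G)"

lemma poly_lift_0: "partial_hom A G \<Longrightarrow> poly_lift G 0 0"
  by (simp add: poly_lift_def partial_homD)

lemma poly_lift_pCons: "(a, c) \<in> G \<Longrightarrow> poly_lift G f h \<Longrightarrow> poly_lift G (pCons a f) (pCons c h)"
  by (auto simp: poly_lift_def coeff_pCons split: nat.splits)

lemma poly_lift_add: "partial_hom A G \<Longrightarrow> poly_lift G f h \<Longrightarrow> poly_lift G f' h' \<Longrightarrow> poly_lift G (f + f') (h + h')"
  by (auto simp: poly_lift_def intro: partial_homD)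

lemma poly_lift_minus: "partial_hom A G \<Longrightarrow> poly_lift G f h \<Longrightarrow> poly_lift G (- f) (- h)"
  by (auto simp: poly_lift_def intro: partial_homD)

lemma poly_lift_diff: "partial_hom A G \<Longrightarrow> poly_lift G f h \<Longrightarrow> poly_lift G f' h' \<Longrightarrow> poly_lift G (f - f') (h - h')"
  by (auto simp: poly_lift_def intro: partial_hom_diff)

lemma poly_lift_mult: "partial_hom A G \<Longrightarrow> poly_lift G f h \<Longrightarrow> poly_lift G f' h' \<Longrightarrow> poly_lift G (f * f') (h * h')"
  by (auto simp: poly_lift_def coeff_mult intro!: partial_hom_sum intro: partial_homD)

lemma poly_lift_monom: "partial_hom A G \<Longrightarrow> (x, y) \<in> G \<Longrightarrow> poly_lift G (Polynomial.monom x n) (Polynomial.monom y n)"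
  by (auto simp: poly_lift_def intro: partial_homD)

lemma poly_lift_smult: "partial_hom A G \<Longrightarrow> (x, y) \<in> G \<Longrightarrow> poly_lift G f h \<Longrightarrow> poly_lift G (Polynomial.smult x f) (Polynomial.smult y h)"
  by (auto simp: poly_lift_def intro: partial_homD)

lemma poly_eq_sum: fixes f :: "'a::field poly" shows "Polynomial.degree f \<le> n \<Longrightarrow> poly f x = (\<Sum>i\<le>n. poly.coeff f i * x ^ i)"
  unfolding poly_altdef by (intro sum.mono_neutral_left) (auto simp: coeff_eq_0)

text \<open>
  The extension of the homomorphism to the ring generated by \<open>b\<close> that sends
  \<open>b\<close> to \<open>\<beta>\<close>.
\<close>

definition hom_adjoin :: "('a::field \<times> 'b::field) set \<Rightarrow> 'a \<Rightarrow> 'b \<Rightarrow> ('a \<times> 'b) set" where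
  "hom_adjoin G b \<beta> = {(poly f b, poly h \<beta>) | f h. poly_lift G f h}"

lemma partial_hom_adjoin:
  assumes A: "is_subring A" "\<beta> \<in> A" and G: "partial_hom A G"
    and cond: "\<And>f h. poly_lift G f h \<Longrightarrow> poly f b = 0 \<Longrightarrow> poly h \<beta> = 0"
  shows "partial_hom A (hom_adjoin G b \<beta>)" "G \<subseteq> hom_adjoin G b \<beta>" "(b, \<beta>) \<in> hom_adjoin G b \<beta>"
proof -
  note D = partial_homD[OF G]
  have I: "(poly f b, poly h \<beta>) \<in> hom_adjoin G b \<beta>" if "poly_lift G f h" for f h
    using that by (auto simp: hom_adjoin_def)
  show sub: "G \<subseteq> hom_adjoin G b \<beta>"
  proof (rule subrelI)
    fix x y assume "(x, y) \<in> G"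
    then show "(x, y) \<in> hom_adjoin G b \<beta>"
      using I[OF poly_lift_pCons[OF _ poly_lift_0[OF G], of x y]] by simp
  qed
  show "(b, \<beta>) \<in> hom_adjoin G b \<beta>"
    using I[OF poly_lift_pCons[OF D(1) poly_lift_pCons[OF D(2) poly_lift_0[OF G]]]] by simp
  show "partial_hom A (hom_adjoin G b \<beta>)"
    unfolding partial_hom_def
  proof (intro conjI allI impI)
    show "(0, 0) \<in> hom_adjoin G b \<beta>" "(1, 1) \<in> hom_adjoin G b \<beta>" using sub D(1,2) by auto
    fix x y assume xy: "(x, y) \<in> hom_adjoin G b \<beta>"
    then obtain f h where fh: "poly_lift G f h" "x = poly f b" "y = poly h \<beta>" by (auto simp: hom_adjoin_def)
    show "(- x, - y) \<in> hom_adjoin G b \<beta>" using I[OF poly_lift_minus[OF G fh(1)]] fh by simp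
    fix x' y' assume xy': "(x', y') \<in> hom_adjoin G b \<beta>"
    then obtain f' h' where fh': "poly_lift G f' h'" "x' = poly f' b" "y' = poly h' \<beta>" by (auto simp: hom_adjoin_def)
    show "(x + x', y + y') \<in> hom_adjoin G b \<beta>" using I[OF poly_lift_add[OF G fh(1) fh'(1)]] fh fh' by simp
    show "(x * x', y * y') \<in> hom_adjoin G b \<beta>" using I[OF poly_lift_mult[OF G fh(1) fh'(1)]] fh fh' by simp
  next
    fix y assume "(0, y) \<in> hom_adjoin G b \<beta>"
    then show "y = 0" using cond by (auto simp: hom_adjoin_def)
  next
    show "snd ` hom_adjoin G b \<beta> \<subseteq> A"
    proof
      fix y assume "y \<in> snd ` hom_adjoin G b \<beta>"
      then obtain f h where fh: "poly_lift G f h" "y = poly h \<beta>" by (auto simp: hom_adjoin_def)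
      have "h \<in> polys_over A" using fh(1) D(7) by (auto simp: poly_lift_def polys_over_def)
      then show "y \<in> A" using poly_in_subring[OF A(1) _ A(2)] fh(2) by simp
    qed
  qed
qed

text \<open>
  This is Chevalley's argument. If \<open>b\<close> cannot be added to the domain with any value
  in \<open>A\<close>, then the images of the polynomials that vanish at \<open>b\<close> have
  no common root, hence generate the unit ideal: \<open>b\<close> satisfies an equation whose
  image is the constant \<open>1\<close>. Such equations for both \<open>b\<close> and its
  inverse can be used to lower each other's degree until they are contradictory.
\<close>

lemma maximal_partial_hom_place:
  fixes A :: "'b::field set" and G :: "('a::field \<times> 'b) set"
  assumes A: "alg_closed_subfield A" and G: "partial_hom A G"
    and max: "\<And>G'. partial_hom A G' \<Longrightarrow> G \<subseteq> G' \<Longrightarrow> G' = G"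
  shows "(x, y) \<in> G \<Longrightarrow> y \<noteq> 0 \<Longrightarrow> (inverse x, inverse y) \<in> G"
    and "(\<exists>y. (b, y) \<in> G) \<or> (\<exists>y. (inverse b, y) \<in> G)"
proof -
  note D = partial_homD[OF G]
  note AF = alg_closed_subfield_is_subfield[OF A]
  note AR = is_subfield_is_subring[OF AF]
  have maxin: "(b, \<beta>) \<in> G"
    if "\<beta> \<in> A" "\<And>f h. poly_lift G f h \<Longrightarrow> poly f b = 0 \<Longrightarrow> poly h \<beta> = 0" for b \<beta>
  proof -
    have "hom_adjoin G b \<beta> = G"
      by (rule max; rule partial_hom_adjoin[OF AR that(1) G]) (use that(2) in blast)+
    moreover have "(b, \<beta>) \<in> hom_adjoin G b \<beta>"
      by (rule partial_hom_adjoin(3)[OF AR that(1) G]) (use that(2) in blast)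
    ultimately show ?thesis by simp
  qed
  show inv: "(inverse x, inverse y) \<in> G" if xy: "(x, y) \<in> G" "y \<noteq> 0" for x y
  proof (rule maxin)
    show "inverse y \<in> A" using D(7)[OF xy(1)] AF is_subfield_inverse by blast
    have x0: "x \<noteq> 0" using D(6) xy by blast
    fix f h assume fh: "poly_lift G f h" "poly f (inverse x) = 0"
    define n where "n = max (Polynomial.degree f) (Polynomial.degree h)"
    have rev: "z ^ n * poly g (inverse z) = (\<Sum>i\<le>n. poly.coeff g i * z ^ (n - i))"
      if "Polynomial.degree g \<le> n" "z \<noteq> 0" for g and z :: "'c::field"
    proof -
      have "z ^ n * poly g (inverse z) = (\<Sum>i\<le>n. poly.coeff g i * (z ^ n * inverse z ^ i))"
        by (simp add: poly_eq_sum[OF that(1)] sum_distrib_left algebra_simps)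
      also have "\<dots> = (\<Sum>i\<le>n. poly.coeff g i * z ^ (n - i))"
        using that(2) by (intro sum.cong) (auto simp: power_diff power_inverse field_class.field_divide_inverse)
      finally show ?thesis .
    qed
    have "((\<Sum>i\<le>n. poly.coeff f i * x ^ (n - i)), (\<Sum>i\<le>n. poly.coeff h i * y ^ (n - i))) \<in> G"
      using fh(1) xy(1)
      by (intro partial_hom_sum[OF G] D(4) partial_hom_power[OF G]) (auto simp: poly_lift_def)
    then have "(x ^ n * poly f (inverse x), y ^ n * poly h (inverse y)) \<in> G"
      using rev[of f x] rev[of h y] x0 xy(2) by (simp add: n_def)
    then have "y ^ n * poly h (inverse y) = 0" using fh(2) by (intro D(6)) simp
    then show "poly h (inverse y) = 0" using xy(2) by simp
  qed
  have unit_relation: "\<exists>f. poly_lift G f 1 \<and> poly f b = 0" if nb: "\<nexists>y. (b, y) \<in> G" for b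
  proof -
    define I where "I = {h. \<exists>f. poly_lift G f h \<and> poly f b = 0}"
    have noroot: "\<exists>h\<in>I. poly h \<beta> \<noteq> 0" if "\<beta> \<in> A" for \<beta>
      using maxin[of \<beta> b] that nb unfolding I_def by blast
    have "0 \<in> A" using is_subringD(1)[OF AR] .
    then obtain h1 where "h1 \<in> I" "h1 \<noteq> 0" using noroot[of 0] by (metis poly_0)
    then obtain h0 where h0: "h0 \<in> I" "h0 \<noteq> 0"
      and least: "\<And>h. h \<in> I \<Longrightarrow> h \<noteq> 0 \<Longrightarrow> Polynomial.degree h0 \<le> Polynomial.degree h"
      using arg_min_nat_lemma[of "\<lambda>h. h \<in> I \<and> h \<noteq> 0" h1 Polynomial.degree] by blast
    obtain f0 where f0: "poly_lift G f0 h0" "poly f0 b = 0" using h0(1) by (auto simp: I_def)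
    define c where "c = Polynomial.lead_coeff h0"
    define u where "u = poly.coeff f0 (Polynomial.degree h0)"
    have uc: "(u, c) \<in> G" "c \<noteq> 0" using f0(1) h0(2) by (auto simp: c_def u_def poly_lift_def)
    note uc' = inv[OF uc]
    \<comment> \<open>The polynomials in \<open>I\<close> are multiples of \<open>h0\<close>, which
      has least degree, so a root of \<open>h0\<close> would be a common root. Division with
      remainder works because \<open>u\<close>, which lifts the leading coefficient of
      \<open>h0\<close>, is invertible in the domain.\<close>
    have "Polynomial.degree h0 = 0"
    proof (rule ccontr)
      assume "Polynomial.degree h0 \<noteq> 0"
      moreover have "\<forall>i. poly.coeff h0 i \<in> A" using f0(1) D(7) by (auto simp: poly_lift_def)
      ultimately obtain \<beta> where \<beta>: "\<beta> \<in> A" "poly h0 \<beta> = 0" using A by (auto simp: alg_closed_subfield_def)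
      have "poly h \<beta> = 0" if "h \<in> I" for h
        using that
      proof (induction "Polynomial.degree h" arbitrary: h rule: less_induct)
        case less
        obtain f where f: "poly_lift G f h" "poly f b = 0" using less.prems by (auto simp: I_def)
        show ?case
        proof (cases "h = 0")
          case False
          define k where "k = Polynomial.degree h - Polynomial.degree h0"
          define q where "q = Polynomial.lead_coeff h * inverse c"
          define q' where "q' = poly.coeff f (Polynomial.degree h) * inverse u"
          have qG: "(q', q) \<in> G" unfolding q_def q'_def using f(1) uc' by (intro D(4)) (auto simp: poly_lift_def)
          define h' where "h' = h - Polynomial.monom q k * h0"
          define f' where "f' = f - Polynomial.monom q' k * f0"
          have "poly_lift G f' h'" unfolding f'_def h'_def
            by (intro poly_lift_diff[OF G] poly_lift_mult[OF G] poly_lift_monom[OF G] f f0 qG)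
          moreover have "poly f' b = 0" using f f0 by (simp add: f'_def)
          ultimately have h'I: "h' \<in> I" by (auto simp: I_def)
          have deg: "Polynomial.degree h = Polynomial.degree h0 + k"
            using least[OF less.prems False] by (simp add: k_def)
          have "Polynomial.degree (Polynomial.monom q k * h0) \<le> Polynomial.degree h"
            using degree_mult_le[of "Polynomial.monom q k" h0] degree_monom_le[of q k] deg by linarith
          then have "Polynomial.degree h' \<le> Polynomial.degree h"
            unfolding h'_def by (intro degree_diff_le) auto
          moreover have "poly.coeff h' (Polynomial.degree h) = 0"
            using uc(2) by (simp add: h'_def coeff_monom_mult deg q_def c_def)
          ultimately have "h' = 0 \<or> Polynomial.degree h' < Polynomial.degree h"
            by (rule eq_zero_or_degree_less)
          then have "poly h' \<beta> = 0" using less.hyps h'I by auto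
          then show ?thesis using \<beta>(2) by (simp add: h'_def)
        qed simp
      qed
      then show False using noroot[OF \<beta>(1)] by blast
    qed
    then have "h0 = [:c:]" unfolding c_def by (metis degree_0_id)
    then have "Polynomial.smult (inverse c) h0 = 1" using uc(2) by (simp add: one_pCons)
    then have "poly_lift G (Polynomial.smult (inverse u) f0) 1"
      using poly_lift_smult[OF G uc' f0(1)] by simp
    then show ?thesis using f0(2) by (intro exI[of _ "Polynomial.smult (inverse u) f0"]) simp
  qed
  have reduce: "\<exists>f'. poly_lift G f' 1 \<and> poly f' b = 0 \<and> Polynomial.degree f' < Polynomial.degree f"
    if f: "poly_lift G f 1" "poly f b = 0" and g: "poly_lift G g 1" "poly g (inverse b) = 0"
      and le: "Polynomial.degree g \<le> Polynomial.degree f" and b0: "b \<noteq> 0" for f g b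
  proof -
    define d where "d = Polynomial.degree f"
    define e where "e = Polynomial.degree g"
    define c where "c = poly.coeff g 0"
    define r where "r = reflect_poly g"
    have cG: "(c, 1) \<in> G" using g(1) by (auto simp: c_def poly_lift_def dest: spec[of _ 0])
    then have c0: "c \<noteq> 0" using D(6)[of 1] by auto
    have d0: "d \<noteq> 0"
    proof
      assume "d = 0"
      then have "f = [:poly.coeff f 0:]" unfolding d_def by (metis degree_0_id)
      then have "poly.coeff f 0 = 0" using f(2) by (metis poly_const_conv)
      moreover have "(poly.coeff f 0, 1) \<in> G" using f(1) by (auto simp: poly_lift_def dest: spec[of _ 0])
      ultimately show False using D(6)[of 1] by auto
    qed
    \<comment> \<open>The leading coefficient of \<open>f\<close> maps to \<open>0\<close>, while
      \<open>c\<close> maps to \<open>1\<close>. So subtracting a multiple of the reversed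
      \<open>g\<close> cancels the leading term of \<open>f\<close> and keeps its image.\<close>
    define q where "q = poly.coeff f d * inverse c"
    have "(poly.coeff f d, 0) \<in> G" using f(1) d0 by (auto simp: poly_lift_def dest: spec[of _ d])
    then have qG: "(q, 0) \<in> G" using D(4)[OF _ inv[OF cG]] by (simp add: q_def)
    define f' where "f' = f - Polynomial.monom q (d - e) * r"
    have rc: "\<exists>y. (poly.coeff r j, y) \<in> G" for j
      using g(1) D(1) by (auto simp: r_def coeff_reflect_poly poly_lift_def)
    have "poly_lift G (Polynomial.monom q (d - e) * r) 0"
      unfolding poly_lift_def
    proof
      fix i
      obtain y where "(poly.coeff r (i - (d - e)), y) \<in> G" using rc by blast
      from D(4)[OF qG this] show "(poly.coeff (Polynomial.monom q (d - e) * r) i, poly.coeff 0 i) \<in> G"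
        using D(1) by (simp add: coeff_monom_mult)
    qed
    then have lift': "poly_lift G f' 1" using poly_lift_diff[OF G f(1)] unfolding f'_def by fastforce
    have degr: "Polynomial.degree r = e" using c0 by (simp add: r_def e_def c_def)
    have lr: "poly.coeff r e = c" by (simp add: r_def e_def c_def coeff_reflect_poly)
    have "poly r b = 0" using g(2) b0 by (simp add: r_def poly_reflect_poly_nz)
    then have root': "poly f' b = 0" using f(2) by (simp add: f'_def)
    have ed: "e \<le> d" using le by (simp add: d_def e_def)
    have "Polynomial.degree (Polynomial.monom q (d - e) * r) \<le> d"
      using degree_mult_le[of "Polynomial.monom q (d - e)" r] degree_monom_le[of q "d - e"] degr ed by linarith
    then have "Polynomial.degree f' \<le> d" unfolding f'_def d_def by (intro degree_diff_le) auto
    moreover have "poly.coeff f' d = 0"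
      using c0 ed lr by (simp add: f'_def coeff_monom_mult q_def)
    ultimately have "f' = 0 \<or> Polynomial.degree f' < d" by (rule eq_zero_or_degree_less)
    moreover have "f' \<noteq> 0"
    proof
      assume "f' = 0"
      then have "(0, 1) \<in> G" using lift' by (auto simp: poly_lift_def dest: spec[of _ 0])
      then show False using D(6) by fastforce
    qed
    ultimately show ?thesis using lift' root' d_def by blast
  qed
  have no_both: False
    if "poly_lift G f 1" "poly f b = 0" "poly_lift G g 1" "poly g (inverse b) = 0" "b \<noteq> 0" for f g b
    using that
  proof (induction "Polynomial.degree f + Polynomial.degree g" arbitrary: f g rule: less_induct)
    case less
    show False
    proof (cases "Polynomial.degree g \<le> Polynomial.degree f")
      case True
      obtain f' where "poly_lift G f' 1" "poly f' b = 0" "Polynomial.degree f' < Polynomial.degree f"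
        using reduce[OF less.prems(1-4) True less.prems(5)] by blast
      then show False using less.hyps[of f' g] less.prems by simp
    next
      case False
      then obtain g' where "poly_lift G g' 1" "poly g' (inverse b) = 0" "Polynomial.degree g' < Polynomial.degree g"
        using reduce[of g "inverse b" f] less.prems by auto
      then show False using less.hyps[of f g'] less.prems by simp
    qed
  qed
  show "(\<exists>y. (b, y) \<in> G) \<or> (\<exists>y. (inverse b, y) \<in> G)"
  proof (rule ccontr)
    assume n: "\<not> ?thesis"
    then have "b \<noteq> 0" using D(1) by auto
    moreover obtain f where "poly_lift G f 1" "poly f b = 0" using unit_relation n by blast
    moreover obtain g where "poly_lift G g 1" "poly g (inverse b) = 0" using unit_relation n by blast
    ultimately show False using no_both by blast
  qed
qed

text \<open>
  The values of a partial homomorphism are taken in an algebraically closed field, so that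
  maximal ones are places: their domain is a valuation ring, and elements with nonzero value are
  units.
\<close>

theorem place_extension:
  fixes A :: "'b::field set" and G0 :: "('a::field \<times> 'b) set"
  assumes A: "alg_closed_subfield A" and G0: "partial_hom A G0"
  shows "\<exists>G. partial_hom A G \<and> G0 \<subseteq> G \<and>
    (\<forall>x y. (x, y) \<in> G \<longrightarrow> y \<noteq> 0 \<longrightarrow> (inverse x, inverse y) \<in> G) \<and>
    (\<forall>b. (\<exists>y. (b, y) \<in> G) \<or> (\<exists>y. (inverse b, y) \<in> G))"
proof -
  let ?S = "{G. partial_hom A G \<and> G0 \<subseteq> G}"
  have "\<exists>M\<in>?S. \<forall>G\<in>?S. M \<subseteq> G \<longrightarrow> G = M"
  proof (rule subset_Zorn_nonempty)
    show "?S \<noteq> {}" using G0 by auto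
    fix C assume C: "C \<noteq> {}" "subset.chain ?S C"
    have ph: "partial_hom A G" "G0 \<subseteq> G" if "G \<in> C" for G using C(2) that by (auto simp: subset.chain_def)
    have two: "\<exists>G\<in>C. u \<in> G \<and> v \<in> G" if "u \<in> \<Union>C" "v \<in> \<Union>C" for u v
    proof -
      obtain G G' where G: "G \<in> C" "u \<in> G" "G' \<in> C" "v \<in> G'" using \<open>u \<in> \<Union>C\<close> \<open>v \<in> \<Union>C\<close> by blast
      then have "G \<subseteq> G' \<or> G' \<subseteq> G" using C(2) unfolding subset_chain_def by blast
      then show ?thesis using G by blast
    qed
    obtain G1 where G1: "G1 \<in> C" using C(1) by blast
    have "partial_hom A (\<Union>C)"
      unfolding partial_hom_def
    proof (intro conjI allI impI)
      show "(0, 0) \<in> \<Union>C" "(1, 1) \<in> \<Union>C" using G1 ph partial_homD(1,2) by blast+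
      show "snd ` \<Union>C \<subseteq> A" using ph(1) partial_homD(7) by fastforce
      fix x y assume xy: "(x, y) \<in> \<Union>C"
      then show "(- x, - y) \<in> \<Union>C" using ph(1) partial_homD(5) by (metis UnionE UnionI)
      fix x' y' assume "(x', y') \<in> \<Union>C"
      then obtain G where "G \<in> C" "(x, y) \<in> G" "(x', y') \<in> G" using two xy by blast
      then show "(x + x', y + y') \<in> \<Union>C" "(x * x', y * y') \<in> \<Union>C"
        using ph(1) partial_homD(3,4) by (metis UnionI)+
    next
      fix y assume "(0, y) \<in> \<Union>C"
      then show "y = 0" using ph(1) partial_homD(6) by (metis UnionE)
    qed
    then show "\<Union>C \<in> ?S" using G1 ph(2) by auto
  qed
  then obtain G where G: "partial_hom A G" "G0 \<subseteq> G"
    and max: "\<And>G'. partial_hom A G' \<Longrightarrow> G \<subseteq> G' \<Longrightarrow> G' = G" by auto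
  show ?thesis
    using G maximal_partial_hom_place[OF A G(1) max] by blast
qed

section \<open>Linear disjointness over an algebraically closed field\<close>

text \<open>
  The relation is divided by the highest power of \<open>w\<close> that divides it. Then
  \<open>w\<close> can be specialized to \<open>0\<close> without losing all coefficients, and a
  nontrivial relation for \<open>\<gamma>\<close> remains.
\<close>

lemma specialize_relation:
  assumes G: "partial_hom A G" and w: "(w, 0) \<in> G" "w \<noteq> 0" and v: "(v, \<gamma>) \<in> G"
    and \<psi>: "\<And>a. a \<in> L \<Longrightarrow> (a, \<psi> a) \<in> G" and rel: "poly_relation L w v"
  shows "\<exists>n d. (\<forall>j. d j \<in> L) \<and> (\<exists>j\<le>(n::nat). d j \<noteq> 0) \<and> (\<Sum>j\<le>n. \<psi> (d j) * \<gamma> ^ j) = 0"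
proof -
  note D = partial_homD[OF G]
  obtain n d where d: "\<forall>i j. d i j \<in> L" "\<exists>i\<le>n. \<exists>j\<le>n. d i j \<noteq> 0"
    "(\<Sum>i\<le>(n::nat). \<Sum>j\<le>n. d i j * w ^ i * v ^ j) = 0" using rel by (auto simp: poly_relation_def)
  define i0 where "i0 = (LEAST i. i \<le> n \<and> (\<exists>j\<le>n. d i j \<noteq> 0))"
  have i0: "i0 \<le> n" "\<exists>j\<le>n. d i0 j \<noteq> 0"
    unfolding i0_def using LeastI_ex[OF d(2)[unfolded Bex_def]] by blast+
  have low: "d i j = 0" if "i < i0" "j \<le> n" for i j
    using not_less_Least[OF that(1)[unfolded i0_def]] that i0(1) by (auto simp: i0_def)
  let ?q = "\<lambda>i. \<Sum>j\<le>n. d i j * v ^ j" and ?q' = "\<lambda>i. \<Sum>j\<le>n. \<psi> (d i j) * \<gamma> ^ j"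
  have "0 = (\<Sum>i\<le>n. w ^ i * ?q i)"
    using d(3) by (simp add: sum_distrib_left mult.assoc mult.left_commute)
  also have "\<dots> = (\<Sum>i\<in>{i0..n}. w ^ i * ?q i)"
    by (rule sum.mono_neutral_right) (auto simp: low)
  also have "\<dots> = (\<Sum>i\<le>n - i0. w ^ (i + i0) * ?q (i + i0))"
    using i0(1) by (intro sum.reindex_bij_witness[of _ "\<lambda>i. i + i0" "\<lambda>i. i - i0"]) auto
  also have "\<dots> = w ^ i0 * (\<Sum>i\<le>n - i0. w ^ i * ?q (i + i0))"
    by (simp add: sum_distrib_left power_add mult.assoc mult.left_commute)
  finally have 0: "(\<Sum>i\<le>n - i0. w ^ i * ?q (i + i0)) = 0" using w(2) by simp
  have qG: "(?q i, ?q' i) \<in> G" for i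
    using d(1) v by (intro partial_hom_sum[OF G] D(4) partial_hom_power[OF G] \<psi>) auto
  have "((\<Sum>i\<le>n - i0. w ^ i * ?q (i + i0)), (\<Sum>i\<le>n - i0. 0 ^ i * ?q' (i + i0))) \<in> G"
    by (intro partial_hom_sum[OF G] D(4) partial_hom_power[OF G] qG w(1))
  then have "(\<Sum>i\<le>n - i0. 0 ^ i * ?q' (i + i0)) = 0" using 0 D(6) by simp
  moreover have "(\<Sum>i\<le>n - i0. 0 ^ i * ?q' (i + i0)) = (\<Sum>i\<in>{0}. 0 ^ i * ?q' (i + i0))"
    by (rule sum.mono_neutral_right) auto
  ultimately have "?q' i0 = 0" by simp
  then show ?thesis using d(1) i0(2) by (intro exI[of _ n] exI[of _ "d i0"]) auto
qed

text \<open>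
  A place that fixes \<open>A\<close> and sends \<open>t\<close> to \<open>0\<close> turns a
  relation with coefficients in the closure of \<open>L(t)\<close> into one with coefficients in
  \<open>L\<close>, once the relation has been divided by a coefficient of largest value. The
  specialized coefficients lie in \<open>L\<close> because they are algebraic over it.
\<close>

theorem linear_disjointness:
  fixes A :: "'a::alg_closed_field set"
  assumes L: "alg_closed_subfield L" and A: "alg_closed_subfield A" "L \<subseteq> A" and t: "t \<notin> A"
    and J: "finite J" "\<And>j. j \<in> J \<Longrightarrow> m j \<in> A" "\<And>j. j \<in> J \<Longrightarrow> b j \<in> acl L {t}"
      "(\<Sum>j\<in>J. b j * m j) = 0" "\<exists>j\<in>J. b j \<noteq> 0"
  shows "\<exists>c. (\<forall>j\<in>J. c j \<in> L) \<and> (\<exists>j\<in>J. c j \<noteq> 0) \<and> (\<Sum>j\<in>J. c j * m j) = 0"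
proof -
  note AF = alg_closed_subfield_is_subfield[OF A(1)]
  note AR = is_subfield_is_subring[OF AF]
  \<comment> \<open>Evaluation at \<open>0\<close> on the ring \<open>A[t]\<close>: well defined, as
    \<open>t\<close> is transcendental over \<open>A\<close>.\<close>
  define G0 where "G0 = (\<lambda>f. (poly f t, poly f 0)) ` polys_over A"
  have G0I: "(poly f t, poly f 0) \<in> G0" if "f \<in> polys_over A" for f using that by (simp add: G0_def)
  have const: "(a, a) \<in> G0" if "a \<in> A" for a
    using G0I[of "[:a:]"] that is_subringD(1)[OF AR] by (simp add: polys_over_0)
  have ph0: "partial_hom A G0"
    unfolding partial_hom_def
  proof (intro conjI allI impI)
    show "(0, 0) \<in> G0" "(1, 1) \<in> G0" using const is_subringD(1,2)[OF AR] by auto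
    show "snd ` G0 \<subseteq> A" using poly_in_subring[OF AR] is_subringD(1)[OF AR] by (auto simp: G0_def)
    fix x y assume "(x, y) \<in> G0"
    then obtain f where f: "f \<in> polys_over A" "x = poly f t" "y = poly f 0" by (auto simp: G0_def)
    show "(- x, - y) \<in> G0" using G0I[OF polys_over_minus[OF AR f(1)]] f by simp
    fix x' y' assume "(x', y') \<in> G0"
    then obtain f' where f': "f' \<in> polys_over A" "x' = poly f' t" "y' = poly f' 0" by (auto simp: G0_def)
    show "(x + x', y + y') \<in> G0" using G0I[OF polys_over_add[OF AR f(1) f'(1)]] f f' by simp
    show "(x * x', y * y') \<in> G0" using G0I[OF polys_over_mult[OF AR f(1) f'(1)]] f f' by simp
  next
    fix y assume "(0, y) \<in> G0"
    then obtain f where f: "f \<in> polys_over A" "poly f t = 0" "y = poly f 0" by (auto simp: G0_def)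
    have "f = 0"
    proof (rule ccontr)
      assume "f \<noteq> 0"
      then have "t \<in> algebraics A" using f by (auto simp: algebraics_def)
      then show False using t algebraics_alg_closed[OF A(1)] by simp
    qed
    then show "y = 0" using f by simp
  qed
  obtain G where G: "partial_hom A G" "G0 \<subseteq> G"
    and val: "\<And>b. (\<exists>y. (b, y) \<in> G) \<or> (\<exists>y. (inverse b, y) \<in> G)"
    using place_extension[OF A(1) ph0] by blast
  note D = partial_homD[OF G(1)]
  have constG: "(a, a) \<in> G" if "a \<in> A" for a using const that G(2) by blast
  have tG: "(t, 0) \<in> G"
    using G0I[of "[:0, 1:]"] G(2) is_subringD(1,2)[OF AR] by (auto simp: polys_over_0)
  have t0: "t \<noteq> 0" using t is_subringD(1)[OF AR] by auto
  \<comment> \<open>Divisibility in a valuation ring is a total preorder; here for a finite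
    set.\<close>
  have dominant: "\<exists>y\<in>B. \<forall>x\<in>B. \<exists>z. (x / y, z) \<in> G" if "finite B" "B \<noteq> {}" "0 \<notin> B" for B :: "'a set"
    using that
  proof (induction B rule: finite_ne_induct)
    case (singleton x)
    then show ?case using D(2) by auto
  next
    case (insert w B)
    then obtain y where y: "y \<in> B" "\<forall>x\<in>B. \<exists>z. (x / y, z) \<in> G" by auto
    have y0: "y \<noteq> 0" "w \<noteq> 0" using y insert.prems by auto
    consider "\<exists>z. (w / y, z) \<in> G" | "\<exists>z. (y / w, z) \<in> G" using val[of "w / y"] by auto
    then show ?case
    proof cases
      case 1
      then show ?thesis using y by (intro bexI[of _ y]) auto
    next
      case 2
      then obtain z where z: "(y / w, z) \<in> G" by blast
      have "\<exists>z. (x / w, z) \<in> G" if xB: "x \<in> insert w B" for x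
      proof (cases "x = w")
        case True
        then show ?thesis using D(2) y0 by auto
      next
        case False
        then obtain z' where "(x / y, z') \<in> G" using y(2) xB by auto
        from D(4)[OF this z] show ?thesis using y0 by auto
      qed
      then show ?thesis by (intro bexI[of _ w]) auto
    qed
  qed
  have "\<exists>y\<in>b ` J - {0}. \<forall>x\<in>b ` J - {0}. \<exists>z. (x / y, z) \<in> G"
    using J(1,5) by (intro dominant) auto
  then obtain j0 where j0: "j0 \<in> J" "b j0 \<noteq> 0" "\<forall>x\<in>b ` J - {0}. \<exists>z. (x / b j0, z) \<in> G" by auto
  have "\<exists>z. (b j / b j0, z) \<in> G" if "j \<in> J" for j
    using j0 that D(1) by (cases "b j = 0") auto
  then obtain c where c: "\<And>j. j \<in> J \<Longrightarrow> (b j / b j0, c j) \<in> G" by metis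
  have cL: "c j \<in> L" if j: "j \<in> J" for j
  proof -
    define \<beta> where "\<beta> = b j / b j0"
    have "\<beta> \<in> acl L {t}" unfolding \<beta>_def
      using alg_closed_subfield_is_subfield[OF acl_closed] J(3) j j0(1) by (blast intro: is_subfield_divide)
    then have "poly_relation L t \<beta>" using acl_insert_relation[of \<beta> L t "{}"] acl_empty[OF L] by simp
    moreover have "(\<beta>, c j) \<in> G" using c[OF j] by (simp add: \<beta>_def)
    ultimately obtain n d where d: "\<forall>j. d j \<in> L" "\<exists>j\<le>n. d j \<noteq> 0" "(\<Sum>k\<le>(n::nat). d k * c j ^ k) = 0"
      using specialize_relation[OF G(1) tG t0, of \<beta> "c j" L "\<lambda>a. a"] constG A(2) by blast
    then show ?thesis using root_in_alg_closed[OF L, of n d "c j"] by blast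
  qed
  have "((\<Sum>j\<in>J. b j / b j0 * m j), (\<Sum>j\<in>J. c j * m j)) \<in> G"
    by (intro partial_hom_sum[OF G(1)] D(4) c constG J(2))
  moreover have "(\<Sum>j\<in>J. b j / b j0 * m j) = (\<Sum>j\<in>J. b j * m j) / b j0"
    by (simp add: sum_divide_distrib)
  ultimately have "(\<Sum>j\<in>J. c j * m j) = 0" using J(4) D(6) by simp
  moreover have "c j0 = 1" using partial_hom_unique[OF G(1) c[OF j0(1)]] D(2) j0(2) by simp
  ultimately show ?thesis using cL j0(1) by (intro exI[of _ c] conjI bexI[of _ j0]) auto
qed

section \<open>The lemma of Ingleton and Main\<close>

lemma acl_acl: "acl (acl F V) W = acl F (V \<union> W)" for F :: "'a::alg_closed_field set"
proof
  have "acl F V \<subseteq> acl F (V \<union> W)" by (rule acl_mono) auto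
  moreover have "W \<subseteq> acl F (V \<union> W)" using acl_gen[of "V \<union> W" F] by auto
  ultimately show "acl (acl F V) W \<subseteq> acl F (V \<union> W)" using acl_least[OF acl_closed] by blast
  have "F \<subseteq> acl (acl F V) W" using acl_base[of F V] acl_base[of "acl F V" W] by auto
  moreover have "V \<subseteq> acl (acl F V) W" using acl_gen[of V F] acl_base[of "acl F V" W] by auto
  ultimately show "acl F (V \<union> W) \<subseteq> acl (acl F V) W"
    using acl_gen[of W "acl F V"] by (intro acl_least acl_closed) auto
qed

text \<open>
  On a set of elements that is minimal among the linearly dependent ones, the relation is unique
  up to a factor in the larger field \<open>E\<close>. By linear disjointness it can be taken
  over \<open>L\<close> and over \<open>L'\<close>, so after normalizing one coefficient to
  \<open>1\<close> it is over both.
\<close>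

lemma shared_relation:
  fixes L :: "'a::alg_closed_field set"
  assumes L: "alg_closed_subfield L" "alg_closed_subfield A" "L \<subseteq> A" "t \<notin> A"
    and L': "alg_closed_subfield L'" "alg_closed_subfield A'" "L' \<subseteq> A'" "t' \<notin> A'"
    and E: "acl L {t} = acl L' {t'}"
    and I: "finite I" "\<And>i. i \<in> I \<Longrightarrow> m i \<in> A \<inter> A'"
    and c: "\<And>i. i \<in> I \<Longrightarrow> c i \<in> L" "\<exists>i\<in>I. c i \<noteq> 0" "(\<Sum>i\<in>I. c i * m i) = 0"
  shows "\<exists>c. (\<forall>i. c i \<in> L \<inter> L') \<and> (\<exists>i\<in>I. c i \<noteq> 0) \<and> (\<Sum>i\<in>I. c i * m i) = 0"
proof -
  define dep where "dep = (\<lambda>L J. \<exists>c. (\<forall>j\<in>J. c j \<in> L) \<and> (\<exists>j\<in>J. c j \<noteq> 0) \<and> (\<Sum>j\<in>J. c j * m j) = 0)"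
  define E where "E = acl L {t}"
  have EE: "E = acl L' {t'}" using E by (simp add: E_def)
  have ES: "is_subring E"
    unfolding E_def by (intro is_subfield_is_subring alg_closed_subfield_is_subfield acl_closed)
  have LE: "L \<subseteq> E" "L' \<subseteq> E" unfolding E_def using acl_base E by auto
  have down: "dep L J" "dep L' J" if "dep E J" "J \<subseteq> I" for J
  proof -
    obtain b where b: "\<forall>j\<in>J. b j \<in> E" "\<exists>j\<in>J. b j \<noteq> 0" "(\<Sum>j\<in>J. b j * m j) = 0"
      using \<open>dep E J\<close> by (auto simp: dep_def)
    have J: "finite J" "\<And>j. j \<in> J \<Longrightarrow> m j \<in> A" "\<And>j. j \<in> J \<Longrightarrow> m j \<in> A'"
      using I \<open>J \<subseteq> I\<close> finite_subset by auto
    show "dep L J" unfolding dep_def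
      by (rule linear_disjointness[OF L J(1,2) _ b(3,2)]) (use b(1) E_def in auto)
    show "dep L' J" unfolding dep_def
      by (rule linear_disjointness[OF L' J(1,3) _ b(3,2)]) (use b(1) EE in auto)
  qed
  have "dep L I" using c unfolding dep_def by blast
  then obtain J where J: "J \<subseteq> I" "dep L J" and least: "\<And>J'. J' \<subseteq> I \<Longrightarrow> dep L J' \<Longrightarrow> card J \<le> card J'"
    using arg_min_nat_lemma[of "\<lambda>J. J \<subseteq> I \<and> dep L J" I card] by blast
  have fJ: "finite J" using J I finite_subset by blast
  obtain c where c: "\<forall>j\<in>J. c j \<in> L" "\<exists>j\<in>J. c j \<noteq> 0" "(\<Sum>j\<in>J. c j * m j) = 0"
    using J(2) by (auto simp: dep_def)
  have "dep E J" using c LE(1) unfolding dep_def by blast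
  then obtain d where d: "\<forall>j\<in>J. d j \<in> L'" "\<exists>j\<in>J. d j \<noteq> 0" "(\<Sum>j\<in>J. d j * m j) = 0"
    using down(2) J(1) unfolding dep_def by blast
  obtain j0 where j0: "j0 \<in> J" "d j0 \<noteq> 0" using d(2) by blast
  \<comment> \<open>This combination of the two relations has no term at \<open>j0\<close>, so
    minimality forces it to be trivial.\<close>
  define e where "e = (\<lambda>j. c j0 * d j - d j0 * c j)"
  have e0: "e j = 0" if "j \<in> J" for j
  proof (rule ccontr)
    assume n: "e j \<noteq> 0"
    have "e i \<in> E" if "i \<in> J" for i
      unfolding e_def using that c(1) d(1) LE j0(1)
      by (intro is_subring_diff[OF ES] is_subringD(4)[OF ES]) auto
    moreover have "j \<in> J - {j0}" using n that by (auto simp: e_def mult.commute)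
    moreover have "(\<Sum>i\<in>J - {j0}. e i * m i) = 0"
    proof -
      have "(\<Sum>i\<in>J. e i * m i) = c j0 * (\<Sum>i\<in>J. d i * m i) - d j0 * (\<Sum>i\<in>J. c i * m i)"
        by (simp add: e_def sum_distrib_left left_diff_distrib sum_subtractf mult.assoc)
      then have "(\<Sum>i\<in>J. e i * m i) = 0" using c(3) d(3) by simp
      moreover have "e j0 = 0" by (simp add: e_def mult.commute)
      ultimately show ?thesis using fJ j0(1) by (simp add: sum.remove)
    qed
    ultimately have "dep E (J - {j0})" using n unfolding dep_def by blast
    then have "dep L (J - {j0})" using down(1) J(1) by blast
    then have "card J \<le> card (J - {j0})" using least[of "J - {j0}"] J(1) by blast
    moreover have "card (J - {j0}) < card J" using fJ j0(1) by (rule card_Diff1_less)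
    ultimately show False by simp
  qed
  have c0: "c j0 \<noteq> 0"
  proof
    assume "c j0 = 0"
    then have "c j = 0" if "j \<in> J" for j using e0[OF that] j0(2) by (simp add: e_def)
    then show False using c(2) by blast
  qed
  have q: "c j / c j0 = d j / d j0" if "j \<in> J" for j
    using e0[OF that] c0 j0(2) by (simp add: e_def field_simps)
  define r where "r = (\<lambda>j. if j \<in> J then c j / c j0 else 0)"
  have L0: "0 \<in> L" "0 \<in> L'" using L(1) L'(1) by (auto simp: alg_closed_subfield_def is_subfield_def)
  have "r j \<in> L" for j
    using c(1) j0(1) L(1) L0 by (auto simp: r_def intro: is_subfield_divide alg_closed_subfield_is_subfield)
  moreover have "r j \<in> L'" for j
    using d(1) j0(1) L'(1) L0 q by (auto simp: r_def intro: is_subfield_divide alg_closed_subfield_is_subfield)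
  moreover have "r j0 \<noteq> 0" using c0 j0(1) by (simp add: r_def)
  moreover have "(\<Sum>i\<in>I. r i * m i) = 0"
  proof -
    have "(\<Sum>i\<in>I. r i * m i) = (\<Sum>i\<in>J. r i * m i)"
      using J(1) I(1) by (intro sum.mono_neutral_right) (auto simp: r_def)
    also have "\<dots> = (\<Sum>i\<in>J. c i * m i) / c j0"
      by (simp add: r_def sum_divide_distrib)
    finally show ?thesis using c(3) by simp
  qed
  ultimately show ?thesis using j0(1) J(1) by (intro exI[of _ r]) auto
qed

text \<open>
  The relation between \<open>a\<close> and \<open>b\<close> is read as a linear relation
  between the monomials \<open>a ^ i * b ^ j\<close>, which lie in the closures of
  \<open>L(a)\<close> and \<open>L'(a)\<close>; the two lines span the same plane \<open>acl L
  {t}\<close>, which does not contain \<open>a\<close>.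
\<close>

lemma descend_to_intersection:
  fixes L :: "'a::alg_closed_field set"
  assumes L: "alg_closed_subfield L" "alg_closed_subfield L'"
    and t: "t \<notin> L" "t' \<notin> L'" "acl L {t} = acl L' {t'}"
    and a: "a \<notin> acl L {t}" "b \<in> acl L {a}" "b \<in> acl L' {a}"
  shows "b \<in> acl (L \<inter> L') {a}"
proof -
  have ex: "s \<notin> acl M {a}" if "alg_closed_subfield M" "s \<notin> M" "a \<notin> acl M {s}" for s M
    using pregeometry.exchange[OF pregeometry_acl[of M], of s a "{}"] acl_empty[of M] that by auto
  obtain n c where c: "\<forall>i j. c i j \<in> L" "\<exists>i\<le>n. \<exists>j\<le>n. c i j \<noteq> 0"
    "(\<Sum>i\<le>(n::nat). \<Sum>j\<le>n. c i j * a ^ i * b ^ j) = 0"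
    using acl_insert_relation[of b L a "{}"] a(2) acl_empty[OF L(1)] by (auto simp: poly_relation_def)
  let ?I = "{..n} \<times> {..n}"
  have "\<exists>c. (\<forall>i. c i \<in> L \<inter> L') \<and> (\<exists>i\<in>?I. c i \<noteq> 0) \<and> (\<Sum>i\<in>?I. c i * (a ^ fst i * b ^ snd i)) = 0"
  proof (rule shared_relation[of L "acl L {a}" t L' "acl L' {a}" t' ?I "\<lambda>i. a ^ fst i * b ^ snd i" "\<lambda>i. c (fst i) (snd i)"])
    show "t \<notin> acl L {a}" using ex[OF L(1) t(1) a(1)] .
    show "t' \<notin> acl L' {a}" using ex[OF L(2) t(2)] a(1) t(3) by simp
    fix i assume "i \<in> ?I"
    have "x \<in> acl M {a} \<Longrightarrow> y \<in> acl M {a} \<Longrightarrow> x ^ k * y ^ l \<in> acl M {a}" for x y k l M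
      using is_subfield_is_subring[OF alg_closed_subfield_is_subfield[OF acl_closed[of M "{a}"]]]
      by (intro is_subringD(4) is_subring_power)
    then show "a ^ fst i * b ^ snd i \<in> acl L {a} \<inter> acl L' {a}"
      using a acl_gen[of "{a}"] by auto
  next
    show "\<exists>i\<in>?I. c (fst i) (snd i) \<noteq> 0" using c(2) by auto
    show "(\<Sum>i\<in>?I. c (fst i) (snd i) * (a ^ fst i * b ^ snd i)) = 0"
      using c(3) by (simp add: sum.cartesian_product[symmetric] case_prod_unfold mult.assoc)
        (simp add: sum.cartesian_product case_prod_unfold mult.assoc)
  qed (use L t acl_closed acl_base[of L] acl_base[of L'] c(1) in auto)
  then obtain c where c: "\<And>i. c i \<in> L \<inter> L'" "\<exists>i\<in>?I. c i \<noteq> 0" "(\<Sum>i\<in>?I. c i * (a ^ fst i * b ^ snd i)) = 0"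
    by blast
  have "poly_relation (L \<inter> L') a b"
    unfolding poly_relation_def
  proof (rule exI[of _ n], rule exI[of _ "\<lambda>i j. c (i, j)"], intro conjI allI)
    fix i j show "c (i, j) \<in> L \<inter> L'" by (rule c(1))
  next
    show "\<exists>i\<le>n. \<exists>j\<le>n. c (i, j) \<noteq> 0" using c(2) by auto
    show "(\<Sum>i\<le>n. \<Sum>j\<le>n. c (i, j) * a ^ i * b ^ j) = 0"
      using c(3) by (simp add: sum.cartesian_product case_prod_unfold mult.assoc)
  qed
  moreover have "alg_closed_subfield (L \<inter> L')"
    using alg_closed_subfield_Inter[of "{L, L'}"] L by auto
  moreover have "a \<notin> L \<inter> L'" using a(1) acl_base[of L "{t}"] by blast
  ultimately show ?thesis
    using poly_relation_algebraic[of "L \<inter> L'" "acl (L \<inter> L') {a}" a b]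
      acl_closed acl_base acl_gen[of "{a}" "L \<inter> L'"] by blast
qed

text \<open>
  The three sets of rank two stand for lines that are pairwise coplanar, but not contained in a
  common plane.
\<close>

locale ingleton_main = pregeometry +
  assumes ingleton_main: "\<lbrakk>finite A; finite B; finite C; rk A = 2; rk B = 2; rk C = 2;
    rk (A \<union> B) \<le> 3; rk (A \<union> C) \<le> 3; rk (B \<union> C) \<le> 3; rk (A \<union> B \<union> C) \<ge> 4\<rbrakk>
    \<Longrightarrow> \<exists>e. e \<notin> cl {} \<and> e \<in> cl A \<and> e \<in> cl B \<and> e \<in> cl C"

text \<open>
  Choose a point \<open>a\<close> of the line \<open>A\<close> off the plane of \<open>B\<close>
  and \<open>C\<close>, and another point \<open>b\<close> of \<open>A\<close>. By coplanarity,
  \<open>b\<close> depends on \<open>a\<close> over either of the closures of \<open>B\<close>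
  and of \<open>C\<close>, hence over their intersection. As \<open>b\<close> does not depend on
  \<open>a\<close> over \<open>F\<close>, the intersection contains a point \<open>e\<close>,
  and exchanging \<open>b\<close> for \<open>e\<close> shows that it is on \<open>A\<close>.
\<close>

theorem ingleton_main_acl: "ingleton_main (acl F)" for F :: "'a::alg_closed_field set"
proof -
  interpret pregeometry "acl F" by (rule pregeometry_acl)
  show ?thesis
  proof
    fix A B C :: "'a set"
    assume fin: "finite A" "finite B" "finite C" and r2: "rk A = 2" "rk B = 2" "rk C = 2"
      and r3: "rk (A \<union> B) \<le> 3" "rk (A \<union> C) \<le> 3" "rk (B \<union> C) \<le> 3" and r4: "rk (A \<union> B \<union> C) \<ge> 4"
    have BC: "rk (B \<union> C) = 3"
    proof -
      have "rk ((B \<union> C) \<union> (A \<union> B)) + rk B \<le> rk (B \<union> C) + rk (A \<union> B)"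
        using fin in_cl by (intro rk_submodular) auto
      moreover have "(B \<union> C) \<union> (A \<union> B) = A \<union> B \<union> C" by auto
      ultimately show ?thesis using r2 r3 r4 by simp
    qed
    have "\<not> A \<subseteq> acl F (B \<union> C)"
    proof
      assume "A \<subseteq> acl F (B \<union> C)"
      then have "A \<union> B \<union> C \<subseteq> acl F (B \<union> C)" using in_cl by auto
      then have "rk (A \<union> B \<union> C) \<le> rk (B \<union> C)" using fin by (intro rk_mono_cl) auto
      then show False using r4 BC by simp
    qed
    then obtain a where a: "a \<in> A" "a \<notin> acl F (B \<union> C)" by blast
    have aB: "a \<notin> acl F B" and aC: "a \<notin> acl F C"
      using a(2) mono[of B "B \<union> C"] mono[of C "B \<union> C"] by auto
    have "\<not> A \<subseteq> acl F {a}"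
    proof
      assume "A \<subseteq> acl F {a}"
      then have "rk A \<le> rk {a}" using fin by (intro rk_mono_cl) auto
      also have "\<dots> \<le> 1" using rk_le_card[of "{a}"] by simp
      finally show False using r2 by simp
    qed
    then obtain b where b: "b \<in> A" "b \<notin> acl F {a}" by blast
    have "A \<union> B \<subseteq> acl F (insert a B)"
    proof -
      have "B \<union> {a} \<subseteq> A \<union> B" using a by auto
      moreover have "rk (insert a B) = 3" using rk_insert_out[OF fin(2) aB] r2 by simp
      ultimately show ?thesis using fin r3 by (intro subset_cl_if_rk) auto
    qed
    then have bB: "b \<in> acl F (insert a B)" using b by blast
    have "A \<union> C \<subseteq> acl F (insert a C)"
    proof -
      have "rk (insert a C) = 3" using rk_insert_out[OF fin(3) aC] r2 by simp
      then show ?thesis using fin r3 a(1) by (intro subset_cl_if_rk) auto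
    qed
    then have bC: "b \<in> acl F (insert a C)" using b by blast
    have span: "\<exists>t. t \<notin> acl F B \<and> acl F (insert t B) = acl F (B \<union> C)"
      if fin: "finite B" "finite C" and r: "rk B = 2" "rk (B \<union> C) = 3" for B C
    proof -
      have "\<not> C \<subseteq> acl F B"
      proof
        assume "C \<subseteq> acl F B"
        then have "rk (B \<union> C) \<le> rk B" using fin in_cl by (intro rk_mono_cl) auto
        then show False using r by simp
      qed
      then obtain t where t: "t \<in> C" "t \<notin> acl F B" by blast
      have "rk (insert t B) = 3" using rk_insert_out[OF fin(1) t(2)] r by simp
      then have "B \<union> C \<subseteq> acl F (insert t B)" using fin r t(1) by (intro subset_cl_if_rk) auto
      then have "acl F (insert t B) = acl F (B \<union> C)"
        using cl_least[of "B \<union> C" "insert t B"] mono[of "insert t B" "B \<union> C"] t(1) by auto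
      then show ?thesis using t by blast
    qed
    obtain t where t: "t \<notin> acl F B" "acl F (insert t B) = acl F (B \<union> C)"
      using span[OF fin(2,3) r2(2) BC] by blast
    obtain t' where t': "t' \<notin> acl F C" "acl F (insert t' C) = acl F (B \<union> C)"
      using span[OF fin(3,2) r2(3)] BC by (auto simp: Un_commute)
    let ?Z = "acl F B \<inter> acl F C"
    have "b \<in> acl ?Z {a}"
      by (rule descend_to_intersection[of _ _ t t'])
        (use t t' a(2) bB bC acl_closed in \<open>auto simp: acl_acl\<close>)
    moreover have acl_Z: "acl ?Z {a} \<subseteq> acl F (insert a S)" if "?Z \<subseteq> acl F S" for S
    proof (rule acl_least[OF acl_closed])
      show "?Z \<subseteq> acl F (insert a S)" using that mono[of S "insert a S"] by blast
    qed (use in_cl in auto)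
    ultimately have "\<not> ?Z \<subseteq> acl F {}" using b(2) by blast
    then obtain e where e: "e \<in> acl F B" "e \<in> acl F C" "e \<notin> acl F {}" by blast
    have "?Z \<subseteq> acl F {e}"
    proof (rule ccontr)
      assume "\<not> ?Z \<subseteq> acl F {e}"
      then obtain z where z: "z \<in> acl F B" "z \<in> acl F C" "z \<notin> acl F {e}" by blast
      have r: "rk {z, e} = 2"
        using rk_insert_out[of "{e}" z] rk_insert_out[of "{}" e] z(3) e(3) rk_le_card[of "{}"] by simp
      have *: "S \<subseteq> acl F {z, e}" if "finite S" "rk S = 2" "z \<in> acl F S" "e \<in> acl F S" for S
      proof -
        have "rk (S \<union> {z, e}) \<le> rk S" using that in_cl by (intro rk_mono_cl) auto
        then have "S \<union> {z, e} \<subseteq> acl F {z, e}" using that r by (intro subset_cl_if_rk) auto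
        then show ?thesis by blast
      qed
      have "B \<union> C \<subseteq> acl F {z, e}" using *[OF fin(2) r2(2)] *[OF fin(3) r2(3)] z e by blast
      then have "rk (B \<union> C) \<le> rk {z, e}" using fin by (intro rk_mono_cl) auto
      then show False using r BC by simp
    qed
    then have "b \<in> acl F (insert e {a})" using acl_Z[of "{e}"] \<open>b \<in> acl ?Z {a}\<close> by (auto simp: insert_commute)
    then have "e \<in> acl F (insert b {a})" using exchange b(2) by blast
    then have "e \<in> acl F A" using mono[of "{b, a}" A] a b by auto
    then show "\<exists>e. e \<notin> acl F {} \<and> e \<in> acl F A \<and> e \<in> acl F B \<and> e \<in> acl F C" using e by blast
  qed
qed

section \<open>Harmonic conjugates from quadrangles in different planes\<close>

context pregeometry
begin

text \<open>
  The elements \<open>u, q, r, s\<close> are the vertices of a quadrangle with \<open>y = uq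
  \<inter> rs\<close>, \<open>z = us \<inter> qr\<close> and \<open>x = qs \<inter> yz\<close>.
  The remaining side \<open>ur\<close> meets \<open>yz\<close> in the harmonic conjugate of
  \<open>x\<close>. Elements of the field represent the points that they generate.
\<close>

definition quad :: "'a \<Rightarrow> 'a \<Rightarrow> 'a \<Rightarrow> 'a \<Rightarrow> 'a \<Rightarrow> 'a \<Rightarrow> 'a \<Rightarrow> bool" where
  "quad y x z u q r s \<longleftrightarrow>
     distinct [y, x, z, u, q, r, s] \<and>
     (\<forall>a\<in>{y, x, z, u, q, r, s}. a \<notin> cl {} \<and> (\<forall>b\<in>{y, x, z, u, q, r, s}. a \<noteq> b \<longrightarrow> a \<notin> cl {b})) \<and>
     x \<in> cl {y, z} \<and> q \<in> cl {y, u} \<and> s \<in> cl {y, r} \<and> s \<in> cl {x, q} \<and> s \<in> cl {z, u} \<and> r \<in> cl {z, q} \<and>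
     u \<notin> cl {y, z}"

lemma cl_line_exchange: "c \<in> cl {a, b} \<Longrightarrow> c \<notin> cl {a} \<Longrightarrow> b \<in> cl {a, c}"
  using exchange[of c b "{a}"] by (simp add: insert_commute)

lemma in_cl_line: "c \<in> cl {a, b} \<Longrightarrow> a \<in> cl V \<Longrightarrow> b \<in> cl V \<Longrightarrow> c \<in> cl V"
  using cl_least[of "{a, b}" V] by auto

lemma rk_pair: "a \<notin> cl {} \<Longrightarrow> b \<notin> cl {a} \<Longrightarrow> rk {a, b} = 2"
  using rk_insert_out[of "{a}" b] rk_insert_out[of "{}" a] rk_le_card[of "{}"] by (simp add: insert_commute)

lemma rk_le_3:
  assumes "V \<subseteq> cl {a, b, c}" "finite V"
  shows "rk V \<le> 3"
proof -
  have "rk V \<le> rk {a, b, c}" using assms by (intro rk_mono_cl) auto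
  also have "\<dots> \<le> card {a, b, c}" by (rule rk_le_card) simp
  also have "\<dots> \<le> 3" by (simp add: card_insert_if)
  finally show ?thesis .
qed

lemma quadD:
  assumes "quad y x z u q r s"
  shows "y \<in> cl {u, q}" "q \<in> cl {y, u}" "u \<in> cl {y, q}"
    "z \<in> cl {u, s}" "s \<in> cl {z, u}" "u \<in> cl {z, s}"
    "x \<in> cl {q, s}" "s \<in> cl {x, q}" "q \<in> cl {x, s}"
    "z \<in> cl {q, r}" "r \<in> cl {z, q}" "q \<in> cl {z, r}"
    "y \<in> cl {r, s}" "s \<in> cl {y, r}" "r \<in> cl {y, s}"
    "x \<in> cl {y, z}" "u \<notin> cl {y, z}" "r \<notin> cl {u}" "u \<notin> cl {}" "z \<notin> cl {y}" "y \<notin> cl {}"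
    "q \<notin> cl {}" "r \<notin> cl {}" "s \<notin> cl {}"
proof -
  have np: "b \<notin> cl {a}" if "a \<in> {y, x, z, u, q, r, s}" "b \<in> {y, x, z, u, q, r, s}" "a \<noteq> b" for a b
    using assms that unfolding quad_def by metis
  have d: "distinct [y, x, z, u, q, r, s]" using assms by (simp add: quad_def)
  have e: "a \<in> cl {b, c}" if "c \<in> cl {a, b}" "c \<noteq> b" "b \<in> {y, x, z, u, q, r, s}" "c \<in> {y, x, z, u, q, r, s}" for a b c
    using cl_line_exchange[of c b a] that np by (simp add: insert_commute)
  show 1: "q \<in> cl {y, u}" "s \<in> cl {z, u}" "s \<in> cl {x, q}" "r \<in> cl {z, q}" "s \<in> cl {y, r}"
    "x \<in> cl {y, z}" "u \<notin> cl {y, z}" using assms by (auto simp: quad_def)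
  show "u \<notin> cl {}" "y \<notin> cl {}" "q \<notin> cl {}" "r \<notin> cl {}" "s \<notin> cl {}" using assms by (auto simp: quad_def)
  show "r \<notin> cl {u}" "z \<notin> cl {y}" using np d by auto
  show "y \<in> cl {u, q}" "z \<in> cl {u, s}" "x \<in> cl {q, s}" "z \<in> cl {q, r}" "y \<in> cl {r, s}"
    using e 1 d by auto
  show "u \<in> cl {y, q}" "u \<in> cl {z, s}" "q \<in> cl {x, s}" "q \<in> cl {z, r}" "r \<in> cl {y, s}"
    using e[of q u y] e[of s u z] e[of s q x] e[of r q z] e[of s r y] 1 d by (auto simp: insert_commute)
qed

end

context ingleton_main
begin

text \<open>
  The lines \<open>uu'\<close>, \<open>qq'\<close>, \<open>ss'\<close> are pairwise coplanar and
  so meet in a point \<open>e\<close>; likewise \<open>qq'\<close>, \<open>rr'\<close>,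
  \<open>ss'\<close> meet in a point \<open>e'\<close>, which is \<open>e\<close> because
  \<open>qq'\<close> and \<open>ss'\<close> are different lines. So \<open>uu'\<close> and
  \<open>rr'\<close> meet, and \<open>ur\<close>, \<open>u'r'\<close>, \<open>yz\<close> are
  three pairwise coplanar lines that are not all in one plane.
\<close>

lemma harmonic_rank4:
  assumes Q: "quad y x z u q r s" and Q': "quad y x z u' q' r' s'" and indep: "u' \<notin> cl {y, z, u}"
  shows "\<exists>e. e \<notin> cl {} \<and> e \<in> cl {y, z} \<and> e \<in> cl {u, r} \<and> e \<in> cl {u', r'}"
proof -
  note D = quadD[OF Q] and D' = quadD[OF Q']
  have uu: "rk {y, z, u, u'} = 4"
  proof -
    have "rk {u', u, y, z} = Suc (Suc (rk {y, z}))"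
      using rk_insert_out[of "{u, y, z}" u'] rk_insert_out[of "{y, z}" u] indep D(17)
      by (simp add: insert_commute)
    then show ?thesis using rk_pair[of y z] D(20,21) by (simp add: insert_commute)
  qed
  have big: "rk V \<ge> 4" if "finite V" "y \<in> cl V" "z \<in> cl V" "u \<in> cl V" "u' \<in> cl V" for V
    using rk_mono_cl[of "{y, z, u, u'}" V] that uu by auto
  have notin: "u' \<notin> cl V" if "V \<subseteq> cl {y, z, u}" for V
    using indep cl_least[OF that] by blast
  have qcl: "q \<in> cl {y, z, u}" "s \<in> cl {y, z, u}" "r \<in> cl {y, z, u}"
    using in_cl_line[OF D(2)] in_cl_line[OF D(5)] in_cl_line[OF D(11)] in_cl by auto
  have pu: "rk {u, u'} = 2" using notin[of "{u}"] D(19) in_cl by (intro rk_pair) auto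
  have pq: "rk {q, q'} = 2"
  proof (rule rk_pair[OF D(22)], rule notI)
    assume "q' \<in> cl {q}"
    then have "q' \<in> cl {y, q}" using mono[of "{q}" "{y, q}"] by auto
    then have "u' \<in> cl {y, q}" using in_cl_line[OF D'(3)] in_cl by auto
    then show False using notin[of "{y, q}"] qcl in_cl by auto
  qed
  have ps: "rk {s, s'} = 2"
  proof (rule rk_pair[OF D(24)], rule notI)
    assume "s' \<in> cl {s}"
    then have "s' \<in> cl {z, s}" using mono[of "{s}" "{z, s}"] by auto
    then have "u' \<in> cl {z, s}" using in_cl_line[OF D'(6)] in_cl by auto
    then show False using notin[of "{z, s}"] qcl in_cl by auto
  qed
  have pr: "rk {r, r'} = 2"
  proof (rule rk_pair[OF D(23)], rule notI)
    assume "r' \<in> cl {r}"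
    then have "r' \<in> cl {y, z, r}" using mono[of "{r}" "{y, z, r}"] by auto
    then have "q' \<in> cl {y, z, r}" using in_cl_line[OF D'(12)] in_cl by auto
    then have "u' \<in> cl {y, z, r}" using in_cl_line[OF D'(3)] in_cl by auto
    then show False using notin[of "{y, z, r}"] qcl in_cl by auto
  qed
  have "q \<in> cl {y, u, u'}" "q' \<in> cl {y, u, u'}"
    using in_cl_line[OF D(2)] in_cl_line[OF D'(2)] in_cl by auto
  then have uq: "rk ({u, u'} \<union> {q, q'}) \<le> 3" using in_cl by (intro rk_le_3[of _ y u u']) auto
  have "s \<in> cl {z, u, u'}" "s' \<in> cl {z, u, u'}"
    using in_cl_line[OF D(5)] in_cl_line[OF D'(5)] in_cl by auto
  then have us: "rk ({u, u'} \<union> {s, s'}) \<le> 3" using in_cl by (intro rk_le_3[of _ z u u']) auto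
  have "s \<in> cl {x, q, q'}" "s' \<in> cl {x, q, q'}"
    using in_cl_line[OF D(8)] in_cl_line[OF D'(8)] in_cl by auto
  then have qs: "rk ({q, q'} \<union> {s, s'}) \<le> 3" using in_cl by (intro rk_le_3[of _ x q q']) auto
  have "r \<in> cl {z, q, q'}" "r' \<in> cl {z, q, q'}"
    using in_cl_line[OF D(11)] in_cl_line[OF D'(11)] in_cl by auto
  then have qr: "rk ({q, q'} \<union> {r, r'}) \<le> 3" using in_cl by (intro rk_le_3[of _ z q q']) auto
  have "s \<in> cl {y, r, r'}" "s' \<in> cl {y, r, r'}"
    using in_cl_line[OF D(14)] in_cl_line[OF D'(14)] in_cl by auto
  then have rs: "rk ({r, r'} \<union> {s, s'}) \<le> 3" using in_cl by (intro rk_le_3[of _ y r r']) auto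
  have uqs: "rk ({u, u'} \<union> {q, q'} \<union> {s, s'}) \<ge> 4"
    by (rule big) (use in_cl in_cl_line[OF D(1)] in_cl_line[OF D(4)] in auto)
  have qrs: "rk ({q, q'} \<union> {r, r'} \<union> {s, s'}) \<ge> 4"
  proof (rule big)
    let ?V = "{q, q'} \<union> {r, r'} \<union> {s, s'}"
    show y: "y \<in> cl ?V" and z: "z \<in> cl ?V"
      using in_cl in_cl_line[OF D(13)] in_cl_line[OF D(10)] by auto
    show "u \<in> cl ?V" "u' \<in> cl ?V" using in_cl_line[OF D(3) y] in_cl_line[OF D'(3) y] in_cl by auto
  qed auto
  obtain e where e: "e \<notin> cl {}" "e \<in> cl {u, u'}" "e \<in> cl {q, q'}" "e \<in> cl {s, s'}"
    using ingleton_main[OF _ _ _ pu pq ps uq us qs uqs] by auto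
  obtain e' where e': "e' \<notin> cl {}" "e' \<in> cl {q, q'}" "e' \<in> cl {r, r'}" "e' \<in> cl {s, s'}"
    using ingleton_main[OF _ _ _ pq pr ps qr qs rs qrs] by auto
  have "e \<in> cl {e'}"
  proof (rule ccontr)
    assume "e \<notin> cl {e'}"
    then have "rk {e', e} = 2" using e' by (intro rk_pair)
    moreover have "rk ({q, q'} \<union> {s, s'}) + rk {e', e} \<le> rk {q, q'} + rk {s, s'}"
      using e e' by (intro rk_submodular) auto
    moreover have "rk (({q, q'} \<union> {s, s'}) \<union> ({u, u'} \<union> {q, q'})) + rk {q, q'}
        \<le> rk ({q, q'} \<union> {s, s'}) + rk ({u, u'} \<union> {q, q'})"
      using in_cl by (intro rk_submodular) auto
    moreover have "({q, q'} \<union> {s, s'}) \<union> ({u, u'} \<union> {q, q'}) = {u, u'} \<union> {q, q'} \<union> {s, s'}" by auto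
    ultimately show False using pq ps uq uqs by simp
  qed
  then have er: "e \<in> cl {r, r'}" using cl_least[of "{e'}" "{r, r'}"] e' by auto
  have re: "rk {e} = 1" using rk_insert_out[of "{}" e] e(1) rk_le_card[of "{}"] by simp
  have ur: "rk ({u, r} \<union> {u', r'}) \<le> 3"
  proof -
    have "rk ({u, u'} \<union> {r, r'}) + rk {e} \<le> rk {u, u'} + rk {r, r'}"
      using e er by (intro rk_submodular) auto
    moreover have "{u, u'} \<union> {r, r'} = {u, r} \<union> {u', r'}" by auto
    ultimately show ?thesis using pu pr re by simp
  qed
  have "rk ({u, r} \<union> {y, z}) \<le> 3" using in_cl qcl by (intro rk_le_3[of _ y z u]) auto
  moreover have "rk ({u', r'} \<union> {y, z}) \<le> 3"
  proof -
    have "q' \<in> cl {y, z, u'}" using in_cl_line[OF D'(2)] in_cl by auto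
    then have "r' \<in> cl {y, z, u'}" using in_cl_line[OF D'(11)] in_cl by auto
    then show ?thesis using in_cl by (intro rk_le_3[of _ y z u']) auto
  qed
  moreover have "rk ({u, r} \<union> {u', r'} \<union> {y, z}) \<ge> 4" by (rule big) (use in_cl in auto)
  moreover have "rk {u, r} = 2" "rk {u', r'} = 2" "rk {y, z} = 2"
    using rk_pair D(18-21) D'(18,19) by auto
  ultimately have "\<exists>e. e \<notin> cl {} \<and> e \<in> cl {u, r} \<and> e \<in> cl {u', r'} \<and> e \<in> cl {y, z}"
    using ur by (intro ingleton_main) auto
  then show ?thesis by blast
qed

end

section \<open>Independent copies of a plane\<close>

definition field_hom_on :: "'a::field set \<Rightarrow> ('a \<Rightarrow> 'b::field) \<Rightarrow> bool" where
  "field_hom_on H \<sigma> \<longleftrightarrow> (\<forall>x\<in>H. \<forall>y\<in>H. \<sigma> (x + y) = \<sigma> x + \<sigma> y \<and> \<sigma> (x * y) = \<sigma> x * \<sigma> y) \<and> \<sigma> 1 = 1"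

lemma field_hom_onD:
  assumes "field_hom_on H \<sigma>" "is_subfield H"
  shows "x \<in> H \<Longrightarrow> y \<in> H \<Longrightarrow> \<sigma> (x + y) = \<sigma> x + \<sigma> y" "x \<in> H \<Longrightarrow> y \<in> H \<Longrightarrow> \<sigma> (x * y) = \<sigma> x * \<sigma> y"
    "\<sigma> 1 = 1" "\<sigma> 0 = 0" "x \<in> H \<Longrightarrow> \<sigma> (- x) = - \<sigma> x" "x \<in> H \<Longrightarrow> \<sigma> (inverse x) = inverse (\<sigma> x)"
    "inj_on \<sigma> H"
proof -
  have H: "0 \<in> H" "1 \<in> H" "\<And>x. x \<in> H \<Longrightarrow> - x \<in> H" "\<And>x. x \<in> H \<Longrightarrow> inverse x \<in> H"
    using assms(2) by (auto simp: is_subfield_def)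
  show add: "\<sigma> (x + y) = \<sigma> x + \<sigma> y" and mult: "\<sigma> (x * y) = \<sigma> x * \<sigma> y" if "x \<in> H" "y \<in> H" for x y
    using assms(1) that by (auto simp: field_hom_on_def)
  show one: "\<sigma> 1 = 1" using assms(1) by (simp add: field_hom_on_def)
  show zero: "\<sigma> 0 = 0" using add[of 0 0] H(1) by (metis add.right_neutral add_left_cancel)
  show minus: "\<sigma> (- x) = - \<sigma> x" if "x \<in> H" for x
    using add[of x "- x"] H that zero by (simp add: eq_neg_iff_add_eq_0 add.commute)
  show inv: "\<sigma> (inverse x) = inverse (\<sigma> x)" if "x \<in> H" for x
  proof (cases "x = 0")
    case False
    then have "\<sigma> x * \<sigma> (inverse x) = 1" using mult[of x "inverse x"] H that one by simp
    then show ?thesis by (metis inverse_unique)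
  qed (use zero in simp)
  show "inj_on \<sigma> H"
  proof (rule inj_onI, rule ccontr)
    fix x y assume xy: "x \<in> H" "y \<in> H" "\<sigma> x = \<sigma> y" "x \<noteq> y"
    have d: "x + - y \<in> H" using xy(1) H(3)[OF xy(2)] assms(2) unfolding is_subfield_def by blast
    have "\<sigma> (x + - y) = 0" using add[of x "- y"] minus xy H by simp
    moreover have "\<sigma> (x + - y) * \<sigma> (inverse (x + - y)) = 1"
      using mult[OF d H(4)[OF d]] one xy by simp
    ultimately show False by simp
  qed
qed

lemma poly_map_hom:
  assumes \<sigma>: "field_hom_on H \<sigma>" "is_subfield H" and "f \<in> polys_over H" "x \<in> H"
  shows "poly (map_poly \<sigma> f) (\<sigma> x) = \<sigma> (poly f x)"
  using assms(3)
proof (induction f)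
  case 0
  then show ?case using field_hom_onD(4)[OF \<sigma>] by simp
next
  case (pCons a f)
  note D = field_hom_onD[OF \<sigma>]
  have f: "poly f x \<in> H" "a \<in> H"
    using poly_in_subring[OF is_subfield_is_subring[OF \<sigma>(2)]] pCons.prems assms(4) by auto
  have "x * poly f x \<in> H" using f assms(4) \<sigma>(2) by (auto simp: is_subfield_def)
  then show ?case using pCons f assms(4) D(1,2,4) by (simp add: map_poly_pCons)
qed

lemma alg_closed_subfield_image:
  fixes \<sigma> :: "'a::field \<Rightarrow> 'b::field"
  assumes \<sigma>: "field_hom_on H \<sigma>" "is_subfield H" and N: "alg_closed_subfield N" "N \<subseteq> H"
  shows "alg_closed_subfield (\<sigma> ` N)"
  unfolding alg_closed_subfield_def
proof (intro conjI allI impI)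
  note D = field_hom_onD[OF \<sigma>]
  have NF: "is_subfield N" using N alg_closed_subfield_is_subfield by blast
  then have N0: "0 \<in> N" "1 \<in> N" by (auto simp: is_subfield_def)
  show "is_subfield (\<sigma> ` N)"
    unfolding is_subfield_def
  proof (intro conjI ballI)
    show "0 \<in> \<sigma> ` N" "1 \<in> \<sigma> ` N" using D(3,4) N0 by (metis imageI)+
    fix x assume "x \<in> \<sigma> ` N"
    then obtain x' where x': "x = \<sigma> x'" "x' \<in> N" by blast
    show "- x \<in> \<sigma> ` N" "inverse x \<in> \<sigma> ` N"
      using x' N(2) NF D(5,6)[of x', symmetric] by (auto simp: is_subfield_def)
    fix y assume "y \<in> \<sigma> ` N"
    then obtain y' where y': "y = \<sigma> y'" "y' \<in> N" by blast
    show "x + y \<in> \<sigma> ` N" "x * y \<in> \<sigma> ` N"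
      using x' y' N(2) NF D(1,2)[of x' y', symmetric] by (auto simp: is_subfield_def)
  qed
  fix g :: "'b poly" assume g: "(\<forall>i. poly.coeff g i \<in> \<sigma> ` N) \<and> Polynomial.degree g > 0"
  define f where "f = map_poly (inv_into N \<sigma>) g"
  have inj: "inj_on \<sigma> N" using D(7) N(2) inj_on_subset by blast
  have i0: "inv_into N \<sigma> 0 = 0" using inv_into_f_f[OF inj N0(1)] D(4) by simp
  have cf: "poly.coeff f i = inv_into N \<sigma> (poly.coeff g i)" for i
    by (simp add: f_def coeff_map_poly i0)
  have fN: "poly.coeff f i \<in> N" for i using g cf inv_into_into[of _ \<sigma> N] by metis
  have gf: "g = map_poly \<sigma> f"
    by (rule poly_eqI) (use g in \<open>auto simp: coeff_map_poly D(4) cf f_inv_into_f\<close>)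
  have "Polynomial.degree g \<le> Polynomial.degree f" unfolding gf by (rule degree_le) (auto simp: coeff_map_poly D(4) coeff_eq_0)
  then obtain x where x: "x \<in> N" "poly f x = 0"
    using N(1) fN g unfolding alg_closed_subfield_def by (metis less_le_trans)
  have "poly g (\<sigma> x) = 0"
    using poly_map_hom[OF \<sigma>, of f x] fN N(2) x D(4) by (auto simp: gf polys_over_def)
  then show "\<exists>x\<in>\<sigma> ` N. poly g x = 0" using x by blast
qed

text \<open>
  Both the image and the preimage of an algebraically closed subfield are algebraically closed,
  which gives the two inclusions.
\<close>

lemma acl_image:
  fixes \<sigma> :: "'a::alg_closed_field \<Rightarrow> 'b::alg_closed_field"
  assumes \<sigma>: "field_hom_on H \<sigma>" and H: "alg_closed_subfield H" and F: "F \<subseteq> H" "V \<subseteq> H"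
  shows "acl (\<sigma> ` F) (\<sigma> ` V) = \<sigma> ` acl F V"
proof
  note HF = alg_closed_subfield_is_subfield[OF H]
  note D = field_hom_onD[OF \<sigma> HF]
  have sub: "acl F V \<subseteq> H" by (rule acl_least[OF H F])
  show "acl (\<sigma> ` F) (\<sigma> ` V) \<subseteq> \<sigma> ` acl F V"
    using acl_base[of F V] acl_gen[of V F]
    by (intro acl_least alg_closed_subfield_image[OF \<sigma> HF acl_closed sub] image_mono)
  define N where "N = acl (\<sigma> ` F) (\<sigma> ` V)"
  have NC: "alg_closed_subfield N" unfolding N_def by (rule acl_closed)
  have NF: "is_subfield N" using NC alg_closed_subfield_is_subfield by blast
  define P where "P = {x \<in> H. \<sigma> x \<in> N}"
  have "alg_closed_subfield P"
    unfolding alg_closed_subfield_def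
  proof (intro conjI allI impI)
    show "is_subfield P"
      using HF NF D by (auto simp: is_subfield_def P_def)
    fix g :: "'a poly" assume g: "(\<forall>i. poly.coeff g i \<in> P) \<and> Polynomial.degree g > 0"
    then have gH: "g \<in> polys_over H" by (auto simp: polys_over_def P_def)
    then obtain x where x: "x \<in> H" "poly g x = 0"
      using g H by (auto simp: alg_closed_subfield_def polys_over_def)
    have "poly (map_poly \<sigma> g) (\<sigma> x) = 0" using poly_map_hom[OF \<sigma> HF gH x(1)] x(2) D(4) by simp
    moreover have "map_poly \<sigma> g \<in> polys_over N"
      using g D(4) by (auto simp: polys_over_def coeff_map_poly P_def)
    moreover have "map_poly \<sigma> g \<noteq> 0"
    proof
      assume "map_poly \<sigma> g = 0"
      then have "\<sigma> (Polynomial.lead_coeff g) = 0" using D(4) by (metis coeff_0 coeff_map_poly)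
      then have "Polynomial.lead_coeff g = 0"
        using inj_onD[OF D(7), of "Polynomial.lead_coeff g" 0] D(4) g HF by (auto simp: P_def is_subfield_def)
      then show False using g by auto
    qed
    ultimately have "\<sigma> x \<in> algebraics N" by (auto simp: algebraics_def)
    then show "\<exists>x\<in>P. poly g x = 0" using x algebraics_alg_closed[OF NC] by (auto simp: P_def)
  qed
  moreover have "F \<subseteq> P" "V \<subseteq> P"
    using F acl_base[of "\<sigma> ` F" "\<sigma> ` V"] acl_gen[of "\<sigma> ` V" "\<sigma> ` F"] by (auto simp: P_def N_def)
  ultimately have "acl F V \<subseteq> P" by (rule acl_least)
  then show "\<sigma> ` acl F V \<subseteq> acl (\<sigma> ` F) (\<sigma> ` V)" by (auto simp: P_def N_def)
qed

lemma acl_image_iff: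
  fixes \<sigma> :: "'a::alg_closed_field \<Rightarrow> 'b::alg_closed_field"
  assumes \<sigma>: "field_hom_on H \<sigma>" and H: "alg_closed_subfield H" and F: "F \<subseteq> H" "V \<subseteq> H" "x \<in> H"
  shows "\<sigma> x \<in> acl (\<sigma> ` F) (\<sigma> ` V) \<longleftrightarrow> x \<in> acl F V"
proof -
  have "inj_on \<sigma> H" using field_hom_onD(7)[OF \<sigma> alg_closed_subfield_is_subfield[OF H]] .
  then show ?thesis
    using acl_image[OF \<sigma> H F(1,2)] F(3) acl_least[OF H F(1,2)] by (auto simp: inj_on_def)
qed

lemma quad_image:
  fixes \<sigma> :: "'a::alg_closed_field \<Rightarrow> 'b::alg_closed_field"
  assumes \<sigma>: "field_hom_on H \<sigma>" and H: "alg_closed_subfield H" and F: "F \<subseteq> H"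
    and pts: "{y, x, z, u, q, r, s} \<subseteq> H" and Q: "pregeometry.quad (acl F) y x z u q r s"
  shows "pregeometry.quad (acl (\<sigma> ` F)) (\<sigma> y) (\<sigma> x) (\<sigma> z) (\<sigma> u) (\<sigma> q) (\<sigma> r) (\<sigma> s)"
proof -
  have inj: "inj_on \<sigma> H" using field_hom_onD(7)[OF \<sigma> alg_closed_subfield_is_subfield[OF H]] .
  have i0: "\<sigma> a \<in> acl (\<sigma> ` F) {} \<longleftrightarrow> a \<in> acl F {}" if "a \<in> H" for a
    using acl_image_iff[OF \<sigma> H F, of "{}" a] that by simp
  have i1: "\<sigma> a \<in> acl (\<sigma> ` F) {\<sigma> b} \<longleftrightarrow> a \<in> acl F {b}" if "a \<in> H" "b \<in> H" for a b
    using acl_image_iff[OF \<sigma> H F, of "{b}" a] that by simp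
  have i2: "\<sigma> a \<in> acl (\<sigma> ` F) {\<sigma> b, \<sigma> c} \<longleftrightarrow> a \<in> acl F {b, c}" if "a \<in> H" "b \<in> H" "c \<in> H" for a b c
    using acl_image_iff[OF \<sigma> H F, of "{b, c}" a] that by simp
  have ne: "\<sigma> a = \<sigma> b \<longleftrightarrow> a = b" if "a \<in> H" "b \<in> H" for a b
    using inj that by (auto simp: inj_on_def)
  show ?thesis
    using Q pts unfolding pregeometry.quad_def[OF pregeometry_acl]
    by (simp add: i0 i1 i2 ne)
qed

lemma alg_closed_subfield_UNIV: "alg_closed_subfield (UNIV :: 'a::alg_closed_field set)"
  using alg_closed_imp_poly_has_root by (auto simp: alg_closed_subfield_def is_subfield_def)

lemma transcendental_poly_0:
  assumes "alg_closed_subfield E" "u \<notin> E" "f \<in> polys_over E" "poly f u = 0"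
  shows "f = 0"
  using assms algebraics_alg_closed[of E] by (auto simp: algebraics_def)

text \<open>
  The homomorphism on \<open>E[u]\<close> that sends \<open>u\<close> to \<open>t\<close>
  extends to a place, which is finite on the closure of \<open>E(u)\<close>: an element with
  infinite value would have an inverse with value \<open>0\<close>, and the algebraic relation
  of this inverse with \<open>u\<close> would specialize to an equation for \<open>t\<close>
  over \<open>\<iota>(E)\<close>.
\<close>

theorem independent_copy:
  fixes \<iota> :: "'a::alg_closed_field \<Rightarrow> 'b::alg_closed_field"
  assumes E: "alg_closed_subfield E" and u: "u \<notin> E"
    and \<iota>: "field_hom_on E \<iota>" and t: "t \<notin> \<iota> ` E"
  shows "\<exists>\<sigma>. field_hom_on (acl E {u}) \<sigma> \<and> (\<forall>x\<in>E. \<sigma> x = \<iota> x) \<and> \<sigma> u = t"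
proof -
  note EF = alg_closed_subfield_is_subfield[OF E]
  note ER = is_subfield_is_subring[OF EF]
  note I = field_hom_onD[OF \<iota> EF]
  have tc: "alg_closed_subfield (\<iota> ` E)" by (rule alg_closed_subfield_image[OF \<iota> EF E order_refl])
  define G0 where "G0 = hom_adjoin ((\<lambda>a. (a, \<iota> a)) ` E) u t"
  let ?G = "(\<lambda>a. (a, \<iota> a)) ` E"
  have lift: "f \<in> polys_over E \<and> h = map_poly \<iota> f" if "poly_lift ?G f h" for f h
    using that by (auto simp: poly_lift_def polys_over_def image_iff coeff_map_poly I(4) intro!: poly_eqI)
  have ph: "partial_hom UNIV ?G"
    using EF I(1,2,5) by (auto simp: partial_hom_def image_iff is_subfield_def I(3,4))
  have UR: "is_subring (UNIV :: 'b set)" by (simp add: is_subring_def)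
  have van: "poly h t = 0" if "poly_lift ?G f h" "poly f u = 0" for f h
    using lift[OF that(1)] transcendental_poly_0[OF E u _ that(2)] by auto
  have A: "partial_hom UNIV G0" "?G \<subseteq> G0" "(u, t) \<in> G0"
    unfolding G0_def by (rule partial_hom_adjoin[OF UR UNIV_I ph]; use van in blast)+
  obtain G where G: "partial_hom UNIV G" "G0 \<subseteq> G"
    and inv: "\<And>x y. (x, y) \<in> G \<Longrightarrow> y \<noteq> 0 \<Longrightarrow> (inverse x, inverse y) \<in> G"
    and val: "\<And>b. (\<exists>y. (b, y) \<in> G) \<or> (\<exists>y. (inverse b, y) \<in> G)"
    using place_extension[OF alg_closed_subfield_UNIV A(1)] by blast
  note D = partial_homD[OF G(1)]
  have base: "(a, \<iota> a) \<in> G" if "a \<in> E" for a using that A(2) G(2) by blast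
  have uG: "(u, t) \<in> G" using A(3) G(2) by blast
  have dom: "\<exists>y. (x, y) \<in> G" if x: "x \<in> acl E {u}" for x
  proof (rule ccontr)
    assume n: "\<nexists>y. (x, y) \<in> G"
    then have x0: "x \<noteq> 0" using D(1) by blast
    obtain y where y: "(inverse x, y) \<in> G" using val n by blast
    have "y = 0" using inv[OF y] n by auto
    have "inverse x \<in> acl E {u}"
      using x is_subfield_inverse[OF alg_closed_subfield_is_subfield[OF acl_closed]] by blast
    then have "poly_relation E (inverse x) u"
      using acl_insert_relation[of "inverse x" E u "{}"] acl_empty[OF E] poly_relation_sym by simp
    then obtain n d where d: "\<forall>j. d j \<in> E" "\<exists>j\<le>n. d j \<noteq> 0" "(\<Sum>j\<le>(n::nat). \<iota> (d j) * t ^ j) = 0"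
      using specialize_relation[OF G(1) _ _ uG base, of "inverse x" E] y \<open>y = 0\<close> x0 by auto
    have "\<exists>j\<le>n. \<iota> (d j) \<noteq> 0" using d(1,2) inj_onD[OF I(7), of _ 0] I(4) EF by (metis is_subfield_def)
    then have "t \<in> \<iota> ` E" using root_in_alg_closed[OF tc, of n "\<lambda>j. \<iota> (d j)" t] d(1,3) by blast
    then show False using t by blast
  qed
  define \<sigma> where "\<sigma> = (\<lambda>x. SOME y. (x, y) \<in> G)"
  have \<sigma>: "(x, \<sigma> x) \<in> G" if "x \<in> acl E {u}" for x
    unfolding \<sigma>_def using dom[OF that] by (rule someI_ex)
  have \<sigma>_eq: "\<sigma> x = y" if "x \<in> acl E {u}" "(x, y) \<in> G" for x y
    using partial_hom_unique[OF G(1) \<sigma>] that by blast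
  have acl_ring: "x + y \<in> acl E {u} \<and> x * y \<in> acl E {u}" "1 \<in> acl E {u}"
    if "x \<in> acl E {u}" "y \<in> acl E {u}" for x y
    using that alg_closed_subfield_is_subfield[OF acl_closed[of E "{u}"]] by (auto simp: is_subfield_def)
  have sub: "E \<subseteq> acl E {u}" "u \<in> acl E {u}" using acl_base acl_gen[of "{u}" E] by auto
  have "field_hom_on (acl E {u}) \<sigma>"
    unfolding field_hom_on_def
  proof (intro conjI ballI)
    fix x y assume xy: "x \<in> acl E {u}" "y \<in> acl E {u}"
    show "\<sigma> (x + y) = \<sigma> x + \<sigma> y"
      by (rule \<sigma>_eq) (use acl_ring(1)[OF xy] D(3)[OF \<sigma>[OF xy(1)] \<sigma>[OF xy(2)]] in auto)
    show "\<sigma> (x * y) = \<sigma> x * \<sigma> y"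
      by (rule \<sigma>_eq) (use acl_ring(1)[OF xy] D(4)[OF \<sigma>[OF xy(1)] \<sigma>[OF xy(2)]] in auto)
  next
    show "\<sigma> 1 = 1" by (rule \<sigma>_eq) (use acl_ring(2) sub(2) D(2) in auto)
  qed
  moreover have "\<forall>x\<in>E. \<sigma> x = \<iota> x" using \<sigma>_eq[OF subsetD[OF sub(1)] base] by blast
  moreover have "\<sigma> u = t" by (rule \<sigma>_eq[OF sub(2) uG])
  ultimately show ?thesis by blast
qed

text \<open>
  The second quadrangle is copied into the plane that \<open>yz\<close> spans with a new
  transcendental \<open>t\<close>. The copy and the original of the first quadrangle lie in
  different planes, so the point of \<open>harmonic_rank4\<close> exists. It is on the line
  \<open>yz\<close>, which the copying map fixes, and can therefore be pulled back to both
  quadrangles. Taking the two quadrangles equal shows that the conjugate exists.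
\<close>

theorem harmonic_concurrence:
  fixes F :: "'a::alg_closed_field set"
  assumes Q: "pregeometry.quad (acl F) y x z u q r s" and Q': "pregeometry.quad (acl F) y x z u' q' r' s'"
  shows "\<exists>e. e \<notin> acl F {} \<and> e \<in> acl F {y, z} \<and> e \<in> acl F {u, r} \<and> e \<in> acl F {u', r'}"
proof -
  interpret pregeometry "acl F" by (rule pregeometry_acl)
  \<comment> \<open>The closure of the field of rational functions over \<open>'a\<close>, with
    \<open>t\<close> as its variable.\<close>
  define \<iota> :: "'a \<Rightarrow> 'a poly fract alg_closure" where "\<iota> = (\<lambda>a. to_ac (to_fract [:a:]))"
  define t :: "'a poly fract alg_closure" where "t = to_ac (to_fract [:0, 1:])"
  define E where "E = acl F {y, z}"
  note D = quadD[OF Q] and D' = quadD[OF Q']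
  have \<iota>: "field_hom_on UNIV \<iota>"
    unfolding field_hom_on_def \<iota>_def
    by (auto simp flip: to_ac_add to_ac_mult to_fract_add to_fract_mult to_fract_1 to_ac_1 simp: one_pCons)
  then have \<iota>E: "field_hom_on E \<iota>" by (simp add: field_hom_on_def)
  have t: "t \<notin> range \<iota>" by (auto simp: t_def \<iota>_def)
  have E: "alg_closed_subfield E" unfolding E_def by (rule acl_closed)
  have "u' \<notin> E" using D'(17) by (simp add: E_def)
  then obtain \<sigma> where \<sigma>: "field_hom_on (acl E {u'}) \<sigma>" "\<forall>x\<in>E. \<sigma> x = \<iota> x" "\<sigma> u' = t"
    using independent_copy[OF E _ \<iota>E, of u' t] t by blast
  define H where "H = acl E {u'}"
  have H: "alg_closed_subfield H" unfolding H_def by (rule acl_closed)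
  have H_eq: "H = acl F {y, z, u'}" unfolding H_def E_def by (simp add: acl_acl insert_commute)
  have yz: "y \<in> E" "z \<in> E" "x \<in> E" using D(16) in_cl by (auto simp: E_def)
  have FE: "F \<subseteq> E" unfolding E_def by (rule acl_base)
  have EH: "E \<subseteq> H" unfolding H_def by (rule acl_base)
  have uH: "u' \<in> H" using acl_gen[of "{u'}" E] by (simp add: H_def)
  have qH: "q' \<in> H" using in_cl_line[OF D'(2)] yz EH uH unfolding H_eq by blast
  have rH: "r' \<in> H" using in_cl_line[OF D'(11)] yz EH qH unfolding H_eq by blast
  have sH: "s' \<in> H" using in_cl_line[OF D'(5)] yz EH uH unfolding H_eq by blast
  have \<sigma>H: "field_hom_on H \<sigma>" using \<sigma>(1) by (simp add: H_def)
  have FF: "\<sigma> ` F = \<iota> ` F" using \<sigma>(2) FE by (intro image_cong) auto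
  have img: "pregeometry.quad (acl (\<iota> ` F)) (\<iota> y) (\<iota> x) (\<iota> z) (\<iota> u) (\<iota> q) (\<iota> r) (\<iota> s)"
    by (rule quad_image[OF \<iota> alg_closed_subfield_UNIV _ _ Q]) auto
  have "pregeometry.quad (acl (\<sigma> ` F)) (\<sigma> y) (\<sigma> x) (\<sigma> z) (\<sigma> u') (\<sigma> q') (\<sigma> r') (\<sigma> s')"
    by (rule quad_image[OF \<sigma>H H _ _ Q']) (use FE EH yz uH qH rH sH in auto)
  then have img': "pregeometry.quad (acl (\<iota> ` F)) (\<iota> y) (\<iota> x) (\<iota> z) (\<sigma> u') (\<sigma> q') (\<sigma> r') (\<sigma> s')"
    using FF \<sigma>(2) yz by simp
  have im: "acl (\<iota> ` F) (\<iota> ` V) = \<iota> ` acl F V" for V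
    by (rule acl_image[OF \<iota> alg_closed_subfield_UNIV]) auto
  have "\<sigma> u' \<notin> acl (\<iota> ` F) {\<iota> y, \<iota> z, \<iota> u}"
    using im[of "{y, z, u}"] t \<sigma>(3) by auto
  from ingleton_main.harmonic_rank4[OF ingleton_main_acl img img' this] obtain e' where
    e': "e' \<notin> acl (\<iota> ` F) {}" "e' \<in> acl (\<iota> ` F) {\<iota> y, \<iota> z}" "e' \<in> acl (\<iota> ` F) {\<iota> u, \<iota> r}"
      "e' \<in> acl (\<iota> ` F) {\<sigma> u', \<sigma> r'}" by blast
  obtain e where e: "e' = \<iota> e" "e \<in> E" using e'(2) im[of "{y, z}"] by (auto simp: E_def)
  have iff: "\<iota> e \<in> acl (\<iota> ` F) (\<iota> ` V) \<longleftrightarrow> e \<in> acl F V" for V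
    by (rule acl_image_iff[OF \<iota> alg_closed_subfield_UNIV]) auto
  have "e \<notin> acl F {}" using e'(1) iff[of "{}"] e(1) by simp
  moreover have "e \<in> acl F {u, r}" using e'(3) iff[of "{u, r}"] e(1) by simp
  moreover have "e \<in> acl F {u', r'}"
  proof -
    have "\<sigma> e \<in> acl (\<sigma> ` F) (\<sigma> ` {u', r'})" using e'(4) e \<sigma>(2) FF by simp
    then show ?thesis using acl_image_iff[OF \<sigma>H H, of F "{u', r'}" e] FE EH uH rH e(2) by auto
  qed
  ultimately show ?thesis using e(2) by (auto simp: E_def)
qed

section \<open>Linear spaces with unique harmonic conjugates\<close>

locale linear_space =
  fixes P :: "'a set" and lines :: "'a set set"
  assumes lines_subset: "l \<in> lines \<Longrightarrow> l \<subseteq> P"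
    and line_exists: "a \<in> P \<Longrightarrow> b \<in> P \<Longrightarrow> a \<noteq> b \<Longrightarrow> \<exists>l\<in>lines. a \<in> l \<and> b \<in> l"
    and line_unique: "l \<in> lines \<Longrightarrow> m \<in> lines \<Longrightarrow> a \<in> l \<Longrightarrow> b \<in> l \<Longrightarrow> a \<in> m \<Longrightarrow> b \<in> m \<Longrightarrow> a \<noteq> b \<Longrightarrow> l = m"
begin

definition coll :: "'a \<Rightarrow> 'a \<Rightarrow> 'a \<Rightarrow> bool" where
  "coll a b c \<longleftrightarrow> (\<exists>l\<in>lines. a \<in> l \<and> b \<in> l \<and> c \<in> l)"

text \<open>The point version of \<open>quad\<close>.\<close>

definition quadr :: "'a \<Rightarrow> 'a \<Rightarrow> 'a \<Rightarrow> 'a \<Rightarrow> 'a \<Rightarrow> 'a \<Rightarrow> 'a \<Rightarrow> bool" where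
  "quadr y x z u q r s \<longleftrightarrow> distinct [y, x, z, u, q, r, s] \<and> {y, x, z, u, q, r, s} \<subseteq> P \<and>
     coll y x z \<and> coll y u q \<and> coll y r s \<and> coll x q s \<and> coll z u s \<and> coll z q r \<and> \<not> coll y z u"

lemma collI: "l \<in> lines \<Longrightarrow> a \<in> l \<Longrightarrow> b \<in> l \<Longrightarrow> c \<in> l \<Longrightarrow> coll a b c"
  by (auto simp: coll_def)

lemma coll_line: "coll a b c \<Longrightarrow> a \<noteq> b \<Longrightarrow> l \<in> lines \<Longrightarrow> a \<in> l \<Longrightarrow> b \<in> l \<Longrightarrow> c \<in> l"
  using line_unique by (auto simp: coll_def)

lemma coll_swap: "coll a b c \<Longrightarrow> coll b a c" "coll a b c \<Longrightarrow> coll a c b"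
  by (auto simp: coll_def)

text \<open>
  Two lines with two common points are equal, so a further collinear triple would make \<open>y,
  z, u\<close> collinear. Only \<open>x, u, r\<close> may be collinear as well, in the Fano
  plane.
\<close>

lemma quadr_lines:
  assumes Q: "quadr y x z u q r s" and T: "T \<subseteq> {y, x, z, u, q, r, s}" "card T = 3" "T \<noteq> {x, u, r}"
    and l: "l \<in> lines" "T \<subseteq> l"
  shows "T \<in> {{y, x, z}, {y, u, q}, {y, r, s}, {x, q, s}, {z, u, s}, {z, q, r}}"
proof -
  have d: "distinct [y, x, z, u, q, r, s]" and c: "coll y x z" "coll y u q" "coll y r s" "coll x q s" "coll z u s" "coll z q r"
    "\<not> coll y z u" using Q by (auto simp: quadr_def)
  obtain l1 where l1: "l1 \<in> lines" "y \<in> l1" "x \<in> l1" "z \<in> l1" using c by (auto simp: coll_def)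
  obtain l2 where l2: "l2 \<in> lines" "y \<in> l2" "u \<in> l2" "q \<in> l2" using c by (auto simp: coll_def)
  obtain l3 where l3: "l3 \<in> lines" "y \<in> l3" "r \<in> l3" "s \<in> l3" using c by (auto simp: coll_def)
  obtain l4 where l4: "l4 \<in> lines" "x \<in> l4" "q \<in> l4" "s \<in> l4" using c by (auto simp: coll_def)
  obtain l5 where l5: "l5 \<in> lines" "z \<in> l5" "u \<in> l5" "s \<in> l5" using c by (auto simp: coll_def)
  obtain l6 where l6: "l6 \<in> lines" "z \<in> l6" "q \<in> l6" "r \<in> l6" using c by (auto simp: coll_def)
  have u: "k = m" if "k \<in> lines" "m \<in> lines" "a \<in> k" "b \<in> k" "a \<in> m" "b \<in> m" "a \<noteq> b" for k m a b
    using line_unique that by blast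
  have u1: "u \<notin> l1" using c(7) l1 by (auto simp: coll_def)
  have q1: "q \<notin> l1" using u[OF l1(1) l2(1), of y q] l1 l2 u1 d by auto
  have s1: "s \<notin> l1" using u[OF l1(1) l5(1), of z s] l1 l5 u1 d by auto
  have r1: "r \<notin> l1" using u[OF l1(1) l3(1), of y r] l1 l3 s1 d by auto
  have x2: "x \<notin> l2" "z \<notin> l2" using u[OF l1(1) l2(1), of y x] u[OF l1(1) l2(1), of y z] l1 l2 u1 d by auto
  have s2: "s \<notin> l2" using u[OF l2(1) l5(1), of u s] l2 l5 x2 d by auto
  have r2: "r \<notin> l2" using u[OF l2(1) l6(1), of q r] l2 l6 x2 d by auto
  have x3: "x \<notin> l3" "z \<notin> l3" using u[OF l1(1) l3(1), of y x] u[OF l1(1) l3(1), of y z] l1 l3 r1 d by auto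
  have u3: "u \<notin> l3" using u[OF l3(1) l5(1), of u s] l3 l5 x3 d by auto
  have q3: "q \<notin> l3" using u[OF l3(1) l4(1), of q s] l3 l4 x3 d by auto
  have y4: "y \<notin> l4" "z \<notin> l4" using u[OF l1(1) l4(1), of x y] u[OF l1(1) l4(1), of x z] l1 l4 q1 d by auto
  have u4: "u \<notin> l4" using u[OF l4(1) l2(1), of u q] l2 l4 y4 d by auto
  have r4: "r \<notin> l4" using u[OF l4(1) l3(1), of r s] l3 l4 y4 d by auto
  have y5: "y \<notin> l5" "x \<notin> l5" using u[OF l1(1) l5(1), of z y] u[OF l1(1) l5(1), of z x] l1 l5 u1 d by auto
  have q5: "q \<notin> l5" using u[OF l5(1) l2(1), of u q] l2 l5 y5 d by auto
  have r5: "r \<notin> l5" using u[OF l5(1) l3(1), of r s] l3 l5 y5 d by auto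
  have y6: "y \<notin> l6" "x \<notin> l6" using u[OF l1(1) l6(1), of z y] u[OF l1(1) l6(1), of z x] l1 l6 q1 d by auto
  have u6: "u \<notin> l6" using u[OF l6(1) l2(1), of u q] l2 l6 y6 d by auto
  have s6: "s \<notin> l6" using u[OF l6(1) l3(1), of r s] l3 l6 y6 d by auto
  have fT: "finite T" using T(2) by (metis card.infinite zero_neq_numeral)
  have sub: "T = R" if "T \<subseteq> R" "card R = 3" "finite R" for R
    using card_subset_eq[OF that(3,1)] that(2) T(2) by simp
  have c3: "card {a, b, c'} = 3" if "a \<noteq> b" "a \<noteq> c'" "b \<noteq> c'" for a b c' using that by simp
  have full: "T = {a, b, c'}" if "T \<inter> {y, x, z, u, q, r, s} \<subseteq> {a, b, c'}" "a \<noteq> b" "a \<noteq> c'" "b \<noteq> c'" for a b c'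
    by (rule sub) (use that T(1) c3[OF that(2-4)] in auto)
  have on: "T \<subseteq> k" if "k \<in> lines" "a \<in> T" "b \<in> T" "a \<noteq> b" "a \<in> k" "b \<in> k" for k a b
    using u[OF that(1) l(1), of a b] that l(2) by auto
  have e1: "T = {y, x, z}" if "T \<subseteq> l1" by (rule full) (use that u1 q1 s1 r1 d in auto)
  have e2: "T = {y, u, q}" if "T \<subseteq> l2" by (rule full) (use that x2 s2 r2 d in auto)
  have e3: "T = {y, r, s}" if "T \<subseteq> l3" by (rule full) (use that x3 u3 q3 d in auto)
  have e4: "T = {x, q, s}" if "T \<subseteq> l4" by (rule full) (use that y4 u4 r4 d in auto)
  have e5: "T = {z, u, s}" if "T \<subseteq> l5" by (rule full) (use that y5 q5 r5 d in auto)
  have e6: "T = {z, q, r}" if "T \<subseteq> l6" by (rule full) (use that y6 u6 s6 d in auto)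
  obtain a b where ab: "a \<in> T" "b \<in> T" "a \<noteq> b" "\<not> {a, b} \<subseteq> {x, u, r}"
  proof -
    have "\<not> T \<subseteq> {x, u, r}" using sub[of "{x, u, r}"] T(3) d by auto
    then obtain a where a: "a \<in> T" "a \<notin> {x, u, r}" by blast
    have "T \<noteq> {a}" using T(2) by auto
    then obtain b where "b \<in> T" "b \<noteq> a" using a by blast
    then show thesis using that[of a b] a by blast
  qed
  have "T \<subseteq> l1 \<or> T \<subseteq> l2 \<or> T \<subseteq> l3 \<or> T \<subseteq> l4 \<or> T \<subseteq> l5 \<or> T \<subseteq> l6"
  proof -
    have "\<exists>k\<in>{l1, l2, l3, l4, l5, l6}. a \<in> k \<and> b \<in> k"
    proof -
      have a: "a = y \<or> a = x \<or> a = z \<or> a = u \<or> a = q \<or> a = r \<or> a = s" and b: "b = y \<or> b = x \<or> b = z \<or> b = u \<or> b = q \<or> b = r \<or> b = s"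
        using ab(1,2) T(1) by auto
      from a b show ?thesis
        using ab(3,4) l1(2-) l2(2-) l3(2-) l4(2-) l5(2-) l6(2-) by (elim disjE) simp_all
    qed
    then show ?thesis using on[OF _ ab(1-3)] l1(1) l2(1) l3(1) l4(1) l5(1) l6(1) by blast
  qed
  then show ?thesis by (elim disjE) (drule e1 e2 e3 e4 e5 e6; simp)+
qed

text \<open>
  The hypothesis on triples is the one in the definition of \<open>HP\<close>; here the
  incidences that construct the quadrangle are picked from it.
\<close>

lemma quadrI_triples:
  assumes d: "distinct [y, x, z, u, q, r, s]" and pts: "{y, x, z, u, q, r, s} \<subseteq> P"
    and c: "\<And>a b c. {a, b, c} \<subseteq> {y, x, z, u, q, r, s} \<Longrightarrow> distinct [a, b, c] \<Longrightarrow> {a, b, c} \<noteq> {x, u, r} \<Longrightarrow>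
      coll a b c \<longleftrightarrow> {a, b, c} \<in> {{y, x, z}, {y, u, q}, {y, r, s}, {x, q, s}, {z, u, s}, {z, q, r}}"
  shows "quadr y x z u q r s"
proof -
  have neq: "V \<noteq> W" if "w \<in> V" "w \<notin> W" for w :: 'a and V W using that by blast
  have d2: "u \<noteq> y" "u \<noteq> x" "u \<noteq> z" "z \<noteq> y" "z \<noteq> x" "q \<noteq> u" "q \<noteq> x" using d by auto
  have "coll y x z" using c[of y x z] neq[of y "{y, x, z}" "{x, u, r}"] d d2 by simp
  moreover have "coll y u q" using c[of y u q] neq[of y "{y, u, q}" "{x, u, r}"] d d2 by simp
  moreover have "coll y r s" using c[of y r s] neq[of y "{y, r, s}" "{x, u, r}"] d d2 by simp
  moreover have "coll x q s" using c[of x q s] neq[of q "{x, q, s}" "{x, u, r}"] d d2 by simp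
  moreover have "coll z u s" using c[of z u s] neq[of z "{z, u, s}" "{x, u, r}"] d d2 by simp
  moreover have "coll z q r" using c[of z q r] neq[of z "{z, q, r}" "{x, u, r}"] d d2 by simp
  moreover have "\<not> coll y z u"
    using c[of y z u] neq[of y "{y, z, u}" "{x, u, r}"] neq[of u "{y, z, u}" "{y, x, z}"] neq[of z "{y, z, u}" "{y, u, q}"]
      neq[of z "{y, z, u}" "{y, r, s}"] neq[of y "{y, z, u}" "{x, q, s}"] neq[of y "{y, z, u}" "{z, u, s}"]
      neq[of y "{y, z, u}" "{z, q, r}"] d d2 by simp
  ultimately show ?thesis using d pts by (simp add: quadr_def)
qed

end

text \<open>
  The assumption says that a conjugate exists (both quadrangles may be equal) and does not
  depend on the quadrangle.
\<close>

locale harmonic_space = linear_space +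
  assumes harmonic: "quadr y x z u q r s \<Longrightarrow> quadr y x z u' q' r' s' \<Longrightarrow>
     \<exists>e. coll y z e \<and> coll u r e \<and> coll u' r' e"
begin

definition hconj :: "'a \<Rightarrow> 'a \<Rightarrow> 'a \<Rightarrow> 'a \<Rightarrow> bool" where
  "hconj y z x x' \<longleftrightarrow> (\<exists>u q r s. quadr y x z u q r s \<and> coll y z x' \<and> coll u r x')"

text \<open>
  A copy of \<open>L\<^sub>p\<close>, with \<open>A i = [0, i, 1]\<close>, \<open>B i = [1, i,
  0]\<close>, \<open>C i = [1, i, 1]\<close> and \<open>D = [0, 1, 0]\<close>. The indices are
  integers that matter modulo \<open>p\<close> only, so that they can be calculated with freely.
\<close>

definition config :: "nat \<Rightarrow> 'a set \<Rightarrow> 'a set \<Rightarrow> 'a set \<Rightarrow> (int \<Rightarrow> 'a) \<Rightarrow> 'a \<Rightarrow> (int \<Rightarrow> 'a) \<Rightarrow> (int \<Rightarrow> 'a) \<Rightarrow> bool" where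
  "config p la lb lc A D B C \<longleftrightarrow>
     la \<in> lines \<and> lb \<in> lines \<and> lc \<in> lines \<and> la \<noteq> lb \<and> la \<noteq> lc \<and> lb \<noteq> lc \<and>
     D \<in> la \<and> D \<in> lb \<and> D \<in> lc \<and>
     (\<forall>i. A i \<in> la \<and> B i \<in> lb \<and> C i \<in> lc \<and> A i \<noteq> D \<and> B i \<noteq> D \<and> C i \<noteq> D) \<and>
     (\<forall>i j. (A i = A j \<longleftrightarrow> int p dvd i - j) \<and> (B i = B j \<longleftrightarrow> int p dvd i - j) \<and> (C i = C j \<longleftrightarrow> int p dvd i - j)) \<and>
     (\<forall>i j. coll (A i) (B j) (C (i + j)))"

lemma configD:
  assumes "config p la lb lc A D B C"
  shows "la \<in> lines" "lb \<in> lines" "lc \<in> lines" "la \<noteq> lb" "la \<noteq> lc" "lb \<noteq> lc"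
    "D \<in> la" "D \<in> lb" "D \<in> lc" "A i \<in> la" "B i \<in> lb" "C i \<in> lc" "A i \<noteq> D" "B i \<noteq> D" "C i \<noteq> D"
    "A i = A j \<longleftrightarrow> int p dvd i - j" "B i = B j \<longleftrightarrow> int p dvd i - j" "C i = C j \<longleftrightarrow> int p dvd i - j"
    "coll (A i) (B j) (C (i + j))"
    "A i \<notin> lb" "A i \<notin> lc" "B i \<notin> la" "B i \<notin> lc" "C i \<notin> la" "C i \<notin> lb"
    "A i \<in> P" "B i \<in> P" "C i \<in> P" "D \<in> P"
proof -
  show 1: "la \<in> lines" "lb \<in> lines" "lc \<in> lines" "la \<noteq> lb" "la \<noteq> lc" "lb \<noteq> lc"
    "D \<in> la" "D \<in> lb" "D \<in> lc" "A i \<in> la" "B i \<in> lb" "C i \<in> lc" "A i \<noteq> D" "B i \<noteq> D" "C i \<noteq> D"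
    "A i = A j \<longleftrightarrow> int p dvd i - j" "B i = B j \<longleftrightarrow> int p dvd i - j" "C i = C j \<longleftrightarrow> int p dvd i - j"
    "coll (A i) (B j) (C (i + j))" using assms unfolding config_def by blast+
  show "A i \<notin> lb" "A i \<notin> lc" "B i \<notin> la" "B i \<notin> lc" "C i \<notin> la" "C i \<notin> lb"
    using 1(1-15) line_unique by metis+
  show "A i \<in> P" "B i \<in> P" "C i \<in> P" "D \<in> P" using 1(1-12) lines_subset by blast+
qed

text \<open>
  The substitution \<open>[x, y, z] \<mapsto> [x, y, x - z]\<close>. It gives the column before
  \<open>B\<close> from the construction of the column after \<open>C\<close>.
\<close>

lemma config_reverse:
  assumes "config p la lb lc A D B C"
  shows "config p la lc lb (\<lambda>i. A (- i)) D C B"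
proof -
  note D = configD[OF assms]
  have "coll (A (- i)) (C j) (B (i + j))" for i j
    using D(19)[of "- i" "i + j"] by (auto simp: coll_def)
  moreover have "int p dvd - i - - j \<longleftrightarrow> int p dvd i - j" for i j
    by (metis dvd_minus_iff minus_diff_eq minus_diff_minus)
  ultimately show ?thesis unfolding config_def using D(1-18) by auto
qed

text \<open>
  With \<open>k = v - m\<close>, the quadrangle with vertices \<open>A k\<close>,
  \<open>D\<close>, \<open>C (v - k)\<close>, \<open>B m\<close> constructs the conjugate of
  \<open>B v\<close> with respect to \<open>A 0\<close> and \<open>C v\<close> on the line of
  \<open>A k\<close> and \<open>C (v - k)\<close>. As the conjugate does not depend on
  \<open>k\<close>, all these lines pass through one point.
\<close>

lemma next_column:
  assumes c: "config p la lb lc A D B C" and p: "p \<ge> 2"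
  shows "\<exists>C'. (\<forall>v w. int p dvd v - w \<longrightarrow> C' v = C' w) \<and> (\<forall>k v. coll (A k) (C (v - k)) (C' v)) \<and>
    (\<forall>v. hconj (A 0) (C v) (B v) (C' v))"
proof -
  note D = configD[OF c]
  have p1: "\<not> int p dvd 1" using p by simp
  have Q: "quadr (A 0) (B v) (C v) (A (v - m)) D (C m) (B m)" if m: "\<not> int p dvd v - m" for v m
  proof -
    have 0: "A 0 \<noteq> A (v - m)" using D(16)[of 0 "v - m"] m by (metis diff_0 dvd_minus_iff)
    have 1: "B v \<noteq> B m" "C v \<noteq> C m" using D(17,18) m by auto
    have 2: "A i \<noteq> B j" "A i \<noteq> C j" "B i \<noteq> C j" for i j
      using D(20,21)[of i] D(11,12)[of j] D(23)[of i] by metis+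
    have 3: "coll (A 0) (B v) (C v)" "coll (A 0) (C m) (B m)" "coll (C v) (A (v - m)) (B m)"
      using D(19)[of 0 v] D(19)[of 0 m] D(19)[of "v - m" m] by (auto simp: coll_def)
    have 4: "coll (A 0) (A (v - m)) D" "coll (B v) D (B m)" "coll (C v) D (C m)"
      using collI D(1-3) D(7-12) by blast+
    have 5: "\<not> coll (A 0) (C v) (A (v - m))"
    proof
      assume "coll (A 0) (C v) (A (v - m))"
      then have "coll (A 0) (A (v - m)) (C v)" by (rule coll_swap)
      then have "C v \<in> la" using coll_line[OF _ 0 D(1) D(10) D(10)] by blast
      then show False using D(24) by blast
    qed
    show ?thesis unfolding quadr_def
      using 0 1 2 2[symmetric] 3 4 5 D(13-15) D(13-15)[symmetric] D(26-29) by simp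
  qed
  \<comment> \<open>The point is defined with \<open>k = 1\<close> and compared with every other
    \<open>k\<close>.\<close>
  define R where "R = (\<lambda>v e. coll (A 0) (C v) e \<and> coll (A 1) (C (v - 1)) e)"
  have uniq: "e = e'" if "R v e" "R v e'" for v e e'
  proof (rule ccontr)
    assume ne: "e \<noteq> e'"
    obtain l where l: "l \<in> lines" "A 0 \<in> l" "C v \<in> l" "e \<in> l" using \<open>R v e\<close> by (auto simp: R_def coll_def)
    obtain m where m: "m \<in> lines" "A 1 \<in> m" "C (v - 1) \<in> m" "e \<in> m" using \<open>R v e\<close> by (auto simp: R_def coll_def)
    have AC: "A i \<noteq> C j" for i j using D(21) D(12) by metis
    have "e' \<in> l" "e' \<in> m" using \<open>R v e'\<close> coll_line l m AC unfolding R_def by blast+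
    then have "l = m" using line_unique l m ne by blast
    moreover have "A 0 \<noteq> A 1" using D(16)[of 1 0] p1 by simp
    ultimately have "l = la" using line_unique l m D(1,10) by blast
    then show False using l D(24) by blast
  qed
  have meet: "\<exists>e. R v e \<and> coll (A k) (C (v - k)) e" if "\<not> int p dvd k" for v k
    using harmonic[OF Q[of v "v - 1"] Q[of v "v - k"]] p1 that by (simp add: R_def)
  define C' where "C' = (\<lambda>v. SOME e. R v e)"
  have RC: "R v (C' v)" for v
  proof -
    have "\<exists>e. R v e" using meet[OF p1, of v] by blast
    then show ?thesis unfolding C'_def by (rule someI_ex)
  qed
  have "C' v = C' w" if vw: "int p dvd v - w" for v w
  proof -
    have "C v = C w" "C (v - 1) = C (w - 1)" using D(18) vw by auto
    then have "R v = R w" by (simp add: R_def)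
    then show ?thesis by (simp add: C'_def)
  qed
  moreover have "coll (A k) (C (v - k)) (C' v)" for k v
  proof (cases "int p dvd k")
    case True
    then have "A k = A 0" "C (v - k) = C v" using D(16,18) by auto
    then show ?thesis using RC[of v] by (simp add: R_def)
  next
    case False
    then show ?thesis using meet[of k v] uniq[OF RC] by blast
  qed
  moreover have "hconj (A 0) (C v) (B v) (C' v)" for v
    unfolding hconj_def
  proof (intro exI conjI)
    show "quadr (A 0) (B v) (C v) (A (v - (v - 1))) D (C (v - 1)) (B (v - 1))" by (rule Q) (use p1 in simp)
    show "coll (A 0) (C v) (C' v)" "coll (A (v - (v - 1))) (C (v - 1)) (C' v)"
      using RC[of v] by (simp_all add: R_def)
  qed
  ultimately show ?thesis by blast
qed

text \<open>
  In coordinates \<open>C' v = [1, v, 2]\<close>. This is a new column only if \<open>2\<close>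
  is not \<open>0\<close> modulo \<open>p\<close>.
\<close>

lemma next_column_facts:
  assumes c: "config p la lb lc A D B C" and p: "prime p" "p \<noteq> 2"
    and per: "\<And>v w. int p dvd v - w \<Longrightarrow> C' v = C' w" and C': "\<And>k v. coll (A k) (C (v - k)) (C' v)"
  shows "\<exists>l\<in>lines. A k \<in> l \<and> B (v - 2 * k) \<in> l \<and> C (v - k) \<in> l \<and> C' v \<in> l"
    "C' v \<notin> la" "C' v \<notin> lb" "C' v \<notin> lc" "C' v = C' w \<longleftrightarrow> int p dvd v - w"
proof -
  note D = configD[OF c]
  have p1: "\<not> int p dvd 1" using p by (simp add: prime_nat_iff)
  have p2: "\<not> int p dvd 2"
    using p by (metis int_dvd_int_iff of_nat_numeral primes_dvd_imp_eq two_is_prime_nat)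
  show ln: "\<exists>l\<in>lines. A k \<in> l \<and> B (v - 2 * k) \<in> l \<and> C (v - k) \<in> l \<and> C' v \<in> l" for k v
  proof -
    obtain l where l: "l \<in> lines" "A k \<in> l" "C (v - k) \<in> l" "C' v \<in> l" using C' by (auto simp: coll_def)
    have "coll (A k) (B (v - 2 * k)) (C (v - k))" using D(19)[of k "v - 2 * k"] by (simp add: algebra_simps)
    then have "coll (A k) (C (v - k)) (B (v - 2 * k))" by (rule coll_swap)
    moreover have "A k \<noteq> C (v - k)" using D(21) D(12) by metis
    ultimately have "B (v - 2 * k) \<in> l" using coll_line l by blast
    then show ?thesis using l by blast
  qed
  have *: "C' v \<noteq> A k" if "C' v \<in> la" for v k
  proof
    assume e: "C' v = A k"
    obtain l where l: "l \<in> lines" "A (k + 1) \<in> l" "C (v - (k + 1)) \<in> l" "C' v \<in> l" using ln by blast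
    have "A (k + 1) \<noteq> A k" using D(16) p1 by simp
    then have "l = la" using line_unique[OF l(1) D(1) l(2) l(4)] e D(10) by metis
    then show False using l D(24) by blast
  qed
  show nA: "C' v \<notin> la" for v
  proof
    assume a: "C' v \<in> la"
    obtain l where l: "l \<in> lines" "A 0 \<in> l" "C (v - 0) \<in> l" "C' v \<in> l" using ln by blast
    have "l = la" using line_unique[OF l(1) D(1) l(4) l(2) a D(10)] *[OF a] by metis
    then show False using l D(24) by blast
  qed
  show "C' v \<notin> lb"
  proof
    assume a: "C' v \<in> lb"
    have "C' v = B (v - 2 * k)" for k
    proof (rule ccontr)
      assume n: "C' v \<noteq> B (v - 2 * k)"
      obtain l where l: "l \<in> lines" "A k \<in> l" "B (v - 2 * k) \<in> l" "C' v \<in> l" using ln by blast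
      have "l = lb" using line_unique[OF l(1) D(2) l(4) l(3) a D(11) n] .
      then show False using l D(20) by blast
    qed
    from this[of 0] this[of 1] have "B v = B (v - 2)" by simp
    then show False using D(17) p2 by simp
  qed
  show "C' v \<notin> lc"
  proof
    assume a: "C' v \<in> lc"
    have "C' v = C (v - k)" for k
    proof (rule ccontr)
      assume n: "C' v \<noteq> C (v - k)"
      obtain l where l: "l \<in> lines" "A k \<in> l" "C (v - k) \<in> l" "C' v \<in> l" using ln by blast
      have "l = lc" using line_unique[OF l(1) D(3) l(4) l(3) a D(12) n] .
      then show False using l D(21) by blast
    qed
    from this[of 0] this[of 1] have "C v = C (v - 1)" by simp
    then show False using D(18) p1 by simp
  qed
  show "C' v = C' w \<longleftrightarrow> int p dvd v - w"
  proof
    assume e: "C' v = C' w"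
    show "int p dvd v - w"
    proof (rule ccontr)
      assume n: "\<not> int p dvd v - w"
      obtain l where l: "l \<in> lines" "A 0 \<in> l" "C (v - 0) \<in> l" "C' v \<in> l" using ln by blast
      obtain m where m: "m \<in> lines" "A 0 \<in> m" "C (w - 0) \<in> m" "C' w \<in> m" using ln by blast
      have "C' v \<noteq> A 0" using nA D(10) by metis
      then have "l = m" using line_unique l m e by metis
      moreover have "C v \<noteq> C w" using D(18) n by simp
      ultimately have "l = lc" using line_unique[OF l(1) D(3)] l(3) m(3) D(12) by simp
      then show False using l D(21) by blast
    qed
  qed (rule per)
qed

text \<open>
  It remains to find the points of the new column on a line with \<open>D\<close>. Given two of
  them, let \<open>\<gamma>\<close> be the mean of their indices \<open>\<alpha>\<close> and
  \<open>\<beta>\<close>. Two quadrangles construct the conjugate of \<open>B \<gamma>\<close>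
  with respect to \<open>B \<alpha>\<close> and \<open>B \<beta>\<close>: for one the last side
  is the line of \<open>C' \<alpha>\<close> and \<open>C' \<beta>\<close>, for the other it lies
  on \<open>la\<close>. So the conjugate is the point \<open>D\<close> of \<open>la\<close> and
  \<open>lb\<close>.
\<close>

lemma next_config:
  assumes c: "config p la lb lc A D B C" and p: "prime p" "p \<noteq> 2"
    and per: "\<And>v w. int p dvd v - w \<Longrightarrow> C' v = C' w" and C': "\<And>k v. coll (A k) (C (v - k)) (C' v)"
  shows "\<exists>lc'. config p la lc lc' A D C C'"
proof -
  note D = configD[OF c]
  note F = next_column_facts[OF c p per C']
  note rc = config_reverse[OF c]
  have p2: "p \<ge> 2" using p(1) by (rule prime_ge_2_nat)
  \<comment> \<open>The column \<open>[1, v, -1]\<close> before \<open>B\<close>, from which the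
    second quadrangle takes a vertex.\<close>
  obtain C0 where per0: "\<And>v w. int p dvd v - w \<Longrightarrow> C0 v = C0 w" and C0: "\<And>k v. coll (A (- k)) (B (v - k)) (C0 v)"
    using next_column[OF rc p2] by blast
  note F0 = next_column_facts[OF rc p per0 C0]
  have n2: "\<not> int p dvd 2"
    using p by (metis int_dvd_int_iff of_nat_numeral primes_dvd_imp_eq two_is_prime_nat)
  have "coll (C' \<alpha>) (C' \<beta>) D" if ab: "\<not> int p dvd \<alpha> - \<beta>" for \<alpha> \<beta>
  proof -
    \<comment> \<open>\<open>h\<close> is the inverse of \<open>2\<close> modulo
      \<open>p\<close>.\<close>
    obtain h where h: "int p = 2 * h - 1"
    proof -
      have "odd p" using p prime_odd_nat[of p] p2 by auto
      then obtain k where "p = 2 * k + 1" by (rule oddE)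
      then show ?thesis using that[of "int k + 1"] by simp
    qed
    define \<gamma> where "\<gamma> = (\<alpha> + \<beta>) * h"
    have g: "2 * \<gamma> - \<alpha> - \<beta> = (\<alpha> + \<beta>) * int p" unfolding h by (simp add: \<gamma>_def algebra_simps)
    have gd: "int p dvd 2 * \<gamma> - \<alpha> - \<beta>" unfolding g by simp
    have pp: "prime (int p)" using p(1) by simp
    have gab: "\<not> int p dvd \<gamma> - \<alpha>" "\<not> int p dvd \<gamma> - \<beta>"
    proof -
      show "\<not> int p dvd \<gamma> - \<alpha>"
      proof
        assume "int p dvd \<gamma> - \<alpha>"
        then have "int p dvd 2 * (\<gamma> - \<alpha>)" by (rule dvd_mult)
        from dvd_diff[OF this gd] have "int p dvd \<beta> - \<alpha>" by (simp add: algebra_simps)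
        then show False using ab dvd_minus_iff[of "int p" "\<beta> - \<alpha>"] by simp
      qed
      show "\<not> int p dvd \<gamma> - \<beta>"
      proof
        assume "int p dvd \<gamma> - \<beta>"
        then have "int p dvd 2 * (\<gamma> - \<beta>)" by (rule dvd_mult)
        from dvd_diff[OF this gd] have "int p dvd \<alpha> - \<beta>" by (simp add: algebra_simps)
        then show False using ab by simp
      qed
    qed
    have B1: "B (2 * \<gamma> - \<beta>) = B \<alpha>" "B (2 * \<gamma> - \<alpha>) = B \<beta>"
      unfolding D(17) using gd by (simp_all add: algebra_simps)
    have ne: "B \<alpha> \<noteq> B \<gamma>" "B \<beta> \<noteq> B \<gamma>" "B \<alpha> \<noteq> B \<beta>" "C' \<alpha> \<noteq> C' \<beta>" "A (\<gamma> - \<alpha>) \<noteq> A (\<gamma> - \<beta>)"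
      using D(17)[of \<gamma> \<alpha>] D(17)[of \<gamma> \<beta>] D(17)[of \<alpha> \<beta>] F(5)[of \<alpha> \<beta>] D(16)[of "\<gamma> - \<beta>" "\<gamma> - \<alpha>"] gab ab by auto
    have inP: "C' v \<in> P" "C0 v \<in> P" for v
      using F(1)[of 0 v] F0(1)[of 0 v] lines_subset by blast+
    have BC: "B i \<noteq> C j" "A i \<noteq> B j" "A i \<noteq> C j" for i j
      using D(23)[of i] D(12)[of j] D(20)[of i] D(11)[of j] D(21)[of i] by metis+
    have nC: "C' v \<noteq> A i" "C' v \<noteq> B i" "C' v \<noteq> C i" "C0 v \<noteq> A i" "C0 v \<noteq> B i" "C0 v \<noteq> C i" for v i
      using F(2-4)[of v] F0(2-4)[of v] D(10-12)[of i] by metis+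
    have Q: "quadr (B \<alpha>) (B \<gamma>) (B \<beta>) (C' \<alpha>) (A 0) (C' \<beta>) (C \<gamma>)"
    proof -
      have 1: "coll (B \<alpha>) (B \<gamma>) (B \<beta>)" using collI D(2,11) by blast
      have 2: "coll (B v) (C' v) (A 0)" "coll (B v) (A 0) (C' v)" for v using F(1)[of 0 v] by (auto simp: coll_def)
      have 3: "coll (B (2 * \<gamma> - v)) (C' v) (C \<gamma>)" for v
        using F(1)[of "v - \<gamma>" v] by (auto simp: coll_def algebra_simps)
      have 4: "coll (B \<gamma>) (A 0) (C \<gamma>)" using D(19)[of 0 \<gamma>] by (auto simp: coll_def)
      have 5: "\<not> coll (B \<alpha>) (B \<beta>) (C' \<alpha>)" using coll_line ne(3) D(2,11) F(3) by blast
      show ?thesis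
        unfolding quadr_def
        using 1 2 3[of \<beta>] 3[of \<alpha>] 4 5 ne ne[symmetric] nC BC BC[symmetric] nC[symmetric] inP D(26-28)
        by (simp add: B1)
    qed
    have Q': "quadr (B \<alpha>) (B \<gamma>) (B \<beta>) (A (\<gamma> - \<alpha>)) (C \<gamma>) (A (\<gamma> - \<beta>)) (C0 \<gamma>)"
    proof -
      have 1: "coll (B \<alpha>) (B \<gamma>) (B \<beta>)" using collI D(2,11) by blast
      have 2: "coll (B v) (A (\<gamma> - v)) (C \<gamma>)" "coll (B v) (C \<gamma>) (A (\<gamma> - v))" for v using D(19)[of "\<gamma> - v" v] by (auto simp: coll_def)
      have 3: "coll (B (2 * \<gamma> - v)) (A (\<gamma> - v)) (C0 \<gamma>)" for v
        using C0[of "v - \<gamma>" \<gamma>] by (auto simp: coll_def algebra_simps)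
      have 4: "coll (B \<gamma>) (C \<gamma>) (C0 \<gamma>)" using F0(1)[of 0 \<gamma>] by (auto simp: coll_def)
      have 5: "\<not> coll (B \<alpha>) (B \<beta>) (A (\<gamma> - \<alpha>))" using coll_line ne(3) D(2,11,20) by blast
      show ?thesis
        unfolding quadr_def
        using 1 2 3[of \<beta>] 3[of \<alpha>] 4 5 ne ne[symmetric] nC BC BC[symmetric] nC[symmetric] inP D(26-28)
        by (simp add: B1)
    qed
    obtain e where e: "coll (B \<alpha>) (B \<beta>) e" "coll (C' \<alpha>) (C' \<beta>) e" "coll (A (\<gamma> - \<alpha>)) (A (\<gamma> - \<beta>)) e"
      using harmonic[OF Q Q'] by blast
    have "e \<in> lb" using coll_line[OF e(1) ne(3) D(2) D(11) D(11)] .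
    moreover have "e \<in> la" using coll_line[OF e(3) ne(5) D(1) D(10) D(10)] .
    ultimately have "e = D" using line_unique D(1,2,4,7,8) by blast
    then show ?thesis using e(2) by simp
  qed
  note colD = this
  have "C' 0 \<noteq> D" using F(2)[of 0] D(7) by metis
  moreover have "C' 0 \<in> P" using F(1)[of 0 0] lines_subset by blast
  ultimately obtain lc' where lc': "lc' \<in> lines" "D \<in> lc'" "C' 0 \<in> lc'" using line_exists D(29) by metis
  have inl: "C' v \<in> lc'" for v
  proof (cases "int p dvd v - 0")
    case True
    then show ?thesis using per[of v 0] lc'(3) by simp
  next
    case False
    then have "\<not> int p dvd 0 - v" by simp
    then have "coll (C' 0) (C' v) D" by (rule colD)
    then have "coll (C' 0) D (C' v)" by (rule coll_swap)
    then show ?thesis using coll_line \<open>C' 0 \<noteq> D\<close> lc' by blast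
  qed
  have "config p la lc lc' A D C C'"
    unfolding config_def
  proof (intro conjI allI)
    show "la \<noteq> lc'" "lc \<noteq> lc'" using F(2,4)[of 0] lc'(3) by auto
    show "C' i \<noteq> D" for i using F(2)[of i] D(7) by metis
    show "coll (A i) (C j) (C' (i + j))" for i j using C'[of i "i + j"] by simp
  qed (use D(1-18) lc' inl F(5) in auto)
  then show ?thesis by blast
qed

text \<open>
  The columns \<open>G n v = [1, v, n]\<close> for \<open>n < p\<close>, together with what is
  needed later: collinearity along three consecutive columns, and the conjugation that produced
  each column. If \<open>p = 2\<close>, then \<open>L\<^sub>p\<close> already contains all of
  them.
\<close>

lemma all_columns:
  assumes c: "config p la lb lc A D B C" and p: "prime p"
  shows "\<exists>G L. G 0 = B \<and> G 1 = C \<and> (\<forall>n. Suc n < p \<longrightarrow> config p la (L n) (L (Suc n)) A D (G n) (G (Suc n))) \<and>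
    (\<forall>n k v. Suc (Suc n) < p \<longrightarrow> (\<exists>l\<in>lines. A k \<in> l \<and> G n (v - 2 * k) \<in> l \<and> G (Suc n) (v - k) \<in> l \<and> G (Suc (Suc n)) v \<in> l)) \<and>
    (\<forall>n v. Suc (Suc n) < p \<longrightarrow> hconj (A 0) (G (Suc n) v) (G n v) (G (Suc (Suc n)) v))"
proof (cases "p = 2")
  case True
  then show ?thesis using c
    by (intro exI[of _ "\<lambda>n. if n = 0 then B else C"] exI[of _ "\<lambda>n. if n = 0 then lb else lc"]) auto
next
  case False
  note p2 = prime_ge_2_nat[OF p]
  \<comment> \<open>The choice runs over pairs of consecutive columns with their lines, and goes on
    beyond the columns that are wanted.\<close>
  let ?st = "\<lambda>(l, m, B, C) (l', m', B', C'). l' = m \<and> B' = C \<and>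
    (\<forall>k v. \<exists>l\<in>lines. A k \<in> l \<and> B (v - 2 * k) \<in> l \<and> C (v - k) \<in> l \<and> C' v \<in> l) \<and>
    (\<forall>v. hconj (A 0) (C v) (B v) (C' v))"
  have "\<exists>f. \<forall>n. (\<lambda>(l, m, B, C). config p la l m A D B C) (f n) \<and> (n = 0 \<longrightarrow> f n = (lb, lc, B, C)) \<and> ?st (f n) (f (Suc n))"
  proof -
    have "\<exists>f. \<forall>n. ((\<lambda>(l, m, B, C). config p la l m A D B C) (f n) \<and> (n = 0 \<longrightarrow> f n = (lb, lc, B, C))) \<and> ?st (f n) (f (Suc n))"
    proof (rule dependent_nat_choice)
      show "\<exists>x. (\<lambda>(l, m, B, C). config p la l m A D B C) x \<and> ((0::nat) = 0 \<longrightarrow> x = (lb, lc, B, C))"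
        using c by auto
      fix x :: "'a set \<times> 'a set \<times> (int \<Rightarrow> 'a) \<times> (int \<Rightarrow> 'a)" and n :: nat
      assume x: "(\<lambda>(l, m, B, C). config p la l m A D B C) x \<and> (n = 0 \<longrightarrow> x = (lb, lc, B, C))"
      obtain l m B' C' where xe: "x = (l, m, B', C')" by (cases x) auto
      have cf: "config p la l m A D B' C'" using x by (simp add: xe)
      obtain C2 where C2: "\<And>v w. int p dvd v - w \<Longrightarrow> C2 v = C2 w" "\<And>k v. coll (A k) (C' (v - k)) (C2 v)"
        "\<And>v. hconj (A 0) (C' v) (B' v) (C2 v)" using next_column[OF cf p2] by blast
      obtain lc' where "config p la m lc' A D C' C2" using next_config[OF cf p False C2(1,2)] by blast
      then show "\<exists>y. ((\<lambda>(l, m, B, C). config p la l m A D B C) y \<and> (Suc n = 0 \<longrightarrow> y = (lb, lc, B, C))) \<and> ?st x y"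
        using next_column_facts(1)[OF cf p False C2(1,2)] C2(3)
        by (intro exI[of _ "(m, lc', C', C2)"]) (simp add: xe)
    qed
    then show ?thesis by simp
  qed
  then obtain f where f': "\<forall>n. (\<lambda>(l, m, B, C). config p la l m A D B C) (f n) \<and> (n = 0 \<longrightarrow> f n = (lb, lc, B, C)) \<and> ?st (f n) (f (Suc n))"
    by (elim exE)
  have f: "(\<lambda>(l, m, B, C). config p la l m A D B C) (f n)" "?st (f n) (f (Suc n))" for n
    using spec[OF f', of n] by simp_all
  have f0: "f 0 = (lb, lc, B, C)" using spec[OF f', of 0] by simp
  define L where "L = (\<lambda>n. fst (f n))"
  define G where "G = (\<lambda>n. fst (snd (snd (f n))))"
  have suc: "fst (f (Suc n)) = fst (snd (f n))" "fst (snd (snd (f (Suc n)))) = snd (snd (snd (f n)))" for n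
    using f(2)[of n] by (simp_all add: case_prod_beta)
  have G1: "G (Suc n) = snd (snd (snd (f n)))" "L (Suc n) = fst (snd (f n))" for n
    by (simp_all add: G_def L_def suc)
  have "G 0 = B" "G 1 = C" using f0 G1(1)[of 0] by (simp_all add: G_def)
  moreover have "config p la (L n) (L (Suc n)) A D (G n) (G (Suc n))" for n
    using f(1)[of n] unfolding G1 by (simp add: G_def L_def case_prod_beta)
  moreover have "\<exists>l\<in>lines. A k \<in> l \<and> G n (v - 2 * k) \<in> l \<and> G (Suc n) (v - k) \<in> l \<and> G (Suc (Suc n)) v \<in> l" for n k v
    using f(2)[of n] unfolding G1(1)[of "Suc n"] unfolding G1(1)[of n] by (simp add: G_def case_prod_beta)
  moreover have "hconj (A 0) (G (Suc n) v) (G n v) (G (Suc (Suc n)) v)" for n v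
    using f(2)[of n] unfolding G1(1)[of "Suc n"] unfolding G1(1)[of n] by (simp add: G_def case_prod_beta)
  ultimately show ?thesis by (intro exI[of _ G] exI[of _ L]) simp
qed

end

section \<open>Planes with homogeneous coordinates\<close>

definition dot3 :: "'k::field \<times> 'k \<times> 'k \<Rightarrow> 'k \<times> 'k \<times> 'k \<Rightarrow> 'k" where
  "dot3 n v = fst n * fst v + fst (snd n) * fst (snd v) + snd (snd n) * snd (snd v)"

text \<open>Cramer's rule, where the minor of the first two coordinates does not vanish.\<close>

lemma plane_combination_aux:
  fixes n1 :: "'k::field"
  assumes w: "a1 * b2 - a2 * b1 \<noteq> 0" and n: "n1 \<noteq> 0 \<or> n2 \<noteq> 0 \<or> n3 \<noteq> 0"
    and a: "n1 * a1 + n2 * a2 + n3 * a3 = 0" and b: "n1 * b1 + n2 * b2 + n3 * b3 = 0"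
    and c: "n1 * c1 + n2 * c2 + n3 * c3 = 0"
  shows "\<exists>\<alpha> \<beta>. c1 = \<alpha> * a1 + \<beta> * b1 \<and> c2 = \<alpha> * a2 + \<beta> * b2 \<and> c3 = \<alpha> * a3 + \<beta> * b3"
proof -
  define w where "w = a1 * b2 - a2 * b1"
  define \<alpha> where "\<alpha> = (c1 * b2 - c2 * b1) / w"
  define \<beta> where "\<beta> = (a1 * c2 - a2 * c1) / w"
  have w0: "w \<noteq> 0" using w by (simp add: w_def)
  have "w * (\<alpha> * a1 + \<beta> * b1) = (c1 * b2 - c2 * b1) * a1 + (a1 * c2 - a2 * c1) * b1"
    using w0 by (simp add: \<alpha>_def \<beta>_def field_simps)
  also have "\<dots> = w * c1" by (simp add: w_def algebra_simps)
  finally have 1: "c1 = \<alpha> * a1 + \<beta> * b1" using w0 by simp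
  have "w * (\<alpha> * a2 + \<beta> * b2) = (c1 * b2 - c2 * b1) * a2 + (a1 * c2 - a2 * c1) * b2"
    using w0 by (simp add: \<alpha>_def \<beta>_def field_simps)
  also have "\<dots> = w * c2" by (simp add: w_def algebra_simps)
  finally have 2: "c2 = \<alpha> * a2 + \<beta> * b2" using w0 by simp
  have n3: "n3 \<noteq> 0"
  proof
    assume z: "n3 = 0"
    have "n1 * w = b2 * (n1 * a1 + n2 * a2) - a2 * (n1 * b1 + n2 * b2)"
      by (simp add: w_def algebra_simps)
    then have "n1 = 0" using a b z w0 by simp
    moreover have "n2 * w = a1 * (n1 * b1 + n2 * b2) - b1 * (n1 * a1 + n2 * a2)"
      by (simp add: w_def algebra_simps)
    then have "n2 = 0" using a b z w0 by simp
    ultimately show False using n z by simp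
  qed
  have "n3 * (\<alpha> * a3 + \<beta> * b3) = \<alpha> * (n3 * a3) + \<beta> * (n3 * b3)" by (simp add: algebra_simps)
  also have "n3 * a3 = - (n1 * a1 + n2 * a2)" using a by (metis add.commute eq_neg_iff_add_eq_0)
  also have "n3 * b3 = - (n1 * b1 + n2 * b2)" using b by (metis add.commute eq_neg_iff_add_eq_0)
  also have "\<alpha> * - (n1 * a1 + n2 * a2) + \<beta> * - (n1 * b1 + n2 * b2)
      = - (n1 * (\<alpha> * a1 + \<beta> * b1) + n2 * (\<alpha> * a2 + \<beta> * b2))" by (simp add: algebra_simps)
  also have "\<dots> = - (n1 * c1 + n2 * c2)" using 1 2 by simp
  also have "\<dots> = n3 * c3" using c by (metis neg_eq_iff_add_eq_0)
  finally have "c3 = \<alpha> * a3 + \<beta> * b3" using n3 by simp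
  then show ?thesis using 1 2 by blast
qed

text \<open>
  The vectors orthogonal to \<open>n\<close> form a space of dimension two, in which
  \<open>a\<close> and \<open>b\<close> are independent as \<open>m\<close> separates them.
  Vectors are only compared through their products with covectors.
\<close>

lemma plane_combination:
  fixes n :: "'k::field \<times> 'k \<times> 'k"
  assumes n: "n \<noteq> (0, 0, 0)" and a: "a \<noteq> (0, 0, 0)" and abc: "dot3 n a = 0" "dot3 n b = 0" "dot3 n c = 0"
    and ab: "dot3 m a = 0" "dot3 m b \<noteq> 0"
  shows "\<exists>\<alpha> \<beta>. \<forall>k. dot3 k c = \<alpha> * dot3 k a + \<beta> * dot3 k b"
proof -
  obtain n1 n2 n3 where ne: "n = (n1, n2, n3)" by (metis surj_pair)
  obtain a1 a2 a3 where ae: "a = (a1, a2, a3)" by (metis surj_pair)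
  obtain b1 b2 b3 where be: "b = (b1, b2, b3)" by (metis surj_pair)
  obtain c1 c2 c3 where ce: "c = (c1, c2, c3)" by (metis surj_pair)
  obtain m1 m2 m3 where me: "m = (m1, m2, m3)" by (metis surj_pair)
  have n0: "n1 \<noteq> 0 \<or> n2 \<noteq> 0 \<or> n3 \<noteq> 0" using n by (auto simp: ne)
  have e: "n1 * a1 + n2 * a2 + n3 * a3 = 0" "n1 * b1 + n2 * b2 + n3 * b3 = 0" "n1 * c1 + n2 * c2 + n3 * c3 = 0"
    using abc by (simp_all add: dot3_def ne ae be ce)
  have "a1 * b2 - a2 * b1 \<noteq> 0 \<or> a2 * b3 - a3 * b2 \<noteq> 0 \<or> a3 * b1 - a1 * b3 \<noteq> 0"
  proof (rule ccontr)
    assume "\<not> ?thesis"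
    then have z: "a1 * b2 = a2 * b1" "a2 * b3 = a3 * b2" "a3 * b1 = a1 * b3" by auto
    have ma: "m1 * a1 + m2 * a2 + m3 * a3 = 0" using ab(1) by (simp add: dot3_def me ae)
    have "a1 * (m1 * b1 + m2 * b2 + m3 * b3) = m1 * (a1 * b1) + m2 * (a1 * b2) + m3 * (a1 * b3)"
      by (simp add: algebra_simps)
    also have "\<dots> = b1 * (m1 * a1 + m2 * a2 + m3 * a3)"
      by (simp only: z(1) z(3)[symmetric]) (simp add: algebra_simps)
    finally have 1: "a1 * (m1 * b1 + m2 * b2 + m3 * b3) = 0" using ma by simp
    have "a2 * (m1 * b1 + m2 * b2 + m3 * b3) = m1 * (a2 * b1) + m2 * (a2 * b2) + m3 * (a2 * b3)"
      by (simp add: algebra_simps)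
    also have "\<dots> = b2 * (m1 * a1 + m2 * a2 + m3 * a3)"
      by (simp only: z(1)[symmetric] z(2)) (simp add: algebra_simps)
    finally have 2: "a2 * (m1 * b1 + m2 * b2 + m3 * b3) = 0" using ma by simp
    have "a3 * (m1 * b1 + m2 * b2 + m3 * b3) = m1 * (a3 * b1) + m2 * (a3 * b2) + m3 * (a3 * b3)"
      by (simp add: algebra_simps)
    also have "\<dots> = b3 * (m1 * a1 + m2 * a2 + m3 * a3)"
      by (simp only: z(3) z(2)[symmetric]) (simp add: algebra_simps)
    finally have 3: "a3 * (m1 * b1 + m2 * b2 + m3 * b3) = 0" using ma by simp
    have "m1 * b1 + m2 * b2 + m3 * b3 \<noteq> 0" using ab(2) by (simp add: dot3_def me be)
    then show False using 1 2 3 a by (simp add: ae)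
  qed
  then obtain \<alpha> \<beta> where "c1 = \<alpha> * a1 + \<beta> * b1 \<and> c2 = \<alpha> * a2 + \<beta> * b2 \<and> c3 = \<alpha> * a3 + \<beta> * b3"
  proof (elim disjE)
    assume "a1 * b2 - a2 * b1 \<noteq> 0"
    from plane_combination_aux[OF this n0 e] that show thesis by blast
  next
    assume w: "a2 * b3 - a3 * b2 \<noteq> 0"
    have "\<exists>\<alpha> \<beta>. c2 = \<alpha> * a2 + \<beta> * b2 \<and> c3 = \<alpha> * a3 + \<beta> * b3 \<and> c1 = \<alpha> * a1 + \<beta> * b1"
      by (rule plane_combination_aux[OF w, of n2 n3 n1]) (use n0 e in \<open>auto simp: add.commute add.left_commute\<close>)
    with that show thesis by blast
  next
    assume w: "a3 * b1 - a1 * b3 \<noteq> 0"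
    have "\<exists>\<alpha> \<beta>. c3 = \<alpha> * a3 + \<beta> * b3 \<and> c1 = \<alpha> * a1 + \<beta> * b1 \<and> c2 = \<alpha> * a2 + \<beta> * b2"
      by (rule plane_combination_aux[OF w, of n3 n1 n2]) (use n0 e in \<open>auto simp: add.commute add.left_commute\<close>)
    with that show thesis by blast
  qed
  then show ?thesis
    by (intro exI[of _ \<alpha>] exI[of _ \<beta>]) (simp add: dot3_def ae be ce algebra_simps)
qed

text \<open>
  If \<open>c = \<alpha> a + \<beta> b = \<alpha>' a' + \<beta>' b'\<close>, then the common
  point of the lines \<open>aa'\<close> and \<open>bb'\<close> is proportional to
  \<open>\<alpha> a - \<alpha>' a'\<close>, as this equals \<open>\<beta>' b' - \<beta>
  b\<close>. The three vectors of this form, for the pairs of three lines through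
  \<open>c\<close>, are linearly dependent.
\<close>

theorem coordinates_desargues:
  fixes vec :: "'p \<Rightarrow> 'k::field \<times> 'k \<times> 'k" and cov :: "'p set \<Rightarrow> 'k \<times> 'k \<times> 'k"
  assumes pp: "projective_plane S L"
    and vec: "\<And>x. x \<in> S \<Longrightarrow> vec x \<noteq> (0, 0, 0)" and cov: "\<And>l. l \<in> L \<Longrightarrow> cov l \<noteq> (0, 0, 0)"
    and inc: "\<And>x l. x \<in> S \<Longrightarrow> l \<in> L \<Longrightarrow> x \<in> l \<longleftrightarrow> dot3 (cov l) (vec x) = 0"
  shows "desargues S L"
proof -
  have LS: "l \<subseteq> S" if "l \<in> L" for l using pp that by (auto simp: projective_plane_def)
  have J1: "\<forall>a\<in>S. \<forall>b\<in>S. a \<noteq> b \<longrightarrow> (\<exists>!l. l \<in> L \<and> a \<in> l \<and> b \<in> l)"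
    and J2: "\<exists>Q. Q \<subseteq> S \<and> card Q = 4 \<and> (\<forall>l\<in>L. card (Q \<inter> l) \<le> 2)"
    using pp unfolding projective_plane_def by auto
  have join: "\<exists>l\<in>L. a \<in> l \<and> b \<in> l" if "a \<in> S" "b \<in> S" "a \<noteq> b" for a b
    using J1 that by blast
  have uniq: "l = m" if "l \<in> L" "m \<in> L" "a \<in> l" "b \<in> l" "a \<in> m" "b \<in> m" "a \<noteq> b" for l m a b
  proof -
    have "a \<in> S" "b \<in> S" using LS that by auto
    then have "\<exists>!l. l \<in> L \<and> a \<in> l \<and> b \<in> l" using J1 that(7) by blast
    then show ?thesis using that by blast
  qed
  have off: "\<exists>x\<in>S. x \<notin> l" if "l \<in> L" for l
  proof -
    obtain Q where Q: "Q \<subseteq> S" "card Q = 4" "card (Q \<inter> l) \<le> 2" using J2 \<open>l \<in> L\<close> by blast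
    then have "Q \<inter> l \<noteq> Q" by auto
    then show ?thesis using Q(1) by blast
  qed
  have sep: "\<exists>l\<in>L. a \<in> l \<and> b \<notin> l" if ab: "a \<in> S" "b \<in> S" "a \<noteq> b" for a b
  proof -
    obtain l where l: "l \<in> L" "a \<in> l" "b \<in> l" using join ab by blast
    obtain x where x: "x \<in> S" "x \<notin> l" using off l by blast
    then obtain m where "m \<in> L" "a \<in> m" "x \<in> m" using join[of a x] ab l by blast
    then show ?thesis using uniq[of l m a b] l x ab by blast
  qed
  have avoid: "\<exists>l\<in>L. a \<notin> l" if a: "a \<in> S" for a
  proof -
    obtain b where b: "b \<in> S" "b \<noteq> a"
    proof -
      obtain Q where Q: "Q \<subseteq> S" "card Q = 4" using J2 by blast
      then have "\<not> Q \<subseteq> {a}" using card_mono[of "{a}" Q] by auto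
      then show thesis using that Q by blast
    qed
    then show ?thesis using sep[of b a] a by blast
  qed
  let ?e = "\<lambda>l x. dot3 (cov l) (vec x)"
  have comb: "\<exists>\<alpha> \<beta>. \<forall>m. ?e m c = \<alpha> * ?e m a + \<beta> * ?e m b"
    if l: "l \<in> L" "a \<in> l" "b \<in> l" "c \<in> l" "a \<noteq> b" for l a b c
  proof -
    have S: "a \<in> S" "b \<in> S" "c \<in> S" using LS l by auto
    obtain m where m: "m \<in> L" "a \<in> m" "b \<notin> m" using sep S l by blast
    show ?thesis
      using plane_combination[OF cov[OF l(1)] vec[OF S(1)], of "vec b" "vec c" "cov m"]
        inc[OF S(1) l(1)] inc[OF S(2) l(1)] inc[OF S(3) l(1)] inc[OF S(1) m(1)] inc[OF S(2) m(1)] l m by blast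
  qed
  have vertex: "\<exists>\<xi>. \<xi> \<noteq> 0 \<and> (\<forall>m. ?e m d = \<xi> * (\<alpha> * ?e m a - \<alpha>' * ?e m a'))"
    if l: "l \<in> L" "l' \<in> L" "l \<noteq> l'" "distinct [c, a, b]" "{c, a, b} \<subseteq> l" "distinct [c, a', b']" "{c, a', b'} \<subseteq> l'"
      and d: "d \<in> S" "on_line L {a, a', d}" "on_line L {b, b', d}"
      and c: "\<forall>m. ?e m c = \<alpha> * ?e m a + \<beta> * ?e m b" "\<forall>m. ?e m c = \<alpha>' * ?e m a' + \<beta>' * ?e m b'"
    for l l' c a b a' b' d \<alpha> \<beta> \<alpha>' \<beta>'
  proof -
    have S: "a \<in> S" "b \<in> S" "c \<in> S" "a' \<in> S" "b' \<in> S" using LS[OF l(1)] LS[OF l(2)] l by auto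
    have nin: "a \<notin> l'" "b \<notin> l'" "a' \<notin> l" "b' \<notin> l" using uniq[OF l(1,2)] l by auto
    obtain k where k: "k \<in> L" "a \<in> k" "a' \<in> k" "d \<in> k" using d(2) by (auto simp: on_line_def)
    obtain k' where k': "k' \<in> L" "b \<in> k'" "b' \<in> k'" "d \<in> k'" using d(3) by (auto simp: on_line_def)
    have ck: "c \<notin> k" using uniq[OF l(1) k(1), of c a] l k nin by auto
    obtain x y where xy: "\<forall>m. ?e m d = x * ?e m a + y * ?e m a'" using comb[OF k] nin(1) l by blast
    obtain z w where zw: "\<forall>m. ?e m d = z * ?e m b + w * ?e m b'" using comb[OF k'] nin(2) l by blast
    have on: "?e l c = 0" "?e l a = 0" "?e l b = 0" "?e l' c = 0" "?e l' a' = 0" "?e l' b' = 0" "?e k a = 0" "?e k a' = 0" "?e k d = 0"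
      using inc S l k d(1) by auto
    have noton: "?e l a' \<noteq> 0" "?e l b' \<noteq> 0" "?e l' a \<noteq> 0" "?e l' b \<noteq> 0" "?e k c \<noteq> 0"
      using inc S l(1,2) k(1) nin ck by blast+
    have b0: "\<beta> \<noteq> 0"
    proof
      assume "\<beta> = 0"
      then have "\<alpha> * ?e l' a = 0" using spec[OF c(1), of l'] on by simp
      then have "\<alpha> = 0" using noton by simp
      then show False using spec[OF c(1), of k] \<open>\<beta> = 0\<close> noton(5) by simp
    qed
    have b0': "\<beta>' \<noteq> 0"
    proof
      assume "\<beta>' = 0"
      then have "\<alpha>' * ?e l a' = 0" using spec[OF c(2), of l] on by simp
      then have "\<alpha>' = 0" using noton by simp
      then show False using spec[OF c(2), of k] \<open>\<beta>' = 0\<close> noton(5) by simp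
    qed
    have "x * \<beta> * ?e l' a = - z * \<alpha> * ?e l' a"
    proof -
      have "\<beta> * ?e l' b = - (\<alpha> * ?e l' a)" using spec[OF c(1), of l'] on by (simp add: eq_neg_iff_add_eq_0 add.commute)
      moreover have "x * ?e l' a = z * ?e l' b" using spec[OF xy, of l'] spec[OF zw, of l'] on by simp
      moreover have "x * \<beta> * ?e l' a = \<beta> * (x * ?e l' a)" "\<beta> * (z * ?e l' b) = z * (\<beta> * ?e l' b)" by simp_all
      ultimately show ?thesis by simp
    qed
    then have x: "x * \<beta> = - z * \<alpha>" using noton(3) by (metis mult_cancel_right)
    have "y * \<beta>' * ?e l a' = - w * \<alpha>' * ?e l a'"
    proof -
      have "\<beta>' * ?e l b' = - (\<alpha>' * ?e l a')" using spec[OF c(2), of l] on by (simp add: eq_neg_iff_add_eq_0 add.commute)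
      moreover have "y * ?e l a' = w * ?e l b'" using spec[OF xy, of l] spec[OF zw, of l] on by simp
      moreover have "y * \<beta>' * ?e l a' = \<beta>' * (y * ?e l a')" "\<beta>' * (w * ?e l b') = w * (\<beta>' * ?e l b')" by simp_all
      ultimately show ?thesis by simp
    qed
    then have y: "y * \<beta>' = - w * \<alpha>'" using noton(1) by (metis mult_cancel_right)
    have "(z * \<beta>' + w * \<beta>) * ?e k c = 0"
    proof -
      have "?e k c = \<beta> * ?e k b" "?e k c = \<beta>' * ?e k b'" using spec[OF c(1), of k] spec[OF c(2), of k] on by simp_all
      moreover have "z * ?e k b + w * ?e k b' = 0" using spec[OF zw, of k] on by simp
      moreover have "(z * \<beta>' + w * \<beta>) * ?e k c = \<beta>' * (z * ?e k c) + \<beta> * (w * ?e k c)"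
        by (simp add: algebra_simps)
      ultimately have "(z * \<beta>' + w * \<beta>) * ?e k c = \<beta>' * (z * (\<beta> * ?e k b)) + \<beta> * (w * (\<beta>' * ?e k b'))"
        by metis
      also have "\<dots> = \<beta> * \<beta>' * (z * ?e k b + w * ?e k b')" by (simp add: algebra_simps)
      finally show ?thesis using \<open>z * ?e k b + w * ?e k b' = 0\<close> by simp
    qed
    then have zw0: "z * \<beta>' = - w * \<beta>" using noton(5) by (simp add: eq_neg_iff_add_eq_0)
    define \<xi> where "\<xi> = - z / \<beta>"
    have xx: "x = \<xi> * \<alpha>" using x b0 by (simp add: \<xi>_def field_simps)
    have "- z * \<beta>' = w * \<beta>" using zw0 by simp
    then have "w = \<xi> * \<beta>'" using b0 by (simp add: \<xi>_def field_simps)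
    then have "y * \<beta>' = - (\<xi> * \<alpha>') * \<beta>'" using y by (simp add: algebra_simps)
    then have yy: "y = - (\<xi> * \<alpha>')" using b0' by (simp only: mult_cancel_right) simp
    have main: "?e m d = \<xi> * (\<alpha> * ?e m a - \<alpha>' * ?e m a')" for m
      using spec[OF xy, of m] by (simp add: xx yy algebra_simps)
    obtain m where "m \<in> L" "d \<notin> m" using avoid d(1) by blast
    then have "?e m d \<noteq> 0" using inc d(1) by blast
    then have "\<xi> \<noteq> 0" using main[of m] by auto
    then show ?thesis using main by blast
  qed
  have "on_line L {d12, d13, d23}"
    if pts: "c \<in> S" "a1 \<in> S" "a2 \<in> S" "a3 \<in> S" "b1 \<in> S" "b2 \<in> S" "b3 \<in> S"
      "l1 \<in> L" "l2 \<in> L" "l3 \<in> L" "d12 \<in> S" "d13 \<in> S" "d23 \<in> S"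
      and l: "distinct [l1, l2, l3]" "distinct [c, a1, b1]" "{c, a1, b1} \<subseteq> l1" "distinct [c, a2, b2]" "{c, a2, b2} \<subseteq> l2"
        "distinct [c, a3, b3]" "{c, a3, b3} \<subseteq> l3"
      and d: "on_line L {a1, a2, d12}" "on_line L {b1, b2, d12}" "on_line L {a1, a3, d13}" "on_line L {b1, b3, d13}"
        "on_line L {a2, a3, d23}" "on_line L {b2, b3, d23}"
    for c a1 a2 a3 b1 b2 b3 l1 l2 l3 d12 d13 d23
  proof -
    obtain \<alpha>1 \<beta>1 where c1: "\<forall>m. ?e m c = \<alpha>1 * ?e m a1 + \<beta>1 * ?e m b1" using comb[of l1 a1 b1 c] pts l by auto
    obtain \<alpha>2 \<beta>2 where c2: "\<forall>m. ?e m c = \<alpha>2 * ?e m a2 + \<beta>2 * ?e m b2" using comb[of l2 a2 b2 c] pts l by auto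
    obtain \<alpha>3 \<beta>3 where c3: "\<forall>m. ?e m c = \<alpha>3 * ?e m a3 + \<beta>3 * ?e m b3" using comb[of l3 a3 b3 c] pts l by auto
    obtain x12 where x12: "x12 \<noteq> 0" "\<forall>m. ?e m d12 = x12 * (\<alpha>1 * ?e m a1 - \<alpha>2 * ?e m a2)"
      using vertex[OF pts(8,9) _ l(2-5) pts(11) d(1,2) c1 c2] l(1) by auto
    obtain x13 where x13: "x13 \<noteq> 0" "\<forall>m. ?e m d13 = x13 * (\<alpha>1 * ?e m a1 - \<alpha>3 * ?e m a3)"
      using vertex[OF pts(8,10) _ l(2,3,6,7) pts(12) d(3,4) c1 c3] l(1) by auto
    obtain x23 where x23: "x23 \<noteq> 0" "\<forall>m. ?e m d23 = x23 * (\<alpha>2 * ?e m a2 - \<alpha>3 * ?e m a3)"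
      using vertex[OF pts(9,10) _ l(4-7) pts(13) d(5,6) c2 c3] l(1) by auto
    show ?thesis
    proof (cases "d12 = d13")
      case True
      obtain k where k: "k \<in> L" "d12 \<in> k" using d(1) by (auto simp: on_line_def)
      have "\<exists>m\<in>L. d12 \<in> m \<and> d23 \<in> m" using join[of d12 d23] pts(11,13) k by (cases "d12 = d23") auto
      then show ?thesis using True by (auto simp: on_line_def)
    next
      case False
      then obtain m where m: "m \<in> L" "d12 \<in> m" "d13 \<in> m" using join pts by blast
      then have "?e m d12 = 0" "?e m d13 = 0" using inc pts by auto
      then have "\<alpha>1 * ?e m a1 = \<alpha>2 * ?e m a2" "\<alpha>1 * ?e m a1 = \<alpha>3 * ?e m a3" using x12 x13 by auto
      then have "?e m d23 = 0" using x23 by simp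
      then have "d23 \<in> m" using inc[of d23 m] pts m by simp
      then show ?thesis using m by (auto simp: on_line_def)
    qed
  qed
  note concl = this
  show ?thesis
    unfolding desargues_def by (intro ballI impI, elim conjE) (rule concl; assumption)
qed

section \<open>The plane generated by a configuration\<close>

lemma prime_solve_mod:
  assumes "prime p" "\<not> int p dvd d"
  shows "\<exists>x. int p dvd d * x - e"
proof -
  have "prime (int p)" using assms(1) by simp
  then have "coprime d (int p)" using assms(2) by (metis prime_imp_coprime coprime_commute)
  then obtain u v where uv: "u * d + v * int p = 1" using bezout_int[of d "int p"] by auto
  have "d * (u * e) - e = e * (u * d + v * int p - 1) - int p * (v * e)" by (simp add: algebra_simps)
  then have "d * (u * e) - e = int p * (- (v * e))" using uv by simp
  then show ?thesis by (intro exI[of _ "u * e"]) (metis dvd_triv_left)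
qed

text \<open>
  All columns of the plane, as \<open>all_columns\<close> provides them, with \<open>G n v = [1,
  v, n]\<close>.
\<close>

locale column_space = harmonic_space +
  fixes p :: nat and la :: "'a set" and A :: "int \<Rightarrow> 'a" and D :: 'a
    and G :: "nat \<Rightarrow> int \<Rightarrow> 'a" and L :: "nat \<Rightarrow> 'a set"
  assumes prime: "prime p"
    and columns: "Suc n < p \<Longrightarrow> config p la (L n) (L (Suc n)) A D (G n) (G (Suc n))"
    and steps: "Suc (Suc n) < p \<Longrightarrow>
      \<exists>l\<in>lines. A k \<in> l \<and> G n (v - 2 * k) \<in> l \<and> G (Suc n) (v - k) \<in> l \<and> G (Suc (Suc n)) v \<in> l"
    and conj: "Suc (Suc n) < p \<Longrightarrow> hconj (A 0) (G (Suc n) v) (G n v) (G (Suc (Suc n)) v)"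
begin

lemma p2: "p \<ge> 2"
  using prime by (rule prime_ge_2_nat)

lemma column_config: "\<exists>lc C. config p la (L 0) lc A D (G 0) C"
  using columns[of 0] p2 by auto

lemma points_A: "la \<in> lines" "D \<in> la" "A i \<in> la" "A i \<noteq> D" "A i = A j \<longleftrightarrow> int p dvd i - j" "A i \<in> P" "D \<in> P"
proof -
  obtain lc C where c: "config p la (L 0) lc A D (G 0) C" using column_config by blast
  note F = configD[OF c]
  show "la \<in> lines" "D \<in> la" "A i \<in> la" "A i \<noteq> D" "A i = A j \<longleftrightarrow> int p dvd i - j" "A i \<in> P" "D \<in> P"
    by (rule F)+
qed

lemma points_G:
  assumes "n < p"
  shows "L n \<in> lines" "la \<noteq> L n" "D \<in> L n" "G n v \<in> L n" "G n v \<noteq> D" "G n v = G n w \<longleftrightarrow> int p dvd v - w"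
    "A i \<notin> L n" "G n v \<notin> la" "G n v \<in> P"
proof -
  consider "Suc n < p" | m where "n = Suc m" "Suc m < p" using assms p2 by (cases n) auto
  then have "L n \<in> lines \<and> la \<noteq> L n \<and> D \<in> L n \<and> G n v \<in> L n \<and> G n v \<noteq> D \<and> (G n v = G n w \<longleftrightarrow> int p dvd v - w) \<and>
    A i \<notin> L n \<and> G n v \<notin> la \<and> G n v \<in> P"
  proof cases
    case 1
    note F = configD[OF columns[OF 1]]
    show ?thesis using F(2,4,8,11,14,17,20,22,27) by blast
  next
    case 2
    note F = configD[OF columns[OF 2(2)]]
    show ?thesis unfolding 2(1) using F(3,5,9,12,15,18,21,24,28) by blast
  qed
  then show "L n \<in> lines" "la \<noteq> L n" "D \<in> L n" "G n v \<in> L n" "G n v \<noteq> D" "G n v = G n w \<longleftrightarrow> int p dvd v - w"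
    "A i \<notin> L n" "G n v \<notin> la" "G n v \<in> P" by blast+
qed

lemma not_dvd_1: "\<not> int p dvd 1"
  using p2 by simp

lemma not_dvd_diff: "n < p \<Longrightarrow> m < p \<Longrightarrow> n \<noteq> m \<Longrightarrow> \<not> int p dvd int m - int n"
proof
  assume nm: "n < p" "m < p" "n \<noteq> m" "int p dvd int m - int n"
  then have "int p \<le> \<bar>int m - int n\<bar>" by (intro zdvd_imp_le) (auto simp: dvd_abs_iff)
  then show False using nm by linarith
qed

text \<open>
  The collinearities along three consecutive columns fit together, as \<open>A k\<close> and a
  point in one column determine the line.
\<close>

lemma transversal_exists:
  "\<exists>l\<in>lines. A k \<in> l \<and> (\<forall>n<p. G n (j + int n * k) \<in> l)"
proof -
  have "coll (A k) (G 0 j) (G 1 (k + j))" using configD(19)[OF columns[of 0]] p2 by auto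
  then obtain l where l: "l \<in> lines" "A k \<in> l" "G 0 j \<in> l" "G 1 (k + j) \<in> l" by (auto simp: coll_def)
  have "(n < p \<longrightarrow> G n (j + int n * k) \<in> l) \<and> (Suc n < p \<longrightarrow> G (Suc n) (j + int (Suc n) * k) \<in> l)" for n
  proof (induction n)
    case 0
    then show ?case using l by (simp add: add.commute)
  next
    case (Suc n)
    have "G (Suc (Suc n)) (j + int (Suc (Suc n)) * k) \<in> l" if s: "Suc (Suc n) < p"
    proof -
      let ?v = "j + int (Suc (Suc n)) * k"
      obtain m where m: "m \<in> lines" "A k \<in> m" "G n (?v - 2 * k) \<in> m" "G (Suc n) (?v - k) \<in> m" "G (Suc (Suc n)) ?v \<in> m"
        using steps[OF s] by blast
      have "?v - 2 * k = j + int n * k" by (simp add: algebra_simps)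
      with m(3) have "G n (j + int n * k) \<in> m" by (simp only:)
      moreover have "G n (j + int n * k) \<in> l" using Suc s by simp
      moreover have "A k \<noteq> G n (j + int n * k)" using points_G(7)[of n k] points_G(4)[of n] s by (metis Suc_lessD)
      ultimately have "l = m" using line_unique[OF l(1) m(1) l(2) _ m(2)] by blast
      then show ?thesis using m(5) by simp
    qed
    then show ?case using Suc by simp
  qed
  then show ?thesis using l by blast
qed

text \<open>The line with equation \<open>y = j x + k z\<close>.\<close>

definition T :: "int \<Rightarrow> int \<Rightarrow> 'a set" where
  "T k j = (SOME l. l \<in> lines \<and> A k \<in> l \<and> (\<forall>n<p. G n (j + int n * k) \<in> l))"

lemma T: "T k j \<in> lines" "A k \<in> T k j" "n < p \<Longrightarrow> G n (j + int n * k) \<in> T k j"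
  using someI_ex[of "\<lambda>l. l \<in> lines \<and> A k \<in> l \<and> (\<forall>n<p. G n (j + int n * k) \<in> l)"] transversal_exists[of k j]
  unfolding T_def by blast+

lemma T_neq: "T k j \<noteq> la" "n < p \<Longrightarrow> T k j \<noteq> L n"
  using T(3)[of 0 j k] points_G(8)[of 0 "j + int 0 * k"] p2 T(2)[of k j] points_G(7)[of n k] by auto

lemma D_T: "D \<notin> T k j"
  using line_unique[OF T(1) points_A(1) _ T(2) points_A(2) points_A(3)] points_A(4) T_neq(1) by metis

lemma A_T: "A i \<in> T k j \<longleftrightarrow> int p dvd i - k"
proof
  assume "A i \<in> T k j"
  then have "A i = A k" using line_unique[OF T(1) points_A(1) _ T(2) points_A(3) points_A(3)] T_neq(1) by metis
  then show "int p dvd i - k" using points_A(5) by simp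
next
  assume "int p dvd i - k"
  then have "A i = A k" using points_A(5) by simp
  then show "A i \<in> T k j" using T(2) by simp
qed

lemma G_T:
  assumes n: "n < p"
  shows "G n v \<in> T k j \<longleftrightarrow> int p dvd j - v + int n * k"
proof -
  have "G n v \<in> T k j \<longleftrightarrow> G n (j + int n * k) = G n v"
    using line_unique[OF T(1) points_G(1)[OF n] _ T(3)[OF n] points_G(4)[OF n] points_G(4)[OF n], of v k j] T(3)[OF n, of j k]
      T_neq(2)[OF n] by metis
  then show ?thesis using points_G(6)[OF n] by (simp add: algebra_simps)
qed

text \<open>
  A point of column \<open>n\<close> on \<open>L m\<close> would be the only common point of
  \<open>L m\<close> with each transversal through it, but these transversals meet \<open>L
  m\<close> in different points.
\<close>

lemma G_L:
  assumes n: "n < p" and m: "m < p"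
  shows "G n v \<in> L m \<longleftrightarrow> n = m"
proof
  assume "n = m" then show "G n v \<in> L m" using points_G(4) n by simp
next
  assume G: "G n v \<in> L m"
  show "n = m"
  proof (rule ccontr)
    assume nm: "n \<noteq> m"
    have "G m (v - int n * k + int m * k) = G n v" for k
    proof (rule ccontr)
      assume ne: "G m (v - int n * k + int m * k) \<noteq> G n v"
      have "G n v \<in> T k (v - int n * k)" using T(3)[OF n, of "v - int n * k" k] by simp
      then have "T k (v - int n * k) = L m"
        using line_unique[OF T(1) points_G(1)[OF m] T(3)[OF m] _ points_G(4)[OF m] G ne] by blast
      then show False using T_neq(2)[OF m] by blast
    qed
    from this[of 1] this[of 0] have "G m (v - int n + int m) = G m v" by simp
    then have "int p dvd int m - int n" using points_G(6)[OF m] by simp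
    then show False using not_dvd_diff[OF n m nm] by simp
  qed
qed

lemma G_eq: "n < p \<Longrightarrow> m < p \<Longrightarrow> G n v = G m w \<longleftrightarrow> n = m \<and> int p dvd v - w"
  using G_L points_G(4,6) by metis

definition S :: "'a set" where
  "S = {D} \<union> range A \<union> (\<Union>n<p. range (G n))"

definition Ls :: "'a set set" where
  "Ls = {la} \<union> L ` {..<p} \<union> {T k j | k j. True}"

lemma S_cases:
  assumes "x \<in> S"
  obtains "x = D" | i where "x = A i" | n v where "n < p" "x = G n v"
  using assms by (auto simp: S_def)

lemma Ls_cases:
  assumes "l \<in> Ls"
  obtains "l = la" | n where "n < p" "l = L n" | k j where "l = T k j"
  using assms by (auto simp: Ls_def)

lemma in_S: "D \<in> S" "A i \<in> S" "n < p \<Longrightarrow> G n v \<in> S"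
  by (auto simp: S_def)

lemma in_Ls: "la \<in> Ls" "n < p \<Longrightarrow> L n \<in> Ls" "T k j \<in> Ls"
  by (auto simp: Ls_def)

lemma S_subset: "S \<subseteq> P"
  using points_A(6,7) points_G(9) by (auto elim: S_cases)

lemma Ls_subset: "Ls \<subseteq> lines"
  using points_A(1) points_G(1) T(1) by (auto elim: Ls_cases)

lemma S_join:
  assumes "x \<in> S" "y \<in> S" "x \<noteq> y"
  shows "\<exists>l\<in>Ls. x \<in> l \<and> y \<in> l"
proof -
  have DA: "\<exists>l\<in>Ls. D \<in> l \<and> A i \<in> l" for i using in_Ls(1) points_A(2,3) by blast
  have DG: "\<exists>l\<in>Ls. D \<in> l \<and> G n v \<in> l" if "n < p" for n v using in_Ls(2)[OF that] points_G(3,4)[OF that] by blast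
  have AA: "\<exists>l\<in>Ls. A i \<in> l \<and> A j \<in> l" for i j using in_Ls(1) points_A(3) by blast
  have AG: "\<exists>l\<in>Ls. A i \<in> l \<and> G n v \<in> l" if "n < p" for i n v
    using in_Ls(3)[of i "v - int n * i"] T(2)[of i] T(3)[OF that, of "v - int n * i" i] by auto
  have GG: "\<exists>l\<in>Ls. G n v \<in> l \<and> G m w \<in> l" if nm: "n < p" "m < p" for n m v w
  proof (cases "n = m")
    case True
    then show ?thesis using in_Ls(2)[OF nm(1)] points_G(4)[OF nm(1)] by blast
  next
    case False
    obtain k where k: "int p dvd (int m - int n) * k - (w - v)"
      using prime_solve_mod[OF prime not_dvd_diff[OF nm False]] by blast
    have "G n v \<in> T k (v - int n * k)" using G_T[OF nm(1)] by simp
    moreover have "G m w \<in> T k (v - int n * k)"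
      unfolding G_T[OF nm(2)] using k by (simp add: algebra_simps)
    ultimately show ?thesis using in_Ls(3) by blast
  qed
  consider (D) "x = D" | (A) i where "x = A i" | (G) n v where "n < p" "x = G n v" using assms(1) by (rule S_cases)
  note cx = this
  consider (D) "y = D" | (A) i where "y = A i" | (G) n v where "n < p" "y = G n v" using assms(2) by (rule S_cases)
  note cy = this
  show ?thesis
  proof (cases rule: cx)
    case D
    show ?thesis
    proof (cases rule: cy)
      case D
      then show ?thesis using \<open>x = D\<close> assms(3) by blast
    next
      case (A j)
      then show ?thesis using D DA[of j] by blast
    next
      case (G m w)
      then show ?thesis using D DG[of m w] by blast
    qed
  next
    case (A i)
    show ?thesis
    proof (cases rule: cy)
      case D
      then show ?thesis using A DA[of i] by blast
    next
      case (A j)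
      then show ?thesis using \<open>x = A i\<close> AA[of i j] by blast
    next
      case (G m w)
      then show ?thesis using \<open>x = A i\<close> AG[of m i w] by blast
    qed
  next
    case (G n v)
    show ?thesis
    proof (cases rule: cy)
      case D
      then show ?thesis using G DG[of n v] by blast
    next
      case (A j)
      then show ?thesis using G AG[of n j v] by blast
    next
      case (G m w)
      then show ?thesis using \<open>x = G n v\<close> \<open>n < p\<close> GG[of n m v w] by blast
    qed
  qed
qed

text \<open>
  Different slopes \<open>k\<close> and \<open>k'\<close> give a solvable linear equation modulo
  \<open>p\<close> for the number of the column; equal slopes meet on \<open>la\<close>.
\<close>

lemma Ls_meet:
  assumes "l \<in> Ls" "m \<in> Ls"
  shows "\<exists>x\<in>S. x \<in> l \<and> x \<in> m"
proof -
  have aL: "\<exists>x\<in>S. x \<in> la \<and> x \<in> L n" if "n < p" for n using in_S(1) points_A(2) points_G(3)[OF that] by blast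
  have aT: "\<exists>x\<in>S. x \<in> la \<and> x \<in> T k j" for k j using in_S(2) points_A(3) T(2) by blast
  have LL: "\<exists>x\<in>S. x \<in> L n \<and> x \<in> L m" if "n < p" "m < p" for n m using in_S(1) points_G(3) that by blast
  have LT: "\<exists>x\<in>S. x \<in> L n \<and> x \<in> T k j" if "n < p" for n k j
    using in_S(3)[OF that] points_G(4)[OF that] T(3)[OF that] by blast
  have TT: "\<exists>x\<in>S. x \<in> T k j \<and> x \<in> T k' j'" for k j k' j'
  proof (cases "int p dvd k - k'")
    case True
    then show ?thesis using A_T T(2) in_S(2) by blast
  next
    case False
    obtain x where x: "int p dvd (k - k') * x - (j' - j)" using prime_solve_mod[OF prime False] by blast
    define n where "n = nat (x mod int p)"
    have n: "n < p" using p2 by (simp add: n_def nat_less_iff)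
    have "int n = x mod int p" using p2 by (simp add: n_def)
    then have "int p dvd int n - x" by (simp add: mod_eq_dvd_iff[symmetric])
    then have "int p dvd (k - k') * (int n - x)" by (rule dvd_mult)
    from dvd_add[OF this x] have d: "int p dvd j + int n * k - j' - int n * k'" by (simp add: algebra_simps)
    have "G n (j + int n * k) \<in> T k' j'"
      unfolding G_T[OF n] using d dvd_minus_iff[of "int p" "j + int n * k - j' - int n * k'"] by (simp add: algebra_simps)
    then show ?thesis using T(3)[OF n] in_S(3)[OF n] by blast
  qed
  consider (a) "l = la" | (L) n where "n < p" "l = L n" | (T) k j where "l = T k j" using assms(1) by (rule Ls_cases)
  note cl = this
  consider (a) "m = la" | (L) n where "n < p" "m = L n" | (T) k j where "m = T k j" using assms(2) by (rule Ls_cases)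
  note cm = this
  have "la \<inter> S \<noteq> {}" using in_S(1) points_A(2) by blast
  show ?thesis
  proof (cases rule: cl)
    case a
    show ?thesis by (cases rule: cm) (use a aL aT \<open>la \<inter> S \<noteq> {}\<close> in auto)
  next
    case (L n)
    show ?thesis by (cases rule: cm) (use L aL[OF L(1)] LL[OF L(1)] LT[OF L(1)] in auto)
  next
    case (T k j)
    show ?thesis by (cases rule: cm) (use T aT[of k j] LT TT in fast)+
  qed
qed

lemma mod_dvd: "int p dvd i mod int p - i"
  by (simp add: mod_eq_dvd_iff[symmetric])

lemma A_mod: "A (i mod int p) = A i"
  using points_A(5) mod_dvd by simp

lemma G_mod: "n < p \<Longrightarrow> G n (i mod int p) = G n i"
  using points_G(6) mod_dvd by simp

lemma mod_range: "i mod int p \<in> {0..<int p}"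
  using p2 by simp

lemma range_A: "range A = A ` {0..<int p}"
  using A_mod mod_range by (metis (no_types, lifting) UNIV_I image_eqI image_subset_iff subsetI subset_antisym)

lemma range_G: "n < p \<Longrightarrow> range (G n) = G n ` {0..<int p}"
  using G_mod[of n] mod_range by (metis (no_types, lifting) UNIV_I image_eqI image_subset_iff subsetI subset_antisym)

lemma finite_S: "finite S"
  unfolding S_def by (auto simp: range_A range_G)

lemma residue_eq: "i \<in> {0..<int p} \<Longrightarrow> j \<in> {0..<int p} \<Longrightarrow> int p dvd i - j \<Longrightarrow> i = j"
  by (metis atLeastLessThan_iff mod_eq_dvd_iff mod_pos_pos_trivial)

text \<open>
  The lines are lines of the ambient space, which can contain more points than those of
  \<open>S\<close>.
\<close>

lemma card_line:
  assumes "l \<in> Ls"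
  shows "card (l \<inter> S) = p + 1"
  using assms
proof (cases rule: Ls_cases)
  case 1
  have "x \<in> insert D (range A)" if "x \<in> la \<inter> S" for x
    using that points_G(8) unfolding S_def by blast
  then have "la \<inter> S = insert D (A ` {0..<int p})"
    unfolding range_A[symmetric] using points_A(2,3) in_S(1,2) by blast
  moreover have "inj_on A {0..<int p}" using points_A(5) residue_eq by (auto simp: inj_on_def)
  moreover have "D \<notin> A ` {0..<int p}" using points_A(4) by (metis imageE)
  ultimately show ?thesis by (simp add: 1 card_image)
next
  case (2 n)
  have "L n \<inter> S = insert D (G n ` {0..<int p})"
  proof (intro equalityI subsetI)
    fix x assume x: "x \<in> L n \<inter> S"
    then have "x \<in> S" by simp
    then show "x \<in> insert D (G n ` {0..<int p})"
      unfolding range_G[OF 2(1), symmetric]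
      by (rule S_cases) (use x points_G(7)[OF 2(1)] G_L[OF _ 2(1)] in auto)
  next
    fix x assume "x \<in> insert D (G n ` {0..<int p})"
    then show "x \<in> L n \<inter> S" using points_G(3,4)[OF 2(1)] in_S 2(1) by auto
  qed
  moreover have "inj_on (G n) {0..<int p}" using points_G(6)[OF 2(1)] residue_eq by (auto simp: inj_on_def)
  moreover have "D \<notin> G n ` {0..<int p}" using points_G(5)[OF 2(1)] by (metis imageE)
  ultimately show ?thesis by (simp add: 2 card_image)
next
  case (3 k j)
  let ?g = "\<lambda>n. G n (j + int n * k)"
  have "T k j \<inter> S = insert (A k) (?g ` {..<p})"
  proof (intro equalityI subsetI)
    fix x assume x: "x \<in> T k j \<inter> S"
    then have "x \<in> S" by simp
    then show "x \<in> insert (A k) (?g ` {..<p})"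
    proof (cases rule: S_cases)
      case 1
      then show ?thesis using x D_T by simp
    next
      case (2 i)
      then show ?thesis using x A_T points_A(5) by auto
    next
      case (3 n v)
      then have "int p dvd j - v + int n * k" using x G_T by auto
      then have "int p dvd (j + int n * k) - v" by (simp add: algebra_simps)
      then have "G n v = ?g n" using points_G(6)[OF 3(1)] by metis
      then show ?thesis using 3 by auto
    qed
  next
    fix x assume "x \<in> insert (A k) (?g ` {..<p})"
    then show "x \<in> T k j \<inter> S" using T in_S by auto
  qed
  moreover have "inj_on ?g {..<p}" using G_eq by (auto simp: inj_on_def)
  moreover have "A k \<notin> ?g ` {..<p}"
  proof
    assume "A k \<in> ?g ` {..<p}"
    then obtain n where n: "n < p" "A k = ?g n" by blast
    then show False using points_G(8)[OF n(1), of "j + int n * k"] points_A(3)[of k] by simp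
  qed
  ultimately show ?thesis by (simp add: 3 card_image)
qed

lemma quadrangle: "\<exists>Q. Q \<subseteq> S \<and> card Q = 4 \<and> (\<forall>l\<in>Ls. card (Q \<inter> l) \<le> 2)"
proof (intro exI conjI ballI)
  have p0: "0 < p" using p2 by simp
  let ?Q = "{A 0, A 1, G 0 0, G 0 1}"
  show "?Q \<subseteq> S" using in_S p0 by auto
  have d: "A 0 \<noteq> A 1" "G 0 0 \<noteq> G 0 1" using points_A(5)[of 1 0] points_G(6)[OF p0, of 1 0] not_dvd_1 by auto
  have AG: "A i \<noteq> G 0 v" for i v using points_G(8)[OF p0] points_A(3) by metis
  show "card ?Q = 4" using d AG by simp
  fix l assume l: "l \<in> Ls"
  then have ll: "l \<in> lines" using Ls_subset by blast
  have 1: "l = la" if "A 0 \<in> l" "A 1 \<in> l" using line_unique[OF ll points_A(1)] that points_A(3) d(1) by blast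
  have 2: "l = L 0" if "G 0 0 \<in> l" "G 0 1 \<in> l" using line_unique[OF ll points_G(1)[OF p0]] that points_G(4)[OF p0] d(2) by blast
  have "?Q \<inter> l \<subseteq> {A 0, A 1} \<or> ?Q \<inter> l \<subseteq> {G 0 0, G 0 1} \<or> (\<exists>a b. ?Q \<inter> l \<subseteq> {a, b})"
  proof (cases "A 0 \<in> l \<and> A 1 \<in> l")
    case True
    then show ?thesis using 1 points_G(8)[OF p0] by auto
  next
    case A: False
    show ?thesis
    proof (cases "G 0 0 \<in> l \<and> G 0 1 \<in> l")
      case True
      then show ?thesis using 2 points_G(7)[OF p0] by auto
    next
      case False
      then have "?Q \<inter> l \<subseteq> {if A 0 \<in> l then A 0 else A 1, if G 0 0 \<in> l then G 0 0 else G 0 1}" using A by auto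
      then show ?thesis by blast
    qed
  qed
  then obtain a b where "?Q \<inter> l \<subseteq> {a, b}" by blast
  then have "card (?Q \<inter> l) \<le> card {a, b}" by (intro card_mono) auto
  also have "\<dots> \<le> 2" by (simp add: card_insert_if)
  finally show "card (?Q \<inter> l) \<le> 2" .
qed

text \<open>
  The points have coordinates \<open>[0, 1, 0]\<close>, \<open>[0, i, 1]\<close>, \<open>[1, v,
  n]\<close>, and the lines have equations \<open>x = 0\<close>, \<open>z = n x\<close>,
  \<open>y = j x + k z\<close>. They are first given by relations \<open>vr\<close> and
  \<open>cr\<close>, because different indices can belong to the same point or line.
\<close>

lemma coordinates:
  assumes char: "CHAR('k::field) = p"
  shows "\<exists>(vec :: 'a \<Rightarrow> 'k \<times> 'k \<times> 'k) (cov :: 'a set \<Rightarrow> 'k \<times> 'k \<times> 'k).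
    (\<forall>x\<in>S. vec x \<noteq> (0, 0, 0)) \<and> (\<forall>l\<in>Ls. cov l \<noteq> (0, 0, 0)) \<and>
    (\<forall>x\<in>S. \<forall>l\<in>Ls. x \<in> l \<longleftrightarrow> dot3 (cov l) (vec x) = 0)"
proof -
  have z: "(of_int i :: 'k) = 0 \<longleftrightarrow> int p dvd i" for i
    using char by (simp add: of_int_eq_0_iff_char_dvd)
  define vr :: "'a \<Rightarrow> 'k \<times> 'k \<times> 'k \<Rightarrow> bool" where
    "vr = (\<lambda>x w. (x = D \<and> w = (0, 1, 0)) \<or> (\<exists>i. x = A i \<and> w = (0, of_int i, 1)) \<or>
      (\<exists>n v. n < p \<and> x = G n v \<and> w = (1, of_int v, of_nat n)))"
  define cr :: "'a set \<Rightarrow> 'k \<times> 'k \<times> 'k \<Rightarrow> bool" where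
    "cr = (\<lambda>l c. (l = la \<and> c = (1, 0, 0)) \<or> (\<exists>n<p. l = L n \<and> c = (- of_nat n, 0, 1)) \<or>
      (\<exists>k j. l = T k j \<and> c = (of_int j, -1, of_int k)))"
  have vI1: "vr D (0, 1, 0)" by (simp add: vr_def)
  have vI2: "vr (A i) (0, of_int i, 1)" for i
    unfolding vr_def by (rule disjI2, rule disjI1, rule exI, rule conjI[OF refl refl])
  have vI3: "vr (G n v) (1, of_int v, of_nat n)" if "n < p" for n v
    unfolding vr_def by (rule disjI2, rule disjI2, rule exI, rule exI, rule conjI[OF that conjI[OF refl refl]])
  have cI1: "cr la (1, 0, 0)" by (simp add: cr_def)
  have cI2: "cr (L n) (- of_nat n, 0, 1)" if "n < p" for n
    unfolding cr_def by (rule disjI2, rule disjI1, rule exI, rule conjI[OF that conjI[OF refl refl]])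
  have cI3: "cr (T k j) (of_int j, -1, of_int k)" for k j
    unfolding cr_def by (rule disjI2, rule disjI2, rule exI, rule exI, rule conjI[OF refl refl])
  have vex: "\<exists>w. vr x w" if "x \<in> S" for x
    by (rule S_cases[OF that]) (use vI1 vI2 vI3 in metis)+
  have cex: "\<exists>c. cr l c" if "l \<in> Ls" for l
    by (rule Ls_cases[OF that]) (use cI1 cI2 cI3 in metis)+
  have vnz: "w \<noteq> (0, 0, 0)" if "vr x w" for x w using that by (auto simp: vr_def)
  have cnz: "c \<noteq> (0, 0, 0)" if "cr l c" for l c using that by (auto simp: cr_def)
  have nn: "(of_nat m - of_nat n :: 'k) = 0 \<longleftrightarrow> n = m" if "n < p" "m < p" for n m
    using z[of "int m - int n"] not_dvd_diff[OF that] by auto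
  have inc: "x \<in> l \<longleftrightarrow> dot3 c w = 0" if x: "vr x w" and l: "cr l c" for x w l c
  proof -
    have A1: "A i \<in> T k j \<longleftrightarrow> (of_int k - of_int i :: 'k) = 0" for i k j
      using A_T[of i k j] z[of "i - k"] by auto
    have G1: "G n v \<in> T k j \<longleftrightarrow> (of_int j - of_int v + of_int k * of_nat n :: 'k) = 0" if "n < p" for n v k j
      using G_T[OF that, of v k j] z[of "j - v + int n * k"] by (simp add: mult.commute)
    have G2: "G n v \<in> L m \<longleftrightarrow> (of_nat n - of_nat m :: 'k) = 0" if "n < p" "m < p" for n m v
      using G_L[OF that] nn[OF that(2,1)] by auto
    consider "x = D" "w = (0, 1, 0)" | i where "x = A i" "w = (0, of_int i, 1)"
      | n v where "n < p" "x = G n v" "w = (1, of_int v, of_nat n)" using x by (auto simp: vr_def)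
    then show ?thesis
    proof cases
      case 1
      then show ?thesis using l points_A(2) points_G(3) D_T by (auto simp: cr_def dot3_def)
    next
      case (2 i)
      then show ?thesis using l points_A(3) points_G(7) by (auto simp: cr_def dot3_def A1)
    next
      case (3 n v)
      then show ?thesis using l points_G(8) G1[OF 3(1)] G2[OF 3(1)] by (auto simp: cr_def dot3_def)
    qed
  qed
  define vec where "vec = (\<lambda>x. SOME w. vr x w)"
  define cov where "cov = (\<lambda>l. SOME c. cr l c)"
  have v: "vr x (vec x)" if "x \<in> S" for x using someI_ex[OF vex[OF that]] by (simp add: vec_def)
  have c: "cr l (cov l)" if "l \<in> Ls" for l using someI_ex[OF cex[OF that]] by (simp add: cov_def)
  show ?thesis
    using v c vnz cnz inc by (intro exI[of _ vec] exI[of _ cov]) blast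
qed

text \<open>The plane is reached from its first two columns by harmonic conjugation, and is closed under it.\<close>

lemma reached:
  assumes "D \<in> W" "\<And>i. A i \<in> W" "\<And>i. G 0 i \<in> W" "\<And>i. G 1 i \<in> W"
    and closed: "\<And>y z x x'. y \<in> W \<Longrightarrow> z \<in> W \<Longrightarrow> x \<in> W \<Longrightarrow> hconj y z x x' \<Longrightarrow> x' \<in> W"
  shows "S \<subseteq> W"
proof -
  have "(n < p \<longrightarrow> (\<forall>v. G n v \<in> W)) \<and> (Suc n < p \<longrightarrow> (\<forall>v. G (Suc n) v \<in> W))" for n
  proof (induction n)
    case 0
    then show ?case using assms(3,4) by simp
  next
    case (Suc n)
    have "G (Suc (Suc n)) v \<in> W" if "Suc (Suc n) < p" for v
      by (rule closed[OF assms(2) _ _ conj[OF that]]) (use Suc that in auto)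
    then show ?case using Suc by simp
  qed
  then show ?thesis using assms(1,2) by (auto elim: S_cases)
qed

lemma off_line: "l \<in> Ls \<Longrightarrow> \<exists>x\<in>S. x \<notin> l"
proof -
  assume l: "l \<in> Ls"
  obtain Q where Q: "Q \<subseteq> S" "card Q = 4" "card (Q \<inter> l) \<le> 2" using quadrangle l by blast
  then have "Q \<inter> l \<noteq> Q" by auto
  then show ?thesis using Q(1) by blast
qed

text \<open>
  A conjugate can be constructed with any quadrangle. Inside \<open>S\<close>, joins and
  intersections exist and every line has at least three points, so there is a quadrangle in
  \<open>S\<close> for the given three points; its last side is a line of \<open>S\<close> and
  meets the line \<open>yz\<close> in \<open>S\<close>.
\<close>

lemma hconj_in_S:
  assumes yzx: "y \<in> S" "z \<in> S" "x \<in> S" and h: "hconj y z x x'"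
  shows "x' \<in> S"
proof -
  obtain u q r s where Q: "quadr y x z u q r s" and x': "coll y z x'" "coll u r x'"
    using h by (auto simp: hconj_def)
  have d: "y \<noteq> x" "y \<noteq> z" "x \<noteq> z" "u \<noteq> r" and cl: "coll y x z" "\<not> coll y z u" using Q by (auto simp: quadr_def)
  have lu: "l = m" if "l \<in> Ls" "m \<in> Ls" "a \<in> l" "b \<in> l" "a \<in> m" "b \<in> m" "a \<noteq> b" for l m a b
    using line_unique Ls_subset that by blast
  obtain l where l: "l \<in> Ls" "y \<in> l" "z \<in> l" using S_join yzx d by blast
  then have lL: "l \<in> lines" using Ls_subset by blast
  have xl: "x \<in> l" using coll_line[OF _ d(2) lL l(2,3)] coll_swap(2)[OF cl(1)] by blast
  obtain Q where Q1: "Q \<in> S" "Q \<notin> l" using off_line l by blast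
  have ne: "x \<noteq> Q" "y \<noteq> Q" "z \<noteq> Q" using Q1 l xl by auto
  obtain mx where mx: "mx \<in> Ls" "x \<in> mx" "Q \<in> mx" using S_join[OF yzx(3) Q1(1) ne(1)] by blast
  obtain my where my: "my \<in> Ls" "y \<in> my" "Q \<in> my" using S_join[OF yzx(1) Q1(1) ne(2)] by blast
  obtain mz where mz: "mz \<in> Ls" "z \<in> mz" "Q \<in> mz" using S_join[OF yzx(2) Q1(1) ne(3)] by blast
  have "\<not> mx \<inter> S \<subseteq> {x, Q}"
  proof
    assume "mx \<inter> S \<subseteq> {x, Q}"
    then have "card (mx \<inter> S) \<le> card {x, Q}" by (intro card_mono) auto
    then show False using card_line[OF mx(1)] ne(1) p2 by simp
  qed
  then obtain s1 where s1: "s1 \<in> S" "s1 \<in> mx" "s1 \<noteq> x" "s1 \<noteq> Q" by blast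
  have lm: "mx \<noteq> l" "my \<noteq> l" "mz \<noteq> l" using Q1 mx my mz by auto
  have s1l: "s1 \<notin> l" using lu[OF mx(1) l(1), of x s1] mx s1 xl lm by blast
  have ynx: "y \<notin> mx" "z \<notin> mx" "x \<notin> my" "z \<notin> my" "x \<notin> mz" "y \<notin> mz"
    using lu[OF mx(1) l(1), of x y] lu[OF mx(1) l(1), of x z] lu[OF my(1) l(1), of y x] lu[OF my(1) l(1), of y z]
      lu[OF mz(1) l(1), of z x] lu[OF mz(1) l(1), of z y] mx my mz l xl lm d by auto
  have s1y: "s1 \<notin> my" "s1 \<notin> mz" using lu[OF mx(1) my(1), of Q s1] lu[OF mx(1) mz(1), of Q s1] mx my mz s1 ynx by auto
  obtain ky where ky: "ky \<in> Ls" "y \<in> ky" "s1 \<in> ky" using S_join[OF yzx(1) s1(1)] s1l l by blast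
  obtain kz where kz: "kz \<in> Ls" "z \<in> kz" "s1 \<in> kz" using S_join[OF yzx(2) s1(1)] s1l l by blast
  have Qk: "Q \<notin> ky" "Q \<notin> kz" using lu[OF mx(1) ky(1), of Q s1] lu[OF mx(1) kz(1), of Q s1] mx ky kz s1 ynx by auto
  have kl: "ky \<noteq> l" "kz \<noteq> l" using ky kz s1l by auto
  obtain u1 where u1: "u1 \<in> S" "u1 \<in> my" "u1 \<in> kz" using Ls_meet[OF my(1) kz(1)] by blast
  obtain r1 where r1: "r1 \<in> S" "r1 \<in> mz" "r1 \<in> ky" using Ls_meet[OF mz(1) ky(1)] by blast
  have yz_k: "y \<notin> kz" "z \<notin> ky" using lu[OF kz(1) l(1), of z y] lu[OF ky(1) l(1), of y z] kz ky l kl d by auto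
  have ul: "u1 \<notin> l" using lu[OF my(1) l(1), of y u1] my u1 l lm yz_k by blast
  have rl: "r1 \<notin> l" using lu[OF mz(1) l(1), of z r1] mz r1 l lm yz_k by blast
  have "mz \<noteq> my" using ynx my by blast
  then have ur: "u1 \<noteq> r1" using lu[OF my(1) mz(1), of Q u1] my mz u1 r1 Qk by blast
  have Q2: "quadr y x z u1 Q r1 s1"
  proof -
    have "distinct [y, x, z, u1, Q, r1, s1]"
      using d ne s1 s1l ul rl l xl ur u1 r1 Qk s1y by auto
    moreover have "{y, x, z, u1, Q, r1, s1} \<subseteq> P" using yzx u1 r1 Q1 s1 S_subset by blast
    moreover have "coll y u1 Q" by (rule collI[of my]) (use my u1 Ls_subset in auto)
    moreover have "coll y r1 s1" by (rule collI[of ky]) (use ky r1 Ls_subset in auto)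
    moreover have "coll x Q s1" by (rule collI[of mx]) (use mx s1 Ls_subset in auto)
    moreover have "coll z u1 s1" by (rule collI[of kz]) (use kz u1 Ls_subset in auto)
    moreover have "coll z Q r1" by (rule collI[of mz]) (use mz r1 Ls_subset in auto)
    moreover have "\<not> coll y z u1" using coll_line[OF _ d(2) lL l(2,3)] ul by blast
    ultimately show ?thesis using cl(1) by (simp add: quadr_def)
  qed
  obtain e where e: "coll y z e" "coll u r e" "coll u1 r1 e" using harmonic[OF Q Q2] by blast
  obtain k where k: "k \<in> Ls" "u1 \<in> k" "r1 \<in> k" using S_join[OF u1(1) r1(1) ur] by blast
  have kL: "k \<in> lines" using k Ls_subset by blast
  have el: "e \<in> l" "e \<in> k" using coll_line[OF e(1) d(2) lL l(2,3)] coll_line[OF e(3) ur kL k(2,3)] by auto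
  obtain e' where e': "e' \<in> S" "e' \<in> l" "e' \<in> k" using Ls_meet[OF l(1) k(1)] by blast
  have "e = e'" using line_unique[OF lL kL el(1) e'(2) el(2) e'(3)] ul k by blast
  moreover have "x' = e"
  proof (rule ccontr)
    assume n: "x' \<noteq> e"
    obtain m where m: "m \<in> lines" "u \<in> m" "r \<in> m" "e \<in> m" using e(2) by (auto simp: coll_def)
    have "x' \<in> m" using coll_line[OF x'(2) d(4) m(1-3)] .
    moreover have "x' \<in> l" using coll_line[OF x'(1) d(2) lL l(2,3)] .
    ultimately have "m = l" using line_unique[OF m(1) lL _ m(4) _ el(1) n] by blast
    then show False using m(2) cl(2) collI lL l by blast
  qed
  ultimately show ?thesis using e' by simp
qed

end

section \<open>The full algebraic matroid\<close>

locale full_algebraic =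
  fixes F :: "'a::alg_closed_field set"
  assumes F: "alg_closed_subfield F"
begin

sublocale pregeometry "acl F"
  by (rule pregeometry_acl)

lemma acl_0: "acl F {} = F"
  by (rule acl_empty[OF F])

lemma independent_singleton: "independent {x} \<longleftrightarrow> x \<notin> F"
  by (simp add: independent_def acl_0)

lemma point_iff: "P \<in> alg_points F \<longleftrightarrow> (\<exists>x. x \<notin> F \<and> P = acl F {x})"
proof
  assume P: "P \<in> alg_points F"
  then have PC: "alg_closed_subfield P" "F \<subseteq> P" and tr: "trdeg F P = 1" by (auto simp: alg_points_def)
  have bound: "enat (card B) \<le> 1" if "B \<subseteq> P" "finite B" "independent B" for B
    unfolding tr[symmetric] trdeg_def using that alg_indep_iff_independent[OF F] by (intro Sup_upper) auto
  have "\<exists>B. B \<subseteq> P \<and> finite B \<and> independent B \<and> card B \<noteq> 0"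
  proof (rule ccontr)
    assume n: "\<not> ?thesis"
    have "trdeg F P \<le> 0"
      unfolding trdeg_def
    proof (rule SUP_least)
      fix B assume "B \<in> {B. B \<subseteq> P \<and> finite B \<and> alg_indep F B}"
      then have "card B = 0" using n alg_indep_iff_independent[OF F, of B] by blast
      then show "enat (card B) \<le> 0" by (simp add: zero_enat_def)
    qed
    then show False using tr by simp
  qed
  then obtain B where B: "B \<subseteq> P" "finite B" "independent B" "card B \<noteq> 0" by blast
  then obtain x where x: "x \<in> B" by fastforce
  then have "independent {x}" using independent_subset[OF B(3)] by blast
  then have xF: "x \<notin> F" by (simp add: independent_singleton)
  have xP: "x \<in> P" using x B by blast
  have "P \<subseteq> acl F {x}"
  proof (rule ccontr)
    assume "\<not> P \<subseteq> acl F {x}"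
    then obtain y where y: "y \<in> P" "y \<notin> acl F {x}" by blast
    have "independent {y, x}" using independent_insert[of "{x}" y] independent_singleton xF y by blast
    then have "enat (card {y, x}) \<le> 1" using bound[of "{y, x}"] y xP by blast
    moreover have "y \<noteq> x" using y in_cl[of x "{x}"] by auto
    ultimately show False by (simp add: one_enat_def)
  qed
  moreover have "acl F {x} \<subseteq> P" using acl_least[OF PC(1,2)] xP by blast
  ultimately show "\<exists>x. x \<notin> F \<and> P = acl F {x}" using xF by blast
next
  assume "\<exists>x. x \<notin> F \<and> P = acl F {x}"
  then obtain x where x: "x \<notin> F" "P = acl F {x}" by blast
  have "trdeg F P = 1"
  proof (rule antisym)
    show "trdeg F P \<le> 1"
      unfolding trdeg_def
    proof (rule SUP_least)
      fix B assume "B \<in> {B. B \<subseteq> P \<and> finite B \<and> alg_indep F B}"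
      then have "independent B" "B \<subseteq> acl F {x}" using alg_indep_iff_independent[OF F] x by auto
      then have "card B \<le> card {x}" using steinitz[of "{x}" B] by simp
      then show "enat (card B) \<le> 1" by (simp add: one_enat_def)
    qed
    have "{x} \<in> {B. B \<subseteq> P \<and> finite B \<and> alg_indep F B}"
      using x in_cl[of x "{x}"] alg_indep_iff_independent[OF F, of "{x}"] independent_singleton by auto
    then have "enat (card {x}) \<le> trdeg F P" unfolding trdeg_def by (rule SUP_upper)
    then show "1 \<le> trdeg F P" by (simp add: one_enat_def)
  qed
  then show "P \<in> alg_points F" using x acl_closed acl_base[of F "{x}"] by (auto simp: alg_points_def)
qed

text \<open>
  A point of the matroid is the closure of each of its elements outside \<open>F\<close>.
  Choosing one of them moves questions about sets of points to sets of field elements.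
\<close>

definition gen :: "'a set \<Rightarrow> 'a" where
  "gen P = (SOME x. x \<notin> F \<and> P = acl F {x})"

lemma gen:
  assumes "P \<in> alg_points F"
  shows "gen P \<notin> F" "P = acl F {gen P}" "gen P \<in> P"
proof -
  show 1: "gen P \<notin> F" "P = acl F {gen P}"
    using someI_ex[OF assms[unfolded point_iff]] by (simp_all add: gen_def)
  show "gen P \<in> P" using 1(2) in_cl[of "gen P" "{gen P}"] by simp
qed

lemma inj_gen: "inj_on gen (alg_points F)"
  using gen(2) by (metis inj_onI)

lemma gen_eq_iff: "P \<in> alg_points F \<Longrightarrow> Q \<in> alg_points F \<Longrightarrow> gen P = gen Q \<longleftrightarrow> P = Q"
  using inj_gen by (auto simp: inj_on_def)

lemma acl_singleton_eq:
  assumes "x \<in> acl F {y}" "x \<notin> F"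
  shows "acl F {x} = acl F {y}"
proof
  show "acl F {x} \<subseteq> acl F {y}" using assms by (intro cl_least) auto
  have "y \<in> acl F {x}" using exchange[of x y "{}"] assms by (simp add: acl_0)
  then show "acl F {y} \<subseteq> acl F {x}" by (intro cl_least) auto
qed

lemma gen_nonparallel:
  assumes "P \<in> alg_points F" "Q \<in> alg_points F" "P \<noteq> Q"
  shows "gen P \<notin> acl F {gen Q}"
  using acl_singleton_eq[of "gen P" "gen Q"] gen[OF assms(1)] gen[OF assms(2)] assms(3) by metis

text \<open>
  Independent representatives generate their points, so they can be exchanged for the chosen
  generators without changing the rank.
\<close>

lemma transversal_iff:
  assumes Q: "finite Q" "Q \<subseteq> alg_points F"
  shows "transversal_indep (alg_indep F) Q \<longleftrightarrow> independent (gen ` Q)"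
proof
  assume "independent (gen ` Q)"
  then have "alg_indep F (gen ` Q)" using alg_indep_iff_independent[OF F, of "gen ` Q"] Q by simp
  then show "transversal_indep (alg_indep F) Q"
    unfolding transversal_indep_def using inj_gen Q gen(3) by (metis inj_on_subset subsetD)
next
  assume "transversal_indep (alg_indep F) Q"
  then obtain f where f: "inj_on f Q" "\<forall>P\<in>Q. f P \<in> P" "alg_indep F (f ` Q)"
    by (auto simp: transversal_indep_def)
  then have ind: "independent (f ` Q)" using alg_indep_iff_independent[OF F, of "f ` Q"] Q by simp
  have "gen P \<in> acl F (f ` Q)" if P: "P \<in> Q" for P
  proof -
    have "independent {f P}" using independent_subset[OF ind, of "{f P}"] P by simp
    then have "f P \<notin> F" by (simp add: independent_singleton)
    moreover have "P = acl F {gen P}" using gen(2) P Q by blast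
    ultimately have "acl F {f P} = P" using acl_singleton_eq[of "f P" "gen P"] f(2) P by auto
    then have "gen P \<in> acl F {f P}" using gen(3) P Q by blast
    then show ?thesis using mono[of "{f P}" "f ` Q"] P by auto
  qed
  then have "f ` Q \<subseteq> acl F (gen ` Q) \<Longrightarrow> rk (gen ` Q) = card (f ` Q)"
    using Q ind by (intro rk_eq) auto
  moreover have "f ` Q \<subseteq> acl F (gen ` Q)"
  proof
    fix x assume "x \<in> f ` Q"
    then obtain P where P: "P \<in> Q" "x = f P" by blast
    then have "x \<in> acl F {gen P}" using f(2) gen(2) Q by blast
    then show "x \<in> acl F (gen ` Q)" using mono[of "{gen P}" "gen ` Q"] P by auto
  qed
  moreover have "gen ` Q \<subseteq> acl F (f ` Q)" using \<open>\<And>P. P \<in> Q \<Longrightarrow> gen P \<in> acl F (f ` Q)\<close> by blast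
  ultimately have "rk (gen ` Q) = card (f ` Q)" by blast
  also have "\<dots> = card (gen ` Q)"
    using f(1) inj_on_subset[OF inj_gen Q(2)] by (simp add: card_image)
  finally show "independent (gen ` Q)" using independent_iff_rk[of "gen ` Q"] Q by simp
qed

abbreviation M :: "'a set matroid" where
  "M \<equiv> full_algebraic_matroid F"

lemma ground_M: "ground M = alg_points F"
  by (simp add: full_algebraic_matroid_def)

lemma indep_M: "finite Q \<Longrightarrow> indep M Q \<longleftrightarrow> Q \<subseteq> alg_points F \<and> independent (gen ` Q)"
  using transversal_iff[of Q] by (auto simp: full_algebraic_matroid_def)

lemma gen_image_basis:
  assumes X: "finite V" "V \<subseteq> alg_points F"
  shows "\<exists>I\<subseteq>V. independent (gen ` I) \<and> gen ` V \<subseteq> acl F (gen ` I) \<and> card I = rk (gen ` V)"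
proof -
  obtain B where B: "B \<subseteq> gen ` V" "independent B" "gen ` V \<subseteq> acl F B" "card B = rk (gen ` V)"
    using rk_basis[of "gen ` V"] X by blast
  define I where "I = {P \<in> V. gen P \<in> B}"
  have "gen ` I = B" using B(1) by (auto simp: I_def)
  moreover have "card (gen ` I) = card I" using inj_gen X(2) by (intro card_image) (auto simp: I_def inj_on_def)
  ultimately show ?thesis using B by (intro exI[of _ I]) (auto simp: I_def)
qed

text \<open>
  The closure in the definition of a matroid uses independent subsets only; a basis of
  \<open>V\<close> among its points shows that nothing is lost.
\<close>

lemma matroid_cl_M:
  assumes V: "finite V" "V \<subseteq> alg_points F"
  shows "matroid_cl M V = {R \<in> alg_points F. gen R \<in> acl F (gen ` V)}"
proof (intro equalityI subsetI)
  fix R assume R: "R \<in> matroid_cl M V"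
  then have RP: "R \<in> alg_points F" by (simp add: matroid_cl_def ground_M)
  from R consider "R \<in> V" | I where "I \<subseteq> V" "indep M I" "\<not> indep M (insert R I)" by (auto simp: matroid_cl_def)
  then have "gen R \<in> acl F (gen ` V)"
  proof cases
    case 1
    then show ?thesis using in_cl by blast
  next
    case 2
    have fI: "finite I" using 2(1) V finite_subset by blast
    have i: "independent (gen ` I)" "I \<subseteq> alg_points F" using 2 indep_M[OF fI] by auto
    have "\<not> independent (insert (gen R) (gen ` I))" using 2(3) indep_M[of "insert R I"] fI i RP by auto
    then have "gen R \<in> acl F (gen ` I)" using independent_insert[OF i(1)] by blast
    then show ?thesis using mono[of "gen ` I" "gen ` V"] 2(1) by blast
  qed
  then show "R \<in> {R \<in> alg_points F. gen R \<in> acl F (gen ` V)}" using RP by simp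
next
  fix R assume R: "R \<in> {R \<in> alg_points F. gen R \<in> acl F (gen ` V)}"
  show "R \<in> matroid_cl M V"
  proof (cases "R \<in> V")
    case True
    then show ?thesis using R by (simp add: matroid_cl_def ground_M)
  next
    case False
    obtain I where I: "I \<subseteq> V" "independent (gen ` I)" "gen ` V \<subseteq> acl F (gen ` I)"
      using gen_image_basis[OF V] by blast
    have fI: "finite I" using I(1) V finite_subset by blast
    have ins: "I \<subseteq> alg_points F" using I V by auto
    have "gen R \<in> acl F (gen ` I)" using R cl_least[OF I(3)] by blast
    moreover have "gen R \<notin> gen ` I" using False I(1) R ins gen_eq_iff by blast
    ultimately have "\<not> independent (gen ` insert R I)" using independent_insert_iff[of "gen R" "gen ` I"] by simp
    then have "\<not> indep M (insert R I)" using indep_M[of "insert R I"] fI by blast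
    moreover have "indep M I" using indep_M[OF fI] I ins by blast
    ultimately show ?thesis using I(1) R by (auto simp: matroid_cl_def ground_M)
  qed
qed

lemma matroid_rank_M:
  assumes V: "finite V" "V \<subseteq> alg_points F"
  shows "matroid_rank M V = enat (rk (gen ` V))"
  unfolding matroid_rank_def
proof (rule antisym)
  show "(SUP I\<in>{I. I \<subseteq> V \<and> finite I \<and> indep M I}. enat (card I)) \<le> enat (rk (gen ` V))"
  proof (rule SUP_least)
    fix I assume I: "I \<in> {I. I \<subseteq> V \<and> finite I \<and> indep M I}"
    then have "independent (gen ` I)" "I \<subseteq> alg_points F" using indep_M by auto
    then have "card (gen ` I) = rk (gen ` I)" using I rk_independent by simp
    also have "\<dots> \<le> rk (gen ` V)" using I V by (intro rk_mono) auto
    finally show "enat (card I) \<le> enat (rk (gen ` V))"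
      using inj_on_subset[OF inj_gen \<open>I \<subseteq> alg_points F\<close>] by (simp add: card_image)
  qed
  obtain I where I: "I \<subseteq> V" "independent (gen ` I)" "card I = rk (gen ` V)"
    using gen_image_basis[OF V] by blast
  have fI: "finite I" using I(1) V finite_subset by blast
  have "I \<in> {I. I \<subseteq> V \<and> finite I \<and> indep M I}" using I fI V indep_M[OF fI] by auto
  then have "enat (card I) \<le> (SUP I\<in>{I. I \<subseteq> V \<and> finite I \<and> indep M I}. enat (card I))" by (rule SUP_upper)
  then show "enat (rk (gen ` V)) \<le> (SUP I\<in>{I. I \<subseteq> V \<and> finite I \<and> indep M I}. enat (card I))" using I by simp
qed

definition lin :: "'a set \<Rightarrow> 'a set \<Rightarrow> 'a set set" where
  "lin P Q = {R \<in> alg_points F. gen R \<in> acl F {gen P, gen Q}}"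

definition alg_lines :: "'a set set set" where
  "alg_lines = {lin P Q | P Q. P \<in> alg_points F \<and> Q \<in> alg_points F \<and> P \<noteq> Q}"

lemma lin_cl: "P \<in> alg_points F \<Longrightarrow> Q \<in> alg_points F \<Longrightarrow> matroid_cl M {P, Q} = lin P Q"
  using matroid_cl_M[of "{P, Q}"] by (simp add: lin_def)

lemma lin_mem: "P \<in> alg_points F \<Longrightarrow> Q \<in> alg_points F \<Longrightarrow> P \<in> lin P Q \<and> Q \<in> lin P Q"
  using in_cl by (auto simp: lin_def)

lemma lin_eq:
  assumes PQ: "P \<in> alg_points F" "Q \<in> alg_points F" "P \<noteq> Q" and RS: "R \<in> lin P Q" "T \<in> lin P Q" "R \<noteq> T"
  shows "lin R T = lin P Q"
proof -
  have pts: "R \<in> alg_points F" "T \<in> alg_points F" using RS by (auto simp: lin_def)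
  have sub: "{gen R, gen T} \<subseteq> acl F {gen P, gen Q}" using RS by (auto simp: lin_def)
  have r: "rk {gen R, gen T} = 2"
    using rk_pair[of "gen R" "gen T"] gen(1)[OF pts(1)] gen_nonparallel[OF pts(2,1)] RS(3) by (simp add: acl_0)
  have "rk ({gen P, gen Q} \<union> {gen R, gen T}) \<le> rk {gen P, gen Q}"
    using sub in_cl by (intro rk_mono_cl) auto
  also have "\<dots> \<le> card {gen P, gen Q}" by (intro rk_le_card) auto
  also have "\<dots> \<le> 2" by (simp add: card_insert_if)
  finally have "{gen P, gen Q} \<union> {gen R, gen T} \<subseteq> acl F {gen R, gen T}" using r by (intro subset_cl_if_rk) auto
  then have "acl F {gen P, gen Q} = acl F {gen R, gen T}"
    using cl_least[OF sub] cl_least[of "{gen P, gen Q}" "{gen R, gen T}"] by blast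
  then show ?thesis by (simp add: lin_def)
qed

sublocale linear_space "alg_points F" alg_lines
proof
  show "l \<subseteq> alg_points F" if "l \<in> alg_lines" for l using that by (auto simp: alg_lines_def lin_def)
  show "\<exists>l\<in>alg_lines. a \<in> l \<and> b \<in> l" if "a \<in> alg_points F" "b \<in> alg_points F" "a \<noteq> b" for a b
    using that lin_mem[of a b] by (auto simp: alg_lines_def)
  show "l = m" if "l \<in> alg_lines" "m \<in> alg_lines" "a \<in> l" "b \<in> l" "a \<in> m" "b \<in> m" "a \<noteq> b" for l m a b
  proof -
    have "k = lin a b" if "k \<in> alg_lines" "a \<in> k" "b \<in> k" for k
      using that lin_eq[OF _ _ _ _ _ \<open>a \<noteq> b\<close>] by (auto simp: alg_lines_def)
    then show ?thesis using that by metis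
  qed
qed

lemma coll_iff:
  assumes "a \<in> alg_points F" "b \<in> alg_points F" "a \<noteq> b"
  shows "coll a b c \<longleftrightarrow> c \<in> lin a b"
proof
  assume "coll a b c"
  then obtain l where l: "l \<in> alg_lines" "a \<in> l" "b \<in> l" "c \<in> l" by (auto simp: coll_def)
  then obtain P Q where PQ: "P \<in> alg_points F" "Q \<in> alg_points F" "P \<noteq> Q" "a \<in> lin P Q" "b \<in> lin P Q" "c \<in> lin P Q"
    by (auto simp: alg_lines_def)
  then show "c \<in> lin a b" using lin_eq[OF PQ(1-5) assms(3)] by simp
next
  assume "c \<in> lin a b"
  moreover have "lin a b \<in> alg_lines" using assms by (auto simp: alg_lines_def)
  ultimately show "coll a b c" using assms lin_mem[of a b] unfolding coll_def by blast
qed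

lemma quadr_quad:
  assumes "quadr y x z u q r s"
  shows "quad (gen y) (gen x) (gen z) (gen u) (gen q) (gen r) (gen s)"
proof -
  have pts: "y \<in> alg_points F" "x \<in> alg_points F" "z \<in> alg_points F" "u \<in> alg_points F"
    "q \<in> alg_points F" "r \<in> alg_points F" "s \<in> alg_points F"
    and d: "distinct [y, x, z, u, q, r, s]" using assms by (auto simp: quadr_def)
  have c: "gen c \<in> acl F {gen a, gen b}" if "coll a b c" "a \<in> alg_points F" "b \<in> alg_points F" "a \<noteq> b" for a b c
    using coll_iff[OF that(2-4)] that(1) by (simp add: lin_def)
  have A: "coll y z x" "coll y u q" "coll y r s" "coll x q s" "coll z u s" "coll z q r" "\<not> coll y z u"
    using assms coll_swap(2) by (auto simp: quadr_def)
  have "gen u \<notin> acl F {gen y, gen z}" using A(7) coll_iff[of y z u] pts d by (auto simp: lin_def)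
  moreover have "distinct [gen y, gen x, gen z, gen u, gen q, gen r, gen s]"
    using d pts by (simp add: gen_eq_iff)
  moreover have "\<forall>a\<in>{y, x, z, u, q, r, s}. gen a \<notin> acl F {} \<and> (\<forall>b\<in>{y, x, z, u, q, r, s}. gen a \<noteq> gen b \<longrightarrow> gen a \<notin> acl F {gen b})"
    using pts gen(1) gen_nonparallel by (auto simp: acl_0)
  ultimately show ?thesis
    unfolding quad_def using c[OF A(1)] c[OF A(2)] c[OF A(3)] c[OF A(4)] c[OF A(5)] c[OF A(6)] pts d by simp
qed

sublocale harmonic_space "alg_points F" alg_lines
proof
  fix y x z u q r s u' q' r' s' assume Q: "quadr y x z u q r s" "quadr y x z u' q' r' s'"
  obtain e where e: "e \<notin> acl F {}" "e \<in> acl F {gen y, gen z}" "e \<in> acl F {gen u, gen r}" "e \<in> acl F {gen u', gen r'}"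
    using harmonic_concurrence[OF quadr_quad[OF Q(1)] quadr_quad[OF Q(2)]] by blast
  define R where "R = acl F {e}"
  have R: "R \<in> alg_points F" using e(1) by (auto simp: point_iff R_def acl_0)
  have "gen R \<in> acl F {e}" using gen(3)[OF R] by (simp add: R_def)
  then have g: "gen R \<in> acl F V" if "e \<in> acl F V" for V using cl_least[of "{e}" V] that by auto
  have "coll a b R" if "e \<in> acl F {gen a, gen b}" "a \<in> alg_points F" "b \<in> alg_points F" "a \<noteq> b" for a b
    using coll_iff[OF that(2-4)] g[OF that(1)] R by (simp add: lin_def)
  then show "\<exists>e. coll y z e \<and> coll u r e \<and> coll u' r' e"
    using e Q unfolding quadr_def by (intro exI[of _ R]) auto
qed

lemma collinear_in_iff:
  assumes "a \<in> alg_points F" "b \<in> alg_points F" "c \<in> alg_points F" "a \<noteq> b"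
  shows "collinear_in M {a, b, c} \<longleftrightarrow> coll a b c"
proof -
  have 2: "rk {gen b, gen a} = 2"
    using rk_pair[of "gen b" "gen a"] gen(1) gen_nonparallel assms by (simp add: acl_0)
  have "matroid_rank M {a, b, c} = enat (rk {gen c, gen b, gen a})"
    using matroid_rank_M[of "{a, b, c}"] assms by (simp add: insert_commute)
  moreover have "gen c \<in> acl F {gen b, gen a} \<longleftrightarrow> rk {gen c, gen b, gen a} \<le> 2"
    using rk_insert_in[of "{gen b, gen a}" "gen c"] rk_insert_out[of "{gen b, gen a}" "gen c"] 2
    by (cases "gen c \<in> acl F {gen b, gen a}") simp_all
  moreover have "enat n \<le> 2 \<longleftrightarrow> n \<le> 2" for n by (simp add: numeral_eq_enat)
  ultimately show ?thesis
    using coll_iff[of a b c] assms by (simp add: collinear_in_def lin_def insert_commute)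
qed

text \<open>
  The definition of \<open>HP\<close> lists all collinear triples. For quadrangles the missing
  ones follow from \<open>quadr_lines\<close>, and the rank is three because \<open>y, z,
  u\<close> generate the other points.
\<close>

lemma HP_quadr: "HP M y x z u q r s \<longleftrightarrow> quadr y x z u q r s"
proof
  assume H: "HP M y x z u q r s"
  let ?V = "{y, x, z, u, q, r, s}"
  have d: "distinct [y, x, z, u, q, r, s]" and pts: "?V \<subseteq> alg_points F"
    using H by (auto simp: HP_def ground_M)
  have c: "coll a b c \<longleftrightarrow> {a, b, c} \<in> {{y, x, z}, {y, u, q}, {y, r, s}, {x, q, s}, {z, u, s}, {z, q, r}}"
    if "{a, b, c} \<subseteq> ?V" "distinct [a, b, c]" "{a, b, c} \<noteq> {x, u, r}" for a b c
  proof -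
    have "card {a, b, c} = 3" using that(2) by simp
    then have "collinear_in M {a, b, c} \<longleftrightarrow> {a, b, c} \<in> {{y, x, z}, {y, u, q}, {y, r, s}, {x, q, s}, {z, u, s}, {z, q, r}}"
      using H[unfolded HP_def, THEN conjunct2, THEN conjunct2, THEN conjunct2, THEN spec, of "{a, b, c}"] that by simp
    moreover have "a \<in> alg_points F" "b \<in> alg_points F" "c \<in> alg_points F"
      using subset_trans[OF that(1) pts] by simp_all
    ultimately show ?thesis using collinear_in_iff[of a b c] that(2) by simp
  qed
  show "quadr y x z u q r s" by (rule quadrI_triples[OF d pts c])
next
  assume Q: "quadr y x z u q r s"
  let ?V = "{y, x, z, u, q, r, s}"
  let ?W = "{{y, x, z}, {y, u, q}, {y, r, s}, {x, q, s}, {z, u, s}, {z, q, r}}"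
  have d: "distinct [y, x, z, u, q, r, s]" and pts: "?V \<subseteq> alg_points F"
    and cl: "coll y x z" "coll y u q" "coll y r s" "coll x q s" "coll z u s" "coll z q r"
    using Q by (auto simp: quadr_def)
  note D = quadD[OF quadr_quad[OF Q]]
  have rank: "matroid_rank M ?V = 3"
  proof -
    let ?B = "{gen u, gen z, gen y}"
    have "gen u \<notin> acl F {gen z, gen y}" using D(17) by (simp add: insert_commute)
    then have r: "rk ?B = 3" using rk_insert_out[of "{gen z, gen y}" "gen u"] rk_pair[OF D(21,20)] by (simp add: insert_commute)
    have b: "gen y \<in> acl F ?B" "gen z \<in> acl F ?B" "gen u \<in> acl F ?B" using in_cl by auto
    have q: "gen q \<in> acl F ?B" using in_cl_line[OF D(2) b(1,3)] .
    have s: "gen s \<in> acl F ?B" using in_cl_line[OF D(5) b(2,3)] .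
    have rr: "gen r \<in> acl F ?B" using in_cl_line[OF D(11) b(2) q] .
    have x: "gen x \<in> acl F ?B" using in_cl_line[OF D(16) b(1,2)] .
    have "rk (gen ` ?V) \<le> rk ?B" by (rule rk_mono_cl) (use b q s rr x in auto)
    moreover have "rk ?B \<le> rk (gen ` ?V)" by (rule rk_mono) auto
    ultimately have "rk (gen ` ?V) = 3" using r by simp
    then show ?thesis using matroid_rank_M[OF _ pts] by (simp add: numeral_eq_enat)
  qed
  have inP: "a \<in> alg_points F" if "a \<in> ?V" for a using pts that by (rule subsetD)
  have "\<forall>T. T \<subseteq> ?V \<and> card T = 3 \<and> T \<noteq> {x, u, r} \<longrightarrow> (collinear_in M T \<longleftrightarrow> T \<in> ?W)"
  proof (intro allI impI, elim conjE)
    fix T assume T: "T \<subseteq> ?V" "card T = 3" "T \<noteq> {x, u, r}"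
    show "collinear_in M T \<longleftrightarrow> T \<in> ?W"
    proof
      assume ct: "collinear_in M T"
      obtain a b c where abc: "T = {a, b, c}" "a \<noteq> b" using T(2) unfolding card_3_iff by (elim exE conjE)
      have "coll a b c"
        using ct collinear_in_iff[of a b c] inP[OF subsetD[OF T(1)]] abc by simp
      then obtain l where "l \<in> alg_lines" "a \<in> l" "b \<in> l" "c \<in> l" unfolding coll_def by (elim bexE conjE)
      then show "T \<in> ?W" using quadr_lines[OF Q T, of l] abc(1) by simp
    next
      have ci: "collinear_in M {a, b, c}" if "coll a b c" "a \<noteq> b" "a \<in> ?V" "b \<in> ?V" "c \<in> ?V" for a b c
        using collinear_in_iff[of a b c] that(1,2) inP[OF that(3)] inP[OF that(4)] inP[OF that(5)] by simp
      have W: "collinear_in M {y, x, z}" "collinear_in M {y, u, q}" "collinear_in M {y, r, s}"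
        "collinear_in M {x, q, s}" "collinear_in M {z, u, s}" "collinear_in M {z, q, r}"
        using ci[OF cl(1)] ci[OF cl(2)] ci[OF cl(3)] ci[OF cl(4)] ci[OF cl(5)] ci[OF cl(6)] d by simp_all
      assume "T \<in> ?W"
      then show "collinear_in M T" by (elim insertE emptyE; hypsubst; intro W)
    qed
  qed
  then show "HP M y x z u q r s" unfolding HP_def ground_M by (intro conjI d pts rank)
qed

lemma harmonic_conj_hconj: "harmonic_conj M y z x x' \<longleftrightarrow> hconj y z x x'"
  unfolding harmonic_conj_def hconj_def HP_quadr
proof (intro iffI; elim exE conjE)
  fix u q r s assume Q: "quadr y x z u q r s" and i: "matroid_cl M {y, z} \<inter> matroid_cl M {u, r} = {x'}"
  have d: "y \<noteq> z" "u \<noteq> r" "{y, z, u, r} \<subseteq> alg_points F" using Q by (auto simp: quadr_def)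
  then have "x' \<in> lin y z" "x' \<in> lin u r" using i lin_cl by auto
  then have "coll y z x'" "coll u r x'" using coll_iff d by auto
  then show "\<exists>u q r s. quadr y x z u q r s \<and> coll y z x' \<and> coll u r x'" using Q by blast
next
  fix u q r s assume Q: "quadr y x z u q r s" and x': "coll y z x'" "coll u r x'"
  have d: "y \<noteq> z" "u \<noteq> r" "{y, z, u, r} \<subseteq> alg_points F" "\<not> coll y z u" using Q by (auto simp: quadr_def)
  have x: "x' \<in> lin y z" "x' \<in> lin u r" using x' coll_iff d by auto
  have L: "lin y z \<in> alg_lines" "lin u r \<in> alg_lines" using d by (auto simp: alg_lines_def)
  have "u \<notin> lin y z" using d coll_iff by auto
  then have "lin y z \<noteq> lin u r" using lin_mem[of u r] d by auto
  then have "lin y z \<inter> lin u r = {x'}" using line_unique[OF L] x by blast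
  then have "matroid_cl M {y, z} \<inter> matroid_cl M {u, r} = {x'}" using lin_cl[of y z] lin_cl[of u r] d(3) by simp
  then show "\<exists>u q r s. quadr y x z u q r s \<and> matroid_cl M {y, z} \<inter> matroid_cl M {u, r} = {x'}"
    using Q by blast
qed

lemma harmonic_step_eq:
  "harmonic_step M W = W \<union> {x \<in> alg_points F. \<exists>a\<in>W. \<exists>b\<in>W. \<exists>c\<in>W. hconj a c b x}"
  by (simp add: harmonic_step_def harmonic_conj_hconj ground_M)

lemma hconj_point: "hconj y z x x' \<Longrightarrow> x' \<in> alg_points F"
  using lines_subset by (auto simp: hconj_def coll_def)

text \<open>The steps increase, so three points of the closure appear together at some step.\<close>

lemma harmonic_closure_closed:
  assumes "y \<in> harmonic_closure M W" "z \<in> harmonic_closure M W" "x \<in> harmonic_closure M W" "hconj y z x x'"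
  shows "x' \<in> harmonic_closure M W"
proof -
  have mon: "(harmonic_step M ^^ m) W \<subseteq> (harmonic_step M ^^ n) W" if "m \<le> n" for m n
    using that by (rule lift_Suc_mono_le[rotated]) (auto simp: harmonic_step_eq)
  obtain i j k where ijk: "y \<in> (harmonic_step M ^^ i) W" "z \<in> (harmonic_step M ^^ j) W" "x \<in> (harmonic_step M ^^ k) W"
    using assms(1-3) by (auto simp: harmonic_closure_def)
  define n where "n = max i (max j k)"
  have "y \<in> (harmonic_step M ^^ n) W" "z \<in> (harmonic_step M ^^ n) W" "x \<in> (harmonic_step M ^^ n) W"
    using subsetD[OF mon ijk(1)] subsetD[OF mon ijk(2)] subsetD[OF mon ijk(3)] by (simp_all add: n_def)
  then have "x' \<in> harmonic_step M ((harmonic_step M ^^ n) W)"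
    using assms(4) hconj_point unfolding harmonic_step_eq by blast
  then have "x' \<in> (harmonic_step M ^^ Suc n) W" by simp
  then show ?thesis unfolding harmonic_closure_def by blast
qed

lemma harmonic_closure_least:
  assumes "W \<subseteq> V" "\<And>y z x x'. y \<in> V \<Longrightarrow> z \<in> V \<Longrightarrow> x \<in> V \<Longrightarrow> hconj y z x x' \<Longrightarrow> x' \<in> V"
  shows "harmonic_closure M W \<subseteq> V"
proof -
  have step: "harmonic_step M U \<subseteq> V" if "U \<subseteq> V" for U
    using that assms(2) lines_subset unfolding harmonic_step_eq by blast
  have "(harmonic_step M ^^ n) W \<subseteq> V" for n
  proof (induction n)
    case (Suc n)
    then show ?case using step by simp
  qed (use assms(1) in simp)
  then show ?thesis by (auto simp: harmonic_closure_def)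
qed

lemma harmonic_closure_base: "W \<subseteq> harmonic_closure M W"
proof
  fix x assume "x \<in> W"
  then have "x \<in> (harmonic_step M ^^ 0) W" by simp
  then show "x \<in> harmonic_closure M W" unfolding harmonic_closure_def by blast
qed

text \<open>
  Lines of the restriction are spanned by two of its points. So they are the traces of the
  ambient lines with at least two points in \<open>S\<close>.
\<close>

lemma matroid_lines_restrict:
  assumes S: "finite S" "S \<subseteq> alg_points F"
  shows "matroid_lines (matroid_restrict M S) = {l \<inter> S | l. l \<in> alg_lines \<and> (\<exists>a\<in>S. \<exists>b\<in>S. a \<noteq> b \<and> a \<in> l \<and> b \<in> l)}"
proof -
  let ?R = "matroid_restrict M S"
  have gr: "ground ?R = S" using S by (auto simp: matroid_restrict_def ground_M)
  have ind: "indep ?R I \<longleftrightarrow> I \<subseteq> S \<and> indep M I" for I by (simp add: matroid_restrict_def)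
  have rank: "matroid_rank ?R V = enat (rk (gen ` V))" if V: "V \<subseteq> S" for V
  proof -
    have "{I. I \<subseteq> V \<and> finite I \<and> indep ?R I} = {I. I \<subseteq> V \<and> finite I \<and> indep M I}" using V ind by auto
    then have "matroid_rank ?R V = matroid_rank M V" by (simp add: matroid_rank_def)
    moreover have "finite V" "V \<subseteq> alg_points F" using V S finite_subset by blast+
    ultimately show ?thesis using matroid_rank_M[of V] by simp
  qed
  have cl: "matroid_cl ?R V = {e \<in> S. gen e \<in> acl F (gen ` V)}" if V: "V \<subseteq> S" for V
  proof -
    have "matroid_cl ?R V = matroid_cl M V \<inter> S"
      unfolding matroid_cl_def gr ind ground_M using V S by auto
    moreover have "finite V" "V \<subseteq> alg_points F" using V S finite_subset by blast+
    ultimately show ?thesis using matroid_cl_M[of V] V S by auto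
  qed
  have two: "matroid_rank ?R V = 2 \<longleftrightarrow> rk (gen ` V) = 2" if "V \<subseteq> S" for V
    using rank[OF that] by (simp add: numeral_eq_enat)
  have pr: "rk {gen a, gen b} = 2" if "a \<in> S" "b \<in> S" "a \<noteq> b" for a b
    using rk_pair[of "gen a" "gen b"] gen(1)[of a] gen_nonparallel[of b a] that S by (auto simp: acl_0)
  show ?thesis
  proof (intro equalityI subsetI)
    fix m assume "m \<in> matroid_lines ?R"
    then have m: "m \<subseteq> S" "matroid_cl ?R m = m" "rk (gen ` m) = 2" using two gr by (auto simp: matroid_lines_def)
    have fm: "finite m" "m \<subseteq> alg_points F" using m S finite_subset by auto
    obtain I where I: "I \<subseteq> m" "independent (gen ` I)" "gen ` m \<subseteq> acl F (gen ` I)" "card I = 2"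
      using gen_image_basis[OF fm] m(3) by auto
    obtain a b where ab: "I = {a, b}" "a \<noteq> b" using I(4) by (auto simp: card_2_iff)
    have abS: "a \<in> S" "b \<in> S" "a \<in> alg_points F" "b \<in> alg_points F" using ab I m S by auto
    have "acl F (gen ` m) = acl F {gen a, gen b}"
      using cl_least[OF I(3)] mono[of "{gen a, gen b}" "gen ` m"] I(1) ab(1) by auto
    then have "m = lin a b \<inter> S" using m(2) cl[OF m(1)] S by (auto simp: lin_def)
    moreover have "lin a b \<in> alg_lines" using abS ab by (auto simp: alg_lines_def)
    moreover have "\<exists>a'\<in>S. \<exists>b'\<in>S. a' \<noteq> b' \<and> a' \<in> lin a b \<and> b' \<in> lin a b"
      using abS(1,2) ab(2) lin_mem[OF abS(3,4)] by (intro bexI[of _ a] bexI[of _ b]) simp_all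
    ultimately show "m \<in> {l \<inter> S | l. l \<in> alg_lines \<and> (\<exists>a\<in>S. \<exists>b\<in>S. a \<noteq> b \<and> a \<in> l \<and> b \<in> l)}"
      unfolding mem_Collect_eq by (intro exI[of _ "lin a b"] conjI)
  next
    fix m assume "m \<in> {l \<inter> S | l. l \<in> alg_lines \<and> (\<exists>a\<in>S. \<exists>b\<in>S. a \<noteq> b \<and> a \<in> l \<and> b \<in> l)}"
    then obtain l a b where l: "m = l \<inter> S" "l \<in> alg_lines" "a \<in> S" "b \<in> S" "a \<noteq> b" "a \<in> l" "b \<in> l" by blast
    have ab: "a \<in> alg_points F" "b \<in> alg_points F" using l S by auto
    have "lin a b \<in> alg_lines" using ab l(5) by (auto simp: alg_lines_def)
    then have ll: "l = lin a b" using line_unique[OF l(2) _ l(6,7)] lin_mem[OF ab] l(5) by blast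
    have mS: "m \<subseteq> S" using l by simp
    have sub: "gen ` m \<subseteq> acl F {gen a, gen b}" using l(1) ll by (auto simp: lin_def)
    have "{gen a, gen b} \<subseteq> gen ` m" using l by auto
    then have eq: "acl F (gen ` m) = acl F {gen a, gen b}" using cl_least[OF sub] mono by blast
    have "matroid_cl ?R m = m" unfolding cl[OF mS] eq using l(1) ll S by (auto simp: lin_def)
    moreover have "rk (gen ` m) = 2"
    proof -
      have fm: "finite (gen ` m)" using mS S finite_subset by blast
      have "rk (gen ` m) \<le> rk {gen a, gen b}" using fm sub by (intro rk_mono_cl) auto
      moreover have "rk {gen a, gen b} \<le> rk (gen ` m)" using fm l by (intro rk_mono) auto
      ultimately show ?thesis using pr[OF l(3-5)] by simp
    qed
    ultimately show "m \<in> matroid_lines ?R" using two[OF mS] mS gr by (simp add: matroid_lines_def)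
  qed
qed

text \<open>
  The plane built from columns contains the configuration, is reached from it by harmonic
  conjugation, and is closed under harmonic conjugation; so it is the harmonic closure.
\<close>

theorem config_closure_plane:
  fixes p :: nat
  assumes p: "prime p" "CHAR('a) = p" and c: "config p la lb lc A D B C"
    and S: "S = harmonic_closure M ({D} \<union> range A \<union> range B \<union> range C)"
    and L: "L = matroid_lines (matroid_restrict M S)"
  shows "desarguesian_plane S L" "plane_order L p"
proof -
  obtain G Ln where G: "G 0 = B" "G 1 = C"
    "\<And>n. Suc n < p \<Longrightarrow> config p la (Ln n) (Ln (Suc n)) A D (G n) (G (Suc n))"
    "\<And>n k v. Suc (Suc n) < p \<Longrightarrow> \<exists>l\<in>alg_lines. A k \<in> l \<and> G n (v - 2 * k) \<in> l \<and> G (Suc n) (v - k) \<in> l \<and> G (Suc (Suc n)) v \<in> l"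
    "\<And>n v. Suc (Suc n) < p \<Longrightarrow> hconj (A 0) (G (Suc n) v) (G n v) (G (Suc (Suc n)) v)"
    using all_columns[OF c p(1)] by blast
  interpret P: column_space "alg_points F" alg_lines p la A D G Ln
    by unfold_locales (use p(1) G(3-5) in auto)
  have p2: "p \<ge> 2" by (rule P.p2)
  have SS: "S = P.S"
  proof
    have base: "{D} \<union> range A \<union> range B \<union> range C \<subseteq> S" unfolding S by (rule harmonic_closure_base)
    show "P.S \<subseteq> S"
    proof (rule P.reached)
      show "D \<in> S" "\<And>i. A i \<in> S" "\<And>i. G 0 i \<in> S" "\<And>i. G 1 i \<in> S" using base G(1,2) by auto
      show "x' \<in> S" if "y \<in> S" "z \<in> S" "x \<in> S" "hconj y z x x'" for y z x x'
        using harmonic_closure_closed that unfolding S by blast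
    qed
    show "S \<subseteq> P.S"
      unfolding S
    proof (rule harmonic_closure_least)
      show "{D} \<union> range A \<union> range B \<union> range C \<subseteq> P.S"
        using P.in_S(1,2) P.in_S(3)[of 0] P.in_S(3)[of 1] p2 G(1,2) by auto
    qed (rule P.hconj_in_S)
  qed
  have Sfin: "finite S" "S \<subseteq> alg_points F" using P.finite_S P.S_subset SS by auto
  have LL: "L = (\<lambda>l. l \<inter> S) ` P.Ls"
    unfolding L matroid_lines_restrict[OF Sfin]
  proof (intro equalityI subsetI)
    fix m assume "m \<in> {l \<inter> S |l. l \<in> alg_lines \<and> (\<exists>a\<in>S. \<exists>b\<in>S. a \<noteq> b \<and> a \<in> l \<and> b \<in> l)}"
    then obtain l a b where l: "m = l \<inter> S" "l \<in> alg_lines" "a \<in> S" "b \<in> S" "a \<noteq> b" "a \<in> l" "b \<in> l" by blast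
    obtain k where k: "k \<in> P.Ls" "a \<in> k" "b \<in> k" using P.S_join[of a b] l(3-5) SS by blast
    then have "l = k" using line_unique[OF l(2) _ l(6,7) k(2,3) l(5)] P.Ls_subset by blast
    then show "m \<in> (\<lambda>l. l \<inter> S) ` P.Ls" using k l by blast
  next
    fix m assume "m \<in> (\<lambda>l. l \<inter> S) ` P.Ls"
    then obtain l where l: "l \<in> P.Ls" "m = l \<inter> S" by blast
    have "card (l \<inter> S) = p + 1" using P.card_line[OF l(1)] SS by simp
    then have ns: "\<not> l \<inter> S \<subseteq> {a}" for a using card_mono[of "{a}" "l \<inter> S"] p2 by auto
    obtain a where a: "a \<in> l \<inter> S" using ns[of undefined] by blast
    obtain b where b: "b \<in> l \<inter> S" "b \<noteq> a" using ns[of a] by blast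
    from a b show "m \<in> {l \<inter> S |l. l \<in> alg_lines \<and> (\<exists>a\<in>S. \<exists>b\<in>S. a \<noteq> b \<and> a \<in> l \<and> b \<in> l)}"
      using l P.Ls_subset by blast
  qed
  show "plane_order L p" unfolding plane_order_def LL using P.card_line SS by auto
  have uniq: "l = m" if "l \<in> P.Ls" "m \<in> P.Ls" "a \<in> l" "b \<in> l" "a \<in> m" "b \<in> m" "a \<noteq> b" for l m a b
    using line_unique[of l m a b] P.Ls_subset that by blast
  have "projective_plane S L"
    unfolding projective_plane_def
  proof (intro conjI ballI impI)
    show "L \<subseteq> Pow S" unfolding LL by auto
    fix a b assume ab: "a \<in> S" "b \<in> S" "a \<noteq> b"
    obtain l where l: "l \<in> P.Ls" "a \<in> l" "b \<in> l" using P.S_join[of a b] ab SS by blast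
    show "\<exists>!l. l \<in> L \<and> a \<in> l \<and> b \<in> l"
    proof (rule ex1I[of _ "l \<inter> S"])
      show "l \<inter> S \<in> L \<and> a \<in> l \<inter> S \<and> b \<in> l \<inter> S" using l ab LL by blast
      fix m assume m: "m \<in> L \<and> a \<in> m \<and> b \<in> m"
      then obtain k where k: "k \<in> P.Ls" "m = k \<inter> S" using LL by blast
      then show "m = l \<inter> S" using uniq[OF k(1) l(1), of a b] l m ab(3) by blast
    qed
  next
    fix l m assume lm: "l \<in> L" "m \<in> L" "l \<noteq> m"
    obtain l' where l': "l' \<in> P.Ls" "l = l' \<inter> S" using lm LL by blast
    obtain m' where m': "m' \<in> P.Ls" "m = m' \<inter> S" using lm LL by blast
    obtain x where x: "x \<in> S" "x \<in> l'" "x \<in> m'" using P.Ls_meet[OF l'(1) m'(1)] SS by blast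
    show "\<exists>!a. a \<in> l \<and> a \<in> m"
    proof (rule ex1I[of _ x])
      show "x \<in> l \<and> x \<in> m" using x l' m' by blast
      fix y assume "y \<in> l \<and> y \<in> m"
      then show "y = x" using uniq[OF l'(1) m'(1), of y x] l' m' x lm(3) by blast
    qed
  next
    obtain Q where Q: "Q \<subseteq> P.S" "card Q = 4" "\<forall>l\<in>P.Ls. card (Q \<inter> l) \<le> 2" using P.quadrangle by blast
    have "Q \<inter> (l \<inter> S) = Q \<inter> l" for l using Q(1) SS by blast
    then show "\<exists>Q\<subseteq>S. card Q = 4 \<and> (\<forall>l\<in>L. card (Q \<inter> l) \<le> 2)"
      using Q SS LL by (intro exI[of _ Q]) auto
  qed
  moreover have "desargues S L"
  proof -
    obtain vec :: "'a set \<Rightarrow> 'a \<times> 'a \<times> 'a" and cov where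
      v: "\<forall>x\<in>P.S. vec x \<noteq> (0, 0, 0)" "\<forall>l\<in>P.Ls. cov l \<noteq> (0, 0, 0)"
      "\<forall>x\<in>P.S. \<forall>l\<in>P.Ls. x \<in> l \<longleftrightarrow> dot3 (cov l) (vec x) = 0"
      using P.coordinates[OF p(2)] by blast
    define ext where "ext = (\<lambda>m. SOME l. l \<in> P.Ls \<and> m = l \<inter> S)"
    have ext: "ext m \<in> P.Ls" "m = ext m \<inter> S" if "m \<in> L" for m
    proof -
      have "\<exists>l. l \<in> P.Ls \<and> m = l \<inter> S" using that LL by blast
      from someI_ex[OF this] show "ext m \<in> P.Ls" "m = ext m \<inter> S" by (simp_all add: ext_def)
    qed
    show ?thesis
    proof (rule coordinates_desargues[OF \<open>projective_plane S L\<close>, of vec "\<lambda>m. cov (ext m)"])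
      show "vec x \<noteq> (0, 0, 0)" if "x \<in> S" for x using v(1) that SS by blast
      show "cov (ext l) \<noteq> (0, 0, 0)" if "l \<in> L" for l using v(2) ext[OF that] by blast
      show "x \<in> l \<longleftrightarrow> dot3 (cov (ext l)) (vec x) = 0" if "x \<in> S" "l \<in> L" for x l
        using v(3) ext[OF that(2)] that(1) SS by blast
    qed
  qed
  ultimately show "desarguesian_plane S L" by (simp add: desarguesian_plane_def)
qed

end

section \<open>Points of the projective plane modulo a prime\<close>

lemma hpoint_eqI:
  assumes p: "prime p" and t: "\<not> int p dvd t"
    and e: "int p dvd x' - t * x" "int p dvd y' - t * y" "int p dvd z' - t * z"
  shows "hpoint p x' y' z' = hpoint p x y z"
proof -
  have sub: "hpoint p x' y' z' \<subseteq> hpoint p x y z"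
    if t: "\<not> int p dvd t" and e: "int p dvd x' - t * x" "int p dvd y' - t * y" "int p dvd z' - t * z"
    for t x y z x' y' z'
  proof
    fix v assume "v \<in> hpoint p x' y' z'"
    then obtain s where s: "\<not> int p dvd s" "v = (s * x' mod int p, s * y' mod int p, s * z' mod int p)"
      by (auto simp: hpoint_def)
    have m: "s * a' mod int p = (s * t) * a mod int p" if "int p dvd a' - t * a" for a a'
    proof -
      have "s * a' - s * t * a = s * (a' - t * a)" by (simp add: algebra_simps)
      then have "int p dvd s * a' - s * t * a" using that by simp
      then show ?thesis by (simp add: mod_eq_dvd_iff)
    qed
    have "prime (int p)" using p by simp
    then have "\<not> int p dvd s * t" using s(1) t by (simp add: prime_dvd_mult_iff)
    then show "v \<in> hpoint p x y z" unfolding hpoint_def using s(2) m[OF e(1)] m[OF e(2)] m[OF e(3)] by blast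
  qed
  obtain s where s: "int p dvd t * s - 1" using prime_solve_mod[OF p t] by blast
  have s0: "\<not> int p dvd s"
  proof
    assume "int p dvd s"
    then have "int p dvd t * s" by simp
    then have "int p dvd 1" using s by (metis dvd_diffD1 dvd_diff_commute dvd_minus_iff diff_diff_eq2 add_diff_cancel_left' dvd_diff)
    then show False using p by (simp add: prime_nat_iff)
  qed
  have b: "int p dvd a - s * a'" if "int p dvd a' - t * a" for a a'
  proof -
    have "a - s * a' = - (s * (a' - t * a)) - a * (t * s - 1)" by (simp add: algebra_simps)
    then show ?thesis using that s by simp
  qed
  show ?thesis using sub[OF t e] sub[OF s0 b[OF e(1)] b[OF e(2)] b[OF e(3)]] by blast
qed

lemma hpoint_self: "prime p \<Longrightarrow> (x mod int p, y mod int p, z mod int p) \<in> hpoint p x y z"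
  unfolding hpoint_def by (intro CollectI exI[of _ 1]) (simp add: prime_nat_iff)

lemma hpointE:
  assumes "v \<in> hpoint p x y z"
  obtains t where "\<not> int p dvd t" "v = (t * x mod int p, t * y mod int p, t * z mod int p)"
  using assms by (auto simp: hpoint_def)

lemma hpoint_eqD:
  assumes p: "prime p" and e: "hpoint p x y z = hpoint p x' y' z'"
  shows "\<exists>t. \<not> int p dvd t \<and> int p dvd x' - t * x \<and> int p dvd y' - t * y \<and> int p dvd z' - t * z"
proof -
  have "(x' mod int p, y' mod int p, z' mod int p) \<in> hpoint p x y z" unfolding e by (rule hpoint_self[OF p])
  then show ?thesis by (elim hpointE) (auto simp: mod_eq_dvd_iff)
qed

lemma hpoint_member:
  assumes p: "prime p" and v: "v \<in> hpoint p x y z"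
  shows "hpoint p (fst v) (fst (snd v)) (snd (snd v)) = hpoint p x y z"
proof -
  obtain t where t: "\<not> int p dvd t" "v = (t * x mod int p, t * y mod int p, t * z mod int p)"
    using v by (rule hpointE)
  have "int p dvd (a mod int p) - a" for a by (simp add: mod_eq_dvd_iff[symmetric])
  then show ?thesis using t by (intro hpoint_eqI[OF p t(1)]) auto
qed

definition pg_points :: "nat \<Rightarrow> (int \<times> int \<times> int) set set" where
  "pg_points p = {hpoint p x y z | x y z. \<not> (int p dvd x \<and> int p dvd y \<and> int p dvd z)}"

definition Lp_points :: "nat \<Rightarrow> (int \<times> int \<times> int) set set" where
  "Lp_points p = range (\<lambda>i. hpoint p 0 i 1) \<union> range (\<lambda>i. hpoint p 1 i 1) \<union> range (\<lambda>i. hpoint p 1 i 0) \<union> {hpoint p 0 1 0}"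

lemma Lp_points_pg: "prime p \<Longrightarrow> Lp_points p \<subseteq> pg_points p"
proof -
  assume "prime p"
  then have "\<not> int p dvd 1" by (simp add: prime_nat_iff)
  moreover have "hpoint p x y z \<in> pg_points p" if "\<not> (int p dvd x \<and> int p dvd y \<and> int p dvd z)" for x y z
    unfolding pg_points_def using that by blast
  ultimately show ?thesis unfolding Lp_points_def by auto
qed

lemma hpoint_mod: "prime p \<Longrightarrow> hpoint p a (i mod int p) b = hpoint p a i b"
  by (rule hpoint_eqI[of p 1]) (auto simp: prime_nat_iff mod_eq_dvd_iff[symmetric])

lemma Lp_points_eq:
  assumes p: "prime p"
  shows "(\<Union>i\<in>{0..<int p}. {hpoint p 0 i 1, hpoint p 1 i 1, hpoint p 1 i 0}) \<union> {hpoint p 0 1 0} = Lp_points p"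
proof -
  have "hpoint p a i b \<in> (\<lambda>i. hpoint p a i b) ` {0..<int p}" for a i b
    using hpoint_mod[OF p, of a i b] p prime_gt_0_nat[OF p]
    by (intro image_eqI[of _ _ "i mod int p"]) auto
  then have "range (\<lambda>i. hpoint p a i b) = (\<lambda>i. hpoint p a i b) ` {0..<int p}" for a b by blast
  then show ?thesis unfolding Lp_points_def by auto
qed

lemma Lp_ground:
  assumes p: "prime p"
  shows "ground (Lp p) = Lp_points p"
    "I \<subseteq> Lp_points p \<Longrightarrow> indep (Lp p) I \<longleftrightarrow> transversal_indep (lin_indep_mod p) I"
    "finite (Lp_points p)"
proof -
  have L: "Lp p = matroid_restrict (PG2 p) (Lp_points p)" unfolding Lp_def Lp_points_eq[OF p] ..
  have E: "PG2 p = \<lparr>ground = pg_points p, indep = (\<lambda>Q. Q \<subseteq> pg_points p \<and> transversal_indep (lin_indep_mod p) Q)\<rparr>"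
    by (simp add: PG2_def pg_points_def Let_def)
  show "ground (Lp p) = Lp_points p" using Lp_points_pg[OF p] by (auto simp: L E matroid_restrict_def)
  show "I \<subseteq> Lp_points p \<Longrightarrow> indep (Lp p) I \<longleftrightarrow> transversal_indep (lin_indep_mod p) I"
    using Lp_points_pg[OF p] by (auto simp: L E matroid_restrict_def)
  show "finite (Lp_points p)" unfolding Lp_points_eq[OF p, symmetric] by auto
qed

lemma sum_three: "a \<noteq> b \<Longrightarrow> a \<noteq> c \<Longrightarrow> b \<noteq> c \<Longrightarrow> (\<Sum>v\<in>{a, b, c}. f v) = f a + f b + (f c :: int)"
  by simp

text \<open>
  Representatives may be arbitrary multiples \<open>t\<^sub>i\<close> of the given vectors, so
  the coefficients of the relation are divided by \<open>t\<^sub>i\<close> modulo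
  \<open>p\<close>. The first one stays nonzero.
\<close>

lemma dependent_hpoints:
  assumes p: "prime p" and d: "distinct [P1, P2, P3]"
    and P: "P1 = hpoint p x1 y1 z1" "P2 = hpoint p x2 y2 z2" "P3 = hpoint p x3 y3 z3"
    and c: "\<not> int p dvd c1"
    and r: "c1 * x1 + c2 * x2 + c3 * x3 = 0" "c1 * y1 + c2 * y2 + c3 * y3 = 0" "c1 * z1 + c2 * z2 + c3 * z3 = 0"
  shows "\<not> transversal_indep (lin_indep_mod p) {P1, P2, P3}"
proof
  assume "transversal_indep (lin_indep_mod p) {P1, P2, P3}"
  then obtain g where g: "inj_on g {P1, P2, P3}" "g P1 \<in> P1" "g P2 \<in> P2" "g P3 \<in> P3"
    "lin_indep_mod p {g P1, g P2, g P3}" by (auto simp: transversal_indep_def)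
  have gd: "g P1 \<noteq> g P2" "g P1 \<noteq> g P3" "g P2 \<noteq> g P3" using g(1) d by (auto simp: inj_on_def)
  obtain t1 where t1: "\<not> int p dvd t1" "g P1 = (t1 * x1 mod int p, t1 * y1 mod int p, t1 * z1 mod int p)"
    using g(2) P(1) hpointE by metis
  obtain t2 where t2: "\<not> int p dvd t2" "g P2 = (t2 * x2 mod int p, t2 * y2 mod int p, t2 * z2 mod int p)"
    using g(3) P(2) hpointE by metis
  obtain t3 where t3: "\<not> int p dvd t3" "g P3 = (t3 * x3 mod int p, t3 * y3 mod int p, t3 * z3 mod int p)"
    using g(4) P(3) hpointE by metis
  obtain k1 where k1: "int p dvd t1 * k1 - c1" using prime_solve_mod[OF p t1(1)] by blast
  obtain k2 where k2: "int p dvd t2 * k2 - c2" using prime_solve_mod[OF p t2(1)] by blast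
  obtain k3 where k3: "int p dvd t3 * k3 - c3" using prime_solve_mod[OF p t3(1)] by blast
  define k where "k = (\<lambda>v. if v = g P1 then k1 else if v = g P2 then k2 else k3)"
  have kk: "k (g P1) = k1" "k (g P2) = k2" "k (g P3) = k3" using gd by (auto simp: k_def)
  have scaled: "int p dvd k' * (t' * a mod int p) - c' * a" if "int p dvd t' * k' - c'" for k' t' c' a
  proof -
    have "k' * (t' * a mod int p) - c' * a = k' * (t' * a mod int p - t' * a) + a * (t' * k' - c')"
      by (simp add: algebra_simps)
    moreover have "int p dvd t' * a mod int p - t' * a" by (simp add: mod_eq_dvd_iff[symmetric])
    ultimately show ?thesis using that by simp
  qed
  have all: "int p dvd k1 * (t1 * a1 mod int p) + k2 * (t2 * a2 mod int p) + k3 * (t3 * a3 mod int p)"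
    if "c1 * a1 + c2 * a2 + c3 * a3 = 0" for a1 a2 a3
  proof -
    have "int p dvd (k1 * (t1 * a1 mod int p) - c1 * a1) + (k2 * (t2 * a2 mod int p) - c2 * a2) + (k3 * (t3 * a3 mod int p) - c3 * a3)"
      by (intro dvd_add scaled k1 k2 k3)
    moreover have "(k1 * (t1 * a1 mod int p) - c1 * a1) + (k2 * (t2 * a2 mod int p) - c2 * a2) + (k3 * (t3 * a3 mod int p) - c3 * a3)
      = k1 * (t1 * a1 mod int p) + k2 * (t2 * a2 mod int p) + k3 * (t3 * a3 mod int p) - (c1 * a1 + c2 * a2 + c3 * a3)" by simp
    ultimately show ?thesis using that by simp
  qed
  have "\<forall>v\<in>{g P1, g P2, g P3}. int p dvd k v"
  proof (rule g(5)[unfolded lin_indep_mod_def sum_three[OF gd], THEN conjunct2, THEN spec, of k, THEN mp], intro conjI)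
    show "int p dvd k (g P1) * fst (g P1) + k (g P2) * fst (g P2) + k (g P3) * fst (g P3)"
      unfolding kk using all[OF r(1)] by (simp add: t1(2) t2(2) t3(2))
    show "int p dvd k (g P1) * fst (snd (g P1)) + k (g P2) * fst (snd (g P2)) + k (g P3) * fst (snd (g P3))"
      unfolding kk using all[OF r(2)] by (simp add: t1(2) t2(2) t3(2))
    show "int p dvd k (g P1) * snd (snd (g P1)) + k (g P2) * snd (snd (g P2)) + k (g P3) * snd (snd (g P3))"
      unfolding kk using all[OF r(3)] by (simp add: t1(2) t2(2) t3(2))
  qed
  then have "int p dvd k1" using kk(1) by force
  then have "int p dvd t1 * k1" by simp
  from dvd_diff[OF this k1] have "int p dvd c1" by simp
  then show False using c by simp
qed

lemma independent_hpoints: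
  assumes "distinct [P1, P2, P3]" "v1 \<in> P1" "v2 \<in> P2" "v3 \<in> P3" "distinct [v1, v2, v3]" "lin_indep_mod p {v1, v2, v3}"
  shows "transversal_indep (lin_indep_mod p) {P1, P2, P3}"
  unfolding transversal_indep_def
  by (rule exI[of _ "\<lambda>P. if P = P1 then v1 else if P = P2 then v2 else v3"])
    (use assms in \<open>simp add: inj_on_def; auto\<close>)

section \<open>Embeddings of \<open>L\<^sub>p\<close>\<close>

context full_algebraic
begin

text \<open>
  An embedding preserves dependence, and three distinct points are dependent if and only if they
  are collinear.
\<close>

lemma embedding_dependent:
  assumes f: "matroid_embedding f (Lp p) M" and p: "prime p"
    and d: "distinct [P1, P2, P3]" "{P1, P2, P3} \<subseteq> Lp_points p"
  shows "coll (f P1) (f P2) (f P3) \<longleftrightarrow> \<not> transversal_indep (lin_indep_mod p) {P1, P2, P3}"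
proof -
  note G = Lp_ground[OF p]
  have inj: "inj_on f (Lp_points p)" and pts: "f ` Lp_points p \<subseteq> alg_points F"
    and ind: "\<And>I. I \<subseteq> Lp_points p \<Longrightarrow> indep (Lp p) I \<longleftrightarrow> indep M (f ` I)"
    using f unfolding matroid_embedding_def G(1) ground_M by auto
  have fp: "f P1 \<in> alg_points F" "f P2 \<in> alg_points F" "f P3 \<in> alg_points F" using pts d(2) by auto
  have fd: "f P1 \<noteq> f P2" "f P1 \<noteq> f P3" "f P2 \<noteq> f P3"
    using d by (simp_all add: inj_on_eq_iff[OF inj])
  have "transversal_indep (lin_indep_mod p) {P1, P2, P3} \<longleftrightarrow> indep M {f P1, f P2, f P3}"
    using G(2)[OF d(2)] ind[OF d(2)] by simp
  also have "\<dots> \<longleftrightarrow> independent {gen (f P3), gen (f P1), gen (f P2)}"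
    using indep_M[of "{f P1, f P2, f P3}"] fp by (simp add: insert_commute)
  also have "\<dots> \<longleftrightarrow> gen (f P3) \<notin> acl F {gen (f P1), gen (f P2)}"
  proof -
    have "independent {gen (f P1), gen (f P2)}"
      using independent_insert[of "{gen (f P2)}" "gen (f P1)"] independent_singleton gen(1)[OF fp(2)]
        gen_nonparallel[OF fp(1,2) fd(1)] by simp
    moreover have "gen (f P3) \<notin> {gen (f P1), gen (f P2)}" using fd fp gen_eq_iff by simp
    ultimately show ?thesis using independent_insert_iff by simp
  qed
  finally show ?thesis using coll_iff[OF fp(1,2) fd(1)] fp(3) by (simp add: lin_def)
qed

text \<open>
  The collinear triples come from \<open>A i + B j = C (i + j)\<close> and, for the columns,
  from \<open>[a, i, b] - [a, 0, b] = i D\<close>. The three columns are different because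
  \<open>D\<close> and the first points of two columns form a basis.
\<close>

lemma embedding_config:
  assumes f: "matroid_embedding f (Lp p) M" and p: "prime p"
  shows "\<exists>la lb lc. config p la lb lc (\<lambda>i. f (hpoint p 0 i 1)) (f (hpoint p 0 1 0)) (\<lambda>i. f (hpoint p 1 i 0)) (\<lambda>i. f (hpoint p 1 i 1))"
proof -
  note G = Lp_ground[OF p]
  have inj: "inj_on f (Lp_points p)" and pts: "f ` Lp_points p \<subseteq> alg_points F"
    using f unfolding matroid_embedding_def G(1) ground_M by auto
  define D where "D = hpoint p 0 1 0"
  define A where "A = (\<lambda>i. hpoint p 0 i 1)"
  define B where "B = (\<lambda>i. hpoint p 1 i 0)"
  define C where "C = (\<lambda>i. hpoint p 1 i 1)"
  have mem: "D \<in> Lp_points p" "A i \<in> Lp_points p" "B i \<in> Lp_points p" "C i \<in> Lp_points p" for i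
    by (auto simp: Lp_points_def A_def B_def C_def D_def)
  have n1: "\<not> int p dvd 1" using p by (simp add: prime_nat_iff)
  have feq: "f P = f Q \<longleftrightarrow> P = Q" if "P \<in> Lp_points p" "Q \<in> Lp_points p" for P Q
    using inj that by (auto simp: inj_on_def)
  have same: "hpoint p a i b = hpoint p a j b \<longleftrightarrow> int p dvd i - j" if ab: "a = 1 \<or> b = 1" for a b i j
  proof
    assume "hpoint p a i b = hpoint p a j b"
    then obtain t where t: "int p dvd a - t * a" "int p dvd j - t * i" "int p dvd b - t * b"
      using hpoint_eqD[OF p] by blast
    have t1: "int p dvd 1 - t" using ab t by auto
    have "int p dvd (j - t * i) - i * (1 - t)" by (intro dvd_diff dvd_mult t1 t(2))
    moreover have "(j - t * i) - i * (1 - t) = j - i" by (simp add: algebra_simps)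
    ultimately have "int p dvd j - i" by (simp only:)
    then show "int p dvd i - j" by (simp add: dvd_diff_commute)
  next
    assume "int p dvd i - j"
    then show "hpoint p a i b = hpoint p a j b" by (intro hpoint_eqI[OF p n1]) auto
  qed
  have ne: "A i \<noteq> D" "B i \<noteq> D" "C i \<noteq> D" "A i \<noteq> B j" "A i \<noteq> C j" "B i \<noteq> C j" for i j
    using n1 hpoint_eqD[OF p] unfolding A_def B_def C_def D_def by (force dest!: hpoint_eqD[OF p])+
  have dep: "coll (f P1) (f P2) (f P3)"
    if "distinct [P1, P2, P3]" "{P1, P2, P3} \<subseteq> Lp_points p" "\<not> transversal_indep (lin_indep_mod p) {P1, P2, P3}" for P1 P2 P3
    using embedding_dependent[OF f p that(1,2)] that(3) by simp
  have trans: "coll (f (A i)) (f (B j)) (f (C (i + j)))" for i j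
  proof (rule dep)
    show "\<not> transversal_indep (lin_indep_mod p) {A i, B j, C (i + j)}"
      by (rule dependent_hpoints[OF p _ A_def[THEN fun_cong] B_def[THEN fun_cong] C_def[THEN fun_cong],
          where ?c1.0 = 1 and ?c2.0 = 1 and ?c3.0 = "-1"])
        (use ne n1 in auto)
  qed (use ne mem in auto)
  have col: "coll (f D) (f (hpoint p a 0 b)) (f (hpoint p a i b))"
    if "a = 1 \<or> b = 1" "\<And>j. hpoint p a j b \<in> Lp_points p" "\<And>j. hpoint p a j b \<noteq> D" for a b i
  proof (cases "hpoint p a i b = hpoint p a 0 b")
    case True
    have "f D \<noteq> f (hpoint p a 0 b)" using feq mem(1) that(2,3) by metis
    then show ?thesis using line_exists[of "f D" "f (hpoint p a 0 b)"] pts mem(1) that(2)[of 0] True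
      by (auto simp: coll_def)
  next
    case False
    have "coll (f (hpoint p a 0 b)) (f (hpoint p a i b)) (f D)"
    proof (rule dep)
      show "\<not> transversal_indep (lin_indep_mod p) {hpoint p a 0 b, hpoint p a i b, D}"
        by (rule dependent_hpoints[OF p _ refl refl D_def,
          where ?c1.0 = 1 and ?c2.0 = "-1" and ?c3.0 = i]) (use False that(3) n1 in auto)
    qed (use False that(2,3) mem(1) in auto)
    then show ?thesis by (auto simp: coll_def)
  qed
  have column: "\<exists>l\<in>alg_lines. f D \<in> l \<and> (\<forall>i. f (hpoint p a i b) \<in> l)"
    if ab: "a = 1 \<or> b = 1" "\<And>j. hpoint p a j b \<in> Lp_points p" "\<And>j. hpoint p a j b \<noteq> D" for a b
  proof -
    have nD: "f D \<noteq> f (hpoint p a 0 b)" using feq mem(1) that(2,3) by metis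
    obtain l where l: "l \<in> alg_lines" "f D \<in> l" "f (hpoint p a 0 b) \<in> l"
      using line_exists[of "f D" "f (hpoint p a 0 b)"] pts mem(1) ab(2)[of 0] nD by auto
    then show ?thesis using coll_line[OF col[OF ab] nD l] by blast
  qed
  obtain la where la: "la \<in> alg_lines" "f D \<in> la" "\<And>i. f (A i) \<in> la"
    using column[of 0 1] mem(2) ne(1) unfolding A_def by auto
  obtain lb where lb: "lb \<in> alg_lines" "f D \<in> lb" "\<And>i. f (B i) \<in> lb"
    using column[of 1 0] mem(3) ne(2) unfolding B_def by auto
  obtain lc where lc: "lc \<in> alg_lines" "f D \<in> lc" "\<And>i. f (C i) \<in> lc"
    using column[of 1 1] mem(4) ne(3) unfolding C_def by auto
  have q1: "1 mod int p = 1" using prime_gt_1_nat[OF p] by simp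
  have Dv: "(0, 1, 0) \<in> D" using hpoint_self[OF p, of 0 1 0] by (simp add: D_def q1)
  have Av: "(0, 0, 1) \<in> A 0" using hpoint_self[OF p, of 0 0 1] by (simp add: A_def q1)
  have Bv: "(1, 0, 0) \<in> B 0" using hpoint_self[OF p, of 1 0 0] by (simp add: B_def q1)
  have Cv: "(1, 0, 1) \<in> C 0" using hpoint_self[OF p, of 1 0 1] by (simp add: C_def q1)
  have indep: "\<not> coll (f P1) (f P2) (f P3)"
    if "distinct [P1, P2, P3]" "{P1, P2, P3} \<subseteq> Lp_points p" "transversal_indep (lin_indep_mod p) {P1, P2, P3}" for P1 P2 P3
    using embedding_dependent[OF f p that(1,2)] that(3) by simp
  have "\<not> coll (f D) (f (A 0)) (f (B 0))"
    by (rule indep; (rule independent_hpoints[OF _ Dv Av Bv])?)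
      (use ne mem in \<open>auto simp: lin_indep_mod_def dvd_add_left_iff dvd_add_right_iff\<close>)
  then have ab: "la \<noteq> lb" using la lb collI by blast
  have "\<not> coll (f D) (f (A 0)) (f (C 0))"
    by (rule indep; (rule independent_hpoints[OF _ Dv Av Cv])?)
      (use ne mem in \<open>auto simp: lin_indep_mod_def dvd_add_left_iff dvd_add_right_iff\<close>)
  then have ac: "la \<noteq> lc" using la lc collI by blast
  have "\<not> coll (f D) (f (B 0)) (f (C 0))"
    by (rule indep; (rule independent_hpoints[OF _ Dv Bv Cv])?)
      (use ne mem in \<open>auto simp: lin_indep_mod_def dvd_add_left_iff dvd_add_right_iff\<close>)
  then have bc: "lb \<noteq> lc" using lb lc collI by blast
  have "config p la lb lc (\<lambda>i. f (A i)) (f D) (\<lambda>i. f (B i)) (\<lambda>i. f (C i))"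
    unfolding config_def
  proof (intro conjI allI)
    fix i j
    show "f (A i) = f (A j) \<longleftrightarrow> int p dvd i - j" using feq mem(2) same[of 0 1] by (simp add: A_def)
    show "f (B i) = f (B j) \<longleftrightarrow> int p dvd i - j" using feq mem(3) same[of 1 0] by (simp add: B_def)
    show "f (C i) = f (C j) \<longleftrightarrow> int p dvd i - j" using feq mem(4) same[of 1 1] by (simp add: C_def)
    show "coll (f (A i)) (f (B j)) (f (C (i + j)))" by (rule trans)
    show "f (A i) \<noteq> f D" "f (B i) \<noteq> f D" "f (C i) \<noteq> f D" using feq mem ne by auto
  qed (use la lb lc ab ac bc in auto)
  then show ?thesis unfolding A_def B_def C_def D_def by blast
qed

end

section \<open>The linear embedding\<close>

context full_algebraic
begin

lemma prime_field:
  assumes p: "prime p" "CHAR('a) = p"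
  shows "is_subfield (range of_int :: 'a set)"
  unfolding is_subfield_def
proof (intro conjI ballI)
  show "0 \<in> range (of_int :: int \<Rightarrow> 'a)" "1 \<in> range (of_int :: int \<Rightarrow> 'a)"
    by (auto intro: range_eqI[of _ _ 0] range_eqI[of _ _ 1])
  fix u :: 'a assume "u \<in> range of_int"
  then obtain i where i: "u = of_int i" by blast
  show "- u \<in> range of_int" unfolding i by (rule range_eqI[of _ _ "- i"]) simp
  show "inverse u \<in> range of_int"
  proof (cases "u = 0")
    case False
    then have "\<not> int p dvd i" using p(2) by (simp add: i of_int_eq_0_iff_char_dvd)
    then obtain j where "int p dvd i * j - 1" using prime_solve_mod[OF p(1)] by blast
    then have "(of_int (i * j - 1) :: 'a) = 0" using p(2) by (simp only: of_int_eq_0_iff_char_dvd)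
    then have "u * of_int j = 1" by (simp add: i)
    then have "inverse u = of_int j" by (rule inverse_unique)
    then show ?thesis by blast
  qed (auto intro: range_eqI[of _ _ 0])
  fix v :: 'a assume "v \<in> range of_int"
  then obtain j where j: "v = of_int j" by blast
  show "u + v \<in> range of_int" unfolding i j by (rule range_eqI[of _ _ "i + j"]) simp
  show "u * v \<in> range of_int" unfolding i j by (rule range_eqI[of _ _ "i * j"]) simp
qed

definition form :: "'a \<Rightarrow> 'a \<Rightarrow> 'a \<Rightarrow> int \<times> int \<times> int \<Rightarrow> 'a" where
  "form x y z v = of_int (fst v) * x + of_int (fst (snd v)) * y + of_int (snd (snd v)) * z"

lemma acl_ops:
  "a \<in> acl F V \<Longrightarrow> b \<in> acl F V \<Longrightarrow> a + b \<in> acl F V" "a \<in> acl F V \<Longrightarrow> b \<in> acl F V \<Longrightarrow> a * b \<in> acl F V"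
  "a \<in> acl F V \<Longrightarrow> - a \<in> acl F V" "a \<in> acl F V \<Longrightarrow> b \<in> acl F V \<Longrightarrow> a / b \<in> acl F V" "of_int k \<in> acl F V"
proof -
  have sf: "is_subfield (acl F V)" by (rule alg_closed_subfield_is_subfield[OF acl_closed])
  show add: "a \<in> acl F V \<Longrightarrow> b \<in> acl F V \<Longrightarrow> a + b \<in> acl F V" for a b using sf unfolding is_subfield_def by blast
  show "a \<in> acl F V \<Longrightarrow> b \<in> acl F V \<Longrightarrow> a * b \<in> acl F V" using sf unfolding is_subfield_def by blast
  show neg: "a \<in> acl F V \<Longrightarrow> - a \<in> acl F V" for a using sf unfolding is_subfield_def by blast
  show "a \<in> acl F V \<Longrightarrow> b \<in> acl F V \<Longrightarrow> a / b \<in> acl F V" by (rule is_subfield_divide[OF sf])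
  have sr: "is_subring (acl F V)" by (rule is_subfield_is_subring[OF sf])
  have nat: "of_nat n \<in> acl F V" for n
  proof (induction n)
    case 0 show ?case using sf by (simp add: is_subfield_def)
  next
    case (Suc n)
    have "1 + of_nat n \<in> acl F V" by (rule add) (use Suc sf in \<open>simp_all add: is_subfield_def\<close>)
    then show ?case by simp
  qed
  show "of_int k \<in> acl F V"
  proof (cases k rule: int_cases2)
    case (nonneg n) then show ?thesis using nat[of n] by simp
  next
    case (nonpos n) then show ?thesis using neg[OF nat[of n]] by simp
  qed
qed

lemma acl_sum: "(\<And>i. i \<in> I \<Longrightarrow> f i \<in> acl F V) \<Longrightarrow> sum f I \<in> acl F V"
  by (intro is_subring_sum is_subfield_is_subring alg_closed_subfield_is_subfield acl_closed)

lemma lspan_acl: "lspan (range of_int) V \<subseteq> acl F V"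
proof
  fix u assume "u \<in> lspan (range of_int) V"
  then show "u \<in> acl F V"
    by (induction rule: lspan.induct) (use acl_ops acl_ops(5)[of 0] in_cl in auto)
qed

lemma solve_linear: "a * x + b = 0 \<Longrightarrow> a \<noteq> 0 \<Longrightarrow> x = - b / (a :: 'a)"
  by (simp add: field_simps eq_neg_iff_add_eq_0)

text \<open>
  A nontrivial linear relation would express one of \<open>x, y, z\<close> by the others.
\<close>

lemma form_zero:
  assumes p: "CHAR('a) = p" and ind: "independent {x, y, z}" and d: "distinct [x, y, z]" and 0: "form x y z v = 0"
  shows "int p dvd fst v" "int p dvd fst (snd v)" "int p dvd snd (snd v)"
proof -
  have *: "int p dvd a" if "of_int a * t + (of_int b * s + of_int c * r) = (0 :: 'a)" "t \<notin> acl F {s, r}" for a b c t s r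
  proof (rule ccontr)
    assume "\<not> int p dvd a"
    then have "(of_int a :: 'a) \<noteq> 0" using p by (simp add: of_int_eq_0_iff_char_dvd)
    then have "t = - (of_int b * s + of_int c * r) / of_int a" using solve_linear that(1) by blast
    also have "\<dots> \<in> acl F {s, r}" by (intro acl_ops) (auto intro: in_cl)
    finally show False using that(2) by simp
  qed
  have n: "x \<notin> acl F {y, z}" "y \<notin> acl F {x, z}" "z \<notin> acl F {x, y}"
  proof -
    have "{x, y, z} - {x} = {y, z}" "{x, y, z} - {y} = {x, z}" "{x, y, z} - {z} = {x, y}" using d by auto
    then show "x \<notin> acl F {y, z}" "y \<notin> acl F {x, z}" "z \<notin> acl F {x, y}" using ind unfolding independent_def by auto
  qed
  show "int p dvd fst v" by (rule *[OF _ n(1)]) (use 0 in \<open>simp add: form_def add.assoc\<close>)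
  show "int p dvd fst (snd v)" by (rule *[where c = "snd (snd v)" and b = "fst v", OF _ n(2)]) (use 0 in \<open>simp add: form_def algebra_simps\<close>)
  show "int p dvd snd (snd v)" by (rule *[where c = "fst (snd v)" and b = "fst v", OF _ n(3)]) (use 0 in \<open>simp add: form_def algebra_simps\<close>)
qed

lemma form_sum:
  "(\<Sum>v\<in>V. of_int (k v) * form x y z v) =
    form x y z (\<Sum>v\<in>V. k v * fst v, \<Sum>v\<in>V. k v * fst (snd v), \<Sum>v\<in>V. k v * snd (snd v))"
  by (induction V rule: infinite_finite_induct) (auto simp: form_def algebra_simps)

text \<open>
  Linearly independent forms over the prime field are extended, by some of \<open>x, y,
  z\<close>, to a basis of the space spanned by \<open>x, y, z\<close>. It has at most three
  elements and its algebraic closure contains \<open>x, y, z\<close>; so it is algebraically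
  independent.
\<close>

lemma linear_independent_forms:
  assumes p: "prime p" "CHAR('a) = p" and ind: "independent {x, y, z}" and d: "distinct [x, y, z]"
    and V: "lin_indep_mod p V"
  shows "inj_on (form x y z) V" "independent (form x y z ` V)"
proof -
  let ?f = "form x y z" and ?L = "range of_int :: 'a set"
  have fV: "finite V" using V by (simp add: lin_indep_mod_def)
  have rel: "int p dvd k v" if "(\<Sum>v\<in>V. of_int (k v) * ?f v) = 0" "v \<in> V" for k v
    using V form_zero[OF p(2) ind d that(1)[unfolded form_sum]] that(2) unfolding lin_indep_mod_def by auto
  have n1: "\<not> int p dvd 1" using p(1) by (simp add: prime_nat_iff)
  show inj: "inj_on ?f V"
  proof (rule inj_onI, rule ccontr)
    fix v w assume vw: "v \<in> V" "w \<in> V" "?f v = ?f w" "v \<noteq> w"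
    let ?k = "\<lambda>u. if u = v then 1 else if u = w then -1 else (0 :: int)"
    have "(\<Sum>u\<in>V. of_int (?k u) * ?f u) = (\<Sum>u\<in>{v, w}. of_int (?k u) * ?f u)"
      using fV vw by (intro sum.mono_neutral_right) auto
    also have "\<dots> = 0" using vw by simp
    finally have "int p dvd ?k v" using rel[of ?k v] vw by blast
    then show False using n1 by simp
  qed
  interpret Fp: pregeometry "lspan ?L" by (rule pregeometry_lspan[OF prime_field[OF p]])
  have ind_p: "Fp.independent (?f ` V)"
    unfolding Fp.independent_def
  proof (intro ballI notI)
    fix a assume "a \<in> ?f ` V" and a: "a \<in> lspan ?L (?f ` V - {a})"
    then obtain v where v: "v \<in> V" "a = ?f v" by blast
    have "?f ` V - {a} = ?f ` (V - {v})" using v inj by (auto simp: inj_on_def)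
    then have "?f v \<in> lspan ?L (?f ` (V - {v}))" using a v by simp
    from lspan_imageD[OF prime_field[OF p] this] obtain J c where
      J: "finite J" "J \<subseteq> V - {v}" "\<forall>i. c i \<in> ?L" "?f v = (\<Sum>i\<in>J. c i * ?f i)" by blast
    have "\<forall>i. \<exists>k. c i = of_int k" using J(3) by blast
    then obtain k where k: "\<And>i. c i = of_int (k i)" by metis
    let ?k = "\<lambda>u. if u = v then -1 else if u \<in> J then k u else (0 :: int)"
    have "(\<Sum>u\<in>V. of_int (?k u) * ?f u) = of_int (?k v) * ?f v + (\<Sum>u\<in>V - {v}. of_int (?k u) * ?f u)"
      using fV v(1) by (simp add: sum.remove)
    also have "(\<Sum>u\<in>V - {v}. of_int (?k u) * ?f u) = (\<Sum>u\<in>J. c u * ?f u)"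
      using fV J(2) k by (intro sum.mono_neutral_cong_right) auto
    finally have "(\<Sum>u\<in>V. of_int (?k u) * ?f u) = 0" using J(4) by simp
    then have "int p dvd ?k v" using rel[of ?k v] v(1) by blast
    then show False using n1 by simp
  qed
  obtain B where B: "?f ` V \<subseteq> B" "B \<subseteq> ?f ` V \<union> {x, y, z}" "Fp.independent B" "?f ` V \<union> {x, y, z} \<subseteq> lspan ?L B"
    using Fp.basis_extend[of "?f ` V \<union> {x, y, z}" "?f ` V"] fV ind_p by auto
  have "?f v \<in> lspan ?L {x, y, z}" for v
    unfolding form_def by (intro lspan.add lspan.scale lspan.gen) auto
  then have "B \<subseteq> lspan ?L {x, y, z}" using B(2) Fp.in_cl[of _ "{x, y, z}"] by blast
  then have c: "finite B" "card B \<le> card {x, y, z}" using Fp.steinitz[of "{x, y, z}" B] B(3) by auto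
  have "{x, y, z} \<subseteq> acl F B" using B(4) lspan_acl[of B] by blast
  then have "rk {x, y, z} \<le> rk B" using c(1) by (intro rk_mono_cl) auto
  then have "card B \<le> rk B" using c(2) rk_independent[OF _ ind] by simp
  then have "independent B" using independent_iff_rk c(1) by blast
  then show "independent (?f ` V)" using independent_subset B(1) by blast
qed

text \<open>
  A linear relation modulo \<open>p\<close> becomes an algebraic relation in characteristic
  \<open>p\<close>.
\<close>

lemma independent_forms_linear:
  assumes p: "CHAR('a) = p" and V: "finite V" "inj_on (form x y z) V" "independent (form x y z ` V)"
  shows "lin_indep_mod p V"
  unfolding lin_indep_mod_def
proof (intro conjI allI impI ballI, rule V(1), elim conjE)
  let ?f = "form x y z"
  fix k v assume k: "int p dvd (\<Sum>v\<in>V. k v * fst v)" "int p dvd (\<Sum>v\<in>V. k v * fst (snd v))"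
    "int p dvd (\<Sum>v\<in>V. k v * snd (snd v))" and v: "v \<in> V"
  have 0: "(\<Sum>v\<in>V. of_int (k v) * ?f v) = 0"
  proof -
    have z: "(of_int i :: 'a) = 0" if "int p dvd i" for i using p that by (simp add: of_int_eq_0_iff_char_dvd)
    show ?thesis unfolding form_sum unfolding form_def fst_conv snd_conv z[OF k(1)] z[OF k(2)] z[OF k(3)] by simp
  qed
  show "int p dvd k v"
  proof (rule ccontr)
    assume "\<not> int p dvd k v"
    then have kv: "(of_int (k v) :: 'a) \<noteq> 0" using p by (simp add: of_int_eq_0_iff_char_dvd)
    have "of_int (k v) * ?f v + (\<Sum>u\<in>V - {v}. of_int (k u) * ?f u) = 0"
      using 0 V(1) v by (simp add: sum.remove)
    then have "?f v = - (\<Sum>u\<in>V - {v}. of_int (k u) * ?f u) / of_int (k v)" using solve_linear kv by blast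
    also have "\<dots> \<in> acl F (?f ` (V - {v}))" by (intro acl_ops acl_sum in_cl imageI)
    also have "?f ` (V - {v}) = ?f ` V - {?f v}" using V(2) v by (auto simp: inj_on_def)
    finally show False using V(3) v by (auto simp: independent_def)
  qed
qed

text \<open>
  Representatives that generate the same points are equally independent. Families are used
  because the representatives of different indices are not known to be different.
\<close>

lemma parallel_independent:
  fixes a b :: "'i \<Rightarrow> 'a"
  assumes I: "finite I" and par: "\<And>i. i \<in> I \<Longrightarrow> acl F {a i} = acl F {b i}"
    and a: "inj_on a I" "independent (a ` I)"
  shows "inj_on b I \<and> independent (b ` I)"
proof -
  have in_other: "f ` I \<subseteq> acl F (g ` I)" if "\<And>i. i \<in> I \<Longrightarrow> acl F {f i} = acl F {g i}" for f g
  proof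
    fix u assume "u \<in> f ` I"
    then obtain i where i: "i \<in> I" "u = f i" by blast
    then have "u \<in> acl F {g i}" using that[OF i(1)] in_cl[of "f i" "{f i}"] by simp
    then show "u \<in> acl F (g ` I)" using mono[of "{g i}" "g ` I"] i(1) by auto
  qed
  have "rk (b ` I) = card (a ` I)"
  proof (rule rk_eq)
    show "a ` I \<subseteq> acl F (b ` I)" "b ` I \<subseteq> acl F (a ` I)" using in_other[of a b] in_other[of b a] par by auto
  qed (use I a in auto)
  also have "\<dots> = card I" using a by (simp add: card_image)
  finally have r: "rk (b ` I) = card I" .
  have "card (b ` I) \<le> card I" using I by (rule card_image_le)
  moreover have "rk (b ` I) \<le> card (b ` I)" using I by (intro rk_le_card) auto
  ultimately have c: "card (b ` I) = card I" using r by simp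
  then have "inj_on b I" using I by (simp add: eq_card_imp_inj_on)
  moreover have "independent (b ` I)" using independent_iff_rk[of "b ` I"] I c r by simp
  ultimately show ?thesis by blast
qed

text \<open>
  The point with coordinates \<open>[a, b, c]\<close> goes to the closure of \<open>a x + b y +
  c z\<close>, which does not depend on the representative. Independence is compared through the
  values of the form on representatives: they are parallel to the generators of the image
  points.
\<close>

theorem linear_embedding:
  assumes p: "prime p" "CHAR('a) = p" and ind: "independent {x, y, z}" and d: "distinct [x, y, z]"
  shows "\<exists>f. matroid_embedding f (Lp p) M"
proof -
  note G = Lp_ground[OF p(1)]
  note forms = linear_independent_forms[OF p ind d]
  let ?l = "form x y z"
  define rep :: "(int \<times> int \<times> int) set \<Rightarrow> int \<times> int \<times> int" where "rep = (\<lambda>Q. SOME v. v \<in> Q)"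
  define f where "f = (\<lambda>Q. acl F {?l (rep Q)})"
  have mult0: "int p dvd k \<Longrightarrow> (of_int k :: 'a) = 0" "(of_int k :: 'a) = 0 \<Longrightarrow> int p dvd k" for k
    using p(2) by (auto simp: of_int_eq_0_iff_char_dvd)
  have of_mod: "(of_int (i mod int p) :: 'a) = of_int i" for i
    using mult0(1)[of "i mod int p - i"] by (simp add: mod_eq_dvd_iff[symmetric])
  \<comment> \<open>Representatives of a point of the plane are multiples of each other modulo
    \<open>p\<close>, hence their values under the form differ by a nonzero constant.\<close>
  have pt: "rep Q \<in> Q \<and> (\<forall>v\<in>Q. ?l v \<notin> F \<and> acl F {?l v} = f Q \<and> \<not> (int p dvd fst v \<and> int p dvd fst (snd v) \<and> int p dvd snd (snd v)) \<and> hpoint p (fst v) (fst (snd v)) (snd (snd v)) = Q)"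
    if Q: "Q \<in> pg_points p" for Q
  proof -
    obtain a b c where abc: "Q = hpoint p a b c" "\<not> (int p dvd a \<and> int p dvd b \<and> int p dvd c)"
      using Q unfolding pg_points_def by blast
    have "rep Q \<in> Q" unfolding rep_def using hpoint_self[OF p(1), of a b c] abc(1) by (metis someI_ex)
    have nF: "?l (a, b, c) \<notin> F"
    proof
      have "lin_indep_mod p {(a, b, c)}"
        using abc(2) p(1) by (auto simp: lin_indep_mod_def prime_dvd_mult_iff)
      from forms(2)[OF this] have "?l (a, b, c) \<notin> F" by (simp add: independent_singleton)
      moreover assume "?l (a, b, c) \<in> F"
      ultimately show False by blast
    qed
    have v: "?l v \<notin> F \<and> acl F {?l v} = acl F {?l (a, b, c)}" if vQ: "v \<in> Q" for v
    proof -
      obtain t where t: "\<not> int p dvd t" "v = (t * a mod int p, t * b mod int p, t * c mod int p)"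
        using vQ abc(1) hpointE by metis
      have e: "?l v = of_int t * ?l (a, b, c)" by (simp add: t(2) form_def of_mod algebra_simps)
      have t0: "(of_int t :: 'a) \<noteq> 0" using t(1) mult0 by blast
      have FF: "F = acl F {}" by (simp add: acl_0)
      have "?l v \<notin> F"
      proof
        assume "?l v \<in> F"
        then have "?l v / of_int t \<in> F" using acl_ops(4,5)[of _ "{}"] unfolding acl_0 by blast
        then show False using nF t0 by (simp add: e)
      qed
      moreover have "?l v \<in> acl F {?l (a, b, c)}" unfolding e by (intro acl_ops) (auto intro: in_cl)
      ultimately show ?thesis using acl_singleton_eq by blast
    qed
    have nz: "\<not> (int p dvd fst v \<and> int p dvd fst (snd v) \<and> int p dvd snd (snd v))" if "v \<in> Q" for v
    proof
      assume "int p dvd fst v \<and> int p dvd fst (snd v) \<and> int p dvd snd (snd v)"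
      then have "?l v = 0" using mult0(1) by (simp add: form_def)
      then show False using v[OF that] acl_ops(5)[of 0 "{}"] unfolding acl_0 by simp
    qed
    have hp: "hpoint p (fst v) (fst (snd v)) (snd (snd v)) = Q" if "v \<in> Q" for v
      using hpoint_member[OF p(1)] that abc(1) by simp
    show ?thesis using \<open>rep Q \<in> Q\<close> v nz hp unfolding f_def by auto
  qed
  have pts: "Q \<in> pg_points p" if "Q \<in> Lp_points p" for Q using that Lp_points_pg[OF p(1)] by blast
  have fpt: "f Q \<in> alg_points F" if "Q \<in> Lp_points p" for Q
    using pt[OF pts[OF that]] unfolding point_iff by metis
  have injf: "inj_on f (Lp_points p)"
  proof (rule inj_onI, rule ccontr)
    fix P Q assume PQ: "P \<in> Lp_points p" "Q \<in> Lp_points p" "f P = f Q" "P \<noteq> Q"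
    note P = pt[OF pts[OF PQ(1)]] and Q = pt[OF pts[OF PQ(2)]]
    let ?v = "rep P" and ?w = "rep Q"
    have v: "hpoint p (fst ?v) (fst (snd ?v)) (snd (snd ?v)) = P" and w: "hpoint p (fst ?w) (fst (snd ?w)) (snd (snd ?w)) = Q"
      and vn: "\<not> (int p dvd fst ?v \<and> int p dvd fst (snd ?v) \<and> int p dvd snd (snd ?v))"
      and wn: "\<not> (int p dvd fst ?w \<and> int p dvd fst (snd ?w) \<and> int p dvd snd (snd ?w))"
      using P Q by blast+
    have vw: "?v \<noteq> ?w" using v w PQ(4) by metis
    have pp: "prime (int p)" using p(1) by simp
    have "lin_indep_mod p {?v, ?w}"
      unfolding lin_indep_mod_def
    proof (intro conjI allI impI, simp, elim conjE)
      fix k assume "int p dvd (\<Sum>v\<in>{?v, ?w}. k v * fst v)" "int p dvd (\<Sum>v\<in>{?v, ?w}. k v * fst (snd v))"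
        "int p dvd (\<Sum>v\<in>{?v, ?w}. k v * snd (snd v))"
      then have k: "int p dvd k ?v * fst ?v + k ?w * fst ?w" "int p dvd k ?v * fst (snd ?v) + k ?w * fst (snd ?w)"
        "int p dvd k ?v * snd (snd ?v) + k ?w * snd (snd ?w)" using vw by simp_all
      have kw: "int p dvd k ?w"
      proof (rule ccontr)
        assume nk: "\<not> int p dvd k ?w"
        obtain s where s: "int p dvd k ?w * s - 1" using prime_solve_mod[OF p(1) nk] by blast
        have wt: "int p dvd w' - (- (s * k ?v)) * v'" if "int p dvd k ?v * v' + k ?w * w'" for v' w'
        proof -
          have "int p dvd s * (k ?v * v' + k ?w * w') - w' * (k ?w * s - 1)" by (intro dvd_diff dvd_mult that s)
          moreover have "s * (k ?v * v' + k ?w * w') - w' * (k ?w * s - 1) = w' - (- (s * k ?v)) * v'"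
            by (simp add: algebra_simps)
          ultimately show ?thesis by (simp only:)
        qed
        have "\<not> int p dvd - (s * k ?v)"
        proof
          assume t: "int p dvd - (s * k ?v)"
          have "int p dvd w'" if "int p dvd w' - (- (s * k ?v)) * v'" for w' v'
          proof -
            have "int p dvd (w' - (- (s * k ?v)) * v') + (- (s * k ?v)) * v'" by (intro dvd_add that dvd_mult2 t)
            then show ?thesis by simp
          qed
          then show False using wn wt[OF k(1)] wt[OF k(2)] wt[OF k(3)] by blast
        qed
        then have "Q = P" using hpoint_eqI[OF p(1) _ wt[OF k(1)] wt[OF k(2)] wt[OF k(3)]] v w by simp
        then show False using PQ(4) by simp
      qed
      have "int p dvd k ?v * v'" if "int p dvd k ?v * v' + k ?w * w'" for v' w'
        using that kw by (metis dvd_add_left_iff dvd_mult2)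
      then have "int p dvd k ?v * fst ?v" "int p dvd k ?v * fst (snd ?v)" "int p dvd k ?v * snd (snd ?v)" using k by blast+
      then have "int p dvd k ?v" using vn pp by (auto simp: prime_dvd_mult_iff)
      then show "\<forall>v\<in>{?v, ?w}. int p dvd k v" using kw by simp
    qed
    from forms[OF this] have i: "inj_on ?l {?v, ?w}" "independent {?l ?v, ?l ?w}" by simp_all
    have ne: "?l ?v \<noteq> ?l ?w" using i(1) vw by (auto simp: inj_on_def)
    have "{?l ?v, ?l ?w} - {?l ?v} = {?l ?w}" using ne by auto
    then have "?l ?v \<notin> acl F {?l ?w}" using i(2) unfolding independent_def by auto
    moreover have "acl F {?l ?v} = acl F {?l ?w}" using PQ(3) by (simp add: f_def)
    ultimately show False using in_cl[of "?l ?v" "{?l ?v}"] by simp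
  qed
  have "indep (Lp p) I \<longleftrightarrow> indep M (f ` I)" if I: "I \<subseteq> Lp_points p" for I
  proof -
    have fin: "finite I" using I G(3) finite_subset by blast
    have fI: "f ` I \<subseteq> alg_points F" using fpt I by blast
    have injI: "inj_on f I" using injf I inj_on_subset by blast
    have injgen: "inj_on (\<lambda>P. gen (f P)) I"
      using injI fI by (auto simp: inj_on_def gen_eq_iff image_subset_iff)
    have par: "acl F {?l v} = acl F {gen (f P)}" if "P \<in> I" "v \<in> P" for P v
    proof -
      have P: "P \<in> pg_points p" "f P \<in> alg_points F" using that(1) I pts fpt by blast+
      have "acl F {?l v} = f P" using pt[OF P(1)] that(2) by blast
      then show ?thesis using gen(2)[OF P(2)] by simp
    qed
    have img: "gen ` f ` I = (\<lambda>P. gen (f P)) ` I" by (simp add: image_image)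
    have "indep (Lp p) I \<longleftrightarrow> transversal_indep (lin_indep_mod p) I" by (rule G(2)[OF I])
    also have "\<dots> \<longleftrightarrow> independent ((\<lambda>P. gen (f P)) ` I)"
    proof
      assume "transversal_indep (lin_indep_mod p) I"
      then obtain g where g: "inj_on g I" "\<forall>P\<in>I. g P \<in> P" "lin_indep_mod p (g ` I)" unfolding transversal_indep_def by blast
      have "inj_on (\<lambda>P. ?l (g P)) I" "independent ((\<lambda>P. ?l (g P)) ` I)"
        using comp_inj_on[OF g(1) forms(1)[OF g(3)]] forms(2)[OF g(3)] by (simp_all add: comp_def image_image)
      then show "independent ((\<lambda>P. gen (f P)) ` I)"
        using parallel_independent[of I "\<lambda>P. ?l (g P)" "\<lambda>P. gen (f P)"] fin par g(2) by blast
    next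
      assume ig: "independent ((\<lambda>P. gen (f P)) ` I)"
      have rp: "rep P \<in> P" if "P \<in> I" for P using pt[OF pts] that I by blast
      have "inj_on (\<lambda>P. ?l (rep P)) I \<and> independent ((\<lambda>P. ?l (rep P)) ` I)"
        by (rule parallel_independent[OF fin _ injgen ig]) (use par rp in simp)
      then have r: "inj_on rep I" "inj_on ?l (rep ` I)" "independent (?l ` rep ` I)"
        by (auto simp: inj_on_def image_image)
      have "lin_indep_mod p (rep ` I)" by (rule independent_forms_linear[OF p(2) _ r(2,3)]) (use fin in simp)
      then show "transversal_indep (lin_indep_mod p) I" unfolding transversal_indep_def using r(1) rp by blast
    qed
    also have "\<dots> \<longleftrightarrow> indep M (f ` I)" using indep_M[of "f ` I"] fin fI img by simp
    finally show ?thesis .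
  qed
  then have "matroid_embedding f (Lp p) M"
    unfolding matroid_embedding_def G(1) ground_M using injf fpt by blast
  then show ?thesis by blast
qed

lemma three_independent:
  assumes r: "matroid_rank M (ground M) \<ge> 3"
  shows "\<exists>x y z. independent {x, y, z} \<and> distinct [x, y, z]"
proof -
  have "\<exists>I. I \<subseteq> ground M \<and> finite I \<and> indep M I \<and> card I \<ge> 3"
  proof (rule ccontr)
    assume n: "\<not> ?thesis"
    have "matroid_rank M (ground M) \<le> 2"
      unfolding matroid_rank_def
    proof (rule SUP_least)
      fix I assume "I \<in> {I. I \<subseteq> ground M \<and> finite I \<and> indep M I}"
      then have "card I \<le> 2" using n by (metis (no_types, lifting) mem_Collect_eq not_less_eq_eq numeral_2_eq_2 numeral_3_eq_3)
      then show "enat (card I) \<le> 2" by (simp add: numeral_eq_enat)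
    qed
    with r have "(3 :: enat) \<le> 2" by (rule order_trans)
    then show False by (simp add: numeral_eq_enat)
  qed
  then obtain I where I: "finite I" "indep M I" "card I \<ge> 3" by blast
  then have ind: "independent (gen ` I)" "I \<subseteq> alg_points F" using indep_M by auto
  have "card (gen ` I) \<ge> 3" using I(3) inj_on_subset[OF inj_gen ind(2)] by (simp add: card_image)
  then obtain T where T: "T \<subseteq> gen ` I" "card T = 3" by (metis obtain_subset_with_card_n)
  then obtain x y z where "T = {x, y, z}" "x \<noteq> y" "y \<noteq> z" "x \<noteq> z" unfolding card_3_iff by blast
  then show ?thesis using independent_subset[OF ind(1) T(1)] by auto
qed

end

theorem corollary4p10:
  fixes p :: nat and F :: "'a::alg_closed_field set"
  assumes "prime p"
    and "CHAR('a) = p"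
    and "alg_closed_subfield F"
    and "trdeg F (UNIV :: 'a set) < \<infinity>"
    and "matroid_rank (full_algebraic_matroid F) (ground (full_algebraic_matroid F)) \<ge> 3"
  shows "(\<exists>f. matroid_embedding f (Lp p) (full_algebraic_matroid F)) \<and>
    (\<forall>f. matroid_embedding f (Lp p) (full_algebraic_matroid F) \<longrightarrow>
      (let M = full_algebraic_matroid F;
           S = harmonic_closure M (f ` ground (Lp p));
           L = matroid_lines (matroid_restrict M S)
       in desarguesian_plane S L \<and> plane_order L p))"
proof -
  interpret full_algebraic F by unfold_locales (rule assms(3))
  have "\<exists>f. matroid_embedding f (Lp p) M"
    using three_independent[OF assms(5)] linear_embedding[OF assms(1,2)] by blast
  moreover have "desarguesian_plane S L \<and> plane_order L p"
    if f: "matroid_embedding f (Lp p) M" and S: "S = harmonic_closure M (f ` ground (Lp p))"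
      and L: "L = matroid_lines (matroid_restrict M S)" for f S L
  proof -
    obtain la lb lc where c: "config p la lb lc (\<lambda>i. f (hpoint p 0 i 1)) (f (hpoint p 0 1 0)) (\<lambda>i. f (hpoint p 1 i 0)) (\<lambda>i. f (hpoint p 1 i 1))"
      using embedding_config[OF f assms(1)] by blast
    have "f ` ground (Lp p) = {f (hpoint p 0 1 0)} \<union> range (\<lambda>i. f (hpoint p 0 i 1)) \<union>
      range (\<lambda>i. f (hpoint p 1 i 0)) \<union> range (\<lambda>i. f (hpoint p 1 i 1))"
      unfolding Lp_ground(1)[OF assms(1)] Lp_points_def by auto
    with S have "S = harmonic_closure M ({f (hpoint p 0 1 0)} \<union> range (\<lambda>i. f (hpoint p 0 i 1)) \<union>
      range (\<lambda>i. f (hpoint p 1 i 0)) \<union> range (\<lambda>i. f (hpoint p 1 i 1)))" by simp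
    from config_closure_plane[OF assms(1,2) c this L] show ?thesis by blast
  qed
  ultimately show ?thesis by (simp add: Let_def)
qed

end
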